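(* Assume the following conditions A1--A5 (all notation as in the context). (A1) $\{x_t\}$ is a strictly stationary and ergodic solution of the vMEM $x_t=\mu_t\odot\varepsilon_t$, $\mu_t=\mu(\vartheta;\mathcal F_{t-1})$, for the parameter $\vartheta=\vartheta_0$ and innovations $\{\varepsilon_t\}$ with distribution $F_\varepsilon$. The point $\vartheta_0$ belongs to a compact set $\Omega_0\subset\mathbb R^K$, and $\mu=(\mu_1,\dots,\mu_d)^\top$ satisfies $\mu_j(\vartheta;\cdot)\ge\omega_0$ for all $j=1,\dots,d$, all $\vartheta\in\Omega_0$ and some $\omega_0>0$. Furthermore there exist $K_0>0$ and $\rho\in(0,1)$ such that $\|\mu(\vartheta;\widetilde{\mathcal F}_t)-\mu(\vartheta;\mathcal F_t)\|<K_0\rho^t$ for all $t$ and all $\vartheta\in\Omega_0$. (A2) $F_\varepsilon=G_{\varphi_0}$ for some $\varphi_0\in\Phi_0\subset\Phi$. The Laplace transform $L_\varphi$ is twice continuously differentiable with respect to $\varphi=(\varphi_1,\dots,\varphi_r)^\top$ on $\Phi_0$, and for all $j,k=1,\dots,r$ $$\int_{\mathbb R^d_+}\sup_{\varphi\in\Phi_0}\Bigl|\frac{\partial L_\varphi(u)}{\partial\varphi_j}\Bigr|^2W(u)\,\mathrm du<\infty,\qquad \int_{\mathbb R^d_+}\sup_{\varphi\in\Phi_0}\Bigl|\frac{\partial^2L_\varphi(u)}{\partial\varphi_j\partial\varphi_k}\Bigr|^2W(u)\,\mathrm du<\infty .$$ Furthermore $\frac{\partial^2L_\varphi(u)}{\partial\varphi_j\partial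 u_i}$ is continuous for all $\varphi\in\Phi_0$, $u\in\mathbb R^d_+$ and all $j=1,\dots,r$, $i=1,\dots,d$. (A3) The estimators $\widehat\vartheta_T$ and $\widehat\varphi_T$ satisfy, as $T\to\infty$, $$\sqrt T(\widehat\vartheta_T-\vartheta_0)=\frac1{\sqrt T}\sum_{t=1}^Tm_{t,1}+o_{\mathsf P}(1),\qquad \sqrt T(\widehat\varphi_T-\varphi_0)=\frac1{\sqrt T}\sum_{t=1}^Tm_{t,2}+o_{\mathsf P}(1),$$ where $\{m_t\}=\{(m_{t,1}^\top,m_{t,2}^\top)^\top\}$ is a strictly stationary sequence of martingale differences with respect to $\{\mathcal F^\varepsilon_{t-1}\}$, $\mathcal F^\varepsilon_{t-1}=\sigma\{\varepsilon_s,\ s\le t-1\}$, with a finite variance matrix. (A4) $\mu(\vartheta;\cdot)$ is twice continuously differentiable with respect to $\vartheta$ on the interior of $\Omega_0$; $\mathsf E\|x_t\|<\infty$ and $$\mathsf E\Bigl\{\Bigl|\frac{\partial\mu_j}{\partial\vartheta_k}(\vartheta_0;\mathcal F_{t-1})\Bigr|\frac{\varepsilon_{t,j}}{\mu_j(\vartheta_0;\mathcal F_{t-1})}\Bigr\}<\infty$$ for all $j=1,\dots,d$, $k=1,\dots,K$; and there is a neighbourhood $U(\vartheta_0)$ of $\vartheta_0$ such that $$\mathsf E\Bigl\{\|x_t\|^2\sup_{\vartheta\in U(\vartheta_0)}\Bigl|\frac{\partial\mu_j(\vartheta;\mathcal F_{t-1})}{\partial\vartheta_k}\frac{\partial\mu_j(\vartheta;\mathcal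 F_{t-1})}{\partial\vartheta_l}\Bigr|\Bigr\}<\infty,\qquad \mathsf E\Bigl\{|x_{t,j}|\sup_{\vartheta\in U(\vartheta_0)}\Bigl|\frac{\partial^2\mu_j(\vartheta;\mathcal F_{t-1})}{\partial\vartheta_k\partial\vartheta_l}\Bigr|\Bigr\}<\infty$$ for all $j=1,\dots,d$, $k,l=1,\dots,K$. (A5) $W:\mathbb R^d_+\to[0,\infty)$ is an integrable function such that $\int_{\mathbb R^d_+}\|u\|^4W(u)\,\mathrm du<\infty$. Then, as $T\to\infty$, the test statistic $S_{T,W}$ converges in distribution to $\int_{\mathbb R^d_+}Z(u)^2W(u)\,\mathrm du$, where $\{Z(u),\ u\in\mathbb R^d_+\}$ is a centred Gaussian process with covariance function $$\mathsf E\,Z(u)Z(s)=\mathsf E\Bigl[\bigl(\mathrm e^{-u^\top\varepsilon_t}-L_{\varphi_0}(u)+u^\top\Gamma(u)m_{t,1}-\dot L_{\varphi_0}(u)^\top m_{t,2}\bigr)\bigl(\mathrm e^{-s^\top\varepsilon_t}-L_{\varphi_0}(s)+s^\top\Gamma(s)m_{t,1}-\dot L_{\varphi_0}(s)^\top m_{t,2}\bigr)\Bigr],\quad u,s\in\mathbb R^d_+,$$ where $\dot L_{\varphi_0}(u)=\frac{\partial L_\varphi(u)}{\partial\varphi}\big|_{\varphi=\varphi_0}$ and $\Gamma(u)$ is the $d\times K$ matrix defined in the context.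
   Context: Notation: $\mathbb R^d_+=(0,\infty)^d$; $\odot$ and $\oslash$ are the elementwise product and elementwise division of vectors; $\mathrm{diag}\{a\}$ is the diagonal matrix with the vector $a$ on the diagonal; $o_{\mathsf P}(1)$ is as $T\to\infty$. Model (vMEM): $\{x_t\}$, $x_t=(x_{t,1},\dots,x_{t,d})^\top$, $d\ge1$, is a time series of non-negative $d$-dimensional random vectors, $\mathcal F_t=\sigma\{x_s,\ s\le t\}$, and $$x_t=\mu_t\odot\varepsilon_t,\qquad \mu_t=\mu(\vartheta;\mathcal F_{t-1}),$$ where $\{\varepsilon_t\}$ are independent copies of a non-negative $d$-dimensional random vector $\varepsilon$ with distribution function $F_\varepsilon$ and $\mathsf E\varepsilon=(1,\dots,1)^\top$, and $\mu$ is a given function specifying the dependence of $\mu_t=\mathsf E(x_t\mid\mathcal F_{t-1})$ on the past through the parameter $\vartheta\in\mathbb R^K$, $K\ge1$. Finite past: $\widetilde{\mathcal F}_t=\sigma\{x_s,\ 1\le s\le t\}$; $\mu(\vartheta;\widetilde{\mathcal F}_t)$ denotes the conditional-mean function computed (recursively) from $x_1,\dots,x_t$ with some specified initial values in place of the unobserved quantities at times $\le 0$. Data and residuals: $x_1,\dots,x_T$ are observed; $\widehat\vartheta_T$ is an estimator of $\vartheta$; $\widehat\mu_t=\mu(\widehat\vartheta_T;\widetilde{\mathcal F}_{t-1})$ and $\widehat\varepsilon_t=x_t\oslash\widehat\mu_t$, $t=1,\dots,T$. Parametric family: $\mathcal G=\{G_\varphi:\varphi\in\Phi\}$, $\Phi\subseteq\mathbb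 R^r$, $r\ge1$, is a family of distributions on $\mathbb R^d_+$ with Laplace transforms $L_\varphi(u)=\int_{\mathbb R^d_+}\mathrm e^{-u^\top y}\,\mathrm dG_\varphi(y)$, $u\in\mathbb R^d_+$; $\widehat\varphi_T$ is an estimator of $\varphi$. Test statistic: with $\widehat L_T(u)=\frac1T\sum_{t=1}^T\mathrm e^{-u^\top\widehat\varepsilon_t}$, $$S_{T,W}=T\int_{\mathbb R^d_+}\bigl[\widehat L_T(u)-L_{\widehat\varphi_T}(u)\bigr]^2W(u)\,\mathrm du .$$ The matrix $\Gamma$: $$\Gamma(u)=\mathsf E\Bigl[\mathrm e^{-u^\top\varepsilon_t}\,[\mathrm{diag}\{\mu(\vartheta_0;\mathcal F_{t-1})\}]^{-1}\,\mathrm{diag}\{\varepsilon_t\}\,\nabla_\vartheta\mu_t(\vartheta_0)\Bigr],$$ where $\nabla_\vartheta\mu_t(\vartheta)=\bigl(\partial\mu_i(\vartheta;\mathcal F_{t-1})/\partial\vartheta_j\bigr)_{i=1,j=1}^{d,K}$ is the $d\times K$ matrix of first derivatives.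
   Formalization: In A3 strict stationarity is required of the joint sequence (ε_t, m_{t,1}, m_{t,2}), since otherwise the covariance formula may depend on t; in A2 the set Φ_0 is taken to be open, so that the derivatives on it are defined. *)

theory Defs
  imports "HOL-Probability.Probability"
begin

definition pos_orthant :: "(real ^ 'd) set" where
  "pos_orthant = {u. \<forall>i. 0 < u $ i}"

definition hadamard_prod :: "real ^ 'd \<Rightarrow> real ^ 'd \<Rightarrow> real ^ 'd" where
  "hadamard_prod a b = (\<chi> i. a $ i * b $ i)"

definition hadamard_div :: "real ^ 'd \<Rightarrow> real ^ 'd \<Rightarrow> real ^ 'd" where
  "hadamard_div a b = (\<chi> i. a $ i / b $ i)"

definition diag_mat :: "real ^ 'd \<Rightarrow> real ^ 'd ^ 'd" where
  "diag_mat a = (\<chi> i j. if i = j then a $ i else 0)"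

definition has_pdiff :: "'n::finite \<Rightarrow> (real ^ 'n \<Rightarrow> real) \<Rightarrow> real ^ 'n \<Rightarrow> bool" where
  "has_pdiff k f \<theta> \<longleftrightarrow> (\<lambda>s. f (\<theta> + s *\<^sub>R axis k 1)) differentiable (at 0)"

definition pdiff :: "'n::finite \<Rightarrow> (real ^ 'n \<Rightarrow> real) \<Rightarrow> real ^ 'n \<Rightarrow> real" where
  "pdiff k f \<theta> = deriv (\<lambda>s. f (\<theta> + s *\<^sub>R axis k 1)) 0"

definition gradient :: "(real ^ 'n::finite \<Rightarrow> real) \<Rightarrow> real ^ 'n \<Rightarrow> real ^ 'n" where
  "gradient f \<theta> = (\<chi> k. pdiff k f \<theta>)"

definition jacobian_mat ::
  "(real ^ 'n::finite \<Rightarrow> real ^ 'd::finite) \<Rightarrow> real ^ 'n \<Rightarrow> real ^ 'n ^ 'd" where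
  "jacobian_mat f \<theta> = (\<chi> i j. pdiff j (\<lambda>\<eta>. f \<eta> $ i) \<theta>)"

text \<open>Twice continuously differentiable; only used for open sets.  Continuity of the function
  and of its first partial derivatives follows from their differentiability.\<close>

definition C2_on :: "(real ^ 'n::finite) set \<Rightarrow> (real ^ 'n \<Rightarrow> real) \<Rightarrow> bool" where
  "C2_on S f \<longleftrightarrow>
     (\<forall>\<theta>\<in>S. f differentiable (at \<theta>)) \<and>
     (\<forall>k. \<forall>\<theta>\<in>S. pdiff k f differentiable (at \<theta>)) \<and>
     (\<forall>k l. continuous_on S (pdiff l (pdiff k f)))"

text \<open>The sigma-algebra generated by \<open>X s\<close>, \<open>s \<in> S\<close>.\<close>

definition gen_sigma ::
  "'w measure \<Rightarrow> (int \<Rightarrow> 'w \<Rightarrow> 'b::topological_space) \<Rightarrow> int set \<Rightarrow> 'w measure" where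
  "gen_sigma M X S =
     sigma (space M) {X s -` A \<inter> space M | s A. s \<in> S \<and> A \<in> sets borel}"

definition strictly_stationary ::
  "'w measure \<Rightarrow> (int \<Rightarrow> 'w \<Rightarrow> 'b::topological_space) \<Rightarrow> bool" where
  "strictly_stationary M X \<longleftrightarrow>
     (\<forall>t. X t \<in> borel_measurable M) \<and>
     (\<forall>h. distr M (PiM UNIV (\<lambda>_::int. borel)) (\<lambda>\<omega> t. X (t + h) \<omega>) =
          distr M (PiM UNIV (\<lambda>_::int. borel)) (\<lambda>\<omega> t. X t \<omega>))"

text \<open>Shift-invariant events of the path space have probability 0 or 1.\<close>

definition ergodic_process ::
  "'w measure \<Rightarrow> (int \<Rightarrow> 'w \<Rightarrow> 'b::topological_space) \<Rightarrow> bool" where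
  "ergodic_process M X \<longleftrightarrow>
     (\<forall>A \<in> sets (PiM UNIV (\<lambda>_::int. borel)).
        {p. (\<lambda>t. p (t + 1)) \<in> A} = A \<longrightarrow>
        measure M {\<omega> \<in> space M. (\<lambda>t. X t \<omega>) \<in> A} \<in> {0, 1})"

text \<open>\<open>F t\<close> is the sigma-algebra up to and including time \<open>t\<close>.\<close>

definition martingale_differences ::
  "'w measure \<Rightarrow> (int \<Rightarrow> 'w measure) \<Rightarrow> (int \<Rightarrow> 'w \<Rightarrow> real ^ 'n) \<Rightarrow> bool" where
  "martingale_differences M F m \<longleftrightarrow>
     (\<forall>t. m t \<in> borel_measurable (F t)) \<and>
     (\<forall>t k. integrable M (\<lambda>\<omega>. m t \<omega> $ k)) \<and>
     (\<forall>t k. AE \<omega> in M. real_cond_exp M (F (t - 1)) (\<lambda>\<omega>. m t \<omega> $ k) \<omega> = 0)"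

definition small_oP :: "'w measure \<Rightarrow> (nat \<Rightarrow> 'w \<Rightarrow> 'b::real_normed_vector) \<Rightarrow> bool" where
  "small_oP M R \<longleftrightarrow>
     (\<forall>e>0. (\<lambda>T. measure M {\<omega> \<in> space M. e < norm (R T \<omega>)}) \<longlonglongrightarrow> 0)"

text \<open>Normal random variables, point masses included.\<close>

definition normal_rv :: "'v measure \<Rightarrow> ('v \<Rightarrow> real) \<Rightarrow> bool" where
  "normal_rv N X \<longleftrightarrow> X \<in> borel_measurable N \<and>
     (\<exists>a. (AE v in N. X v = a) \<or>
          (\<exists>\<sigma>>0. distributed N lborel X (\<lambda>y. ennreal (normal_density a \<sigma> y))))"

definition gaussian_process :: "'v measure \<Rightarrow> 'i set \<Rightarrow> ('i \<Rightarrow> 'v \<Rightarrow> real) \<Rightarrow> bool" where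
  "gaussian_process N I Z \<longleftrightarrow> prob_space N \<and>
     (\<forall>J c. finite J \<and> J \<subseteq> I \<longrightarrow> normal_rv N (\<lambda>v. \<Sum>u\<in>J. c u * Z u v))"

text \<open>The joint measurability is what makes path integrals of the process random variables.\<close>

definition centred_gaussian_with_cov ::
  "'v measure \<Rightarrow> (real ^ 'd) set \<Rightarrow> (real ^ 'd \<Rightarrow> 'v \<Rightarrow> real) \<Rightarrow>
   (real ^ 'd \<Rightarrow> real ^ 'd \<Rightarrow> real) \<Rightarrow> bool" where
  "centred_gaussian_with_cov N I Z C \<longleftrightarrow>
     gaussian_process N I Z \<and>
     (\<lambda>(v, u). Z u v) \<in> borel_measurable (N \<Otimes>\<^sub>M restrict_space borel I) \<and>
     (\<forall>u\<in>I. (\<integral>v. Z u v \<partial>N) = 0) \<and>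
     (\<forall>u\<in>I. \<forall>s\<in>I. (\<integral>v. Z u v * Z s v \<partial>N) = C u s)"

text \<open>The infinite past \<open>x\<^sub>t, x\<^sub>t\<^sub>-\<^sub>1, \<dots>\<close> and the observations \<open>x\<^sub>1, \<dots>, x\<^sub>t\<close>.  A function
  \<open>\<mu>\<close> of a parameter and an infinite past encodes \<open>\<mu>(\<theta>; F\<^sub>t)\<close> as \<open>\<mu> \<theta> (past x t \<omega>)\<close>; a function
  \<open>\<mu>f\<close> of a parameter and a list encodes the finite-past version as \<open>\<mu>f \<theta> (observed x t \<omega>)\<close>,
  the initial values being part of \<open>\<mu>f\<close>.\<close>

definition past :: "(int \<Rightarrow> 'w \<Rightarrow> real ^ 'd) \<Rightarrow> int \<Rightarrow> 'w \<Rightarrow> nat \<Rightarrow> real ^ 'd" where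
  "past x t \<omega> = (\<lambda>n. x (t - int n) \<omega>)"

definition observed :: "(int \<Rightarrow> 'w \<Rightarrow> real ^ 'd) \<Rightarrow> nat \<Rightarrow> 'w \<Rightarrow> (real ^ 'd) list" where
  "observed x t \<omega> = map (\<lambda>s. x (int s) \<omega>) [1..<Suc t]"

definition laplace :: "(real ^ 'd) measure \<Rightarrow> real ^ 'd \<Rightarrow> real" where
  "laplace G u = (LINT y:pos_orthant|G. exp (- (u \<bullet> y)))"

definition mu_hat ::
  "(real ^ 'k \<Rightarrow> (real ^ 'd) list \<Rightarrow> real ^ 'd) \<Rightarrow> (int \<Rightarrow> 'w \<Rightarrow> real ^ 'd) \<Rightarrow>
   (nat \<Rightarrow> 'w \<Rightarrow> real ^ 'k) \<Rightarrow> nat \<Rightarrow> nat \<Rightarrow> 'w \<Rightarrow> real ^ 'd" where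
  "mu_hat \<mu>f x \<theta>hat T t \<omega> = \<mu>f (\<theta>hat T \<omega>) (observed x (t - 1) \<omega>)"

definition residual ::
  "(real ^ 'k \<Rightarrow> (real ^ 'd) list \<Rightarrow> real ^ 'd) \<Rightarrow> (int \<Rightarrow> 'w \<Rightarrow> real ^ 'd) \<Rightarrow>
   (nat \<Rightarrow> 'w \<Rightarrow> real ^ 'k) \<Rightarrow> nat \<Rightarrow> nat \<Rightarrow> 'w \<Rightarrow> real ^ 'd" where
  "residual \<mu>f x \<theta>hat T t \<omega> = hadamard_div (x (int t) \<omega>) (mu_hat \<mu>f x \<theta>hat T t \<omega>)"

definition emp_laplace ::
  "(real ^ 'k \<Rightarrow> (real ^ 'd) list \<Rightarrow> real ^ 'd) \<Rightarrow> (int \<Rightarrow> 'w \<Rightarrow> real ^ 'd) \<Rightarrow>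
   (nat \<Rightarrow> 'w \<Rightarrow> real ^ 'k) \<Rightarrow> nat \<Rightarrow> 'w \<Rightarrow> real ^ 'd \<Rightarrow> real" where
  "emp_laplace \<mu>f x \<theta>hat T \<omega> u =
     (1 / real T) * (\<Sum>t = 1..T. exp (- (u \<bullet> residual \<mu>f x \<theta>hat T t \<omega>)))"

definition test_stat ::
  "(real ^ 'k \<Rightarrow> (real ^ 'd) list \<Rightarrow> real ^ 'd) \<Rightarrow> (int \<Rightarrow> 'w \<Rightarrow> real ^ 'd) \<Rightarrow>
   (nat \<Rightarrow> 'w \<Rightarrow> real ^ 'k) \<Rightarrow> (real ^ 'r \<Rightarrow> (real ^ 'd) measure) \<Rightarrow>
   (nat \<Rightarrow> 'w \<Rightarrow> real ^ 'r) \<Rightarrow> (real ^ 'd \<Rightarrow> real) \<Rightarrow> nat \<Rightarrow> 'w \<Rightarrow> real" where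
  "test_stat \<mu>f x \<theta>hat G \<phi>hat W T \<omega> =
     real T * (LINT u:pos_orthant|lborel.
       (emp_laplace \<mu>f x \<theta>hat T \<omega> u - laplace (G (\<phi>hat T \<omega>)) u)\<^sup>2 * W u)"

definition Gamma_mat ::
  "'w measure \<Rightarrow> (real ^ 'k \<Rightarrow> (nat \<Rightarrow> real ^ 'd) \<Rightarrow> real ^ 'd) \<Rightarrow> (int \<Rightarrow> 'w \<Rightarrow> real ^ 'd) \<Rightarrow>
   (int \<Rightarrow> 'w \<Rightarrow> real ^ 'd) \<Rightarrow> real ^ 'k \<Rightarrow> int \<Rightarrow> real ^ 'd \<Rightarrow> real ^ 'k ^ 'd" where
  "Gamma_mat M \<mu> x \<epsilon> \<theta>0 t u =
     (\<integral>\<omega>. exp (- (u \<bullet> \<epsilon> t \<omega>)) *\<^sub>R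
        (matrix_inv (diag_mat (\<mu> \<theta>0 (past x (t - 1) \<omega>))) ** diag_mat (\<epsilon> t \<omega>)
          ** jacobian_mat (\<lambda>\<theta>. \<mu> \<theta> (past x (t - 1) \<omega>)) \<theta>0) \<partial>M)"

definition Y_term ::
  "'w measure \<Rightarrow> (real ^ 'k \<Rightarrow> (nat \<Rightarrow> real ^ 'd) \<Rightarrow> real ^ 'd) \<Rightarrow> (int \<Rightarrow> 'w \<Rightarrow> real ^ 'd) \<Rightarrow>
   (int \<Rightarrow> 'w \<Rightarrow> real ^ 'd) \<Rightarrow> real ^ 'k \<Rightarrow> (real ^ 'r \<Rightarrow> (real ^ 'd) measure) \<Rightarrow> real ^ 'r \<Rightarrow>
   (int \<Rightarrow> 'w \<Rightarrow> real ^ 'k) \<Rightarrow> (int \<Rightarrow> 'w \<Rightarrow> real ^ 'r) \<Rightarrow> int \<Rightarrow> real ^ 'd \<Rightarrow> 'w \<Rightarrow> real" where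
  "Y_term M \<mu> x \<epsilon> \<theta>0 G \<phi>0 m1 m2 t u \<omega> =
     exp (- (u \<bullet> \<epsilon> t \<omega>)) - laplace (G \<phi>0) u
     + u \<bullet> (Gamma_mat M \<mu> x \<epsilon> \<theta>0 t u *v m1 t \<omega>)
     - gradient (\<lambda>\<phi>. laplace (G \<phi>) u) \<phi>0 \<bullet> m2 t \<omega>"

definition limit_cov ::
  "'w measure \<Rightarrow> (real ^ 'k \<Rightarrow> (nat \<Rightarrow> real ^ 'd) \<Rightarrow> real ^ 'd) \<Rightarrow> (int \<Rightarrow> 'w \<Rightarrow> real ^ 'd) \<Rightarrow>
   (int \<Rightarrow> 'w \<Rightarrow> real ^ 'd) \<Rightarrow> real ^ 'k \<Rightarrow> (real ^ 'r \<Rightarrow> (real ^ 'd) measure) \<Rightarrow> real ^ 'r \<Rightarrow>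
   (int \<Rightarrow> 'w \<Rightarrow> real ^ 'k) \<Rightarrow> (int \<Rightarrow> 'w \<Rightarrow> real ^ 'r) \<Rightarrow> int \<Rightarrow> real ^ 'd \<Rightarrow> real ^ 'd \<Rightarrow> real"
  where
  "limit_cov M \<mu> x \<epsilon> \<theta>0 G \<phi>0 m1 m2 t u s =
     (\<integral>\<omega>. Y_term M \<mu> x \<epsilon> \<theta>0 G \<phi>0 m1 m2 t u \<omega> * Y_term M \<mu> x \<epsilon> \<theta>0 G \<phi>0 m1 m2 t s \<omega> \<partial>M)"

end

theory Submission
  imports Defs
begin

text \<open>Let \<open>\<nu>\<close> be the measure \<open>W du\<close> on the orthant, so that the statistic is the squared \<open>L\<^sup>2(\<nu>)\<close>
  norm of the scaled difference of transforms.  Replacing the initial values (a geometrically small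
  error) and expanding \<open>exp (- u \<bullet> (x\<^sub>t \<oslash> \<mu>\<^sub>t(\<theta>)))\<close> at \<open>\<theta>0\<close> and \<open>L\<^sub>\<phi>(u)\<close> at \<open>\<phi>0\<close>, where Birkhoff's theorem
  turns the average gradient into \<open>u\<^sup>T \<Gamma>(u)\<close>, this difference is \<open>T\<^sup>-\<^sup>1\<^sup>/\<^sup>2 \<Sum> Y\<^sub>t(u)\<close> up to an error whose
  \<open>L\<^sup>2(\<nu>)\<close> norm vanishes in probability.  The remainders are suprema over a countable dense set of
  parameters, hence measurable, on balls shrinking like \<open>T\<^sup>-\<^sup>1\<^sup>/\<^sup>4\<close>.

  The \<open>Y\<^sub>t(u)\<close> are stationary martingale differences adapted to independent innovations.  The law of
  large numbers for their squares follows from Birkhoff's theorem and the zero-one law, so McLeish's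
  argument gives a central limit theorem for the finite-dimensional distributions.  The second
  moments of \<open>T\<^sup>-\<^sup>1\<^sup>/\<^sup>2 \<Sum> Y\<^sub>t(u)\<close> do not depend on \<open>T\<close>, and then convergence of finite-dimensional
  distributions suffices for the convergence of the integrated square: no tightness in a function
  space is needed.  A jointly measurable version of the limit is constructed from independent
  standard normal variables.\<close>

section \<open>The ergodic theorem\<close>

text \<open>Ergodicity is given for \<open>x\<close>, whereas the joint process of innovations and
  martingale differences is only stationary. This is why two ergodic arguments occur: averages of
  gradients are functionals of the path of \<open>x\<close>, but the squares of the martingale
  differences rely on the zero-one law of the innovations, which concerns one-sided pasts and hence
  calls for a reversal of time. The second obstacle is measurability. Neither the suprema over
  \<open>U\<close> in the moment conditions nor the infinite-past functions evaluated at the random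
  \<open>\<theta>hat T\<close> are measurable by hypothesis, so every remainder is majorised by a
  countable supremum that is valid for all parameters of a ball at once. The radius of this ball
  must tend to zero, to make the remainders small, but more slowly than \<open>1 / sqrt T\<close>,
  to contain the estimators with probability tending to one. Finally, the limit has to be reached
  for every Gaussian process with the right covariance on any probability space; all limits are
  therefore expressed by characteristic functions, which the covariance determines.\<close>

locale ergodic_transformation = prob_space +
  fixes \<tau> :: "'a \<Rightarrow> 'a"
  assumes tau_measurable [measurable]: "\<tau> \<in> measurable M M"
    and tau_preserves: "distr M M \<tau> = M"
    and tau_ergodic: "\<And>A. A \<in> sets M \<Longrightarrow> \<tau> -` A \<inter> space M = A \<Longrightarrow> prob A \<in> {0, 1}"
begin

lemma integral_comp_tau:
  fixes f :: "'a \<Rightarrow> real"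
  assumes [measurable]: "f \<in> borel_measurable M"
  shows "(\<integral>w. f (\<tau> w) \<partial>M) = (\<integral>w. f w \<partial>M)"
  using integral_distr[of \<tau> M M f] tau_preserves by simp

lemma integrable_comp_tau:
  fixes f :: "'a \<Rightarrow> real"
  assumes "integrable M f"
  shows "integrable M (\<lambda>w. f (\<tau> w))"
  using integrable_distr_eq[of \<tau> M M f] tau_preserves assms by auto

text \<open>The maximum of \<open>0\<close> and the Birkhoff sums of length \<open>1\<close> to
  \<open>n\<close>, in the recursive form due to Garsia: passing from \<open>n\<close> to
  \<open>Suc n\<close> only involves the value at \<open>\<tau> w\<close>, and this is what the
  maximal inequality exploits.\<close>

primrec running_max :: "('a \<Rightarrow> real) \<Rightarrow> nat \<Rightarrow> 'a \<Rightarrow> real" where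
  "running_max f 0 w = 0"
| "running_max f (Suc n) w = max 0 (f w + running_max f n (\<tau> w))"

lemma integrable_running_max:
  assumes "integrable M f"
  shows "integrable M (running_max f n)"
proof (induction n)
  case 0
  then show ?case by (simp add: fun_eq_iff[of "running_max f 0"])
next
  case (Suc n)
  from integrable_comp_tau[OF Suc] assms
  show ?case by (auto simp: running_max.simps(2)[abs_def])
qed

lemma running_max_nonneg: "0 \<le> running_max f n w"
  by (cases n) auto

lemma running_max_mono: "running_max f n w \<le> running_max f (Suc n) w"
proof (induction n arbitrary: w)
  case 0
  then show ?case by simp
next
  case (Suc n)
  from Suc[of "\<tau> w"] show ?case by auto
qed

lemma birkhoff_sum_le_running_max: "(\<Sum>k<n. f ((\<tau> ^^ k) w)) \<le> running_max f n w"
proof (induction n arbitrary: w)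
  case (Suc n)
  have "(\<Sum>k<Suc n. f ((\<tau> ^^ k) w)) = f w + (\<Sum>k<n. f ((\<tau> ^^ k) (\<tau> w)))"
    by (subst sum.lessThan_Suc_shift) (simp add: funpow_swap1)
  with Suc[of "\<tau> w"] show ?case by auto
qed auto

lemma birkhoff_sum_Suc:
  "(\<Sum>k<Suc n. f ((\<tau> ^^ k) w)) = f w + (\<Sum>k<n. (f ((\<tau> ^^ k) (\<tau> w)) :: real))"
  by (subst sum.lessThan_Suc_shift) (simp add: funpow_swap1)

text \<open>Garsia's proof of Hopf's inequality. Where the maximum is positive, it equals
  \<open>f w\<close> plus the maximum of one step less at \<open>\<tau> w\<close>, hence is at most
  \<open>f w + running_max f (Suc n) (\<tau> w)\<close>; elsewhere it is zero while the value at
  \<open>\<tau> w\<close> is nonnegative. On integration the two maxima cancel because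
  \<open>\<tau>\<close> preserves the measure.\<close>

lemma maximal_ergodic:
  assumes f: "integrable M f"
  shows "0 \<le> (\<integral>w. f w * indicator {w\<in>space M. 0 < running_max f (Suc n) w} w \<partial>M)"
proof -
  have [measurable]: "f \<in> borel_measurable M" "running_max f n \<in> borel_measurable M" for n
    using f integrable_running_max[OF f] by auto
  have i: "integrable M (running_max f (Suc n))" "integrable M (\<lambda>w. running_max f (Suc n) (\<tau> w))"
    using integrable_running_max[OF f, of "Suc n"] integrable_comp_tau by (simp_all del: running_max.simps)
  have "0 = (\<integral>w. running_max f (Suc n) w - running_max f (Suc n) (\<tau> w) \<partial>M)"
    using i integral_comp_tau[of "running_max f (Suc n)"] by (simp del: running_max.simps)
  also have "\<dots> \<le> (\<integral>w. f w * indicator {w\<in>space M. 0 < running_max f (Suc n) w} w \<partial>M)"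
  proof (rule integral_mono)
    fix w assume w: "w \<in> space M"
    show "running_max f (Suc n) w - running_max f (Suc n) (\<tau> w)
      \<le> f w * indicator {w\<in>space M. 0 < running_max f (Suc n) w} w"
      using w running_max_mono[of f n "\<tau> w"] running_max_nonneg[of f "Suc n" "\<tau> w"]
      by (auto simp: indicator_def max_def simp del: running_max.simps(2)
          simp: running_max.simps(2)[of f n w] split: if_splits)
  qed (use i f in \<open>auto intro!: integrable_real_mult_indicator simp del: running_max.simps\<close>)
  finally show ?thesis .
qed

text \<open>The sets where the running maximum is positive increase to a set of full measure, so the
  maximal inequality passes to the limit by dominated convergence with majorant
  \<open>\<bar>f w\<bar>\<close>.\<close>

lemma integral_nonneg_if_running_max_pos:
  fixes f :: "'a \<Rightarrow> real"
  assumes f: "integrable M f" and pos: "AE w in M. \<exists>n. 0 < (\<Sum>k<n. f ((\<tau> ^^ k) w))"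
  shows "0 \<le> (\<integral>w. f w \<partial>M)"
proof -
  have [measurable]: "f \<in> borel_measurable M"
    using f by auto
  define R where "R n = running_max f (Suc n)" for n
  have [measurable]: "R n \<in> borel_measurable M" for n
    unfolding R_def by (rule borel_measurable_integrable[OF integrable_running_max[OF f]])
  let ?g = "\<lambda>n w. f w * indicator {w\<in>space M. 0 < R n w} w"
  have lim: "(\<lambda>n. \<integral>w. ?g n w \<partial>M) \<longlonglongrightarrow> (\<integral>w. f w \<partial>M)"
  proof (rule integral_dominated_convergence[where w = "\<lambda>w. \<bar>f w\<bar>"])
    show "AE w in M. (\<lambda>n. ?g n w) \<longlonglongrightarrow> f w"
      using pos AE_space
    proof eventually_elim
      case (elim w)
      then obtain m where m: "0 < (\<Sum>k<m. f ((\<tau> ^^ k) w))" by auto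
      have pos: "0 < R n w" if "m \<le> n" for n
      proof -
        have "running_max f m w \<le> running_max f (Suc n) w"
          by (rule lift_Suc_mono_le[of "\<lambda>n. running_max f n w"]) (use that in \<open>auto simp del: running_max.simps intro: running_max_mono\<close>)
        with birkhoff_sum_le_running_max[where f=f and n=m and w=w] m show ?thesis
          unfolding R_def by linarith
      qed
      have "f w = ?g n w" if "m \<le> n" for n
        using pos[OF that] elim(2) by simp
      then have "eventually (\<lambda>n. f w = ?g n w) sequentially"
        by (rule eventually_sequentiallyI[of m]) 
      then show ?case by (rule Lim_transform_eventually[OF tendsto_const])
    qed
    show "f \<in> borel_measurable M" "?g n \<in> borel_measurable M" for n by measurable
    show "integrable M (\<lambda>w. \<bar>f w\<bar>)" using f by auto
    show "AE w in M. norm (?g n w) \<le> \<bar>f w\<bar>" for n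
      by (rule AE_I2) (simp add: indicator_def)
  qed
  have nonneg: "0 \<le> (\<integral>w. ?g n w \<partial>M)" for n
    unfolding R_def by (rule maximal_ergodic[OF f])
  show ?thesis
    by (rule LIMSEQ_le_const[OF lim]) (rule exI, rule allI, rule impI, rule nonneg)
qed

text \<open>Unboundedness from above is a shift-invariant property of the sums, so it has
  probability zero or one. Probability one would make some sum positive almost everywhere and force
  a nonnegative integral.\<close>

lemma birkhoff_sums_bounded:
  fixes f :: "'a \<Rightarrow> real"
  assumes f: "integrable M f" and neg: "(\<integral>w. f w \<partial>M) < 0"
  shows "AE w in M. \<exists>K::nat. \<forall>n. (\<Sum>k<n. f ((\<tau> ^^ k) w)) \<le> real K"
proof -
  have [measurable]: "f \<in> borel_measurable M" using f by auto
  let ?S = "\<lambda>n w. (\<Sum>k<n. f ((\<tau> ^^ k) w))"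
  define A where "A = {w\<in>space M. \<forall>K::nat. \<exists>n. real K < ?S n w}"
  have [measurable]: "A \<in> sets M" unfolding A_def by measurable
  \<comment> \<open>The sums at \<open>w\<close> and at \<open>\<tau> w\<close> differ by an index
    shift and the finite number \<open>f w\<close>, which is absorbed by enlarging the bound
    \<open>K\<close> to \<open>K'\<close>.\<close>
  have "w \<in> A \<longleftrightarrow> \<tau> w \<in> A" if w: "w \<in> space M" for w
  proof -
    have tw: "\<tau> w \<in> space M" using w by (rule measurable_space[OF tau_measurable])
    have "\<exists>n. real K < ?S n (\<tau> w)" if a: "\<forall>K::nat. \<exists>n. real K < ?S n w" for K
    proof -
      obtain K' :: nat where K': "real K + \<bar>f w\<bar> < K'" using reals_Archimedean2 by blast
      obtain n where n: "real K' < ?S n w" using a by auto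
      then obtain m where "n = Suc m" by (cases n) (use K' in auto)
      then have "real K < ?S m (\<tau> w)" using n K' birkhoff_sum_Suc[of f w m] by auto
      then show ?thesis by auto
    qed
    moreover have "\<exists>n. real K < ?S n w" if a: "\<forall>K::nat. \<exists>n. real K < ?S n (\<tau> w)" for K
    proof -
      obtain K' :: nat where K': "real K + \<bar>f w\<bar> < K'" using reals_Archimedean2 by blast
      obtain n where n: "real K' < ?S n (\<tau> w)" using a by auto
      then have "real K < ?S (Suc n) w"
        using K' birkhoff_sum_Suc[of f w n] by (simp del: sum.lessThan_Suc)
      then show ?thesis by (rule exI)
    qed
    ultimately show ?thesis using w tw unfolding A_def by blast
  qed
  then have "\<tau> -` A \<inter> space M = A" using sets.sets_into_space[of A M] by auto
  then have "prob A \<in> {0,1}" by (intro tau_ergodic) auto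
  moreover have "prob A \<noteq> 1"
  proof
    assume "prob A = 1"
    then have "AE w in M. w \<in> A" by (simp add: prob_eq_1)
    then have "AE w in M. \<exists>n. 0 < ?S n w"
      by eventually_elim (auto simp: A_def dest!: spec[of _ 0])
    from integral_nonneg_if_running_max_pos[OF f this] neg show False by simp
  qed
  ultimately have "AE w in M. w \<notin> A" by (simp add: prob_eq_0)
  with AE_space show ?thesis
    by eventually_elim (auto simp: A_def not_less)
qed

text \<open>Subtracting the mean plus \<open>1 / Suc m\<close> makes the integral negative; the
  centred sums are then bounded above by some \<open>K\<close>, and \<open>K / n\<close> disappears
  in the average. Countably many \<open>m\<close> give a single null set for all
  \<open>c\<close>.\<close>

lemma birkhoff_upper:
  fixes f :: "'a \<Rightarrow> real"
  assumes f: "integrable M f"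
  shows "AE w in M. \<forall>c>(\<integral>w. f w \<partial>M). eventually (\<lambda>n. (\<Sum>k<n. f ((\<tau> ^^ k) w)) / n < c) sequentially"
proof -
  have "AE w in M. \<forall>m::nat. \<exists>K::nat. \<forall>n.
      (\<Sum>k<n. f ((\<tau> ^^ k) w) - ((\<integral>w. f w \<partial>M) + 1 / Suc m)) \<le> real K"
    unfolding AE_all_countable using f prob_space
    by (intro allI birkhoff_sums_bounded) auto
  then show ?thesis
  proof eventually_elim
    case (elim w)
    show ?case
    proof (intro allI impI)
      fix c assume c: "(\<integral>w. f w \<partial>M) < c"
      then obtain m where m: "1 / Suc m < (c - (\<integral>w. f w \<partial>M))"
        using reals_Archimedean[of "c - (\<integral>w. f w \<partial>M)"] by (auto simp: inverse_eq_divide)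
      define d where "d = (\<integral>w. f w \<partial>M) + 1 / Suc m"
      have dc: "d < c" using m by (simp add: d_def)
      obtain K :: nat where K: "\<And>n. (\<Sum>k<n. f ((\<tau> ^^ k) w) - d) \<le> real K" 
        using elim unfolding d_def by blast
      have "(\<lambda>n. d + real K / real n) \<longlonglongrightarrow> d + 0"
        by (intro tendsto_add tendsto_const lim_const_over_n)
      then have "eventually (\<lambda>n. d + real K / real n < c) sequentially"
        using dc by (intro order_tendstoD) auto
      with eventually_gt_at_top[of "0::nat"]
      show "eventually (\<lambda>n. (\<Sum>k<n. f ((\<tau> ^^ k) w)) / n < c) sequentially"
      proof eventually_elim
        case (elim n)
        have "(\<Sum>k<n. f ((\<tau> ^^ k) w)) \<le> n * d + K" using K[of n] by (simp add: sum_subtractf)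
        then have "(\<Sum>k<n. f ((\<tau> ^^ k) w)) / n \<le> d + K / n"
          using elim by (simp add: field_simps)
        with elim show ?case by linarith
      qed
    qed
  qed
qed

theorem birkhoff:
  fixes f :: "'a \<Rightarrow> real"
  assumes f: "integrable M f"
  shows "AE w in M. (\<lambda>n. (\<Sum>k<n. f ((\<tau> ^^ k) w)) / real n) \<longlonglongrightarrow> (\<integral>w. f w \<partial>M)"
proof -
  have "integrable M (\<lambda>w. - f w)" using f by auto
  from birkhoff_upper[OF f] birkhoff_upper[OF this] show ?thesis
  proof eventually_elim
    case (elim w)
    show ?case
    proof (rule order_tendstoI)
      fix a assume "a < (\<integral>w. f w \<partial>M)"
      then have "eventually (\<lambda>n. (\<Sum>k<n. - f ((\<tau> ^^ k) w)) / n < -a) sequentially"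
        using elim(2) by auto
      then show "eventually (\<lambda>n. a < (\<Sum>k<n. f ((\<tau> ^^ k) w)) / n) sequentially"
        by eventually_elim (simp add: sum_negf)
    next
      fix a assume "(\<integral>w. f w \<partial>M) < a"
      then show "eventually (\<lambda>n. (\<Sum>k<n. f ((\<tau> ^^ k) w)) / n < a) sequentially"
        using elim(1) by auto
    qed
  qed
qed

end

section \<open>A martingale central limit theorem\<close>

lemma abs_exp_neg_diff_le: 
  fixes x y :: real
  assumes "0 \<le> x" "0 \<le> y"
  shows "\<bar>exp (- x) - exp (- y)\<bar> \<le> \<bar>x - y\<bar>"
proof -
  have "\<bar>exp (- a) - exp (- b)\<bar> \<le> \<bar>a - b\<bar>" if "0 \<le> a" "a \<le> b" for a b :: real
  proof -
    have "exp (- a) - exp (- b) = exp (- a) * (1 - exp (- (b - a)))"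
      by (simp add: algebra_simps flip: exp_add)
    also have "\<dots> \<le> 1 * (b - a)"
      using that exp_ge_add_one_self[of "- (b - a)"] by (intro mult_mono) (auto simp: algebra_simps)
    finally show ?thesis using that by auto
  qed
  from this[of x y] this[of y x] assms show ?thesis
    by (cases "x \<le> y") (auto simp: abs_minus_commute)
qed

lemma exp_neg_taylor1:
  fixes y :: real
  assumes "0 \<le> y"
  shows "\<bar>exp (- y) - (1 - y)\<bar> \<le> y\<^sup>2 / 2"
proof -
  have "\<exists>t. \<bar>t\<bar> \<le> \<bar>-y\<bar> \<and> exp (- y) = (\<Sum>m<2. (-y) ^ m / fact m) + exp t / fact 2 * (-y) ^ 2"
    by (rule Maclaurin_exp_le)
  then obtain t where t: "\<bar>t\<bar> \<le> y" "exp (- y) = 1 - y + exp t / 2 * y\<^sup>2"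
    using assms by (auto simp: numeral_2_eq_2)
  have "(\<lambda>x. exp (- x) - (1 - x)) 0 \<le> (\<lambda>x. exp (- x) - (1 - x)) y"
    using exp_ge_add_one_self[of "-y"] by simp
  moreover have "(\<lambda>x::real. exp (- x) - (1 - x) - x\<^sup>2 / 2) y \<le> (\<lambda>x. exp (- x) - (1 - x) - x\<^sup>2 / 2) 0"
    using assms
  proof (rule DERIV_nonpos_imp_nonincreasing)
    fix x :: real assume "0 \<le> x"
    have "((\<lambda>x. exp (- x) - (1 - x) - x\<^sup>2 / 2) has_real_derivative - exp (-x) + 1 - x) (at x)"
      by (auto intro!: derivative_eq_intros)
    moreover have "- exp (-x) + 1 - x \<le> 0" using exp_ge_add_one_self[of "-x"] by simp
    ultimately show "\<exists>z. ((\<lambda>x. exp (- x) - (1 - x) - x\<^sup>2 / 2) has_real_derivative z) (at x) \<and> z \<le> 0"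
      by blast
  qed
  ultimately show ?thesis by auto
qed

lemma norm_one_plus_i: "cmod (1 + \<i> * of_real x) = sqrt (1 + x\<^sup>2)"
  by (simp add: cmod_def)

lemma one_le_norm_one_plus_i: "1 \<le> cmod (1 + \<i> * of_real x)"
  unfolding norm_one_plus_i by simp

lemma one_plus_i_nonzero: "1 + \<i> * of_real x \<noteq> 0"
  using one_le_norm_one_plus_i[of x] by (metis norm_zero not_one_le_zero)

lemma inverse_norm_one_plus_i_le: "1 / cmod (1 + \<i> * of_real x) \<le> 1"
  using one_le_norm_one_plus_i[of x] by (subst divide_le_eq_1) auto

text \<open>The expansion behind McLeish's theorem: up to a cubic error, \<open>iexp x\<close> is
  \<open>1 + \<i> * x\<close> times a Gaussian factor. For small \<open>x\<close> the product of
  \<open>1 + \<i> * x\<close> with \<open>1 - x^2 / 2\<close> agrees with the second Taylor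
  polynomial up to \<open>- \<i> * x^3 / 2\<close>; otherwise both quantities have modulus at most
  one and the cubic bound exceeds two.\<close>

lemma iexp_quotient_approx:
  "cmod (iexp x / (1 + \<i> * of_real x) - of_real (exp (- (x\<^sup>2 / 2)))) \<le> 2 * \<bar>x\<bar> ^ 3"
proof (cases "\<bar>x\<bar> \<le> 1")
  case True
  let ?d = "1 + \<i> * of_real x" and ?e = "exp (- (x\<^sup>2 / 2))"
  have "iexp x / ?d - of_real ?e = (iexp x - ?d * of_real ?e) / ?d"
    using one_plus_i_nonzero[of x] by (simp add: divide_simps)
  then have "cmod (iexp x / ?d - of_real ?e) = cmod (iexp x - ?d * of_real ?e) / cmod ?d"
    by (simp only: norm_divide)
  also have "\<dots> \<le> cmod (iexp x - ?d * of_real ?e)"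
    using one_le_norm_one_plus_i[of x] by (intro divide_le_eq[THEN iffD2])
      (auto simp: mult_le_cancel_left1)
  also have "iexp x - ?d * of_real ?e = (iexp x - (\<Sum>k\<le>2. (\<i> * x) ^ k / fact k))
      + (\<i> * of_real (x ^ 3 / 2)) - ?d * of_real (?e - (1 - x\<^sup>2 / 2))"
    by (simp add: numeral_2_eq_2 numeral_3_eq_3 algebra_simps)
  also have "cmod \<dots> \<le> cmod (iexp x - (\<Sum>k\<le>2. (\<i> * x) ^ k / fact k)) + cmod (\<i> * of_real (x ^ 3 / 2))
      + cmod ?d * \<bar>?e - (1 - x\<^sup>2 / 2)\<bar>"
    by (rule order_trans[OF norm_triangle_ineq4 add_mono[OF norm_triangle_ineq]])
       (simp only: norm_mult norm_of_real)
  also have "\<dots> \<le> \<bar>x\<bar> ^ 3 / 6 + \<bar>x\<bar> ^ 3 / 2 + 2 * (\<bar>x\<bar> ^ 3 / 8)"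
  proof (intro add_mono mult_mono)
    show "cmod (iexp x - (\<Sum>k\<le>2. (\<i> * x) ^ k / fact k)) \<le> \<bar>x\<bar> ^ 3 / 6"
      using iexp_approx1[of x 2] by (simp add: eval_nat_numeral)
    show "cmod (\<i> * of_real (x ^ 3 / 2)) \<le> \<bar>x\<bar> ^ 3 / 2"
      by (simp add: norm_mult norm_power norm_divide)
    show "cmod ?d \<le> 2"
      using True norm_triangle_ineq[of 1 "\<i> * of_real x"] by (simp add: norm_mult)
    have "\<bar>?e - (1 - x\<^sup>2 / 2)\<bar> \<le> (x\<^sup>2 / 2)\<^sup>2 / 2" by (rule exp_neg_taylor1) simp
    also have "\<dots> = \<bar>x\<bar> * \<bar>x\<bar> ^ 3 / 8"
      by (simp add: power2_eq_square eval_nat_numeral abs_mult[symmetric])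
    also have "\<dots> \<le> 1 * \<bar>x\<bar> ^ 3 / 8" using True by (intro divide_right_mono mult_right_mono) auto
    finally show "\<bar>?e - (1 - x\<^sup>2 / 2)\<bar> \<le> \<bar>x\<bar> ^ 3 / 8" by simp
  qed auto
  also have "\<dots> \<le> 2 * \<bar>x\<bar> ^ 3" by simp
  finally show ?thesis .
next
  case False
  have "cmod (iexp x / (1 + \<i> * of_real x)) \<le> 1"
    using inverse_norm_one_plus_i_le[of x] by (simp add: norm_divide)
  then have "cmod (iexp x / (1 + \<i> * of_real x) - of_real (exp (- (x\<^sup>2 / 2)))) \<le> 1 + 1"
    by (intro order_trans[OF norm_triangle_ineq4] add_mono) auto
  also have "\<dots> \<le> 2 * \<bar>x\<bar> ^ 3" using False by simp
  finally show ?thesis .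
qed

text \<open>The pathwise part of the argument. Terms are set to zero once the squares of the earlier
  terms add up to more than \<open>C\<close>. Testing \<open>V (n - 1)\<close> rather than
  \<open>V n\<close> makes the decision depend on the past only, as the martingale property
  requires; the price is that the one term crossing the level is still included.\<close>

locale stopped_sequence =
  fixes x :: "nat \<Rightarrow> real" and C :: real
  assumes C: "0 \<le> C"
begin

definition V :: "nat \<Rightarrow> real" where "V n = (\<Sum>s=1..n. (x s)\<^sup>2)"
definition z :: "nat \<Rightarrow> real" where "z n = (if V (n - 1) \<le> C then x n else 0)"
definition P :: "nat \<Rightarrow> complex" where "P n = (\<Prod>s=1..n. 1 + \<i> * of_real (z s))"

lemma V_mono: "m \<le> n \<Longrightarrow> V m \<le> V n"
  unfolding V_def by (intro sum_mono2) auto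

lemma z_eq_x: "V n \<le> C \<Longrightarrow> s \<le> n \<Longrightarrow> z s = x s"
  unfolding z_def using V_mono[of "s - 1" n] by (cases s) auto

lemma norm_P_le_if: "V n \<le> C \<Longrightarrow> cmod (P n) \<le> exp (C / 2)"
proof -
  assume V: "V n \<le> C"
  have "cmod (P n) = (\<Prod>s=1..n. sqrt (1 + (x s)\<^sup>2))"
    unfolding P_def prod_norm[symmetric]
    by (intro prod.cong) (auto simp: norm_one_plus_i z_eq_x[OF V])
  also have "\<dots> \<le> (\<Prod>s=1..n. exp ((x s)\<^sup>2 / 2))"
  proof (intro prod_mono conjI)
    fix s
    have "sqrt (1 + (x s)\<^sup>2) \<le> sqrt (exp ((x s)\<^sup>2))" by (intro real_sqrt_le_mono exp_ge_add_one_self)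
    also have "\<dots> = exp ((x s)\<^sup>2 / 2)"
      by (intro real_sqrt_unique) (auto simp: power2_eq_square simp flip: exp_add)
    finally show "sqrt (1 + (x s)\<^sup>2) \<le> exp ((x s)\<^sup>2 / 2)" .
  qed auto
  also have "\<dots> = exp (V n / 2)" by (simp add: V_def exp_sum[symmetric] sum_divide_distrib)
  also have "\<dots> \<le> exp (C / 2)" using V by simp
  finally show ?thesis .
qed

lemma P_Suc: "P (Suc n) = P n * (1 + \<i> * of_real (z (Suc n)))"
  by (simp add: P_def)

text \<open>Below the level each factor has modulus at most \<open>exp (x^2 / 2)\<close>, which
  gives \<open>exp (C / 2)\<close>; the crossing term contributes one further factor of at most
  \<open>1 + b\<close>, and all later factors are one.\<close>

lemma norm_P_le:
  assumes b: "\<And>s. s \<in> {1..n} \<Longrightarrow> \<bar>x s\<bar> \<le> b" "0 \<le> b"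
  shows "cmod (P n) \<le> exp (C / 2) * (1 + b)"
  using b(1)
proof (induction n)
  case 0
  then show ?case using b(2) C by (simp add: P_def) (metis add.commute add_increasing2 exp_ge_zero
    mult_mono' one_le_exp_iff zero_le_divide_iff zero_le_numeral mult_1 le_add_same_cancel1 zero_le_one)
next
  case (Suc n)
  show ?case
  proof (cases "V n \<le> C")
    case True
    have "cmod (P (Suc n)) = cmod (P n) * cmod (1 + \<i> * of_real (x (Suc n)))"
      using True by (simp add: P_Suc norm_mult z_def)
    also have "\<dots> \<le> exp (C / 2) * (1 + b)"
    proof (intro mult_mono norm_P_le_if True)
      show "cmod (1 + \<i> * of_real (x (Suc n))) \<le> 1 + b"
        using norm_triangle_ineq[of 1 "\<i> * of_real (x (Suc n))"] Suc.prems[of "Suc n"]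
        by (simp add: norm_mult)
    qed auto
    finally show ?thesis .
  next
    case False
    then have "P (Suc n) = P n" by (simp add: P_Suc z_def)
    with Suc show ?thesis by auto
  qed
qed

text \<open>Splits off \<open>P n\<close>, whose expectation will turn out to be one, from a factor
  that is nearly deterministic by \<open>quotient_prod_approx\<close>.\<close>

lemma iexp_factor: "iexp (\<Sum>s=1..n. z s) = P n * (\<Prod>s=1..n. iexp (z s) / (1 + \<i> * of_real (z s)))"
proof -
  have "P n * (\<Prod>s=1..n. iexp (z s) / (1 + \<i> * of_real (z s))) = (\<Prod>s=1..n. iexp (z s))"
    unfolding P_def prod.distrib[symmetric] using one_plus_i_nonzero by (intro prod.cong) auto
  also have "\<dots> = iexp (\<Sum>s=1..n. z s)"
    by (simp add: exp_sum sum_distrib_left)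
  finally show ?thesis by simp
qed

text \<open>Both products have factors of modulus at most one, so their difference is at most the
  sum of the differences of the factors. The cubic bounds become \<open>2 * b\<close> times the
  squares, which is small when the largest term is.\<close>

lemma quotient_prod_approx:
  assumes V: "V n \<le> C" and b: "\<And>s. s \<in> {1..n} \<Longrightarrow> \<bar>x s\<bar> \<le> b"
  shows "cmod ((\<Prod>s=1..n. iexp (z s) / (1 + \<i> * of_real (z s))) - of_real (exp (- (V n / 2)))) \<le> 2 * b * V n"
proof -
  have "of_real (exp (- (V n / 2))) = (\<Prod>s=1..n. complex_of_real (exp (- ((x s)\<^sup>2 / 2))))"
    by (simp add: V_def exp_sum[symmetric] sum_divide_distrib sum_negf flip: of_real_prod)
  moreover have "(\<Prod>s=1..n. iexp (z s) / (1 + \<i> * of_real (z s))) = (\<Prod>s=1..n. iexp (x s) / (1 + \<i> * of_real (x s)))"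
    by (intro prod.cong) (auto simp: z_eq_x[OF V])
  ultimately have "cmod ((\<Prod>s=1..n. iexp (z s) / (1 + \<i> * of_real (z s))) - of_real (exp (- (V n / 2))))
    = cmod ((\<Prod>s=1..n. iexp (x s) / (1 + \<i> * of_real (x s))) - (\<Prod>s=1..n. complex_of_real (exp (- ((x s)\<^sup>2 / 2)))))"
    by simp
  also have "\<dots> \<le> (\<Sum>s=1..n. cmod (iexp (x s) / (1 + \<i> * of_real (x s)) - of_real (exp (- ((x s)\<^sup>2 / 2)))))"
    using inverse_norm_one_plus_i_le by (intro norm_prod_diff) (auto simp: norm_divide)
  also have "\<dots> \<le> (\<Sum>s=1..n. 2 * b * (x s)\<^sup>2)"
  proof (intro sum_mono)
    fix s assume s: "s \<in> {1..n}"
    have "2 * \<bar>x s\<bar> ^ 3 = 2 * \<bar>x s\<bar> * (x s)\<^sup>2" by (simp add: eval_nat_numeral)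
    also have "\<dots> \<le> 2 * b * (x s)\<^sup>2" using b[OF s] by (intro mult_right_mono) auto
    finally show "cmod (iexp (x s) / (1 + \<i> * of_real (x s)) - of_real (exp (- ((x s)\<^sup>2 / 2)))) \<le> 2 * b * (x s)\<^sup>2"
      using iexp_quotient_approx[of "x s"] by linarith
  qed
  finally show ?thesis by (simp add: V_def sum_distrib_left)
qed

end

text \<open>The Lindeberg condition of a sequence whose members share one square-integrable
  law.\<close>

lemma small_tail_second_moment:
  fixes f :: "'a \<Rightarrow> real"
  assumes f: "integrable M (\<lambda>w. (f w)\<^sup>2)" "f \<in> borel_measurable M" and \<delta>: "0 < \<delta>"
  shows "(\<lambda>n. \<integral>w. (f w)\<^sup>2 * indicator {y. \<delta> * sqrt (real n) < \<bar>y\<bar>} (f w) \<partial>M) \<longlonglongrightarrow> 0"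
proof -
  have "(\<lambda>n. \<integral>w. (f w)\<^sup>2 * indicator {y. \<delta> * sqrt (real n) < \<bar>y\<bar>} (f w) \<partial>M) \<longlonglongrightarrow> (\<integral>w. 0 \<partial>M)"
  proof (rule integral_dominated_convergence[where w = "\<lambda>w. (f w)\<^sup>2"])
    show "AE w in M. (\<lambda>n. (f w)\<^sup>2 * indicator {y. \<delta> * sqrt (real n) < \<bar>y\<bar>} (f w)) \<longlonglongrightarrow> 0"
    proof (rule AE_I2)
      fix w
      have "filterlim (\<lambda>n. \<delta> * sqrt (real n)) at_top sequentially"
        using \<delta> by (intro filterlim_tendsto_pos_mult_at_top[OF tendsto_const] 
            filterlim_compose[OF sqrt_at_top filterlim_real_sequentially]) auto
      then have "eventually (\<lambda>n. \<bar>f w\<bar> \<le> \<delta> * sqrt (real n)) sequentially"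
        by (simp add: filterlim_at_top)
      then have "eventually (\<lambda>n. 0 = (f w)\<^sup>2 * indicator {y. \<delta> * sqrt (real n) < \<bar>y\<bar>} (f w)) sequentially"
        by eventually_elim auto
      then show "(\<lambda>n. (f w)\<^sup>2 * indicator {y. \<delta> * sqrt (real n) < \<bar>y\<bar>} (f w)) \<longlonglongrightarrow> 0"
        by (rule Lim_transform_eventually[OF tendsto_const])
    qed
    show "(\<lambda>w. (f w)\<^sup>2 * indicator {y. \<delta> * sqrt (real n) < \<bar>y\<bar>} (f w)) \<in> borel_measurable M" for n
      using f(2) by measurable
  qed (use f in \<open>auto simp: indicator_def\<close>)
  then show ?thesis by simp
qed

lemma (in prob_space) integrable_iexp_of_real:
  fixes f :: "'a \<Rightarrow> real"
  assumes "f \<in> borel_measurable M"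
  shows "integrable M (\<lambda>w. iexp (f w))"
  using assms by (intro integrable_iexp) auto

text \<open>McLeish's setting. The martingale property is stated as orthogonality to bounded
  functions of the past, the form in which it acts on the product \<open>P\<close>. Identical laws
  of the \<open>D n\<close> provide the Lindeberg condition, and \<open>s\<close> is the limit of
  the averaged squares.\<close>

locale martingale_difference_array = prob_space +
  fixes D :: "nat \<Rightarrow> 'a \<Rightarrow> real" and F :: "nat \<Rightarrow> 'a measure" and s :: real
  assumes F_sub: "\<And>n. subalgebra M (F n)"
    and F_mono: "\<And>n. sets (F n) \<subseteq> sets (F (Suc n))"
    and D_adapted: "\<And>n. D (Suc n) \<in> borel_measurable (F (Suc n))"
    and D_md: "\<And>n g. g \<in> borel_measurable (F n) \<Longrightarrow> (\<exists>B. \<forall>w\<in>space M. \<bar>g w\<bar> \<le> B) \<Longrightarrow>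
       (\<integral>w. g w * D (Suc n) w \<partial>M) = 0"
    and D_L2: "\<And>n. integrable M (\<lambda>w. (D (Suc n) w)\<^sup>2)"
    and D_distr: "\<And>n. distr M borel (D (Suc n)) = distr M borel (D 1)"
    and D_lln: "\<And>e. 0 < e \<Longrightarrow>
       (\<lambda>T. prob {w\<in>space M. e < \<bar>(\<Sum>t=1..T. (D t w)\<^sup>2) / real T - s\<bar>}) \<longlonglongrightarrow> 0"
    and s_nonneg: "0 \<le> s"
begin

lemma D_measurable [measurable]: "0 < n \<Longrightarrow> D n \<in> borel_measurable M"
  using measurable_from_subalg[OF F_sub D_adapted[of "n - 1"]] by simp

lemma D_L2': "0 < n \<Longrightarrow> integrable M (\<lambda>w. (D n w)\<^sup>2)"
  using D_L2[of "n - 1"] by simp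

lemma D_integrable: "0 < n \<Longrightarrow> integrable M (D n)"
  by (rule square_integrable_imp_integrable) (auto intro: D_L2')

lemma D_adapted': "0 < k \<Longrightarrow> k \<le> n \<Longrightarrow> D k \<in> borel_measurable (F n)"
proof -
  assume k: "0 < k" "k \<le> n"
  have "sets (F k) \<subseteq> sets (F n)"
    using k(2) F_mono by (rule lift_Suc_mono_le[rotated])
  moreover have "space (F k) = space (F n)" 
    using F_sub by (auto simp: subalgebra_def)
  ultimately have "borel_measurable (F k) \<subseteq> borel_measurable (F n)"
    by (intro measurable_mono) auto
  then show ?thesis using D_adapted[of "k - 1"] k by auto
qed

lemma D_md_complex:
  fixes g :: "'a \<Rightarrow> complex"
  assumes g: "g \<in> borel_measurable (F n)" and B: "\<And>w. w \<in> space M \<Longrightarrow> cmod (g w) \<le> B"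
  shows "(\<integral>w. g w * of_real (D (Suc n) w) \<partial>M) = 0"
    and "integrable M (\<lambda>w. g w * of_real (D (Suc n) w))"
proof -
  have gM [measurable]: "g \<in> borel_measurable M" using measurable_from_subalg[OF F_sub g] .
  show int: "integrable M (\<lambda>w. g w * of_real (D (Suc n) w))"
  proof (rule Bochner_Integration.integrable_bound[where f = "\<lambda>w. B * D (Suc n) w"])
    show "AE w in M. norm (g w * of_real (D (Suc n) w)) \<le> norm (B * D (Suc n) w)"
      using B by (intro AE_I2) (auto simp: norm_mult abs_mult intro!: mult_right_mono order_trans[OF B])
  qed (use D_integrable[of "Suc n"] in auto)
  have "(\<integral>w. Re (g w) * D (Suc n) w \<partial>M) = 0" "(\<integral>w. Im (g w) * D (Suc n) w \<partial>M) = 0"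
    using g by (intro D_md exI[of _ B] ballI order_trans[OF abs_Re_le_cmod B] order_trans[OF abs_Im_le_cmod B]; simp)+
  then show "(\<integral>w. g w * of_real (D (Suc n) w) \<partial>M) = 0"
    using integral_Re[OF int] integral_Im[OF int] by (intro complex_eqI) simp_all
qed

context
  fixes T :: nat
  assumes T: "0 < T"
begin

definition X :: "'a \<Rightarrow> nat \<Rightarrow> real" where "X w t = D t w / sqrt (real T)"

text \<open>The level exceeds the limit \<open>s\<close> of \<open>V T\<close> by one, so with
  probability tending to one nothing is set to zero up to time \<open>T\<close>.\<close>

interpretation st: stopped_sequence "X w" "s + 1" for w
  using s_nonneg by unfold_locales auto

lemma V_measurable: "n \<le> m \<Longrightarrow> (\<lambda>w. st.V w n) \<in> borel_measurable (F m)"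
  unfolding st.V_def X_def using D_adapted' by (intro borel_measurable_sum) auto

lemma X_measurable: "0 < n \<Longrightarrow> n \<le> m \<Longrightarrow> (\<lambda>w. X w n) \<in> borel_measurable (F m)"
  unfolding X_def using D_adapted'[of n m] by auto

lemma z_measurable': "0 < n \<Longrightarrow> n \<le> m \<Longrightarrow> (\<lambda>w. st.z w n) \<in> borel_measurable (F m)"
  unfolding st.z_def using X_measurable[of n m] V_measurable[of "n - 1" m] by simp

lemma z_measurable: "0 < n \<Longrightarrow> (\<lambda>w. st.z w n) \<in> borel_measurable (F n)"
  using z_measurable'[of n n] by simp

lemma P_measurable: "(\<lambda>w. st.P w n) \<in> borel_measurable (F n)"
  unfolding st.P_def using z_measurable' by (intro borel_measurable_prod) auto

lemma X_integrable: "0 < n \<Longrightarrow> integrable M (\<lambda>w. X w n)"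
  unfolding X_def using D_integrable[of n] by auto

lemma P_integrable: "integrable M (\<lambda>w. st.P w n)"
proof (rule Bochner_Integration.integrable_bound)
  show "integrable M (\<lambda>w. exp ((s + 1) / 2) * (1 + (\<Sum>t=1..n. \<bar>X w t\<bar>)))"
    using X_integrable
    by (intro integrable_mult_right Bochner_Integration.integrable_add Bochner_Integration.integrable_sum integrable_abs) auto
  show "(\<lambda>w. st.P w n) \<in> borel_measurable M"
    using measurable_from_subalg[OF F_sub P_measurable] .
  have "cmod (st.P w n) \<le> exp ((s + 1) / 2) * (1 + (\<Sum>t=1..n. \<bar>X w t\<bar>))" for w
    by (intro st.norm_P_le member_le_sum[of _ "{1..n}" "\<lambda>t. \<bar>X w t\<bar>"] sum_nonneg) auto
  then show "AE w in M. norm (st.P w n) \<le> norm (exp ((s + 1) / 2) * (1 + (\<Sum>t=1..n. \<bar>X w t\<bar>)))"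
    by (intro AE_I2) (simp add: abs_mult sum_nonneg add_nonneg_nonneg)
qed

text \<open>Each step adds to \<open>P n\<close> the next difference times a bounded function
  \<open>g\<close> of the past: while \<open>V n \<le> s + 1\<close>, the modulus of
  \<open>P n\<close> is at most \<open>exp ((s + 1) / 2)\<close>, and beyond that level nothing is
  added. The expectation therefore never changes.\<close>

lemma P_expectation: "(\<integral>w. st.P w n \<partial>M) = 1"
proof (induction n)
  case 0
  then show ?case by (simp add: st.P_def prob_space)
next
  case (Suc n)
  define g where "g w = (if st.V w n \<le> s + 1 then st.P w n * (\<i> / of_real (sqrt T)) else 0)" for w
  have gm: "g \<in> borel_measurable (F n)"
    unfolding g_def using P_measurable[of n] V_measurable[of n n] by (intro measurable_If) auto
  have gb: "cmod (g w) \<le> exp ((s + 1) / 2) * (1 / sqrt T)" for w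
    unfolding g_def using st.norm_P_le_if[of w n] 
    by (auto simp: norm_mult norm_divide intro!: divide_right_mono)
  have "st.P w (Suc n) = st.P w n + g w * of_real (D (Suc n) w)" for w
    by (simp add: st.P_Suc g_def st.z_def X_def distrib_left)
  then have "(\<integral>w. st.P w (Suc n) \<partial>M) = (\<integral>w. st.P w n \<partial>M) + (\<integral>w. g w * of_real (D (Suc n) w) \<partial>M)"
    using D_md_complex(2)[OF gm gb] P_integrable by simp
  with D_md_complex(1)[OF gm gb] Suc show ?case by simp
qed

text \<open>Together with \<open>\<delta>\<close> a majorant of the largest term. Unlike the maximum
  it is a sum, so its expectation is controlled termwise by the truncated second moment.\<close>

definition N :: "real \<Rightarrow> 'a \<Rightarrow> real" where
  "N \<delta> w = (\<Sum>t=1..T. \<bar>X w t\<bar> * indicator {y. \<delta> < \<bar>y\<bar>} (X w t))"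

lemma N_nonneg: "0 \<le> N \<delta> w"
  unfolding N_def by (intro sum_nonneg) auto

lemma N_measurable [measurable]: "N \<delta> \<in> borel_measurable M"
  unfolding N_def X_def by measurable

lemma X_le_N:
  assumes "t \<in> {1..T}" "0 \<le> \<delta>"
  shows "\<bar>X w t\<bar> \<le> \<delta> + N \<delta> w"
proof (cases "\<delta> < \<bar>X w t\<bar>")
  case True
  then have "\<bar>X w t\<bar> = \<bar>X w t\<bar> * indicator {y. \<delta> < \<bar>y\<bar>} (X w t)" by simp
  also have "\<dots> \<le> N \<delta> w"
    unfolding N_def using assms by (intro member_le_sum) auto
  finally show ?thesis using assms by simp
qed (use N_nonneg[of \<delta> w] in linarith)

lemma N_integrable: "integrable M (N \<delta>)"
  unfolding N_def
proof (intro Bochner_Integration.integrable_sum)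
  fix t assume "t \<in> {1..T}"
  then have i: "integrable M (\<lambda>w. X w t)" by (intro X_integrable) auto
  then have [measurable]: "(\<lambda>w. X w t) \<in> borel_measurable M" by auto
  show "integrable M (\<lambda>w. \<bar>X w t\<bar> * indicator {y. \<delta> < \<bar>y\<bar>} (X w t))"
    by (rule Bochner_Integration.integrable_bound[OF i]) (auto simp: indicator_def)
qed

text \<open>A term beyond \<open>\<delta>\<close> is at most its square divided by
  \<open>\<delta>\<close>; the \<open>T\<close> identical expectations cancel the factor
  \<open>1 / T\<close> in the squares.\<close>

lemma N_expectation:
  assumes \<delta>: "0 < \<delta>"
  shows "(\<integral>w. N \<delta> w \<partial>M) \<le> (\<integral>w. (D 1 w)\<^sup>2 * indicator {y. \<delta> * sqrt T < \<bar>y\<bar>} (D 1 w) \<partial>M) / \<delta>"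
proof -
  let ?h = "\<lambda>y::real. y\<^sup>2 * indicator {y. \<delta> * sqrt T < \<bar>y\<bar>} y"
  have hm: "?h \<in> borel_measurable borel" by measurable
  have sT: "0 < sqrt (real T)" using T by simp
  have hi: "integrable M (\<lambda>w. ?h (D t w))" if "0 < t" for t
  proof (rule Bochner_Integration.integrable_bound[OF D_L2'[OF that]])
    show "(\<lambda>w. ?h (D t w)) \<in> borel_measurable M" using that hm by measurable
    show "AE w in M. norm (?h (D t w)) \<le> norm ((D t w)\<^sup>2)"
      by (rule AE_I2) (simp add: indicator_def)
  qed
  have eq: "(\<integral>w. ?h (D t w) \<partial>M) = (\<integral>w. ?h (D 1 w) \<partial>M)" if t: "0 < t" for t
  proof -
    have "(\<integral>w. ?h (D t w) \<partial>M) = (\<integral>y. ?h y \<partial>distr M borel (D t))"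
      using t hm by (intro integral_distr[symmetric]) auto
    also have "distr M borel (D t) = distr M borel (D 1)" using D_distr[of "t - 1"] t by simp
    also have "(\<integral>y. ?h y \<partial>distr M borel (D 1)) = (\<integral>w. ?h (D 1 w) \<partial>M)"
      using hm by (intro integral_distr) auto
    finally show ?thesis .
  qed
  have "(\<integral>w. N \<delta> w \<partial>M) \<le> (\<integral>w. (\<Sum>t=1..T. ?h (D t w) / (T * \<delta>)) \<partial>M)"
  proof (rule integral_mono[OF N_integrable])
    show "integrable M (\<lambda>w. \<Sum>t=1..T. ?h (D t w) / (T * \<delta>))"
      using hi by (intro Bochner_Integration.integrable_sum integrable_divide) auto
    fix w
    show "N \<delta> w \<le> (\<Sum>t=1..T. ?h (D t w) / (T * \<delta>))"
      unfolding N_def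
    proof (rule sum_mono)
      fix t
      have iff: "\<delta> < \<bar>X w t\<bar> \<longleftrightarrow> \<delta> * sqrt T < \<bar>D t w\<bar>"
        using sT by (simp add: X_def field_simps)
      have "\<bar>X w t\<bar> \<le> (D t w)\<^sup>2 / (T * \<delta>)" if "\<delta> < \<bar>X w t\<bar>"
      proof -
        have "\<bar>X w t\<bar> * \<delta> \<le> \<bar>X w t\<bar> * \<bar>X w t\<bar>" using that by (intro mult_left_mono) auto
        also have "\<dots> = (D t w)\<^sup>2 / T"
          by (simp add: X_def power2_eq_square flip: abs_mult)
        finally have "\<bar>X w t\<bar> \<le> (D t w)\<^sup>2 / T / \<delta>"
          by (subst pos_le_divide_eq[OF \<delta>])
        then show ?thesis by (simp only: divide_divide_eq_left)
      qed
      then show "\<bar>X w t\<bar> * indicator {y. \<delta> < \<bar>y\<bar>} (X w t) \<le> ?h (D t w) / (T * \<delta>)"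
        using iff by (auto simp: indicator_def)
    qed
  qed
  also have "\<dots> = (\<Sum>t=1..T. (\<integral>w. ?h (D 1 w) \<partial>M) / (T * \<delta>))"
  proof (subst Bochner_Integration.integral_sum)
    show "integrable M (\<lambda>w. ?h (D t w) / (T * \<delta>))" if "t \<in> {1..T}" for t
      using hi[of t] that by (intro integrable_divide) auto
    show "(\<Sum>t=1..T. \<integral>w. ?h (D t w) / (T * \<delta>) \<partial>M) = (\<Sum>t=1..T. (\<integral>w. ?h (D 1 w) \<partial>M) / (T * \<delta>))"
    proof (rule sum.cong[OF refl])
      fix t assume t: "t \<in> {1..T}"
      show "(\<integral>w. ?h (D t w) / (T * \<delta>) \<partial>M) = (\<integral>w. ?h (D 1 w) \<partial>M) / (T * \<delta>)"
        unfolding integral_divide_zero using eq[of t] t by (simp only: atLeastAtMost_iff) simp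
    qed
  qed
  also have "\<dots> = (\<integral>w. ?h (D 1 w) \<partial>M) / \<delta>" using T by simp
  finally show ?thesis .
qed

text \<open>As \<open>st.P w T\<close> has expectation one, the left side is the modulus of the
  expectation of \<open>?h\<close>. If the averaged squares are near \<open>s\<close> and no term is
  large, nothing is stopped and the factorisation makes \<open>?h\<close> small. The events
  \<open>B1\<close> and \<open>B2\<close> have small probability; on them \<open>st.P w T\<close> is
  bounded only in terms of \<open>N \<delta> w\<close>, whence the last summand.\<close>

lemma char_bound:
  assumes \<delta>: "0 < \<delta>" "\<delta> < 1"
  shows "cmod ((\<integral>w. iexp (\<Sum>t=1..T. X w t) \<partial>M) - of_real (exp (- (s / 2))))
    \<le> exp ((s + 1) / 2) * (12 * s + 15) * \<delta>
      + (3 + 2 * exp ((s + 1) / 2)) * (prob {w\<in>space M. \<delta> < \<bar>(\<Sum>t=1..T. (D t w)\<^sup>2) / real T - s\<bar>}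
          + (\<integral>w. N \<delta> w \<partial>M) / \<delta>)
      + exp ((s + 1) / 2) * (\<integral>w. N \<delta> w \<partial>M)"
proof -
  let ?E = "exp ((s + 1) / 2)" and ?c = "exp (- (s / 2))"
  define B1 where "B1 = {w\<in>space M. \<delta> < \<bar>(\<Sum>t=1..T. (D t w)\<^sup>2) / real T - s\<bar>}"
  define B2 where "B2 = {w\<in>space M. \<delta> \<le> N \<delta> w}"
  have [measurable]: "B1 \<in> sets M" "B2 \<in> sets M" unfolding B1_def B2_def by measurable
  have PB2: "prob B2 \<le> (\<integral>w. N \<delta> w \<partial>M) / \<delta>"
    unfolding B2_def using integral_Markov_inequality_measure[OF N_integrable, of "{}" \<delta>] \<delta> N_nonneg by auto
  let ?S = "\<lambda>w. \<Sum>t=1..T. X w t" and ?Z = "\<lambda>w. \<Sum>t=1..T. st.z w t"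
  have zm [measurable]: "(\<lambda>w. st.z w t) \<in> borel_measurable M" if "0 < t" for t
    using measurable_from_subalg[OF F_sub z_measurable[OF that]] .
  have [measurable]: "?Z \<in> borel_measurable M" "?S \<in> borel_measurable M"
    using borel_measurable_integrable[OF X_integrable] zm by (auto intro!: borel_measurable_sum)
  have iS: "integrable M (\<lambda>w. iexp (?S w))" "integrable M (\<lambda>w. iexp (?Z w))"
    by (rule integrable_iexp_of_real; measurable)+
  let ?h = "\<lambda>w. (iexp (?S w) - iexp (?Z w)) + (iexp (?Z w) - of_real ?c * st.P w T)"
  have hb: "cmod (?h w) \<le> ?E * (12 * s + 15) * \<delta> + (3 + 2 * ?E) * (indicator B1 w + indicator B2 w) + ?E * N \<delta> w"
    if w: "w \<in> space M" for w
  proof (cases "w \<in> B1 \<union> B2")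
    case True
    have "cmod (?h w) \<le> (1 + 1) + (1 + ?c * cmod (st.P w T))"
      by (intro order_trans[OF norm_triangle_ineq] order_trans[OF norm_triangle_ineq4] add_mono)
         (simp_all add: norm_mult)
    also have "\<dots> \<le> (1 + 1) + (1 + 1 * (?E * (1 + (\<delta> + N \<delta> w))))"
      using s_nonneg \<delta> N_nonneg[of \<delta> w] X_le_N[of _ \<delta> w]
      by (intro add_mono mult_mono st.norm_P_le) auto
    also have "\<dots> = 3 + ?E * (1 + \<delta>) + ?E * N \<delta> w" by (simp add: algebra_simps)
    also have "\<dots> \<le> 3 + ?E * 2 + ?E * N \<delta> w" using \<delta> by (intro add_mono mult_left_mono) auto
    also have "\<dots> \<le> ?E * (12 * s + 15) * \<delta> + (3 + 2 * ?E) * (indicator B1 w + indicator B2 w) + ?E * N \<delta> w"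
    proof -
      have "3 + ?E * 2 = (3 + 2 * ?E) * 1" by simp
      also have "\<dots> \<le> (3 + 2 * ?E) * (indicator B1 w + indicator B2 w)"
        using True by (intro mult_left_mono) (auto simp: indicator_def add_nonneg_nonneg)
      also have "\<dots> \<le> ?E * (12 * s + 15) * \<delta> + (3 + 2 * ?E) * (indicator B1 w + indicator B2 w)"
        using s_nonneg \<delta> by simp
      finally show ?thesis by (rule add_right_mono)
    qed
    finally show ?thesis .
  next
    case False
    have V: "st.V w T = (\<Sum>t=1..T. (D t w)\<^sup>2) / real T"
      unfolding st.V_def X_def by (simp add: power_divide sum_divide_distrib)
    have V1: "\<bar>st.V w T - s\<bar> \<le> \<delta>" and N1: "N \<delta> w < \<delta>"
      using False w unfolding V B1_def B2_def by auto
    have V2: "st.V w T \<le> s + 1" using V1 \<delta> by auto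
    have V0: "0 \<le> st.V w T" unfolding st.V_def by (intro sum_nonneg) auto
    have b: "\<bar>X w t\<bar> \<le> 2 * \<delta>" if "t \<in> {1..T}" for t using X_le_N[OF that, of \<delta> w] N1 \<delta> by auto
    have "?S w = ?Z w" using st.z_eq_x[OF V2] by (intro sum.cong) auto
    then have "cmod (?h w) = cmod (st.P w T * ((\<Prod>t=1..T. iexp (st.z w t) / (1 + \<i> * of_real (st.z w t))) - of_real ?c))"
      by (simp only: st.iexp_factor) (simp add: algebra_simps)
    also have "\<dots> \<le> (?E * (1 + 2 * \<delta>)) * (2 * (2 * \<delta>) * st.V w T + \<delta>)"
      unfolding norm_mult
    proof (intro mult_mono st.norm_P_le b)
      have "cmod (of_real (exp (- (st.V w T / 2))) - complex_of_real ?c) = \<bar>exp (- (st.V w T / 2)) - ?c\<bar>"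
        by (simp only: norm_of_real flip: of_real_diff)
      also have "\<dots> \<le> \<bar>st.V w T / 2 - s / 2\<bar>" using V0 s_nonneg by (intro abs_exp_neg_diff_le) auto
      also have "\<dots> \<le> \<delta>" using V1 by auto
      finally show "cmod ((\<Prod>t=1..T. iexp (st.z w t) / (1 + \<i> * of_real (st.z w t))) - of_real ?c) \<le> 2 * (2 * \<delta>) * st.V w T + \<delta>"
        by (intro norm_diff_triangle_le[OF st.quotient_prod_approx] V2 b)
    qed (use \<delta> in auto)
    \<comment> \<open>With \<open>\<delta> < 1\<close> and \<open>V \<le> s + 1\<close> the last two
      factors are at most \<open>3\<close> and \<open>(4 * (s + 1) + 1) * \<delta>\<close>; this is
      the origin of \<open>12 * s + 15\<close>.\<close>
    also have "\<dots> \<le> (?E * (1 + 2 * 1)) * (2 * (2 * \<delta>) * (s + 1) + \<delta>)"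
      using \<delta> V2 V0 by (intro mult_mono add_mono mult_left_mono) auto
    also have "\<dots> = ?E * (12 * s + 15) * \<delta>" by (simp add: algebra_simps)
    also have "\<dots> \<le> ?E * (12 * s + 15) * \<delta> + (3 + 2 * ?E) * (indicator B1 w + indicator B2 w) + ?E * N \<delta> w"
      using N_nonneg[of \<delta> w] by (simp add: add_nonneg_nonneg)
    finally show ?thesis .
  qed
  have lin: "(\<integral>w. a + b * (indicator B1 w + indicator B2 w) + c * N \<delta> w \<partial>M)
      = a + b * (prob B1 + prob B2) + c * (\<integral>w. N \<delta> w \<partial>M)" for a b c :: real
    using N_integrable[of \<delta>] by (simp add: prob_space emeasure_eq_measure)
  have "(\<integral>w. ?h w \<partial>M) = (\<integral>w. iexp (?S w) \<partial>M) - of_real ?c * (\<integral>w. st.P w T \<partial>M)"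
    using iS P_integrable[of T] by (simp add: Bochner_Integration.integral_add Bochner_Integration.integral_diff del: of_real_sum of_real_exp)
  then have "cmod ((\<integral>w. iexp (?S w) \<partial>M) - of_real ?c) = cmod (\<integral>w. ?h w \<partial>M)"
    unfolding P_expectation by simp
  also have "\<dots> \<le> (\<integral>w. cmod (?h w) \<partial>M)" by (rule integral_norm_bound)
  also have "\<dots> \<le> (\<integral>w. ?E * (12 * s + 15) * \<delta> + (3 + 2 * ?E) * (indicator B1 w + indicator B2 w) + ?E * N \<delta> w \<partial>M)"
    using iS P_integrable[of T] N_integrable
    by (intro integral_mono hb integrable_norm Bochner_Integration.integrable_add Bochner_Integration.integrable_diff
        integrable_mult_right integrable_const integrable_real_indicator) (auto simp: emeasure_eq_measure)
  also have "\<dots> = ?E * (12 * s + 15) * \<delta> + (3 + 2 * ?E) * (prob B1 + prob B2) + ?E * (\<integral>w. N \<delta> w \<partial>M)"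
    by (rule lin)
  also have "\<dots> \<le> ?E * (12 * s + 15) * \<delta> + (3 + 2 * ?E) * (prob B1 + (\<integral>w. N \<delta> w \<partial>M) / \<delta>) + ?E * (\<integral>w. N \<delta> w \<partial>M)"
    by (intro add_right_mono add_left_mono mult_left_mono PB2) (simp add: add_nonneg_nonneg)
  finally show ?thesis unfolding B1_def .
qed

end

theorem martingale_clt:
  "(\<lambda>T. \<integral>w. iexp ((\<Sum>t=1..T. D t w) / sqrt (real T)) \<partial>M) \<longlonglongrightarrow> of_real (exp (- (s / 2)))"
proof (rule LIMSEQ_I)
  fix r :: real assume r: "0 < r"
  let ?E = "exp ((s + 1) / 2)"
  \<comment> \<open>This choice makes the deterministic part of \<open>char_bound\<close> at most
    \<open>r / 2\<close>; with \<open>\<delta>\<close> fixed, the other parts vanish as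
    \<open>T\<close> grows.\<close>
  define \<delta> where "\<delta> = min (1/2) (r / (2 * (?E * (12 * s + 15))))"
  have pos: "0 < ?E * (12 * s + 15)" using s_nonneg by auto
  then have \<delta>: "0 < \<delta>" "\<delta> < 1" using r unfolding \<delta>_def by auto
  have "?E * (12 * s + 15) * \<delta> \<le> ?E * (12 * s + 15) * (r / (2 * (?E * (12 * s + 15))))"
    using pos unfolding \<delta>_def by (intro mult_left_mono) auto
  also have "\<dots> = r / 2" using pos by (simp add: field_simps)
  finally have d2: "?E * (12 * s + 15) * \<delta> \<le> r / 2" .
  let ?tail = "\<lambda>T. (\<integral>w. (D 1 w)\<^sup>2 * indicator {y. \<delta> * sqrt (real T) < \<bar>y\<bar>} (D 1 w) \<partial>M) / \<delta>"
  let ?p = "\<lambda>T. prob {w\<in>space M. \<delta> < \<bar>(\<Sum>t=1..T. (D t w)\<^sup>2) / real T - s\<bar>}"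
  have "?tail \<longlonglongrightarrow> 0 / \<delta>"
    by (intro tendsto_divide small_tail_second_moment tendsto_const D_L2') (use \<delta> in auto)
  then have "(\<lambda>T. (3 + 2 * ?E) * (?p T + ?tail T / \<delta>) + ?E * ?tail T) \<longlonglongrightarrow> (3 + 2 * ?E) * (0 + (0 / \<delta>) / \<delta>) + ?E * (0 / \<delta>)"
    by (intro tendsto_add tendsto_mult tendsto_const tendsto_divide D_lln \<delta>) (use \<delta> in auto)
  then have "eventually (\<lambda>T. (3 + 2 * ?E) * (?p T + ?tail T / \<delta>) + ?E * ?tail T < r / 2) sequentially"
    using r by (intro order_tendstoD) auto
  then have "eventually (\<lambda>T. cmod ((\<integral>w. iexp ((\<Sum>t=1..T. D t w) / sqrt (real T)) \<partial>M) - of_real (exp (- (s / 2)))) < r) sequentially"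
    using eventually_gt_at_top[of "0::nat"]
  proof eventually_elim
    case (elim T)
    have "(\<Sum>t=1..T. X T w t) = (\<Sum>t=1..T. D t w) / sqrt (real T)" for w
      using elim by (simp add: X_def sum_divide_distrib)
    then have "cmod ((\<integral>w. iexp ((\<Sum>t=1..T. D t w) / sqrt (real T)) \<partial>M) - of_real (exp (- (s / 2))))
      \<le> ?E * (12 * s + 15) * \<delta> + (3 + 2 * ?E) * (?p T + (\<integral>w. N T \<delta> w \<partial>M) / \<delta>)
      + ?E * (\<integral>w. N T \<delta> w \<partial>M)"
      using char_bound[OF elim(2) \<delta>] by simp
    also have "\<dots> \<le> r / 2 + (3 + 2 * ?E) * (?p T + ?tail T / \<delta>) + ?E * ?tail T"
      using N_expectation[OF elim(2) \<delta>(1)] \<delta> d2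
      by (intro add_mono mult_left_mono divide_right_mono) (auto simp: add_nonneg_nonneg)
    finally show ?case using elim(1) by linarith
  qed
  then show "\<exists>no. \<forall>n\<ge>no. cmod ((\<integral>w. iexp ((\<Sum>t=1..n. D t w) / sqrt (real n)) \<partial>M) - of_real (exp (- (s / 2)))) < r"
    by (simp add: eventually_sequentially)
qed

end

section \<open>Stationary sequences\<close>

lemma path_measurable:
  assumes "\<And>t::'i. X t \<in> borel_measurable M"
  shows "(\<lambda>w t. X t w) \<in> measurable M (PiM UNIV (\<lambda>_. borel))"
  using assms by (intro measurable_PiM_single') auto

lemma shift_measurable:
  "(\<lambda>p i. p (k i)) \<in> measurable (PiM UNIV (\<lambda>_. borel)) (PiM UNIV (\<lambda>_. borel))"
  by (intro measurable_PiM_single') auto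

lemma strictly_stationary_measurable:
  "strictly_stationary M X \<Longrightarrow> X t \<in> borel_measurable M"
  by (simp add: strictly_stationary_def)

lemma strictly_stationary_distr_path:
  fixes X :: "int \<Rightarrow> 'a \<Rightarrow> 'b::topological_space"
  assumes X: "strictly_stationary M X"
    and g: "g \<in> measurable (PiM UNIV (\<lambda>_::int. borel)) N"
  shows "distr M N (\<lambda>w. g (\<lambda>t. X (t + h) w)) = distr M N (\<lambda>w. g (\<lambda>t. X t w))"
proof -
  have [measurable]: "X t \<in> borel_measurable M" for t using X by (rule strictly_stationary_measurable)
  have "distr M N (\<lambda>w. g (\<lambda>t. X (t + h) w)) = distr (distr M (PiM UNIV (\<lambda>_. borel)) (\<lambda>w t. X (t + h) w)) N g" for h
    by (subst distr_distr[OF g path_measurable]) (auto simp: comp_def)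
  from this[of h] this[of 0] X show ?thesis
    by (simp add: strictly_stationary_def)
qed

lemma strictly_stationary_compose:
  assumes X: "strictly_stationary M X" and g: "g \<in> borel_measurable borel"
  shows "strictly_stationary M (\<lambda>t w. g (X t w))"
  unfolding strictly_stationary_def
proof (intro conjI allI)
  fix t h
  have [measurable]: "g \<in> borel_measurable borel" by fact
  show "(\<lambda>w. g (X t w)) \<in> borel_measurable M"
    using strictly_stationary_measurable[OF X] by measurable
  have "(\<lambda>p t. g (p t)) \<in> measurable (PiM UNIV (\<lambda>_::int. borel)) (PiM UNIV (\<lambda>_::int. borel))"
    by (intro measurable_PiM_single') auto
  from strictly_stationary_distr_path[OF X this, of h]
  show "distr M (PiM UNIV (\<lambda>_::int. borel)) (\<lambda>w t. g (X (t + h) w)) =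
    distr M (PiM UNIV (\<lambda>_::int. borel)) (\<lambda>w t. g (X t w))" .
qed

lemma strictly_stationary_distr:
  assumes X: "strictly_stationary M X"
  shows "distr M borel (X t) = distr M borel (X 0)"
  using strictly_stationary_distr_path[OF X, of "\<lambda>p. p 0" borel t] by simp

lemma (in ergodic_transformation) birkhoff_in_probability:
  fixes f :: "'a \<Rightarrow> real"
  assumes f: "integrable M f" and e: "0 < e"
  shows "(\<lambda>n. prob {w\<in>space M. e < \<bar>(\<Sum>k<n. f ((\<tau> ^^ k) w)) / real n - (\<integral>w. f w \<partial>M)\<bar>}) \<longlonglongrightarrow> 0"
proof -
  have [measurable]: "f \<in> borel_measurable M" using f by auto
  let ?d = "\<lambda>n w. \<bar>(\<Sum>k<n. f ((\<tau> ^^ k) w)) / real n - (\<integral>w. f w \<partial>M)\<bar>"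
  have "(\<lambda>n. \<integral>w. indicator {w\<in>space M. e < ?d n w} w \<partial>M) \<longlonglongrightarrow> (\<integral>w. (0::real) \<partial>M)"
  proof (rule integral_dominated_convergence[where w = "\<lambda>_. 1"])
    show "AE w in M. (\<lambda>n. indicator {w\<in>space M. e < ?d n w} w) \<longlonglongrightarrow> (0::real)"
      using birkhoff[OF f]
    proof eventually_elim
      case (elim w)
      then have "eventually (\<lambda>n. ?d n w < e) sequentially"
        using e by (auto dest!: tendstoD simp: dist_real_def)
      then have "eventually (\<lambda>n. 0 = indicator {w\<in>space M. e < ?d n w} w) sequentially"
        by eventually_elim auto
      then show ?case by (rule Lim_transform_eventually[OF tendsto_const])
    qed
    show "AE w in M. norm (indicator {w\<in>space M. e < ?d n w} w :: real) \<le> 1" for n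
      by (auto simp: indicator_def)
  qed auto
  then show ?thesis by simp
qed

section \<open>Sigma-algebras generated by a process and the zero-one law\<close>

lemma space_gen_sigma [simp]: "space (gen_sigma M X S) = space M"
  by (simp add: gen_sigma_def space_measure_of_conv)

lemma sets_gen_sigma:
  "sets (gen_sigma M X S) = sigma_sets (space M) {X s -` A \<inter> space M | s A. s \<in> S \<and> A \<in> sets borel}"
  unfolding gen_sigma_def by (intro sets_measure_of) auto

lemma gen_sigma_mono: "S \<subseteq> S' \<Longrightarrow> sets (gen_sigma M X S) \<subseteq> sets (gen_sigma M X S')"
  unfolding sets_gen_sigma by (intro sigma_sets_mono') auto

lemma measurable_gen_sigma: "s \<in> S \<Longrightarrow> X s \<in> borel_measurable (gen_sigma M X S)"
  by (intro measurableI) (auto simp: sets_gen_sigma)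

lemma subalgebra_gen_sigma:
  assumes "\<And>s. s \<in> S \<Longrightarrow> X s \<in> borel_measurable M"
  shows "subalgebra M (gen_sigma M X S)"
  unfolding subalgebra_def sets_gen_sigma
  using assms by (auto intro!: sets.sigma_sets_subset simp: measurable_sets)

lemma borel_measurable_gen_sigma_mono:
  "S \<subseteq> S' \<Longrightarrow> f \<in> borel_measurable (gen_sigma M X S) \<Longrightarrow> f \<in> borel_measurable (gen_sigma M X S')"
  using gen_sigma_mono[of S S' M X] by (auto simp: measurable_def)

text \<open>Kolmogorov's law concerns sequences indexed by natural numbers; sending \<open>k\<close>
  to the time \<open>- 1 - int k\<close> turns the remote past into the tail of such a
  sequence.\<close>

lemma (in prob_space) prob_zero_one_if_in_remote_past:
  fixes \<epsilon> :: "int \<Rightarrow> 'a \<Rightarrow> 'b::topological_space"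
  assumes indep: "indep_vars (\<lambda>_. borel) \<epsilon> UNIV"
    and B: "\<And>n::nat. B \<in> sets (gen_sigma M \<epsilon> {..- 1 - int n})"
  shows "prob B \<in> {0, 1}"
proof -
  define \<A> where "\<A> = (\<lambda>k::nat. {\<epsilon> (- 1 - int k) -` A \<inter> space M | A. A \<in> sets borel})"
  have rv: "random_variable borel (\<epsilon> t)" for t
    using indep by (auto simp: indep_vars_def2)
  have ind: "indep_sets (\<lambda>t. {\<epsilon> t -` A \<inter> space M | A. A \<in> sets borel}) UNIV"
    using indep by (auto simp: indep_vars_def2)
  have "prob B = 0 \<or> prob B = 1"
  proof (rule kolmogorov_0_1_law)
    fix k show "sigma_algebra (space M) (\<A> k)"
      using sets.sigma_algebra_axioms[of "vimage_algebra (space M) (\<epsilon> (- 1 - int k)) borel"]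
        sets_vimage_algebra2[of "\<epsilon> (- 1 - int k)" "space M" borel]
      by (simp add: \<A>_def)
  next
    show "indep_sets \<A> UNIV"
    proof (rule indep_setsI)
      show "\<A> k \<subseteq> events" for k using rv by (auto simp: \<A>_def measurable_sets)
    next
      fix A J assume J: "J \<noteq> {}" "J \<subseteq> (UNIV :: nat set)" "finite J" "\<forall>j\<in>J. A j \<in> \<A> j"
      define k where "k = (\<lambda>j::nat. - 1 - int j)"
      have inj: "inj k" by (auto simp: k_def inj_on_def)
      define A' where "A' t = A (inv k t)" for t
      have A': "A' (k j) = A j" for j using inj by (simp add: A'_def)
      have "prob (\<Inter>t\<in>k ` J. A' t) = (\<Prod>t\<in>k ` J. prob (A' t))"
      proof (rule indep_setsD[OF ind])
        show "\<forall>t\<in>k ` J. A' t \<in> {\<epsilon> t -` A \<inter> space M | A. A \<in> sets borel}"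
        proof (rule ballI)
          fix t assume "t \<in> k ` J"
          then obtain j where j: "t = k j" "j \<in> J" by auto
          then have "A' t = A j" "A j \<in> \<A> j" using J(4) A' by auto
          then show "A' t \<in> {\<epsilon> t -` A \<inter> space M | A. A \<in> sets borel}"
            by (simp add: \<A>_def j k_def)
        qed
      qed (use J in auto)
      then show "prob (\<Inter>j\<in>J. A j) = (\<Prod>j\<in>J. prob (A j))"
        using inj by (simp add: A' prod.reindex inj_on_def)
    qed
  next
    show "B \<in> tail_events \<A>"
      unfolding tail_events_def
    proof (rule INT_I)
      fix n :: nat
      have "{\<epsilon> s -` A \<inter> space M |s A. s \<in> {..- 1 - int n} \<and> A \<in> sets borel} \<subseteq> \<Union> (\<A> ` {n..})"
      proof safe
        fix s A assume s: "s \<le> - 1 - int n" and A: "A \<in> sets (borel :: 'b measure)"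
        define k where "k = nat (- 1 - s)"
        have "s = - 1 - int k" "k \<ge> n" using s by (auto simp: k_def)
        then show "\<epsilon> s -` A \<inter> space M \<in> \<Union> (\<A> ` {n..})"
          using A by (auto simp: \<A>_def intro!: bexI[of _ k])
      qed
      then show "B \<in> sigma_sets (space M) (\<Union> (\<A> ` {n..}))"
        using B[of n] sigma_sets_mono'[of _ "\<Union> (\<A> ` {n..})"] unfolding sets_gen_sigma by blast
    qed
  qed
  then show ?thesis by auto
qed

text \<open>The forward averages have the law of the averages of \<open>D (-1), \<dots>, D (-n)\<close>, which are
  one-sided functionals of the path \<open>D (-1), D (-2), \<dots>\<close>: an event invariant under its shift lies
  in the remote past of \<open>\<epsilon>\<close>.\<close>

lemma (in prob_space) adapted_stationary_lln:
  fixes \<epsilon> :: "int \<Rightarrow> 'a \<Rightarrow> 'b::topological_space" and D :: "int \<Rightarrow> 'a \<Rightarrow> real"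
  assumes indep: "indep_vars (\<lambda>_. borel) \<epsilon> UNIV"
    and adapted: "\<And>t. D t \<in> borel_measurable (gen_sigma M \<epsilon> {..t})"
    and stat: "strictly_stationary M D"
    and int: "integrable M (D 0)" and e: "0 < e"
  shows "(\<lambda>n. prob {w\<in>space M. e < \<bar>(\<Sum>t=1..n. D (int t) w) / real n - (\<integral>w. D 0 w \<partial>M)\<bar>}) \<longlonglongrightarrow> 0"
proof -
  let ?P = "PiM UNIV (\<lambda>_::nat. borel :: real measure)"
  define \<zeta> where "\<zeta> = (\<lambda>w n::nat. D (- 1 - int n) w)"
  define \<tau> where "\<tau> = (\<lambda>(p::nat \<Rightarrow> real) n. p (Suc n))"
  have Dm [measurable]: "D t \<in> borel_measurable M" for t
    using stat by (rule strictly_stationary_measurable)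
  have zm [measurable]: "\<zeta> \<in> measurable M ?P"
    unfolding \<zeta>_def by (rule path_measurable) simp
  have tm [measurable]: "\<tau> \<in> measurable ?P ?P"
    unfolding \<tau>_def by (rule shift_measurable)
  define N where "N = distr M ?P \<zeta>"
  have sN [simp, measurable_cong]: "sets N = sets ?P" by (simp add: N_def)
  have spN [simp]: "space N = UNIV" by (simp add: N_def space_PiM)
  interpret N: prob_space N unfolding N_def by (rule prob_space_distr) simp
  have tau_n: "(\<tau> ^^ n) p = (\<lambda>k. p (k + n))" for n p
    by (induction n arbitrary: p) (auto simp: \<tau>_def funpow_swap1)
  have law: "distr M ?P (\<lambda>w n. D (- 1 - int n + h) w) = N" for h
    using strictly_stationary_distr_path[OF stat, of "\<lambda>p (n::nat). p (- 1 - int n)" ?P h]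
      shift_measurable[of "\<lambda>n::nat. - 1 - int n"] by (simp add: N_def \<zeta>_def)
  interpret N: ergodic_transformation N \<tau>
  proof
    show "\<tau> \<in> measurable N N" by measurable
    have "distr N N \<tau> = distr M ?P (\<tau> \<circ> \<zeta>)"
      unfolding N_def by (subst distr_distr) (auto cong: distr_cong)
    also have "\<tau> \<circ> \<zeta> = (\<lambda>w n. D (- 1 - int n + (- 1)) w)"
    proof (intro ext)
      fix w n
      have "- 1 - int (Suc n) = - 1 - int n + (- 1)" by simp
      then show "(\<tau> \<circ> \<zeta>) w n = D (- 1 - int n + (- 1)) w"
        unfolding \<tau>_def \<zeta>_def comp_def by (simp only:)
    qed
    finally show "distr N N \<tau> = N" unfolding law .
  next
    fix A assume A: "A \<in> sets N" "\<tau> -` A \<inter> space N = A"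
    \<comment> \<open>Invariance iterated \<open>n\<close> times: membership is decided by what is
      left after \<open>n\<close> shifts, and for \<open>\<zeta> w\<close> these are the values of
      \<open>D\<close> at times up to \<open>- 1 - int n\<close>.\<close>
    have inv: "p \<in> A \<longleftrightarrow> (\<tau> ^^ n) p \<in> A" for n p
    proof (induction n)
      case (Suc n)
      have "(\<tau> ^^ Suc n) p \<in> A \<longleftrightarrow> (\<tau> ^^ n) p \<in> \<tau> -` A \<inter> space N" by simp
      with A(2) Suc show ?case by simp
    qed auto
    define B where "B = \<zeta> -` A \<inter> space M"
    have "prob B \<in> {0, 1}"
    proof (rule prob_zero_one_if_in_remote_past[OF indep])
      fix n :: nat
      have "B = (\<lambda>w k. D (- 1 - int n - int k) w) -` A \<inter> space M"
      proof -
        have "- 1 - int (k + n) = - 1 - int n - int k" for k by simp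
        then have eq: "(\<tau> ^^ n) (\<zeta> w) = (\<lambda>k. D (- 1 - int n - int k) w)" for w
          unfolding tau_n \<zeta>_def by (simp only:)
        have "\<zeta> w \<in> A \<longleftrightarrow> (\<lambda>k. D (- 1 - int n - int k) w) \<in> A" for w
          using inv[of "\<zeta> w" n] unfolding eq .
        then show ?thesis by (simp add: B_def vimage_def)
      qed
      also have "\<dots> = (\<lambda>w k. D (- 1 - int n - int k) w) -` A \<inter> space (gen_sigma M \<epsilon> {..- 1 - int n})"
        by simp
      also have "\<dots> \<in> sets (gen_sigma M \<epsilon> {..- 1 - int n})"
      proof (rule measurable_sets)
        show "(\<lambda>w k. D (- 1 - int n - int k) w) \<in> measurable (gen_sigma M \<epsilon> {..- 1 - int n}) ?P"
          by (intro path_measurable borel_measurable_gen_sigma_mono[OF _ adapted]) auto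
      qed (use A in simp)
      finally show "B \<in> sets (gen_sigma M \<epsilon> {..- 1 - int n})" .
    qed
    moreover have "measure N A = prob B"
      unfolding N_def B_def using A by (intro measure_distr) auto
    ultimately show "N.prob A \<in> {0, 1}" by simp
  qed
  have "distr N borel (\<lambda>p. p 0) = distr M borel ((\<lambda>p. p 0) \<circ> \<zeta>)"
    unfolding N_def by (subst distr_distr) auto
  also have "(\<lambda>p. p 0) \<circ> \<zeta> = D (- 1)" by (simp add: \<zeta>_def fun_eq_iff)
  finally have d0: "distr N borel (\<lambda>p. p 0) = distr M borel (D 0)"
    using strictly_stationary_distr[OF stat, of "-1"] by simp
  have pm: "(\<lambda>p. p 0) \<in> borel_measurable N" by measurable
  have idm: "(\<lambda>x::real. x) \<in> borel_measurable borel" by simp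
  have "integrable (distr N borel (\<lambda>p. p 0)) (\<lambda>x. x)"
    unfolding d0 by (rule integrable_distr_eq[OF Dm idm, THEN iffD2, OF int])
  then have i0: "integrable N (\<lambda>p. p 0)" by (rule integrable_distr_eq[OF pm idm, THEN iffD1])
  have e0: "(\<integral>p. p 0 \<partial>N) = (\<integral>w. D 0 w \<partial>M)"
    using trans[OF integral_distr[OF pm idm, symmetric, unfolded d0] integral_distr[OF Dm[of 0] idm]] .
  have eq: "N.prob {p\<in>space N. e < \<bar>(\<Sum>k<n. ((\<tau> ^^ k) p) 0) / real n - (\<integral>p. p 0 \<partial>N)\<bar>}
    = prob {w\<in>space M. e < \<bar>(\<Sum>t=1..n. D (int t) w) / real n - (\<integral>w. D 0 w \<partial>M)\<bar>}" for n
  proof -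
    let ?S = "{p\<in>space N. e < \<bar>(\<Sum>k<n. ((\<tau> ^^ k) p) 0) / real n - (\<integral>p. p 0 \<partial>N)\<bar>}"
    have "?S \<in> sets N" unfolding tau_n by measurable
    then have S: "?S \<in> sets ?P" by simp
    \<comment> \<open>Stationarity with shift \<open>int n + 1\<close> sends position
      \<open>k\<close> to time \<open>int n - int k\<close>, so the positions \<open>k < n\<close>
      become the times \<open>n, ..., 1\<close> of the forward average.\<close>
    have "N.prob ?S = measure (distr M ?P (\<lambda>w k. D (- 1 - int k + (int n + 1)) w)) ?S"
      using law[of "int n + 1"] by simp
    also have "\<dots> = prob ((\<lambda>w k. D (- 1 - int k + (int n + 1)) w) -` ?S \<inter> space M)"
      using S by (intro measure_distr path_measurable) auto
    also have "(\<lambda>w k. D (- 1 - int k + (int n + 1)) w) -` ?S \<inter> space M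
      = {w\<in>space M. e < \<bar>(\<Sum>t=1..n. D (int t) w) / real n - (\<integral>w. D 0 w \<partial>M)\<bar>}"
    proof -
      have "(\<Sum>k<n. D (int n - int k) w) = (\<Sum>t=1..n. D (int t) w)" for w
        by (rule sum.reindex_bij_witness[of _ "\<lambda>t. n - t" "\<lambda>k. n - k"]) auto
      then show ?thesis by (auto simp: tau_n e0)
    qed
    finally show ?thesis .
  qed
  from N.birkhoff_in_probability[OF i0 e] show ?thesis unfolding eq .
qed

section \<open>Integrated squares of random fields\<close>

text \<open>Bounded, at most \<open>y^2\<close> and convergent to \<open>y^2\<close> as
  \<open>a\<close> tends to zero. Being affine in \<open>cos (a * y)\<close>, it leads to integrals
  whose moments are expressible by characteristic functions.\<close>

definition trig_square :: "real \<Rightarrow> real \<Rightarrow> real" where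
  "trig_square a y = 2 / a\<^sup>2 * (1 - cos (a * y))"

lemma trig_square_eq: "trig_square a y = (2 / a * sin (a * y / 2))\<^sup>2"
  unfolding trig_square_def using cos_double_sin[of "a * y / 2"]
  by (simp add: power_mult_distrib power_divide)

lemma trig_square_nonneg: "0 \<le> trig_square a y"
  unfolding trig_square_eq by simp

lemma trig_square_le: "a \<noteq> 0 \<Longrightarrow> trig_square a y \<le> y\<^sup>2"
proof -
  assume a: "a \<noteq> 0"
  have "\<bar>2 / a * sin (a * y / 2)\<bar> \<le> \<bar>2 / a\<bar> * \<bar>a * y / 2\<bar>"
    unfolding abs_mult by (intro mult_left_mono abs_sin_x_le_abs_x) auto
  also have "\<dots> = \<bar>y\<bar>" using a by (simp add: abs_mult)
  finally show ?thesis unfolding trig_square_eq abs_le_square_iff[symmetric] .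
qed

lemma trig_square_bounded: "trig_square a y \<le> 4 / a\<^sup>2"
proof -
  have "1 - cos (a * y) \<le> 2" using cos_ge_minus_one[of "a * y"] by linarith
  then have "2 / a\<^sup>2 * (1 - cos (a * y)) \<le> 2 / a\<^sup>2 * 2" by (intro mult_left_mono) auto
  then show ?thesis unfolding trig_square_def by simp
qed

lemma trig_square_tendsto: "(\<lambda>n. trig_square (1 / Suc n) y) \<longlonglongrightarrow> y\<^sup>2"
proof -
  have bound: "\<bar>2 / a * sin (a * y / 2) - y\<bar> \<le> a\<^sup>2 * \<bar>y\<bar> ^ 3" if a: "0 < a" for a
  proof -
    have "\<bar>sin (a * y / 2) - (\<Sum>m<3. sin_coeff m * (a * y / 2) ^ m)\<bar> \<le> inverse (fact 3) * \<bar>a * y / 2\<bar> ^ 3"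
      by (rule Maclaurin_sin_bound)
    then have b: "\<bar>sin (a * y / 2) - a * y / 2\<bar> \<le> \<bar>a * y / 2\<bar> ^ 3 / 6"
      by (simp add: eval_nat_numeral sin_coeff_def)
    have "2 / a * sin (a * y / 2) - y = 2 / a * (sin (a * y / 2) - a * y / 2)"
      using a by (simp add: field_simps)
    then have "\<bar>2 / a * sin (a * y / 2) - y\<bar> = 2 / a * \<bar>sin (a * y / 2) - a * y / 2\<bar>"
      using a by (simp only: abs_mult) simp
    also have "\<dots> \<le> 2 / a * (\<bar>a * y / 2\<bar> ^ 3 / 6)"
      using a by (intro mult_left_mono b) auto
    also have "\<dots> = a\<^sup>2 * \<bar>y\<bar> ^ 3 / 24"
      using a by (simp add: abs_mult power_mult_distrib power_divide power2_eq_square eval_nat_numeral)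
    also have "\<dots> \<le> a\<^sup>2 * \<bar>y\<bar> ^ 3" by (simp add: zero_le_mult_iff)
    finally show ?thesis .
  qed
  have l: "(\<lambda>n. (1 / real (Suc n))\<^sup>2 * \<bar>y\<bar> ^ 3) \<longlonglongrightarrow> 0"
  proof -
    have "(\<lambda>n. (1 / real (Suc n))\<^sup>2 * \<bar>y\<bar> ^ 3) \<longlonglongrightarrow> 0\<^sup>2 * \<bar>y\<bar> ^ 3"
      by (intro tendsto_mult tendsto_power tendsto_const) (rule LIMSEQ_Suc[OF lim_1_over_n])
    then show ?thesis by simp
  qed
  have "(\<lambda>n. 2 / (1 / Suc n) * sin ((1 / Suc n) * y / 2) - y) \<longlonglongrightarrow> 0"
    by (rule Lim_null_comparison[OF _ l]) (use bound[of "1 / Suc n" for n] in \<open>auto simp del: of_nat_Suc\<close>)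
  then have "(\<lambda>n. 2 / (1 / Suc n) * sin ((1 / Suc n) * y / 2)) \<longlonglongrightarrow> y"
    by (rule LIM_zero_cancel)
  then show ?thesis unfolding trig_square_eq by (rule tendsto_power)
qed

lemma trig_square_measurable [measurable]: "trig_square a \<in> borel_measurable borel"
  unfolding trig_square_def by measurable

lemma norm_iexp_diff_le: "cmod (iexp a - iexp b) \<le> \<bar>a - b\<bar>"
proof -
  have "iexp a - iexp b = iexp b * (iexp (a - b) - 1)"
    by (simp add: algebra_simps flip: exp_add)
  then have "cmod (iexp a - iexp b) = cmod (iexp (a - b) - 1)" by (simp add: norm_mult)
  also have "\<dots> \<le> \<bar>a - b\<bar>" using iexp_approx1[of "a - b" 0] by simp
  finally show ?thesis .
qed

text \<open>Adds \<open>b\<close> times the coordinate \<open>u\<close> to a combination over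
  \<open>J\<close>, with \<open>u\<close> possibly in \<open>J\<close> already; the coefficients
  then have to be added up.\<close>

lemma sum_insert_coefficient:
  fixes f :: "'u \<Rightarrow> real"
  assumes "finite J"
  shows "(\<Sum>r\<in>insert u J. ((if r \<in> J then c r else 0) + (if r = u then b else 0)) * f r)
    = (\<Sum>r\<in>J. c r * f r) + b * f u"
proof -
  have "(\<Sum>r\<in>insert u J. ((if r \<in> J then c r else 0) + (if r = u then b else 0)) * f r)
    = (\<Sum>r\<in>insert u J. if r \<in> J then c r * f r else 0) + (\<Sum>r\<in>insert u J. if r = u then b * f r else 0)"
    unfolding sum.distrib[symmetric] by (intro sum.cong) (auto simp: algebra_simps)
  also have "(\<Sum>r\<in>insert u J. if r = u then b * f r else 0) = b * f u"
    using assms by (simp add: sum.delta)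
  also have "(\<Sum>r\<in>insert u J. if r \<in> J then c r * f r else 0) = (\<Sum>r\<in>J. c r * f r)"
    using assms by (intro sum.mono_neutral_cong_right) auto
  finally show ?thesis .
qed

lemma (in prob_space) norm_integral_le_const:
  fixes f :: "'a \<Rightarrow> 'b::{banach, second_countable_topology}"
  assumes "f \<in> borel_measurable M" "\<And>w. norm (f w) \<le> B"
  shows "norm (\<integral>w. f w \<partial>M) \<le> B"
proof -
  have "integrable M f" using assms by (intro integrable_const_bound[where B = B]) auto
  then have "norm (\<integral>w. f w \<partial>M) \<le> (\<integral>w. B \<partial>M)"
    using assms(2) by (intro order_trans[OF integral_norm_bound integral_mono]) auto
  then show ?thesis by (simp add: prob_space)
qed

lemma (in prob_space) integral_trig_square:
  assumes [measurable]: "f \<in> borel_measurable M"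
  shows "(\<integral>w. trig_square a (f w) \<partial>M) = 2 / a\<^sup>2 * (1 - Re (\<integral>w. iexp (a * f w) \<partial>M))"
proof -
  have i: "integrable M (\<lambda>w. iexp (a * f w))" by (rule integrable_iexp_of_real) measurable
  have "Re (iexp (a * f w)) = cos (a * f w)" for w
    by (simp add: Re_exp)
  then have e: "Re (\<integral>w. iexp (a * f w) \<partial>M) = (\<integral>w. cos (a * f w) \<partial>M)"
    using integral_Re[OF i] by (simp only:)
  have "integrable M (\<lambda>w. cos (a * f w))" by (rule integrable_const_bound[where B = 1]) auto
  then show ?thesis unfolding trig_square_def e by (simp add: prob_space)
qed

lemma (in prob_space) iexp_moment_approx:
  assumes [measurable]: "f \<in> borel_measurable M" and f: "\<And>w. \<bar>f w\<bar> \<le> K"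
  shows "cmod ((\<integral>w. iexp (t * f w) \<partial>M) - (\<Sum>k\<le>m. (\<i> * of_real t) ^ k / fact k * (\<integral>w. complex_of_real (f w ^ k) \<partial>M)))
      \<le> (\<bar>t\<bar> * K) ^ Suc m / fact (Suc m)"
proof -
  have i: "integrable M (\<lambda>w. complex_of_real (f w ^ k))" for k
    by (rule integrable_const_bound[where B = "K ^ k"])
       (auto intro!: AE_I2 power_mono f simp: norm_power)
  have "(\<integral>w. iexp (t * f w) \<partial>M) - (\<Sum>k\<le>m. (\<i> * of_real t) ^ k / fact k * (\<integral>w. complex_of_real (f w ^ k) \<partial>M))
    = (\<integral>w. iexp (t * f w) - (\<Sum>k\<le>m. (\<i> * of_real t) ^ k / fact k * complex_of_real (f w ^ k)) \<partial>M)"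
    using i by (subst Bochner_Integration.integral_diff)
      (auto intro!: integrable_iexp_of_real Bochner_Integration.integrable_sum integrable_mult_right
        simp: Bochner_Integration.integral_sum simp del: of_real_mult of_real_power)
  also have "cmod \<dots> \<le> (\<bar>t\<bar> * K) ^ Suc m / fact (Suc m)"
  proof (rule norm_integral_le_const)
    fix w
    have "cmod (iexp (t * f w) - (\<Sum>k\<le>m. (\<i> * of_real t) ^ k / fact k * complex_of_real (f w ^ k)))
      \<le> \<bar>t * f w\<bar> ^ Suc m / fact (Suc m)"
      using iexp_approx1[of "t * f w" m] by (simp add: power_mult_distrib mult_ac)
    also have "\<dots> \<le> (\<bar>t\<bar> * K) ^ Suc m / fact (Suc m)"
      unfolding abs_mult using f by (intro divide_right_mono power_mono mult_left_mono) auto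
    finally show "cmod (iexp (t * f w) - (\<Sum>k\<le>m. (\<i> * of_real t) ^ k / fact k * complex_of_real (f w ^ k)))
      \<le> (\<bar>t\<bar> * K) ^ Suc m / fact (Suc m)" .
  qed measurable
  finally show ?thesis .
qed

section \<open>Moments of the integrated cosine\<close>

locale random_field = prob_space M + nu: finite_measure \<nu> for M :: "'a measure" and \<nu> :: "'u measure" +
  fixes Y :: "'u \<Rightarrow> 'a \<Rightarrow> real"
  assumes field_measurable [measurable]: "(\<lambda>(w, u). Y u w) \<in> borel_measurable (M \<Otimes>\<^sub>M \<nu>)"
begin

sublocale pair_sigma_finite M \<nu> ..

lemma field_measurable_at: "u \<in> space \<nu> \<Longrightarrow> Y u \<in> borel_measurable M"
  using measurable_compose[OF measurable_Pair2' field_measurable] by simp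

definition cos_integral :: "real \<Rightarrow> 'a \<Rightarrow> real" where
  "cos_integral a w = (\<integral>u. cos (a * Y u w) \<partial>\<nu>)"

lemma cos_integral_measurable [measurable]: "cos_integral a \<in> borel_measurable M"
  unfolding cos_integral_def by measurable

lemma cos_integrable: "w \<in> space M \<Longrightarrow> integrable \<nu> (\<lambda>u. cos (a * Y u w))"
  by (rule nu.integrable_const_bound[where B = 1]) auto

lemma cos_integral_bounded: "\<bar>cos_integral a w\<bar> \<le> measure \<nu> (space \<nu>)"
proof -
  have "\<bar>cos_integral a w\<bar> \<le> (\<integral>u. \<bar>cos (a * Y u w)\<bar> \<partial>\<nu>)"
    unfolding cos_integral_def by (rule integral_abs_bound)
  also have "\<dots> \<le> (\<integral>u. 1 \<partial>\<nu>)"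
    by (rule integral_mono') (auto intro: nu.integrable_const)
  finally show ?thesis by simp
qed

text \<open>The moment of order \<open>k\<close> multiplied by a character at finitely many points.
  Without the character the induction on \<open>k\<close> would not close, since each step turns one
  cosine into two more characters.\<close>

definition cos_moment :: "real \<Rightarrow> nat \<Rightarrow> 'u set \<Rightarrow> ('u \<Rightarrow> real) \<Rightarrow> complex" where
  "cos_moment a k J c = (\<integral>w. of_real (cos_integral a w ^ k) * iexp (\<Sum>r\<in>J. c r * Y r w) \<partial>M)"

text \<open>One of the \<open>Suc k\<close> factors is written as an integral over \<open>u\<close>,
  exchanged with the expectation, and \<open>cos (a * Y u w)\<close> is split into the two
  characters with coefficients \<open>a\<close> and \<open>- a\<close> at \<open>u\<close>.\<close>

lemma cos_moment_Suc:
  fixes c :: "'u \<Rightarrow> real"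
  defines "c' \<equiv> \<lambda>J b u r. (if r \<in> J then c r else 0) + (if r = u then b else 0)"
  assumes J: "finite J" "J \<subseteq> space \<nu>"
  shows "cos_moment a (Suc k) J c =
      (\<integral>u. (cos_moment a k (insert u J) (c' J a u) + cos_moment a k (insert u J) (c' J (- a) u)) / 2 \<partial>\<nu>)"
    and "(\<lambda>u. (cos_moment a k (insert u J) (c' J a u) + cos_moment a k (insert u J) (c' J (- a) u)) / 2)
      \<in> borel_measurable \<nu>"
proof -
  let ?K = "measure \<nu> (space \<nu>)"
  define L where "L w = (\<Sum>r\<in>J. c r * Y r w)" for w
  have [measurable]: "Y r \<in> borel_measurable M" if "r \<in> J" for r using J that by (intro field_measurable_at) auto
  have Lm [measurable]: "L \<in> borel_measurable M" unfolding L_def by measurable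
  have sum_eq: "(\<Sum>r\<in>insert u J. c' J b u r * Y r w) = L w + b * Y u w" for u w b
    unfolding L_def c'_def using J(1) by (rule sum_insert_coefficient)
  have ib: "integrable M (\<lambda>w. of_real (cos_integral a w ^ k) * iexp (L w + b * Y u w))" if u: "u \<in> space \<nu>" for u b
  proof (rule integrable_const_bound[where B = "?K ^ k"])
    have [measurable]: "Y u \<in> borel_measurable M" using u by (rule field_measurable_at)
    show "(\<lambda>w. of_real (cos_integral a w ^ k) * iexp (L w + b * Y u w)) \<in> borel_measurable M" by measurable
    show "AE w in M. norm (of_real (cos_integral a w ^ k) * iexp (L w + b * Y u w)) \<le> ?K ^ k"
      using cos_integral_bounded by (intro AE_I2) (simp add: norm_mult norm_power power_mono)
  qed
  have cos_split: "complex_of_real (cos (a * y)) * iexp l = (iexp (l + a * y) + iexp (l + (- a) * y)) / 2" for y l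
  proof -
    have e: "iexp (l + b * y) = iexp l * iexp (b * y)" for b :: real
      by (simp add: exp_add distrib_left)
    have c: "complex_of_real (cos (a * y)) = (iexp (a * y) + iexp (- a * y)) / 2"
      by (simp add: cos_exp_eq flip: cos_of_real)
    show ?thesis unfolding e c by (simp add: algebra_simps)
  qed
  let ?f = "\<lambda>w u. of_real (cos_integral a w ^ k) * (complex_of_real (cos (a * Y u w)) * iexp (L w))"
  have int: "integrable (M \<Otimes>\<^sub>M \<nu>) (case_prod ?f)"
  proof -
    interpret P: finite_measure "M \<Otimes>\<^sub>M \<nu>"
      using nu.finite_measure_axioms finite_measure_axioms by (rule finite_measure_pair_measure)
    show ?thesis
    proof (rule P.integrable_const_bound[where B = "?K ^ k"])
      show "AE x in M \<Otimes>\<^sub>M \<nu>. norm (case_prod ?f x) \<le> ?K ^ k"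
      proof (intro AE_I2, clarify)
        fix w u
        have "norm (?f w u) = \<bar>cos_integral a w\<bar> ^ k * \<bar>cos (a * Y u w)\<bar>"
          by (simp add: norm_mult norm_power)
        also have "\<dots> \<le> ?K ^ k * 1"
          using cos_integral_bounded by (intro mult_mono power_mono) auto
        finally show "norm (?f w u) \<le> ?K ^ k" by simp
      qed
    qed measurable
  qed
  have "(\<integral>w. of_real (cos_integral a w ^ Suc k) * iexp (L w) \<partial>M) = (\<integral>w. (\<integral>u. ?f w u \<partial>\<nu>) \<partial>M)"
  proof (rule Bochner_Integration.integral_cong[OF refl])
    fix w assume "w \<in> space M"
    show "of_real (cos_integral a w ^ Suc k) * iexp (L w) = (\<integral>u. ?f w u \<partial>\<nu>)"
      unfolding integral_mult_right_zero integral_mult_left_zero integral_complex_of_real cos_integral_def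
      by (simp only: power_Suc2 of_real_mult mult.assoc)
  qed
  also have "\<dots> = (\<integral>u. (\<integral>w. ?f w u \<partial>M) \<partial>\<nu>)" using Fubini_integral[OF int] by simp
  also have "\<dots> = (\<integral>u. ((\<integral>w. of_real (cos_integral a w ^ k) * iexp (L w + a * Y u w) \<partial>M)
      + (\<integral>w. of_real (cos_integral a w ^ k) * iexp (L w + (- a) * Y u w) \<partial>M)) / 2 \<partial>\<nu>)"
  proof (rule Bochner_Integration.integral_cong[OF refl])
    fix u assume u: "u \<in> space \<nu>"
    have "(\<integral>w. ?f w u \<partial>M) = (\<integral>w. (of_real (cos_integral a w ^ k) * iexp (L w + a * Y u w)
        + of_real (cos_integral a w ^ k) * iexp (L w + (- a) * Y u w)) / 2 \<partial>M)"
      unfolding cos_split by (simp only: distrib_left add_divide_distrib times_divide_eq_right)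
    then show "(\<integral>w. ?f w u \<partial>M) = ((\<integral>w. of_real (cos_integral a w ^ k) * iexp (L w + a * Y u w) \<partial>M)
      + (\<integral>w. of_real (cos_integral a w ^ k) * iexp (L w + (- a) * Y u w) \<partial>M)) / 2"
      by (simp only: integral_divide_zero Bochner_Integration.integral_add[OF ib[OF u] ib[OF u]])
  qed
  finally show "cos_moment a (Suc k) J c =
      (\<integral>u. (cos_moment a k (insert u J) (c' J a u) + cos_moment a k (insert u J) (c' J (- a) u)) / 2 \<partial>\<nu>)"
    unfolding cos_moment_def sum_eq L_def[symmetric] .
  show "(\<lambda>u. (cos_moment a k (insert u J) (c' J a u) + cos_moment a k (insert u J) (c' J (- a) u)) / 2)
      \<in> borel_measurable \<nu>"
    unfolding cos_moment_def sum_eq by measurable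
qed

lemma cos_moment_zero: "cos_moment a 0 J c = (\<integral>w. iexp (\<Sum>r\<in>J. c r * Y r w) \<partial>M)"
  by (simp add: cos_moment_def)

lemma cos_moment_bounded:
  assumes J: "finite J" "J \<subseteq> space \<nu>"
  shows "cmod (cos_moment a k J c) \<le> measure \<nu> (space \<nu>) ^ k"
proof -
  let ?K = "measure \<nu> (space \<nu>)"
  have [measurable]: "Y r \<in> borel_measurable M" if "r \<in> J" for r using J that by (intro field_measurable_at) auto
  have b: "cmod (of_real (cos_integral a w ^ k) * iexp (\<Sum>r\<in>J. c r * Y r w)) \<le> ?K ^ k" for w
    using cos_integral_bounded by (simp add: norm_mult norm_power power_mono del: of_real_sum)
  show ?thesis unfolding cos_moment_def
    by (rule norm_integral_le_const[OF _ b]) measurable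
qed

lemma square_integrable_product:
  assumes L2: "\<And>u. u \<in> space \<nu> \<Longrightarrow> integrable M (\<lambda>w. (Y u w)\<^sup>2)"
    and C: "\<And>u. u \<in> space \<nu> \<Longrightarrow> (\<integral>w. (Y u w)\<^sup>2 \<partial>M) = C u" and Ci: "integrable \<nu> C"
  shows "integrable (M \<Otimes>\<^sub>M \<nu>) (\<lambda>(w, u). (Y u w)\<^sup>2)"
proof -
  interpret Q: pair_sigma_finite \<nu> M ..
  have "integrable (\<nu> \<Otimes>\<^sub>M M) (\<lambda>(u, w). (Y u w)\<^sup>2)"
  proof (rule Q.Fubini_integrable)
    show "(\<lambda>(u, w). (Y u w)\<^sup>2) \<in> borel_measurable (\<nu> \<Otimes>\<^sub>M M)" by measurable
    show "integrable \<nu> (\<lambda>u. \<integral>w. norm (case (u, w) of (u, w) \<Rightarrow> (Y u w)\<^sup>2) \<partial>M)"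
      using Ci by (rule Bochner_Integration.integrable_cong[OF refl, THEN iffD1, rotated]) (simp add: C)
  qed (use L2 in auto)
  from Q.integrable_product_swap[OF this] show ?thesis by simp
qed

text \<open>Characters are Lipschitz, and as \<open>trig_square a y \<le> y^2\<close> the error is
  the expectation of a nonnegative difference, which Fubini's theorem reduces to second moments at
  single points. The integral of the surrogate is affine in \<open>cos_integral\<close>, whence the
  constant phase factor.\<close>

lemma char_trig_square_approx:
  assumes L2: "\<And>u. u \<in> space \<nu> \<Longrightarrow> integrable M (\<lambda>w. (Y u w)\<^sup>2)"
    and C: "\<And>u. u \<in> space \<nu> \<Longrightarrow> (\<integral>w. (Y u w)\<^sup>2 \<partial>M) = C u" and Ci: "integrable \<nu> C"
    and a: "a \<noteq> 0"
  shows "cmod ((\<integral>w. iexp (t * (\<integral>u. (Y u w)\<^sup>2 \<partial>\<nu>)) \<partial>M)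
      - iexp (t * (2 / a\<^sup>2) * measure \<nu> (space \<nu>)) * (\<integral>w. iexp (- t * (2 / a\<^sup>2) * cos_integral a w) \<partial>M))
    \<le> \<bar>t\<bar> * (\<integral>u. C u - (\<integral>w. trig_square a (Y u w) \<partial>M) \<partial>\<nu>)"
proof -
  have int2: "integrable (M \<Otimes>\<^sub>M \<nu>) (\<lambda>(w, u). (Y u w)\<^sup>2)"
    using L2 C Ci by (rule square_integrable_product)
  have inth: "integrable (M \<Otimes>\<^sub>M \<nu>) (\<lambda>(w, u). trig_square a (Y u w))"
    by (rule Bochner_Integration.integrable_bound[OF int2])
       (auto simp: trig_square_nonneg intro!: AE_I2 trig_square_le[OF a])
  let ?I = "\<lambda>w. \<integral>u. (Y u w)\<^sup>2 \<partial>\<nu>" and ?H = "\<lambda>w. \<integral>u. trig_square a (Y u w) \<partial>\<nu>"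
  have H: "?H w = 2 / a\<^sup>2 * (measure \<nu> (space \<nu>) - cos_integral a w)" if "w \<in> space M" for w
    unfolding trig_square_def cos_integral_def using cos_integrable[OF that, of a] by simp
  have eqH: "iexp (t * (2 / a\<^sup>2) * measure \<nu> (space \<nu>)) * (\<integral>w. iexp (- t * (2 / a\<^sup>2) * cos_integral a w) \<partial>M)
    = (\<integral>w. iexp (t * ?H w) \<partial>M)"
    unfolding integral_mult_right_zero[symmetric]
    by (intro Bochner_Integration.integral_cong[OF refl]) (simp add: H algebra_simps flip: exp_add)
  have [measurable]: "?I \<in> borel_measurable M" "?H \<in> borel_measurable M" by measurable
  have "cmod ((\<integral>w. iexp (t * ?I w) \<partial>M) - (\<integral>w. iexp (t * ?H w) \<partial>M))
    = cmod (\<integral>w. iexp (t * ?I w) - iexp (t * ?H w) \<partial>M)"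
    by (subst Bochner_Integration.integral_diff) (auto intro!: integrable_iexp_of_real simp del: of_real_mult)
  also have "\<dots> \<le> (\<integral>w. cmod (iexp (t * ?I w) - iexp (t * ?H w)) \<partial>M)" by (rule integral_norm_bound)
  also have "\<dots> \<le> (\<integral>w. \<bar>t\<bar> * (?I w - ?H w) \<partial>M)"
  proof (rule integral_mono_AE)
    show "integrable M (\<lambda>w. cmod (iexp (t * ?I w) - iexp (t * ?H w)))"
      by (intro integrable_norm Bochner_Integration.integrable_diff integrable_iexp_of_real) measurable
    show "integrable M (\<lambda>w. \<bar>t\<bar> * (?I w - ?H w))"
      using integrable_fst[OF int2] integrable_fst[OF inth] by auto
    show "AE w in M. cmod (iexp (t * ?I w) - iexp (t * ?H w)) \<le> \<bar>t\<bar> * (?I w - ?H w)"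
      using AE_integrable_fst[OF int2] AE_integrable_fst[OF inth]
    proof eventually_elim
      case (elim w)
      have "?H w \<le> ?I w" using elim by (intro integral_mono trig_square_le a) auto
      moreover have "cmod (iexp (t * ?I w) - iexp (t * ?H w)) \<le> \<bar>t * ?I w - t * ?H w\<bar>"
        by (rule norm_iexp_diff_le)
      ultimately show ?case by (simp add: abs_mult flip: right_diff_distrib)
    qed
  qed
  also have "\<dots> = \<bar>t\<bar> * ((\<integral>w. ?I w \<partial>M) - (\<integral>w. ?H w \<partial>M))"
    using integrable_fst[OF int2] integrable_fst[OF inth] by simp
  also have "(\<integral>w. ?I w \<partial>M) = (\<integral>u. C u \<partial>\<nu>)"
    using Fubini_integral[OF int2] C by (simp cong: Bochner_Integration.integral_cong)
  also have "(\<integral>w. ?H w \<partial>M) = (\<integral>u. (\<integral>w. trig_square a (Y u w) \<partial>M) \<partial>\<nu>)"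
    using Fubini_integral[OF inth] by simp
  also have "(\<integral>u. C u \<partial>\<nu>) - (\<integral>u. (\<integral>w. trig_square a (Y u w) \<partial>M) \<partial>\<nu>)
    = (\<integral>u. C u - (\<integral>w. trig_square a (Y u w) \<partial>M) \<partial>\<nu>)"
    using Ci integrable_snd[OF inth] by simp
  finally show ?thesis unfolding eqH .
qed

end

lemma norm_diff_less_thirds:
  fixes a b c d :: "'a::real_normed_vector"
  assumes "norm (a - b) < r / 3" "norm (b - c) < r / 3" "norm (d - c) < r / 3"
  shows "norm (a - d) < r"
  using norm_triangle_ineq[of "a - b" "b - c"] norm_triangle_ineq4[of "a - c" "d - c"] assms by simp

text \<open>The common bound \<open>K\<close> makes the exponential series of the characteristic
  functions converge uniformly in \<open>n\<close>, so convergence of finitely many moments suffices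
  for a given accuracy.\<close>

lemma bounded_moments_imp_char_tendsto:
  fixes X :: "nat \<Rightarrow> 'a \<Rightarrow> real" and X' :: "'b \<Rightarrow> real"
  assumes M: "prob_space M" and N: "prob_space N"
    and X [measurable]: "\<And>n. X n \<in> borel_measurable M" and X' [measurable]: "X' \<in> borel_measurable N"
    and K: "\<And>n w. \<bar>X n w\<bar> \<le> K" "\<And>w. \<bar>X' w\<bar> \<le> K"
    and lim: "\<And>k. (\<lambda>n. \<integral>w. complex_of_real (X n w ^ k) \<partial>M) \<longlonglongrightarrow> (\<integral>w. complex_of_real (X' w ^ k) \<partial>N)"
  shows "(\<lambda>n. \<integral>w. iexp (t * X n w) \<partial>M) \<longlonglongrightarrow> (\<integral>w. iexp (t * X' w) \<partial>N)"
proof (rule LIMSEQ_I)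
  fix r :: real assume r: "0 < r"
  have "(\<lambda>m. (\<bar>t\<bar> * K) ^ Suc m / fact (Suc m)) \<longlonglongrightarrow> 0"
    using LIMSEQ_Suc[OF summable_LIMSEQ_zero[OF summable_exp[of "\<bar>t\<bar> * K"]]]
    by (simp only: divide_inverse mult.commute)
  then have "eventually (\<lambda>m. (\<bar>t\<bar> * K) ^ Suc m / fact (Suc m) < r / 3) sequentially"
    using r by (intro order_tendstoD) auto
  then obtain m where m: "(\<bar>t\<bar> * K) ^ Suc m / fact (Suc m) < r / 3"
    by (auto simp only: eventually_sequentially)
  let ?S = "\<lambda>n. \<Sum>k\<le>m. (\<i> * of_real t) ^ k / fact k * (\<integral>w. complex_of_real (X n w ^ k) \<partial>M)"
  let ?S' = "\<Sum>k\<le>m. (\<i> * of_real t) ^ k / fact k * (\<integral>w. complex_of_real (X' w ^ k) \<partial>N)"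
  have "?S \<longlonglongrightarrow> ?S'" by (intro tendsto_sum tendsto_mult tendsto_const lim)
  then obtain n0 where n0: "\<And>n. n \<ge> n0 \<Longrightarrow> cmod (?S n - ?S') < r / 3"
    using r LIMSEQ_D[of ?S ?S' "r / 3"] by auto
  have "cmod ((\<integral>w. iexp (t * X n w) \<partial>M) - (\<integral>w. iexp (t * X' w) \<partial>N)) < r" if n: "n \<ge> n0" for n
  proof -
    have "cmod ((\<integral>w. iexp (t * X n w) \<partial>M) - ?S n) < r / 3"
      using prob_space.iexp_moment_approx[OF M X K(1), where t = t and m = m] m by (rule le_less_trans)
    moreover have "cmod ((\<integral>w. iexp (t * X' w) \<partial>N) - ?S') < r / 3"
      using prob_space.iexp_moment_approx[OF N X' K(2), where t = t and m = m] m by (rule le_less_trans)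
    ultimately show ?thesis by (rule norm_diff_less_thirds[OF _ n0[OF n]])
  qed
  then show "\<exists>no. \<forall>n\<ge>no. cmod ((\<integral>w. iexp (t * X n w) \<partial>M) - (\<integral>w. iexp (t * X' w) \<partial>N)) < r" by blast
qed

text \<open>The moments of the integrated cosine are integrals of finite-dimensional characteristic
  functions, so the finite-dimensional limits determine the limit of the bounded surrogate
  \<^term>\<open>trig_square a\<close> of the square; the equality of second moments controls the error uniformly.\<close>

theorem integrated_square_char_tendsto:
  fixes Y :: "nat \<Rightarrow> 'u \<Rightarrow> 'a \<Rightarrow> real" and Z :: "'u \<Rightarrow> 'b \<Rightarrow> real"
  assumes Y: "\<And>T. random_field M \<nu> (Y T)" and Z: "random_field N \<nu> Z"
    and fdd: "\<And>J c. finite J \<Longrightarrow> J \<subseteq> space \<nu> \<Longrightarrow>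
      (\<lambda>T. \<integral>w. iexp (\<Sum>u\<in>J. c u * Y T u w) \<partial>M) \<longlonglongrightarrow> (\<integral>v. iexp (\<Sum>u\<in>J. c u * Z u v) \<partial>N)"
    and Y2: "\<And>T u. 0 < T \<Longrightarrow> u \<in> space \<nu> \<Longrightarrow> integrable M (\<lambda>w. (Y T u w)\<^sup>2)"
      "\<And>T u. 0 < T \<Longrightarrow> u \<in> space \<nu> \<Longrightarrow> (\<integral>w. (Y T u w)\<^sup>2 \<partial>M) = C u"
    and Z2: "\<And>u. u \<in> space \<nu> \<Longrightarrow> integrable N (\<lambda>v. (Z u v)\<^sup>2)"
      "\<And>u. u \<in> space \<nu> \<Longrightarrow> (\<integral>v. (Z u v)\<^sup>2 \<partial>N) = C u"
    and Ci: "integrable \<nu> C"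
  shows "(\<lambda>T. \<integral>w. iexp (t * (\<integral>u. (Y T u w)\<^sup>2 \<partial>\<nu>)) \<partial>M) \<longlonglongrightarrow> (\<integral>v. iexp (t * (\<integral>u. (Z u v)\<^sup>2 \<partial>\<nu>)) \<partial>N)"
proof -
  interpret Y: random_field M \<nu> "Y T" for T by (rule Y)
  interpret Z: random_field N \<nu> Z by (rule Z)
  let ?K = "measure \<nu> (space \<nu>)"
  \<comment> \<open>The induction runs over all \<open>J\<close> and \<open>c\<close> at once; the
    recursion is an integral over \<open>u\<close> of moments of lower order, bounded by
    \<open>?K ^ k\<close>, so dominated convergence applies.\<close>
  have moments: "(\<lambda>T. Y.cos_moment T a k J c) \<longlonglongrightarrow> Z.cos_moment a k J c"
    if J: "finite J" "J \<subseteq> space \<nu>" for a k J c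
    using J
  proof (induction k arbitrary: J c)
    case 0
    then show ?case using fdd by (simp add: Y.cos_moment_zero Z.cos_moment_zero)
  next
    case (Suc k)
    show ?case unfolding Y.cos_moment_Suc(1)[OF Suc.prems] Z.cos_moment_Suc(1)[OF Suc.prems]
    proof (rule integral_dominated_convergence[where w = "\<lambda>_. ?K ^ k", OF Z.cos_moment_Suc(2) Y.cos_moment_Suc(2)])
      have avg: "cmod ((x + y) / 2) \<le> ?K ^ k" if "cmod x \<le> ?K ^ k" "cmod y \<le> ?K ^ k" for x y
        using norm_triangle_ineq[of x y] that by (simp add: norm_divide)
      show "AE u in \<nu>. cmod ((Y.cos_moment T a k (insert u J) (\<lambda>r. (if r \<in> J then c r else 0) + (if r = u then a else 0))
          + Y.cos_moment T a k (insert u J) (\<lambda>r. (if r \<in> J then c r else 0) + (if r = u then - a else 0))) / 2) \<le> ?K ^ k" for T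
        using Suc.prems by (intro AE_I2 avg Y.cos_moment_bounded) auto
    qed (use Suc in \<open>auto intro!: AE_I2 tendsto_divide tendsto_add Suc.IH tendsto_const\<close>)
  qed
  \<comment> \<open>For \<open>J = {}\<close> the character is one and the plain moments remain; no
    coefficient is evaluated, so \<open>undefined\<close> is harmless.\<close>
  have cos_char: "(\<lambda>T. \<integral>w. iexp (r * Y.cos_integral T a w) \<partial>M) \<longlonglongrightarrow> (\<integral>v. iexp (r * Z.cos_integral a v) \<partial>N)" for a r
    using moments[of "{}" a _ undefined] unfolding Y.cos_moment_def Z.cos_moment_def
    by (intro bounded_moments_imp_char_tendsto[where K = ?K] Y.prob_space_axioms Z.prob_space_axioms
        Y.cos_integral_bounded Z.cos_integral_bounded) auto
  have int_h: "integrable M (\<lambda>w. trig_square a (Y T u w))" if "u \<in> space \<nu>" for a T u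
    using trig_square_nonneg trig_square_bounded measurable_compose[OF Y.field_measurable_at[OF that] trig_square_measurable]
    by (intro Y.integrable_const_bound[where B = "4 / a\<^sup>2"]) auto
  have int_hZ: "integrable N (\<lambda>v. trig_square a (Z u v))" if "u \<in> space \<nu>" for a u
    using trig_square_nonneg trig_square_bounded measurable_compose[OF Z.field_measurable_at[OF that] trig_square_measurable]
    by (intro Z.integrable_const_bound[where B = "4 / a\<^sup>2"]) auto
  have h_tendsto: "(\<lambda>T. \<integral>w. trig_square a (Y T u w) \<partial>M) \<longlonglongrightarrow> (\<integral>v. trig_square a (Z u v) \<partial>N)"
    if u: "u \<in> space \<nu>" for a u
  proof -
    have "(\<lambda>T. \<integral>w. iexp (a * Y T u w) \<partial>M) \<longlonglongrightarrow> (\<integral>v. iexp (a * Z u v) \<partial>N)"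
      using fdd[of "{u}" "\<lambda>_. a"] u by simp
    then show ?thesis
      unfolding Y.integral_trig_square[OF Y.field_measurable_at[OF u]] Z.integral_trig_square[OF Z.field_measurable_at[OF u]]
      by (intro tendsto_mult tendsto_const tendsto_diff tendsto_Re)
  qed
  define gY where "gY T a u = C u - (\<integral>w. trig_square a (Y T u w) \<partial>M)" for T a u
  define gZ where "gZ a u = C u - (\<integral>v. trig_square a (Z u v) \<partial>N)" for a u
  have [measurable]: "C \<in> borel_measurable \<nu>" using Ci by auto
  have gYm [measurable]: "gY T a \<in> borel_measurable \<nu>" for T a unfolding gY_def by measurable
  have gZm [measurable]: "gZ a \<in> borel_measurable \<nu>" for a unfolding gZ_def by measurable
  have gY_bounds: "\<bar>gY T a u\<bar> \<le> C u" if "u \<in> space \<nu>" "a \<noteq> 0" "0 < T" for T a u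
  proof -
    have "(\<integral>w. trig_square a (Y T u w) \<partial>M) \<le> (\<integral>w. (Y T u w)\<^sup>2 \<partial>M)"
      using that by (intro integral_mono int_h Y2 trig_square_le) auto
    moreover have "0 \<le> (\<integral>w. trig_square a (Y T u w) \<partial>M)" by (simp add: trig_square_nonneg)
    ultimately show ?thesis unfolding gY_def using Y2(2)[of T u] that by simp
  qed
  have gZ_bounds: "0 \<le> gZ a u" "gZ a u \<le> C u" if "u \<in> space \<nu>" "a \<noteq> 0" for a u
  proof -
    have "(\<integral>v. trig_square a (Z u v) \<partial>N) \<le> (\<integral>v. (Z u v)\<^sup>2 \<partial>N)"
      using that by (intro integral_mono int_hZ Z2 trig_square_le) auto
    moreover have "0 \<le> (\<integral>v. trig_square a (Z u v) \<partial>N)" by (simp add: trig_square_nonneg)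
    ultimately show "0 \<le> gZ a u" "gZ a u \<le> C u" unfolding gZ_def using Z2(2)[of u] that by auto
  qed
  have gY_tendsto: "(\<lambda>T. \<integral>u. gY T a u \<partial>\<nu>) \<longlonglongrightarrow> (\<integral>u. gZ a u \<partial>\<nu>)" if a: "a \<noteq> 0" for a
  proof -
    \<comment> \<open>The second moments are prescribed for positive \<open>T\<close> only, so the
      majorant \<open>C\<close> is available from index one on.\<close>
    have "(\<lambda>T. \<integral>u. gY (Suc T) a u \<partial>\<nu>) \<longlonglongrightarrow> (\<integral>u. gZ a u \<partial>\<nu>)"
    proof (rule integral_dominated_convergence[where w = C])
      show "AE u in \<nu>. (\<lambda>T. gY (Suc T) a u) \<longlonglongrightarrow> gZ a u"
        unfolding gY_def gZ_def by (intro AE_I2 tendsto_diff tendsto_const LIMSEQ_Suc h_tendsto)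
      show "AE u in \<nu>. norm (gY (Suc T) a u) \<le> C u" for T
        using gY_bounds a by (intro AE_I2) auto
    qed (use Ci in auto)
    then show ?thesis by (rule LIMSEQ_imp_Suc)
  qed
  have gZ_tendsto: "(\<lambda>n. \<integral>u. gZ (1 / Suc n) u \<partial>\<nu>) \<longlonglongrightarrow> (\<integral>u. 0 \<partial>\<nu>)"
  proof (rule integral_dominated_convergence[where w = C])
    show "AE u in \<nu>. (\<lambda>n. gZ (1 / Suc n) u) \<longlonglongrightarrow> 0"
    proof (rule AE_I2)
      fix u assume u: "u \<in> space \<nu>"
      have [measurable]: "Z u \<in> borel_measurable N" using u by (rule Z.field_measurable_at)
      have "(\<lambda>n. \<integral>v. trig_square (1 / Suc n) (Z u v) \<partial>N) \<longlonglongrightarrow> (\<integral>v. (Z u v)\<^sup>2 \<partial>N)"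
      proof (rule integral_dominated_convergence[where w = "\<lambda>v. (Z u v)\<^sup>2"])
        show "AE v in N. norm (trig_square (1 / Suc n) (Z u v)) \<le> (Z u v)\<^sup>2" for n
          by (intro AE_I2) (simp add: trig_square_nonneg trig_square_le del: of_nat_Suc)
        show "AE v in N. (\<lambda>n. trig_square (1 / Suc n) (Z u v)) \<longlonglongrightarrow> (Z u v)\<^sup>2"
          by (intro AE_I2 trig_square_tendsto)
      qed (use Z2(1)[OF u] in auto)
      then have "(\<lambda>n. gZ (1 / Suc n) u) \<longlonglongrightarrow> C u - (\<integral>v. (Z u v)\<^sup>2 \<partial>N)"
        unfolding gZ_def by (intro tendsto_diff tendsto_const)
      then show "(\<lambda>n. gZ (1 / Suc n) u) \<longlonglongrightarrow> 0" using Z2(2)[OF u] by simp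
    qed
    show "AE u in \<nu>. norm (gZ (1 / Suc n) u) \<le> C u" for n
      using gZ_bounds[of _ "1 / Suc n"] by (intro AE_I2) (simp del: of_nat_Suc)
  qed (use Ci in auto)
  show ?thesis
  proof (rule LIMSEQ_I)
    fix r :: real assume r: "0 < r"
    let ?A = "\<lambda>T. \<integral>w. iexp (t * (\<integral>u. (Y T u w)\<^sup>2 \<partial>\<nu>)) \<partial>M" and ?B = "\<integral>v. iexp (t * (\<integral>u. (Z u v)\<^sup>2 \<partial>\<nu>)) \<partial>N"
    \<comment> \<open>The scale \<open>a\<close> is chosen from the limit field alone; as
      \<open>gY\<close> converges to \<open>gZ\<close> in integral for this fixed \<open>a\<close>,
      the same bound then holds for all large \<open>T\<close>.\<close>
    have "(\<lambda>n. \<bar>t\<bar> * (\<integral>u. gZ (1 / Suc n) u \<partial>\<nu>)) \<longlonglongrightarrow> \<bar>t\<bar> * 0"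
      using gZ_tendsto by (intro tendsto_mult tendsto_const) simp
    then have "eventually (\<lambda>n. \<bar>t\<bar> * (\<integral>u. gZ (1 / Suc n) u \<partial>\<nu>) < r / 3) sequentially"
      using r by (intro order_tendstoD) auto
    then obtain n where n: "\<bar>t\<bar> * (\<integral>u. gZ (1 / Suc n) u \<partial>\<nu>) < r / 3"
      by (auto simp only: eventually_sequentially)
    define a where "a = 1 / real (Suc n)"
    have a: "a \<noteq> 0" by (simp add: a_def)
    let ?e = "iexp (t * (2 / a\<^sup>2) * ?K)"
    let ?HY = "\<lambda>T. ?e * (\<integral>w. iexp (- t * (2 / a\<^sup>2) * Y.cos_integral T a w) \<partial>M)"
    let ?HZ = "?e * (\<integral>v. iexp (- t * (2 / a\<^sup>2) * Z.cos_integral a v) \<partial>N)"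
    have BZ: "cmod (?B - ?HZ) < r / 3"
      using Z.char_trig_square_approx[of C a t] Z2 Ci a n unfolding gZ_def a_def[symmetric] by (meson le_less_trans)
    have AY: "cmod (?A T - ?HY T) \<le> \<bar>t\<bar> * (\<integral>u. gY T a u \<partial>\<nu>)" if "0 < T" for T
      using Y.char_trig_square_approx[of T C a t] Y2[OF that] Ci a unfolding gY_def by blast
    have "(\<lambda>T. \<bar>t\<bar> * (\<integral>u. gY T a u \<partial>\<nu>)) \<longlonglongrightarrow> \<bar>t\<bar> * (\<integral>u. gZ a u \<partial>\<nu>)"
      by (intro tendsto_mult tendsto_const gY_tendsto a)
    then have "eventually (\<lambda>T. \<bar>t\<bar> * (\<integral>u. gY T a u \<partial>\<nu>) < r / 3) sequentially"
      using n unfolding a_def[symmetric] by (rule order_tendstoD)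
    moreover have lim: "?HY \<longlonglongrightarrow> ?HZ" by (intro tendsto_mult tendsto_const cos_char)
    have "eventually (\<lambda>T. cmod (?HY T - ?HZ) < r / 3) sequentially"
      using tendstoD[OF lim, of "r / 3"] r unfolding dist_norm by (simp only: zero_less_divide_iff) simp
    ultimately have "eventually (\<lambda>T. cmod (?A T - ?B) < r) sequentially"
      using eventually_gt_at_top[of 0]
    proof eventually_elim
      case (elim T)
      from norm_diff_less_thirds[OF le_less_trans[OF AY[OF elim(3)] elim(1)] elim(2) BZ]
      show ?case .
    qed
    then show "\<exists>no. \<forall>T\<ge>no. cmod (?A T - ?B) < r" by (simp only: eventually_sequentially)
  qed
qed

section \<open>Gaussian random fields\<close>

lemma std_normal_distributed:
  "distributed std_normal_distribution lborel (\<lambda>x. x) (\<lambda>x. ennreal (std_normal_density x))"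
  unfolding distributed_def by (auto intro!: measure_eqI simp: emeasure_distr)

lemma char_normal_density:
  assumes "0 < \<sigma>"
  shows "char (density lborel (\<lambda>x. ennreal (normal_density a \<sigma> x))) t = iexp (t * a) * of_real (exp (- (t\<^sup>2 * \<sigma>\<^sup>2 / 2)))"
proof -
  interpret S: prob_space std_normal_distribution
    using real_dist_normal_dist by (rule real_distribution.axioms)
  have "distributed std_normal_distribution lborel (\<lambda>x. a + \<sigma> * x) (normal_density (a + \<sigma> * 0) (\<bar>\<sigma>\<bar> * 1))"
    using assms by (intro S.normal_density_affine std_normal_distributed) auto
  then have "density lborel (\<lambda>x. ennreal (normal_density a \<sigma> x)) = distr std_normal_distribution lborel (\<lambda>x. a + \<sigma> * x)"
    using assms by (simp add: distributed_def)
  also have "\<dots> = distr std_normal_distribution borel (\<lambda>x. a + \<sigma> * x)"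
    by (rule distr_cong) auto
  finally have "char (density lborel (\<lambda>x. ennreal (normal_density a \<sigma> x))) t
    = (\<integral>x. iexp (t * (a + \<sigma> * x)) \<partial>std_normal_distribution)"
    unfolding char_def by (simp add: integral_distr)
  also have "\<dots> = (\<integral>x. iexp (t * a) * iexp ((t * \<sigma>) * x) \<partial>std_normal_distribution)"
    by (intro Bochner_Integration.integral_cong[OF refl]) (simp add: distrib_left mult_ac flip: exp_add)
  also have "\<dots> = iexp (t * a) * char std_normal_distribution (t * \<sigma>)"
    unfolding char_def by simp
  finally show ?thesis
    unfolding char_std_normal_distribution by (simp add: power_mult_distrib)
qed

lemma (in prob_space) char_distr_eq:
  assumes [measurable]: "X \<in> borel_measurable M"
  shows "char (distr M borel X) t = (\<integral>w. iexp (t * X w) \<partial>M)"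
  unfolding char_def by (subst integral_distr) auto

lemma (in prob_space) normal_rv_second_moment:
  assumes X: "distributed M lborel X (\<lambda>y. ennreal (normal_density a \<sigma> y))" and \<sigma>: "0 < \<sigma>"
  shows "integrable M (\<lambda>w. (X w)\<^sup>2)" "integrable M X"
proof -
  have "integrable lborel (\<lambda>x. normal_density a \<sigma> x * (x - a) ^ 2)" "integrable lborel (\<lambda>x. normal_density a \<sigma> x * (x - a) ^ 1)"
    "integrable lborel (\<lambda>x. normal_density a \<sigma> x)"
    using \<sigma> by (intro integrable_normal_moment integrable_normal_density; simp)+
  then have "integrable lborel (\<lambda>x. normal_density a \<sigma> x * (x - a) ^ 2 + 2 * a * (normal_density a \<sigma> x * (x - a) ^ 1) + a\<^sup>2 * normal_density a \<sigma> x)"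
    by (intro Bochner_Integration.integrable_add integrable_mult_right)
  then have "integrable lborel (\<lambda>x. normal_density a \<sigma> x * x\<^sup>2)"
    by (rule Bochner_Integration.integrable_cong[OF refl, THEN iffD1, rotated])
       (simp add: power2_eq_square algebra_simps)
  then show i2: "integrable M (\<lambda>w. (X w)\<^sup>2)"
    by (subst distributed_integrable[OF X, symmetric]) auto
  have "X \<in> borel_measurable M" using distributed_measurable[OF X] by simp
  then show "integrable M X" using i2 by (rule square_integrable_imp_integrable)
qed

text \<open>A normal variable is here a point mass or has a normal density; with mean zero both
  cases obey one formula, the point mass sitting at zero with vanishing second moment.\<close>

lemma (in prob_space) normal_rv_zero_mean_char:
  assumes X: "normal_rv M X" and mean: "(\<integral>w. X w \<partial>M) = 0"
  shows "integrable M (\<lambda>w. (X w)\<^sup>2)" and "integrable M X"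
    and "(\<integral>w. iexp (t * X w) \<partial>M) = of_real (exp (- (t\<^sup>2 * (\<integral>w. (X w)\<^sup>2 \<partial>M) / 2)))"
proof -
  have Xm [measurable]: "X \<in> borel_measurable M" using X by (simp add: normal_rv_def)
  obtain a where "(AE w in M. X w = a) \<or> (\<exists>\<sigma>>0. distributed M lborel X (\<lambda>y. ennreal (normal_density a \<sigma> y)))"
    using X by (auto simp: normal_rv_def)
  then have "integrable M (\<lambda>w. (X w)\<^sup>2) \<and> integrable M X \<and>
    (\<integral>w. iexp (t * X w) \<partial>M) = of_real (exp (- (t\<^sup>2 * (\<integral>w. (X w)\<^sup>2 \<partial>M) / 2)))"
  proof
    assume a: "AE w in M. X w = a"
    have "(\<integral>w. X w \<partial>M) = (\<integral>w. a \<partial>M)" using a by (intro integral_cong_AE) auto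
    then have "a = 0" using mean by (simp add: prob_space)
    then have X0: "AE w in M. X w = 0" using a by simp
    have "(\<integral>w. iexp (t * X w) \<partial>M) = (\<integral>w. 1 \<partial>M)" using X0 by (intro integral_cong_AE) auto
    moreover have "(\<integral>w. (X w)\<^sup>2 \<partial>M) = (\<integral>w. 0 \<partial>M)" using X0 by (intro integral_cong_AE) auto
    moreover have "integrable M (\<lambda>w. (X w)\<^sup>2)"
      by (rule integrable_cong_AE_imp[of M "\<lambda>_. 0::real", OF integrable_zero]) (use X0 in auto)
    moreover have "integrable M X"
      by (rule integrable_cong_AE_imp[of M "\<lambda>_. 0::real", OF integrable_zero]) (use X0 in auto)
    ultimately show ?thesis by (simp add: prob_space)
  next
    assume "\<exists>\<sigma>>0. distributed M lborel X (\<lambda>y. ennreal (normal_density a \<sigma> y))"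
    then obtain \<sigma> where \<sigma>: "0 < \<sigma>" and D: "distributed M lborel X (\<lambda>y. ennreal (normal_density a \<sigma> y))" by auto
    have a0: "a = 0" using normal_distributed_expectation[OF \<sigma> D] mean by simp
    have v: "(\<integral>w. (X w)\<^sup>2 \<partial>M) = \<sigma>\<^sup>2" using normal_distributed_variance[OF \<sigma> D] mean by simp
    have "distr M borel X = distr M lborel X" by (rule distr_cong) auto
    also have "\<dots> = density lborel (\<lambda>y. ennreal (normal_density a \<sigma> y))" using D by (simp add: distributed_def)
    finally have "(\<integral>w. iexp (t * X w) \<partial>M) = of_real (exp (- (t\<^sup>2 * \<sigma>\<^sup>2 / 2)))"
      using char_distr_eq[OF Xm, of t] char_normal_density[OF \<sigma>, of a t] a0 by simp
    then show ?thesis using normal_rv_second_moment[OF D \<sigma>] v by simp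
  qed
  then show "integrable M (\<lambda>w. (X w)\<^sup>2)" and "integrable M X"
    and "(\<integral>w. iexp (t * X w) \<partial>M) = of_real (exp (- (t\<^sup>2 * (\<integral>w. (X w)\<^sup>2 \<partial>M) / 2)))"
    by blast+
qed

text \<open>Levy's uniqueness theorem identifies the law. The value \<open>s = 0\<close> means the
  point mass at zero and is treated apart, because a normal density requires a positive
  deviation.\<close>

lemma (in prob_space) normal_rv_if_char:
  assumes Xm [measurable]: "X \<in> borel_measurable M" and s: "0 \<le> s"
    and ch: "\<And>t. (\<integral>w. iexp (t * X w) \<partial>M) = of_real (exp (- (t\<^sup>2 * s / 2)))"
  shows "normal_rv M X" "(\<integral>w. X w \<partial>M) = 0" "(\<integral>w. (X w)\<^sup>2 \<partial>M) = s"
    "integrable M (\<lambda>w. (X w)\<^sup>2)" "integrable M X"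
proof -
  have rd: "real_distribution (distr M borel X)" by (rule real_distribution_distr) simp
  have "normal_rv M X \<and> (\<integral>w. X w \<partial>M) = 0 \<and> (\<integral>w. (X w)\<^sup>2 \<partial>M) = s"
  proof (cases "s = 0")
    case True
    interpret R: prob_space "return borel (0::real)" by (rule prob_space_return) simp
    have "real_distribution (return borel (0::real))" by unfold_locales auto
    moreover have "char (distr M borel X) = char (return borel 0)"
      unfolding fun_eq_iff char_distr_eq[OF Xm] ch using True by (simp add: char_def integral_return)
    ultimately have eq: "distr M borel X = return borel 0" using rd by (intro Levy_uniqueness)
    have "AE x in distr M borel X. x = 0" unfolding eq by (subst AE_return) auto
    then have X0: "AE w in M. X w = 0" by (subst (asm) AE_distr_iff) auto
    have "(\<integral>w. X w \<partial>M) = (\<integral>w. 0 \<partial>M)" "(\<integral>w. (X w)\<^sup>2 \<partial>M) = (\<integral>w. 0 \<partial>M)"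
      using X0 by (intro integral_cong_AE; auto)+
    then show ?thesis using X0 True by (auto simp: normal_rv_def)
  next
    case False
    define \<sigma> where "\<sigma> = sqrt s"
    have \<sigma>: "0 < \<sigma>" "\<sigma>\<^sup>2 = s" using False s by (auto simp: \<sigma>_def)
    let ?N = "density lborel (\<lambda>x. ennreal (normal_density 0 \<sigma> x))"
    interpret R: prob_space ?N by (rule prob_space_normal_density[OF \<sigma>(1)])
    have "real_distribution ?N" by unfold_locales auto
    moreover have "char (distr M borel X) = char ?N"
      unfolding fun_eq_iff char_distr_eq[OF Xm] ch char_normal_density[OF \<sigma>(1)] \<sigma>(2) by simp
    ultimately have eq: "distr M borel X = ?N" using rd by (intro Levy_uniqueness)
    have "distr M lborel X = distr M borel X" by (rule distr_cong) auto
    then have D: "distributed M lborel X (\<lambda>x. ennreal (normal_density 0 \<sigma> x))"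
      unfolding distributed_def using eq by auto
    have e: "(\<integral>w. X w \<partial>M) = 0" using normal_distributed_expectation[OF \<sigma>(1) D] .
    have "(\<integral>w. (X w)\<^sup>2 \<partial>M) = s" using normal_distributed_variance[OF \<sigma>(1) D] e \<sigma>(2) by simp
    with e D \<sigma> show ?thesis by (auto simp: normal_rv_def)
  qed
  then show n: "normal_rv M X" and e: "(\<integral>w. X w \<partial>M) = 0" and "(\<integral>w. (X w)\<^sup>2 \<partial>M) = s" by blast+
  show "integrable M (\<lambda>w. (X w)\<^sup>2)" by (rule normal_rv_zero_mean_char(1)[OF n e])
  show "integrable M X" by (rule normal_rv_zero_mean_char(2)[OF n e])
qed

section \<open>Square-integrable functions and orthonormalisation\<close>

definition L2 :: "'a measure \<Rightarrow> ('a \<Rightarrow> real) \<Rightarrow> bool" where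
  "L2 M f \<longleftrightarrow> f \<in> borel_measurable M \<and> integrable M (\<lambda>w. (f w)\<^sup>2)"

lemma L2_mult:
  assumes "L2 M f" "L2 M g"
  shows "integrable M (\<lambda>w. f w * g w)"
proof (rule Bochner_Integration.integrable_bound)
  show "integrable M (\<lambda>w. (f w)\<^sup>2 + (g w)\<^sup>2)" using assms by (auto simp: L2_def)
  show "(\<lambda>w. f w * g w) \<in> borel_measurable M" using assms by (auto simp: L2_def)
  have "\<bar>x * y\<bar> \<le> x\<^sup>2 + y\<^sup>2" for x y :: real
  proof -
    have "2 * \<bar>x * y\<bar> \<le> x\<^sup>2 + y\<^sup>2"
      using sum_squares_bound[of "\<bar>x\<bar>" "\<bar>y\<bar>"] by (simp add: abs_mult mult.assoc)
    then show ?thesis using abs_ge_zero[of "x * y"] by linarith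
  qed
  then show "AE w in M. norm (f w * g w) \<le> norm ((f w)\<^sup>2 + (g w)\<^sup>2)"
    by (intro AE_I2) auto
qed

lemma L2_add: "L2 M f \<Longrightarrow> L2 M g \<Longrightarrow> L2 M (\<lambda>w. f w + g w)"
  using L2_mult[of M f g] by (auto simp: L2_def power2_sum mult.assoc)

lemma L2_scale: "L2 M f \<Longrightarrow> L2 M (\<lambda>w. c * f w)"
  by (auto simp: L2_def power_mult_distrib)

lemma L2_diff: "L2 M f \<Longrightarrow> L2 M g \<Longrightarrow> L2 M (\<lambda>w. f w - g w)"
  using L2_add[of M f "\<lambda>w. - 1 * g w"] L2_scale[of M g "- 1"] by simp

lemma L2_sum: "(\<And>i. i \<in> A \<Longrightarrow> L2 M (f i)) \<Longrightarrow> L2 M (\<lambda>w. \<Sum>i\<in>A. f i w)"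
proof (induction A rule: infinite_finite_induct)
  case (insert x F)
  then show ?case by (simp add: L2_add)
qed (auto simp: L2_def)

lemma L2_square: "L2 M f \<Longrightarrow> integrable M (\<lambda>w. (f w)\<^sup>2)" and L2_measurable: "L2 M f \<Longrightarrow> f \<in> borel_measurable M"
  by (simp_all add: L2_def)


lemma integral_sum_orthogonal:
  assumes L: "\<And>i. i \<in> A \<Longrightarrow> L2 M (f i)" and A: "finite A"
    and orth: "\<And>i j. i \<in> A \<Longrightarrow> j \<in> A \<Longrightarrow> i \<noteq> j \<Longrightarrow> (\<integral>w. f i w * f j w \<partial>M) = 0"
  shows "(\<integral>w. (\<Sum>i\<in>A. c i * f i w)\<^sup>2 \<partial>M) = (\<Sum>i\<in>A. (c i)\<^sup>2 * (\<integral>w. (f i w)\<^sup>2 \<partial>M))"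
proof -
  have "(\<integral>w. (\<Sum>i\<in>A. c i * f i w)\<^sup>2 \<partial>M) = (\<integral>w. (\<Sum>i\<in>A. \<Sum>j\<in>A. (c i * c j) * (f i w * f j w)) \<partial>M)"
    by (simp add: power2_eq_square sum_product mult_ac)
  also have "\<dots> = (\<Sum>i\<in>A. \<Sum>j\<in>A. (c i * c j) * (\<integral>w. f i w * f j w \<partial>M))"
    using L2_mult[OF L L] by (simp add: Bochner_Integration.integral_sum)
  also have "\<dots> = (\<Sum>i\<in>A. \<Sum>j\<in>A. if j = i then (c i * c j) * (\<integral>w. f i w * f j w \<partial>M) else 0)"
    using orth by (intro sum.cong) auto
  also have "\<dots> = (\<Sum>i\<in>A. (c i)\<^sup>2 * (\<integral>w. (f i w)\<^sup>2 \<partial>M))"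
    using A by (simp add: power2_eq_square)
  finally show ?thesis .
qed

text \<open>Division by zero yields zero: if \<open>v n\<close> depends linearly on its predecessors
  almost everywhere, the basis element is the zero function. All elements thus have norm one or
  zero, and no vector has to be left out of the sequence.\<close>

fun gram_schmidt :: "'a measure \<Rightarrow> (nat \<Rightarrow> 'a \<Rightarrow> real) \<Rightarrow> nat \<Rightarrow> 'a \<Rightarrow> real" where
  "gram_schmidt M v n =
     (let r = (\<lambda>w. v n w - (\<Sum>k<n. (\<integral>w'. v n w' * gram_schmidt M v k w' \<partial>M) * gram_schmidt M v k w))
      in (\<lambda>w. r w / sqrt (\<integral>w'. (r w')\<^sup>2 \<partial>M)))"

declare gram_schmidt.simps [simp del]

context
  fixes M :: "'a measure" and v :: "nat \<Rightarrow> 'a \<Rightarrow> real"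
  assumes v: "\<And>n. L2 M (v n)"
begin

abbreviation gs_basis :: "nat \<Rightarrow> 'a \<Rightarrow> real" where "gs_basis \<equiv> gram_schmidt M v"

definition gs_coeff :: "nat \<Rightarrow> nat \<Rightarrow> real" where "gs_coeff n k = (\<integral>w. v n w * gs_basis k w \<partial>M)"
definition gs_residual :: "nat \<Rightarrow> 'a \<Rightarrow> real" where
  "gs_residual n w = v n w - (\<Sum>k<n. gs_coeff n k * gs_basis k w)"
definition gs_norm :: "nat \<Rightarrow> real" where "gs_norm n = sqrt (\<integral>w. (gs_residual n w)\<^sup>2 \<partial>M)"

lemma gs_basis_eq: "gs_basis n = (\<lambda>w. gs_residual n w / gs_norm n)"
  by (subst gram_schmidt.simps) (simp add: gs_residual_def gs_norm_def gs_coeff_def Let_def fun_eq_iff)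

lemma L2_gs_basis: "L2 M (gs_basis n)"
proof (induction n rule: less_induct)
  case (less n)
  have "L2 M (gs_residual n)"
    unfolding gs_residual_def[abs_def] by (intro L2_diff v L2_sum L2_scale less) auto
  from L2_scale[OF this, of "1 / gs_norm n"] show ?case by (simp add: gs_basis_eq)
qed

lemma L2_gs_residual: "L2 M (gs_residual n)"
  unfolding gs_residual_def[abs_def] by (intro L2_diff v L2_sum L2_scale L2_gs_basis)

lemma gs_norm_squared: "(gs_norm n)\<^sup>2 = (\<integral>w. (gs_residual n w)\<^sup>2 \<partial>M)"
  unfolding gs_norm_def by (intro real_sqrt_pow2 integral_nonneg_AE) auto

lemma gs_residual_AE: "AE w in M. gs_residual n w = gs_norm n * gs_basis n w"
proof (cases "gs_norm n = 0")
  case True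
  then have "(\<integral>w. (gs_residual n w)\<^sup>2 \<partial>M) = 0" using gs_norm_squared[of n] by simp
  then have "AE w in M. (gs_residual n w)\<^sup>2 = 0"
    by (subst (asm) integral_nonneg_eq_0_iff_AE) (use L2_square[OF L2_gs_residual] in auto)
  then show ?thesis using True by simp
qed (simp add: gs_basis_eq)

lemma gs_basis_norm: "(\<integral>w. (gs_basis n w)\<^sup>2 \<partial>M) = (if gs_norm n = 0 then 0 else 1)"
proof (cases "gs_norm n = 0")
  case False
  then show ?thesis
    using gs_norm_squared[of n, symmetric] by (simp add: gs_basis_eq power_divide)
qed (simp add: gs_basis_eq)

lemma gs_basis_zero: "gs_norm k = 0 \<Longrightarrow> gs_coeff n k = 0"
  by (simp add: gs_coeff_def gs_basis_eq)

text \<open>The projection removes from \<open>v n\<close> its component along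
  \<open>gs_basis k\<close>, and by induction the other basis elements below \<open>n\<close>
  contribute nothing. A zero element has zero coefficient, so the case \<open>j = k\<close> holds
  for it as well.\<close>

lemma gs_basis_orthogonal_less: "k < n \<Longrightarrow> (\<integral>w. gs_basis n w * gs_basis k w \<partial>M) = 0"
proof (induction n arbitrary: k rule: less_induct)
  case (less n)
  have "(\<integral>w. gs_residual n w * gs_basis k w \<partial>M) = gs_coeff n k - (\<Sum>j<n. gs_coeff n j * (\<integral>w. gs_basis j w * gs_basis k w \<partial>M))"
    unfolding gs_residual_def gs_coeff_def[of n k]
    using L2_mult[OF v L2_gs_basis] L2_mult[OF L2_gs_basis L2_gs_basis]
    by (simp add: left_diff_distrib sum_distrib_right mult.assoc Bochner_Integration.integral_sum)
  also have "(\<Sum>j<n. gs_coeff n j * (\<integral>w. gs_basis j w * gs_basis k w \<partial>M)) = (\<Sum>j<n. if j = k then gs_coeff n k else 0)"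
  proof (rule sum.cong[OF refl])
    fix j assume j: "j \<in> {..<n}"
    consider "j = k" | "j < k" | "k < j" by linarith
    then show "gs_coeff n j * (\<integral>w. gs_basis j w * gs_basis k w \<partial>M) = (if j = k then gs_coeff n k else 0)"
    proof cases
      case 1
      then show ?thesis using gs_basis_norm[of k] gs_basis_zero[of k n] by (auto simp: power2_eq_square)
    next
      case 2
      then show ?thesis using less.IH[of k j] less.prems by (simp add: mult.commute)
    next
      case 3
      then show ?thesis using less.IH[of j k] j by simp
    qed
  qed
  also have "\<dots> = gs_coeff n k" using less.prems by simp
  finally show ?case by (simp add: gs_basis_eq[of n])
qed

lemma gs_basis_orthogonal: "i \<noteq> j \<Longrightarrow> (\<integral>w. gs_basis i w * gs_basis j w \<partial>M) = 0"
  using gs_basis_orthogonal_less[of j i] gs_basis_orthogonal_less[of i j] by (cases "i < j") (auto simp: mult.commute)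

lemma gs_coeff_diag: "gs_coeff n n = gs_norm n"
proof -
  have "gs_coeff n n = (\<integral>w. (gs_residual n w + (\<Sum>k<n. gs_coeff n k * gs_basis k w)) * gs_basis n w \<partial>M)"
    unfolding gs_residual_def gs_coeff_def[of n n] by simp
  also have "\<dots> = (\<integral>w. gs_residual n w * gs_basis n w \<partial>M) + (\<Sum>k<n. gs_coeff n k * (\<integral>w. gs_basis k w * gs_basis n w \<partial>M))"
    using L2_mult[OF L2_gs_residual L2_gs_basis] L2_mult[OF L2_gs_basis L2_gs_basis]
    by (simp add: distrib_right sum_distrib_right mult.assoc Bochner_Integration.integral_sum)
  also have "(\<Sum>k<n. gs_coeff n k * (\<integral>w. gs_basis k w * gs_basis n w \<partial>M)) = 0"
    by (intro sum.neutral) (auto intro: gs_basis_orthogonal)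
  also have "(\<integral>w. gs_residual n w * gs_basis n w \<partial>M) = gs_norm n"
    using gs_norm_squared[of n, symmetric] by (simp add: gs_basis_eq power2_eq_square)
  finally show ?thesis by simp
qed

text \<open>Only almost everywhere, since a residual of norm zero vanishes up to a null set while
  its basis element is zero everywhere.\<close>

lemma v_expansion: "AE w in M. v n w = (\<Sum>k\<le>n. gs_coeff n k * gs_basis k w)"
  using gs_residual_AE[of n]
  by eventually_elim (simp add: gs_residual_def gs_coeff_diag flip: lessThan_Suc_atMost)

text \<open>Replacing the orthonormal functions by independent standard normal coordinates preserves
  second moments: this is the isometry from the span of the \<open>v n\<close> into Gaussian
  variables.\<close>

definition gauss :: "nat \<Rightarrow> (nat \<Rightarrow> real) \<Rightarrow> real" where
  "gauss n \<xi> = (\<Sum>k\<le>n. gs_coeff n k * \<xi> k)"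

end

section \<open>Independent standard normal variables\<close>

interpretation std_normal: prob_space std_normal_distribution
  using real_dist_normal_dist by (rule real_distribution.axioms)

abbreviation white_noise :: "(nat \<Rightarrow> real) measure" where
  "white_noise \<equiv> PiM UNIV (\<lambda>_::nat. std_normal_distribution)"

interpretation white_noise: prob_space white_noise
  by (rule prob_space_PiM) (rule std_normal.prob_space_axioms)

lemma white_noise_coordinate [measurable]: "(\<lambda>\<xi>. \<xi> k) \<in> borel_measurable white_noise"
  using measurable_component_singleton[of k UNIV "\<lambda>_. std_normal_distribution"] by simp

lemma distr_white_noise_coordinate: "distr white_noise borel (\<lambda>\<xi>. \<xi> k) = std_normal_distribution"
proof -
  have "distr white_noise borel (\<lambda>\<xi>. \<xi> k) = distr white_noise std_normal_distribution (\<lambda>\<xi>. \<xi> k)"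
    by (rule distr_cong) auto
  also have "\<dots> = std_normal_distribution"
    by (rule distr_PiM_component) (auto intro: std_normal.prob_space_axioms)
  finally show ?thesis .
qed

lemma white_noise_indep: "white_noise.indep_vars (\<lambda>_. borel) (\<lambda>k \<xi>. \<xi> k) UNIV"
proof (subst white_noise.indep_vars_iff_distr_eq_PiM')
  have "distr white_noise (PiM UNIV (\<lambda>_. borel)) (\<lambda>x. \<lambda>i\<in>UNIV. x i) = distr white_noise white_noise (\<lambda>x. x)"
    by (rule distr_cong) (auto intro!: sets_PiM_cong)
  then show "distr white_noise (PiM UNIV (\<lambda>_. borel)) (\<lambda>x. \<lambda>i\<in>UNIV. x i)
    = (\<Pi>\<^sub>M i\<in>UNIV. distr white_noise borel (\<lambda>\<xi>. \<xi> i))"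
    by (simp add: distr_white_noise_coordinate)
qed auto

lemma char_white_noise_sum:
  "(\<integral>\<xi>. iexp (\<Sum>k\<le>n. d k * \<xi> k) \<partial>white_noise) = of_real (exp (- ((\<Sum>k\<le>n. (d k)\<^sup>2) / 2)))"
proof -
  have ind: "white_noise.indep_vars (\<lambda>_. borel) (\<lambda>k \<xi>. d k * \<xi> k) {..n}"
    by (rule white_noise.indep_vars_compose2[OF white_noise.indep_vars_subset[OF white_noise_indep]]) auto
  have "(\<integral>\<xi>. iexp (\<Sum>k\<le>n. d k * \<xi> k) \<partial>white_noise)
    = char (distr white_noise borel (\<lambda>\<xi>. \<Sum>k\<le>n. d k * \<xi> k)) 1"
    by (subst white_noise.char_distr_eq) auto
  also have "\<dots> = (\<Prod>k\<le>n. char (distr white_noise borel (\<lambda>\<xi>. d k * \<xi> k)) 1)"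
    by (rule white_noise.char_distr_sum[OF ind])
  also have "\<dots> = (\<Prod>k\<le>n. complex_of_real (exp (- ((d k)\<^sup>2 / 2))))"
  proof (rule prod.cong[OF refl])
    fix k
    have "char (distr white_noise borel (\<lambda>\<xi>. d k * \<xi> k)) 1 = (\<integral>\<xi>. iexp (d k * \<xi> k) \<partial>white_noise)"
      by (subst white_noise.char_distr_eq) auto
    also have "\<dots> = char (distr white_noise borel (\<lambda>\<xi>. \<xi> k)) (d k)"
      by (subst white_noise.char_distr_eq) auto
    also have "\<dots> = complex_of_real (exp (- ((d k)\<^sup>2 / 2)))"
      unfolding distr_white_noise_coordinate char_std_normal_distribution by simp
    finally show "char (distr white_noise borel (\<lambda>\<xi>. d k * \<xi> k)) 1 = complex_of_real (exp (- ((d k)\<^sup>2 / 2)))" .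
  qed
  also have "\<dots> = of_real (exp (- ((\<Sum>k\<le>n. (d k)\<^sup>2) / 2)))"
    by (simp add: exp_sum[symmetric] sum_negf sum_divide_distrib flip: of_real_prod)
  finally show ?thesis .
qed

text \<open>A finite combination of the constructed variables is a combination of independent
  normals whose squared coefficients add up to the second moment of the same combination of the
  \<open>v n\<close>. The index set \<open>J\<close> is kept apart from the map \<open>n\<close>, so
  that one variable may occur several times.\<close>

lemma gaussian_sequence_exists:
  fixes v :: "nat \<Rightarrow> 'a \<Rightarrow> real"
  assumes v: "\<And>n. L2 M (v n)"
  shows "\<exists>G. (\<forall>n. G n \<in> borel_measurable white_noise) \<and>
    (\<forall>(J::'j set) c n. finite J \<longrightarrow>
       (\<integral>\<xi>. iexp (\<Sum>j\<in>J. c j * G (n j) \<xi>) \<partial>white_noise) = of_real (exp (- ((\<integral>w. (\<Sum>j\<in>J. c j * v (n j) w)\<^sup>2 \<partial>M) / 2))))"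
proof -
  have m: "gauss M v n \<in> borel_measurable white_noise" for n
    unfolding gauss_def[OF v, abs_def] by measurable
  have ch: "(\<integral>\<xi>. iexp (\<Sum>j\<in>J. c j * gauss M v (n j) \<xi>) \<partial>white_noise)
    = of_real (exp (- ((\<integral>w. (\<Sum>j\<in>J. c j * v (n j) w)\<^sup>2 \<partial>M) / 2)))"
    if J: "finite J" for J :: "'j set" and c n
  proof -
  define K where "K = Max (insert 0 (n ` J))"
  have K: "n j \<le> K" if "j \<in> J" for j unfolding K_def using J that by (intro Max_ge) auto
  \<comment> \<open>The coefficient of the \<open>k\<close>-th basis element, after all expansions
    have been extended by zeros to the common length \<open>K\<close>.\<close>
  define d where "d k = (\<Sum>j\<in>J. c j * (if k \<le> n j then gs_coeff M v (n j) k else 0))" for k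
  have sum_eq: "(\<Sum>j\<in>J. c j * (\<Sum>k\<le>n j. gs_coeff M v (n j) k * f k)) = (\<Sum>k\<le>K. d k * f k)" for f :: "nat \<Rightarrow> real"
  proof -
    have "(\<Sum>j\<in>J. c j * (\<Sum>k\<le>n j. gs_coeff M v (n j) k * f k))
      = (\<Sum>j\<in>J. c j * (\<Sum>k\<le>K. (if k \<le> n j then gs_coeff M v (n j) k else 0) * f k))"
    proof (rule sum.cong[OF refl])
      fix j assume j: "j \<in> J"
      have "(\<Sum>k\<le>n j. gs_coeff M v (n j) k * f k) = (\<Sum>k\<le>K. (if k \<le> n j then gs_coeff M v (n j) k else 0) * f k)"
        using K[OF j] by (intro sum.mono_neutral_cong_left) auto
      then show "c j * (\<Sum>k\<le>n j. gs_coeff M v (n j) k * f k)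
        = c j * (\<Sum>k\<le>K. (if k \<le> n j then gs_coeff M v (n j) k else 0) * f k)" by simp
    qed
    also have "\<dots> = (\<Sum>k\<le>K. d k * f k)"
      unfolding d_def sum_distrib_left sum_distrib_right by (subst sum.swap) (simp add: mult.assoc)
    finally show ?thesis .
  qed
  have "(\<integral>\<xi>. iexp (\<Sum>j\<in>J. c j * gauss M v (n j) \<xi>) \<partial>white_noise) = of_real (exp (- ((\<Sum>k\<le>K. (d k)\<^sup>2) / 2)))"
    unfolding gauss_def[OF v] sum_eq by (rule char_white_noise_sum)
  also have "(\<Sum>k\<le>K. (d k)\<^sup>2) = (\<Sum>k\<le>K. (d k)\<^sup>2 * (\<integral>w. (gram_schmidt M v k w)\<^sup>2 \<partial>M))"
  proof (intro sum.cong refl)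
    fix k
    show "(d k)\<^sup>2 = (d k)\<^sup>2 * (\<integral>w. (gram_schmidt M v k w)\<^sup>2 \<partial>M)"
    proof (cases "gs_norm M v k = 0")
      case True
      then have "d k = 0" unfolding d_def by (intro sum.neutral) (auto simp: gs_basis_zero[OF v])
      then show ?thesis by simp
    next
      case False
      then show ?thesis using gs_basis_norm[of M v k, OF v] by simp
    qed
  qed
  also have "\<dots> = (\<integral>w. (\<Sum>k\<le>K. d k * gram_schmidt M v k w)\<^sup>2 \<partial>M)"
    by (rule integral_sum_orthogonal[symmetric]) (auto intro: L2_gs_basis[OF v] gs_basis_orthogonal[OF v])
  also have "\<dots> = (\<integral>w. (\<Sum>j\<in>J. c j * v (n j) w)\<^sup>2 \<partial>M)"
  proof (rule integral_cong_AE)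
    have [measurable]: "gram_schmidt M v k \<in> borel_measurable M" "v k \<in> borel_measurable M" for k
      by (rule L2_measurable[OF L2_gs_basis[OF v]], rule L2_measurable[OF v])
    show "(\<lambda>w. (\<Sum>k\<le>K. d k * gram_schmidt M v k w)\<^sup>2) \<in> borel_measurable M"
      "(\<lambda>w. (\<Sum>j\<in>J. c j * v (n j) w)\<^sup>2) \<in> borel_measurable M" by measurable
    have "AE w in M. \<forall>j\<in>J. v (n j) w = (\<Sum>k\<le>n j. gs_coeff M v (n j) k * gram_schmidt M v k w)"
      using J v_expansion[OF v] by (intro AE_finite_allI) auto
    then show "AE w in M. (\<Sum>k\<le>K. d k * gram_schmidt M v k w)\<^sup>2 = (\<Sum>j\<in>J. c j * v (n j) w)\<^sup>2"
      by eventually_elim (simp flip: sum_eq)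
  qed
  finally show ?thesis .
  qed
  from m ch show ?thesis by (intro exI[of _ "gauss M v"] conjI allI impI)
qed


text \<open>Young's inequality for the cross term \<open>2 * b * (a - b)\<close>. The free weight
  trades the share of \<open>b^2\<close> against that of the squared difference.\<close>

lemma square_diff_bound:
  fixes a b :: real
  assumes "0 < \<eta>"
  shows "\<bar>a\<^sup>2 - b\<^sup>2\<bar> \<le> \<eta> * b\<^sup>2 + (1 + 1 / \<eta>) * (a - b)\<^sup>2"
proof -
  have ab: "2 * \<bar>b * (a - b)\<bar> \<le> \<eta> * b\<^sup>2 + (a - b)\<^sup>2 / \<eta>"
  proof -
    have "2 * (sqrt \<eta> * \<bar>b\<bar>) * (\<bar>a - b\<bar> / sqrt \<eta>) \<le> (sqrt \<eta> * \<bar>b\<bar>)\<^sup>2 + (\<bar>a - b\<bar> / sqrt \<eta>)\<^sup>2"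
      by (rule sum_squares_bound)
    then show ?thesis using assms by (simp add: power_mult_distrib power_divide abs_mult mult.assoc)
  qed
  have "a\<^sup>2 - b\<^sup>2 = 2 * (b * (a - b)) + (a - b)\<^sup>2" by (simp add: power2_eq_square algebra_simps)
  then have "\<bar>a\<^sup>2 - b\<^sup>2\<bar> \<le> 2 * \<bar>b * (a - b)\<bar> + (a - b)\<^sup>2"
    using abs_triangle_ineq[of "2 * (b * (a - b))" "(a - b)\<^sup>2"] by (simp add: abs_mult)
  with ab show ?thesis by (simp add: distrib_right)
qed

lemma L2_square_tendsto:
  assumes f: "\<And>k. L2 M (f k)" and g: "L2 M g"
    and lim: "(\<lambda>k. \<integral>w. (f k w - g w)\<^sup>2 \<partial>M) \<longlonglongrightarrow> 0"
  shows "(\<lambda>k. \<integral>w. (f k w)\<^sup>2 \<partial>M) \<longlonglongrightarrow> (\<integral>w. (g w)\<^sup>2 \<partial>M)"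
proof (rule LIMSEQ_I)
  fix r :: real assume r: "0 < r"
  define B where "B = (\<integral>w. (g w)\<^sup>2 \<partial>M)"
  have B: "0 \<le> B" unfolding B_def by simp
  define \<eta> where "\<eta> = r / 2 / (B + 1)"
  have \<eta>: "0 < \<eta>" using r B by (simp add: \<eta>_def)
  have \<eta>B: "\<eta> * B < r"
  proof -
    have "\<eta> * B \<le> \<eta> * (B + 1)" using \<eta> by (intro mult_left_mono) auto
    also have "\<dots> = r / 2" 
    proof -
      have "B + 1 \<noteq> 0" using B by simp
      moreover have "a / b * b = a" if "b \<noteq> 0" for a b :: real using that by simp
      ultimately show ?thesis unfolding \<eta>_def by blast
    qed
    finally show ?thesis using r by simp
  qed
  have bound: "\<bar>(\<integral>w. (f k w)\<^sup>2 \<partial>M) - B\<bar> \<le> \<eta> * B + (1 + 1 / \<eta>) * (\<integral>w. (f k w - g w)\<^sup>2 \<partial>M)" for k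
  proof -
    note i = L2_square[OF f[of k]] L2_square[OF g] L2_square[OF L2_diff[OF f[of k] g]]
    have "\<bar>(\<integral>w. (f k w)\<^sup>2 \<partial>M) - B\<bar> = \<bar>\<integral>w. (f k w)\<^sup>2 - (g w)\<^sup>2 \<partial>M\<bar>"
      unfolding B_def using i by simp
    also have "\<dots> \<le> (\<integral>w. \<bar>(f k w)\<^sup>2 - (g w)\<^sup>2\<bar> \<partial>M)" by (rule integral_abs_bound)
    also have "\<dots> \<le> (\<integral>w. \<eta> * (g w)\<^sup>2 + (1 + 1 / \<eta>) * (f k w - g w)\<^sup>2 \<partial>M)"
      using i by (intro integral_mono square_diff_bound \<eta>) auto
    also have "\<dots> = \<eta> * B + (1 + 1 / \<eta>) * (\<integral>w. (f k w - g w)\<^sup>2 \<partial>M)"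
      unfolding B_def using i by simp
    finally show ?thesis .
  qed
  have "(\<lambda>k. \<eta> * B + (1 + 1 / \<eta>) * (\<integral>w. (f k w - g w)\<^sup>2 \<partial>M)) \<longlonglongrightarrow> \<eta> * B + (1 + 1 / \<eta>) * 0"
    by (intro tendsto_intros lim)
  then have "eventually (\<lambda>k. \<eta> * B + (1 + 1 / \<eta>) * (\<integral>w. (f k w - g w)\<^sup>2 \<partial>M) < r) sequentially"
    using \<eta>B by (intro order_tendstoD(2)[where a = r]) auto
  then have "eventually (\<lambda>k. norm ((\<integral>w. (f k w)\<^sup>2 \<partial>M) - B) < r) sequentially"
    using bound unfolding real_norm_def by (rule eventually_mono[OF _ le_less_trans])
  then show "\<exists>no. \<forall>k\<ge>no. norm ((\<integral>w. (f k w)\<^sup>2 \<partial>M) - (\<integral>w. (g w)\<^sup>2 \<partial>M)) < r"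
    unfolding B_def eventually_sequentially .
qed

text \<open>\<open>Z u\<close> is the almost sure limit along the indices \<open>n\<^sub>k(u)\<close>, the first ones with
  \<open>Y (q n)\<close> at squared distance below \<open>4\<^sup>-\<^sup>k\<close> from \<open>Y u\<close>; a choice measurable in \<open>u\<close> gives joint
  measurability.\<close>

theorem gaussian_field_exists:
  fixes Y :: "'u \<Rightarrow> 'a \<Rightarrow> real" and q :: "nat \<Rightarrow> 'u"
  assumes M: "prob_space M" and Y: "\<And>u. u \<in> space R \<Longrightarrow> L2 M (Y u)" and q: "\<And>n. q n \<in> space R"
    and dense: "\<And>u e. u \<in> space R \<Longrightarrow> 0 < e \<Longrightarrow> \<exists>n. (\<integral>w. (Y (q n) w - Y u w)\<^sup>2 \<partial>M) < e"
    and dist_measurable: "\<And>n. (\<lambda>u. \<integral>w. (Y (q n) w - Y u w)\<^sup>2 \<partial>M) \<in> borel_measurable R"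
  shows "\<exists>Z. (\<lambda>(\<xi>, u). Z u \<xi>) \<in> borel_measurable (white_noise \<Otimes>\<^sub>M R) \<and>
    (\<forall>J c. finite J \<longrightarrow> J \<subseteq> space R \<longrightarrow>
       (\<integral>\<xi>. iexp (\<Sum>u\<in>J. c u * Z u \<xi>) \<partial>white_noise) = of_real (exp (- ((\<integral>w. (\<Sum>u\<in>J. c u * Y u w)\<^sup>2 \<partial>M) / 2))))"
proof -
  note [measurable] = dist_measurable
  let ?d = "\<lambda>n u. \<integral>w. (Y (q n) w - Y u w)\<^sup>2 \<partial>M"
  obtain G where G [measurable]: "\<And>n. G n \<in> borel_measurable white_noise" and
    Gc': "\<forall>(J::nat set) c n. finite J \<longrightarrow> (\<integral>\<xi>. iexp (\<Sum>j\<in>J. c j * G (n j) \<xi>) \<partial>white_noise)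
      = of_real (exp (- ((\<integral>w. (\<Sum>j\<in>J. c j * Y (q (n j)) w)\<^sup>2 \<partial>M) / 2)))"
    using gaussian_sequence_exists[of M "\<lambda>n. Y (q n)"] Y q by blast
  \<comment> \<open>The variables were obtained together with a formula for finite sets of natural
    numbers only; an enumeration of \<open>J\<close> carries it over to any index type.\<close>
  have Gc: "(\<integral>\<xi>. iexp (\<Sum>j\<in>J. c j * G (n j) \<xi>) \<partial>white_noise)
      = of_real (exp (- ((\<integral>w. (\<Sum>j\<in>J. c j * Y (q (n j)) w)\<^sup>2 \<partial>M) / 2)))"
    if J: "finite J" for J :: "'i set" and c n
  proof -
    obtain h where h: "bij_betw h {0..<card J} J" using ex_bij_betw_nat_finite[OF J] by blast
    have "(\<Sum>j\<in>J. F j) = (\<Sum>i\<in>{0..<card J}. F (h i))" for F :: "'i \<Rightarrow> real"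
      using sum.reindex_bij_betw[OF h, of F] by simp
    then show ?thesis using Gc'[rule_format, of "{0..<card J}" "\<lambda>i. c (h i)" "\<lambda>i. n (h i)"] by simp
  qed
  define nk where "nk k u = (LEAST n. ?d n u < (1/4) ^ k)" for k u
  have nk: "?d (nk k u) u < (1/4) ^ k" if "u \<in> space R" for k u
    unfolding nk_def by (rule LeastI_ex) (use dense[OF that, of "(1/4)^k"] in auto)
  have nk_meas [measurable]: "nk k \<in> measurable R (count_space UNIV)" for k
    unfolding nk_def by measurable
  \<comment> \<open>On divergent sequences \<open>lim\<close> has an arbitrary value; measurability
    holds nevertheless, and for each \<open>u\<close> divergence has probability zero.\<close>
  define Z where "Z u \<xi> = lim (\<lambda>k. G (nk k u) \<xi>)" for u \<xi>
  have "(\<lambda>x. G (nk k (snd x)) (fst x)) \<in> borel_measurable (white_noise \<Otimes>\<^sub>M R)" for k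
    by (rule measurable_compose_countable[where f = "\<lambda>n x. G n (fst x)" and g = "\<lambda>x. nk k (snd x)"]) measurable
  then have Zm: "(\<lambda>(\<xi>, u). Z u \<xi>) \<in> borel_measurable (white_noise \<Otimes>\<^sub>M R)"
    unfolding Z_def split_beta' by (rule borel_measurable_lim_metric[where f = "\<lambda>k x. G (nk k (snd x)) (fst x)"])
  have conv: "AE \<xi> in white_noise. (\<lambda>k. G (nk k u) \<xi>) \<longlonglongrightarrow> Z u \<xi>" if u: "u \<in> space R" for u
  proof -
    define D where "D k \<xi> = G (nk (Suc k) u) \<xi> - G (nk k u) \<xi>" for k \<xi>
    have Dm [measurable]: "D k \<in> borel_measurable white_noise" for k unfolding D_def[abs_def] by measurable
    have D2: "integrable white_noise (\<lambda>\<xi>. (D k \<xi>)\<^sup>2)" "(\<integral>\<xi>. (D k \<xi>)\<^sup>2 \<partial>white_noise) \<le> 4 * (1/4) ^ k" for k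
    proof -
      define s where "s = (\<integral>w. (Y (q (nk (Suc k) u)) w - Y (q (nk k u)) w)\<^sup>2 \<partial>M)"
      \<comment> \<open>The two indices may coincide, so the increment is written as a sum over the
        Booleans rather than over a set of indices.\<close>
      have ch: "(\<integral>\<xi>. iexp (t * D k \<xi>) \<partial>white_noise) = of_real (exp (- (t\<^sup>2 * s / 2)))" for t
      proof -
        have "(\<integral>\<xi>. iexp (t * D k \<xi>) \<partial>white_noise)
          = (\<integral>\<xi>. iexp (\<Sum>b\<in>UNIV. (if b then t else - t) * G (if b then nk (Suc k) u else nk k u) \<xi>) \<partial>white_noise)"
          by (simp add: UNIV_bool D_def algebra_simps)
        also have "\<dots> = of_real (exp (- ((\<integral>w. (\<Sum>b\<in>UNIV. (if b then t else - t) * Y (q (if b then nk (Suc k) u else nk k u)) w)\<^sup>2 \<partial>M) / 2)))"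
          by (rule Gc) simp
        also have "(\<lambda>w. (\<Sum>b\<in>UNIV. (if b then t else - t) * Y (q (if b then nk (Suc k) u else nk k u)) w)\<^sup>2)
          = (\<lambda>w. t\<^sup>2 * (Y (q (nk (Suc k) u)) w - Y (q (nk k u)) w)\<^sup>2)"
          by (rule ext) (simp add: UNIV_bool power2_eq_square algebra_simps)
        finally show ?thesis by (simp add: s_def)
      qed
      have s0: "0 \<le> s" unfolding s_def by simp
      note N = white_noise.normal_rv_if_char[OF Dm s0 ch]
      show "integrable white_noise (\<lambda>\<xi>. (D k \<xi>)\<^sup>2)" by (rule N(4))
      let ?a = "\<lambda>w. Y (q (nk (Suc k) u)) w - Y u w" and ?b = "\<lambda>w. Y (q (nk k u)) w - Y u w"
      have i: "integrable M (\<lambda>w. (?a w)\<^sup>2)" "integrable M (\<lambda>w. (?b w)\<^sup>2)"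
        "integrable M (\<lambda>w. (Y (q (nk (Suc k) u)) w - Y (q (nk k u)) w)\<^sup>2)"
        using u q by (intro L2_square L2_diff Y; simp)+
      have "(x - y)\<^sup>2 \<le> 2 * (x - z)\<^sup>2 + 2 * (y - z)\<^sup>2" for x y z :: real
        using zero_le_power2[of "x + y - 2 * z"] by (simp add: power2_eq_square algebra_simps)
      then have "s \<le> (\<integral>w. 2 * (?a w)\<^sup>2 + 2 * (?b w)\<^sup>2 \<partial>M)"
        unfolding s_def using i by (intro integral_mono) auto
      also have "\<dots> = 2 * ?d (nk (Suc k) u) u + 2 * ?d (nk k u) u" using i by simp
      also have "\<dots> \<le> 2 * (1/4) ^ Suc k + 2 * (1/4) ^ k"
        using nk[OF u, of k] nk[OF u, of "Suc k"] by (intro add_mono mult_left_mono less_imp_le) auto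
      also have "\<dots> \<le> 4 * (1/4) ^ k" by simp
      finally show "(\<integral>\<xi>. (D k \<xi>)\<^sup>2 \<partial>white_noise) \<le> 4 * (1/4) ^ k" using N(3) by simp
    qed
    have D1: "(\<integral>\<^sup>+\<xi>. ennreal \<bar>D k \<xi>\<bar> \<partial>white_noise) \<le> ennreal (5 * (1/2) ^ k)" for k
    proof -
      \<comment> \<open>Turns the bound \<open>4 * (1/4) ^ k\<close> on second moments into the
        summable bound \<open>5 * (1/2) ^ k\<close> on first absolute moments.\<close>
      have pt: "\<bar>x\<bar> \<le> 2 ^ k * x\<^sup>2 + (1/2) ^ k" for x :: real
      proof (cases "\<bar>x\<bar> \<le> (1/2) ^ k")
        case False
        then have "(1/2) ^ k * \<bar>x\<bar> \<le> \<bar>x\<bar> * \<bar>x\<bar>" by (intro mult_right_mono) auto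
        then have "2 ^ k * ((1/2) ^ k * \<bar>x\<bar>) \<le> 2 ^ k * (\<bar>x\<bar> * \<bar>x\<bar>)" by (intro mult_left_mono) auto
        then have "\<bar>x\<bar> \<le> 2 ^ k * x\<^sup>2" by (simp add: power2_eq_square power_one_over)
        then show ?thesis by (simp add: add_increasing2)
      qed (simp add: add_increasing)
      have "(\<integral>\<^sup>+\<xi>. ennreal \<bar>D k \<xi>\<bar> \<partial>white_noise) \<le> (\<integral>\<^sup>+\<xi>. ennreal (2 ^ k * (D k \<xi>)\<^sup>2 + (1/2) ^ k) \<partial>white_noise)"
        using pt by (intro nn_integral_mono ennreal_leI)
      also have "\<dots> = ennreal (\<integral>\<xi>. 2 ^ k * (D k \<xi>)\<^sup>2 + (1/2) ^ k \<partial>white_noise)"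
        using D2(1) by (intro nn_integral_eq_integral) auto
      also have "(\<integral>\<xi>. 2 ^ k * (D k \<xi>)\<^sup>2 + (1/2) ^ k \<partial>white_noise) = 2 ^ k * (\<integral>\<xi>. (D k \<xi>)\<^sup>2 \<partial>white_noise) + (1/2) ^ k"
        using D2(1) by (simp add: white_noise.prob_space)
      also have "ennreal \<dots> \<le> ennreal (2 ^ k * (4 * (1/4) ^ k) + (1/2) ^ k)"
        using D2(2) by (intro ennreal_leI add_mono mult_left_mono) auto
      also have "2 ^ k * (4 * (1/4) ^ k) + (1/2) ^ k = 5 * (1/2 :: real) ^ k"
        by (simp add: power_mult_distrib[symmetric] flip: power_mult_distrib)
      finally show ?thesis .
    qed
    have "(\<integral>\<^sup>+\<xi>. (\<Sum>k. ennreal \<bar>D k \<xi>\<bar>) \<partial>white_noise) = (\<Sum>k. \<integral>\<^sup>+\<xi>. ennreal \<bar>D k \<xi>\<bar> \<partial>white_noise)"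
      by (rule nn_integral_suminf) measurable
    also have "\<dots> \<le> (\<Sum>k. ennreal (5 * (1/2) ^ k))" using D1 by (intro suminf_le) auto
    also have "\<dots> < \<infinity>"
      by (subst suminf_ennreal2) (auto intro!: summable_mult summable_geometric)
    finally have "AE \<xi> in white_noise. (\<Sum>k. ennreal \<bar>D k \<xi>\<bar>) \<noteq> \<infinity>"
      by (intro nn_integral_PInf_AE) auto
    then show ?thesis
    proof eventually_elim
      case (elim \<xi>)
      then have "summable (\<lambda>k. \<bar>D k \<xi>\<bar>)" by (intro summable_suminf_not_top) auto
      then have "summable (\<lambda>k. D k \<xi>)" by (rule summable_rabs_cancel)
      then have "(\<lambda>m. \<Sum>k<m. D k \<xi>) \<longlonglongrightarrow> (\<Sum>k. D k \<xi>)" by (rule summable_LIMSEQ)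
      then have "(\<lambda>m. G (nk 0 u) \<xi> + (\<Sum>k<m. D k \<xi>)) \<longlonglongrightarrow> G (nk 0 u) \<xi> + (\<Sum>k. D k \<xi>)"
        by (intro tendsto_intros)
      moreover have "G (nk 0 u) \<xi> + (\<Sum>k<m. D k \<xi>) = G (nk m u) \<xi>" for m
        unfolding D_def using sum_lessThan_telescope[of "\<lambda>k. G (nk k u) \<xi>" m] by simp
      ultimately have "convergent (\<lambda>k. G (nk k u) \<xi>)" by (auto simp: convergent_def)
      then show ?case unfolding Z_def by (simp add: convergent_LIMSEQ_iff)
    qed
  qed
  \<comment> \<open>Both sides are limits of the characteristic functions at the approximating
    indices: the left one by dominated convergence, the right one because the second moments
    converge.\<close>
  have "(\<integral>\<xi>. iexp (\<Sum>u\<in>J. c u * Z u \<xi>) \<partial>white_noise) = of_real (exp (- ((\<integral>w. (\<Sum>u\<in>J. c u * Y u w)\<^sup>2 \<partial>M) / 2)))"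
    if J: "finite J" "J \<subseteq> space R" for J c
  proof (rule LIMSEQ_unique)
    have Zu [measurable]: "Z u \<in> borel_measurable white_noise" if "u \<in> J" for u
      using measurable_compose[OF measurable_Pair2' Zm, of u] that J by auto
    show "(\<lambda>k. \<integral>\<xi>. iexp (\<Sum>u\<in>J. c u * G (nk k u) \<xi>) \<partial>white_noise) \<longlonglongrightarrow> (\<integral>\<xi>. iexp (\<Sum>u\<in>J. c u * Z u \<xi>) \<partial>white_noise)"
    proof (rule integral_dominated_convergence[where w = "\<lambda>_. 1"])
      have "AE \<xi> in white_noise. \<forall>u\<in>J. (\<lambda>k. G (nk k u) \<xi>) \<longlonglongrightarrow> Z u \<xi>"
        using J conv by (intro AE_finite_allI) auto
      then show "AE \<xi> in white_noise. (\<lambda>k. iexp (\<Sum>u\<in>J. c u * G (nk k u) \<xi>)) \<longlonglongrightarrow> iexp (\<Sum>u\<in>J. c u * Z u \<xi>)"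
        by eventually_elim (auto intro!: tendsto_exp tendsto_mult tendsto_of_real tendsto_sum tendsto_const)
      show "(\<lambda>\<xi>. iexp (\<Sum>u\<in>J. c u * Z u \<xi>)) \<in> borel_measurable white_noise" by measurable
      show "(\<lambda>\<xi>. iexp (\<Sum>u\<in>J. c u * G (nk k u) \<xi>)) \<in> borel_measurable white_noise" for k by measurable
    qed auto
    have "(\<lambda>k. \<integral>w. (\<Sum>u\<in>J. c u * Y (q (nk k u)) w)\<^sup>2 \<partial>M) \<longlonglongrightarrow> (\<integral>w. (\<Sum>u\<in>J. c u * Y u w)\<^sup>2 \<partial>M)"
    proof (rule L2_square_tendsto)
      show "L2 M (\<lambda>w. \<Sum>u\<in>J. c u * Y (q (nk k u)) w)" for k using q by (intro L2_sum L2_scale Y) auto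
      show "L2 M (\<lambda>w. \<Sum>u\<in>J. c u * Y u w)" using J by (intro L2_sum L2_scale Y) auto
      have L: "L2 M (\<lambda>w. Y (q n) w - Y u w)" if "u \<in> J" for u n using that J q by (intro L2_diff Y) auto
      have bound: "(\<integral>w. ((\<Sum>u\<in>J. c u * Y (q (nk k u)) w) - (\<Sum>u\<in>J. c u * Y u w))\<^sup>2 \<partial>M)
        \<le> (\<Sum>u\<in>J. (c u)\<^sup>2 * (1/4) ^ k) * card J" for k
      proof -
        have "(\<integral>w. ((\<Sum>u\<in>J. c u * Y (q (nk k u)) w) - (\<Sum>u\<in>J. c u * Y u w))\<^sup>2 \<partial>M)
          \<le> (\<integral>w. (\<Sum>u\<in>J. (c u)\<^sup>2 * (Y (q (nk k u)) w - Y u w)\<^sup>2) * card J \<partial>M)"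
        proof (rule integral_mono)
          show "integrable M (\<lambda>w. ((\<Sum>u\<in>J. c u * Y (q (nk k u)) w) - (\<Sum>u\<in>J. c u * Y u w))\<^sup>2)"
            using J q by (intro L2_square L2_diff L2_sum L2_scale Y) auto
          show "integrable M (\<lambda>w. (\<Sum>u\<in>J. (c u)\<^sup>2 * (Y (q (nk k u)) w - Y u w)\<^sup>2) * card J)"
            using L2_square[OF L] by (intro integrable_mult_left Bochner_Integration.integrable_sum integrable_mult_right) auto
          fix w
          show "((\<Sum>u\<in>J. c u * Y (q (nk k u)) w) - (\<Sum>u\<in>J. c u * Y u w))\<^sup>2 \<le> (\<Sum>u\<in>J. (c u)\<^sup>2 * (Y (q (nk k u)) w - Y u w)\<^sup>2) * card J"
            using sum_squared_le_sum_of_squares[of "\<lambda>u. c u * (Y (q (nk k u)) w - Y u w)" J]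
            by (simp add: right_diff_distrib sum_subtractf flip: power_mult_distrib)
        qed
        also have "\<dots> = (\<Sum>u\<in>J. (c u)\<^sup>2 * ?d (nk k u) u) * card J"
          using L2_square[OF L] by (simp add: Bochner_Integration.integral_sum)
        also have "\<dots> \<le> (\<Sum>u\<in>J. (c u)\<^sup>2 * (1/4) ^ k) * card J"
          using J by (intro mult_right_mono sum_mono mult_left_mono less_imp_le[OF nk]) auto
        finally show ?thesis .
      qed
      have l: "(\<lambda>k. (\<Sum>u\<in>J. (c u)\<^sup>2 * (1/4) ^ k) * card J) \<longlonglongrightarrow> (\<Sum>u\<in>J. (c u)\<^sup>2 * 0) * card J"
        by (intro tendsto_intros LIMSEQ_power_zero) auto
      show "(\<lambda>k. \<integral>w. ((\<Sum>u\<in>J. c u * Y (q (nk k u)) w) - (\<Sum>u\<in>J. c u * Y u w))\<^sup>2 \<partial>M) \<longlonglongrightarrow> 0"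
        by (rule tendsto_sandwich[OF _ _ tendsto_const l[simplified]]) (use bound in \<open>auto intro!: always_eventually\<close>)
    qed
    then show "(\<lambda>k. \<integral>\<xi>. iexp (\<Sum>u\<in>J. c u * G (nk k u) \<xi>) \<partial>white_noise) \<longlonglongrightarrow> of_real (exp (- ((\<integral>w. (\<Sum>u\<in>J. c u * Y u w)\<^sup>2 \<partial>M) / 2)))"
      unfolding Gc[OF J(1)] by (intro tendsto_intros) auto
  qed
  with Zm show ?thesis by blast
qed

section \<open>Measurable bounds for differentiable parametric functions\<close>

lemma differentiable_gradient:
  fixes f :: "real ^ 'n::finite \<Rightarrow> real"
  assumes f: "f differentiable (at \<theta>)"
  shows "(f has_derivative (\<lambda>h. gradient f \<theta> \<bullet> h)) (at \<theta>)"
    and "((\<lambda>s. f (\<theta> + s *\<^sub>R axis k 1)) has_real_derivative pdiff k f \<theta>) (at 0)"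
proof -
  obtain f' where f': "(f has_derivative f') (at \<theta>)" using f by (auto simp: differentiable_def)
  have lin: "linear f'" using f' by (rule has_derivative_linear)
  have dk: "((\<lambda>s. f (\<theta> + s *\<^sub>R axis k 1)) has_real_derivative f' (axis k 1)) (at 0)" for k
  proof -
    have "((\<lambda>s. \<theta> + s *\<^sub>R axis k 1) has_derivative (\<lambda>s. s *\<^sub>R axis k 1)) (at (0::real))"
      by (auto intro!: derivative_eq_intros)
    moreover have "(f has_derivative f') (at (\<theta> + 0 *\<^sub>R axis k 1))" using f' by simp
    ultimately have "((\<lambda>s. f (\<theta> + s *\<^sub>R axis k 1)) has_derivative (\<lambda>s. f' (s *\<^sub>R axis k 1))) (at 0)"
      by (rule has_derivative_compose)
    then show ?thesis
      by (simp add: has_field_derivative_def linear_scale[OF lin] mult_commute_abs)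
  qed
  then have p: "pdiff k f \<theta> = f' (axis k 1)" for k
    unfolding pdiff_def by (rule DERIV_imp_deriv)
  then show "((\<lambda>s. f (\<theta> + s *\<^sub>R axis k 1)) has_real_derivative pdiff k f \<theta>) (at 0)" using dk by simp
  have "f' h = gradient f \<theta> \<bullet> h" for h
  proof -
    have "f' h = f' (\<Sum>k\<in>UNIV. (h $ k) *\<^sub>R axis k 1)"
      using basis_expansion[of h] by (simp add: scalar_mult_eq_scaleR)
    also have "\<dots> = (\<Sum>k\<in>UNIV. (h $ k) * f' (axis k 1))"
      by (simp add: linear_sum[OF lin] linear_scale[OF lin])
    also have "\<dots> = gradient f \<theta> \<bullet> h"
      by (simp add: inner_vec_def gradient_def p mult.commute)
    finally show ?thesis .
  qed
  then have "f' = (\<lambda>h. gradient f \<theta> \<bullet> h)" by auto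
  with f' show "(f has_derivative (\<lambda>h. gradient f \<theta> \<bullet> h)) (at \<theta>)" by simp
qed

text \<open>A version of the partial derivative that is measurable in any further argument of \<open>f\<close>.\<close>

definition seq_pdiff :: "'n::finite \<Rightarrow> (real ^ 'n \<Rightarrow> real) \<Rightarrow> real ^ 'n \<Rightarrow> real" where
  "seq_pdiff k f \<theta> = lim (\<lambda>n. (f (\<theta> + (1 / real (Suc n)) *\<^sub>R axis k 1) - f \<theta>) * real (Suc n))"

definition seq_gradient :: "(real ^ 'n::finite \<Rightarrow> real) \<Rightarrow> real ^ 'n \<Rightarrow> real ^ 'n" where
  "seq_gradient f \<theta> = (\<chi> k. seq_pdiff k f \<theta>)"

lemma seq_pdiff_eq:
  assumes "f differentiable (at \<theta>)"
  shows "seq_pdiff k f \<theta> = pdiff k f \<theta>"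
proof -
  have "((\<lambda>s. (f (\<theta> + (0 + s) *\<^sub>R axis k 1) - f (\<theta> + 0 *\<^sub>R axis k 1)) / s) \<longlongrightarrow> pdiff k f \<theta>) (at 0)"
    using differentiable_gradient(2)[OF assms, of k] unfolding DERIV_def by simp
  moreover have "filterlim (\<lambda>n. 1 / real (Suc n)) (at 0) sequentially"
    unfolding filterlim_at by (intro conjI LIMSEQ_Suc[OF lim_1_over_n] always_eventually) auto
  ultimately have "(\<lambda>n. (f (\<theta> + (0 + 1 / real (Suc n)) *\<^sub>R axis k 1) - f (\<theta> + 0 *\<^sub>R axis k 1)) / (1 / real (Suc n))) \<longlonglongrightarrow> pdiff k f \<theta>"
    by (rule filterlim_compose)
  then show ?thesis unfolding seq_pdiff_def by (intro limI) simp
qed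

lemma seq_gradient_eq: "f differentiable (at \<theta>) \<Longrightarrow> seq_gradient f \<theta> = gradient f \<theta>"
  by (simp add: seq_gradient_def gradient_def seq_pdiff_eq)

lemma seq_pdiff_measurable:
  assumes "\<And>\<theta>. (\<lambda>w. f \<theta> w) \<in> borel_measurable M"
  shows "(\<lambda>w. seq_pdiff k (\<lambda>\<theta>. f \<theta> w) \<theta>) \<in> borel_measurable M"
  unfolding seq_pdiff_def using assms by (intro borel_measurable_lim_metric borel_measurable_times borel_measurable_diff) auto

lemma vec_lambda_measurable:
  fixes g :: "'n::finite \<Rightarrow> 'a \<Rightarrow> real"
  assumes "\<And>k. g k \<in> borel_measurable M"
  shows "(\<lambda>w. \<chi> k. g k w) \<in> borel_measurable M"
proof (rule borel_measurable_euclidean_space[THEN iffD2], rule ballI)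
  fix i :: "real ^ 'n" assume "i \<in> Basis"
  then obtain k where "i = axis k 1" by (auto simp: Basis_vec_def)
  then show "(\<lambda>w. (\<chi> k. g k w) \<bullet> i) \<in> borel_measurable M" using assms[of k] by (simp add: inner_axis)
qed

lemma seq_gradient_measurable:
  assumes "\<And>\<theta>. (\<lambda>w. f \<theta> w) \<in> borel_measurable M"
  shows "(\<lambda>w. seq_gradient (\<lambda>\<theta>. f \<theta> w) \<theta>) \<in> borel_measurable M"
  unfolding seq_gradient_def by (intro vec_lambda_measurable seq_pdiff_measurable assms)

text \<open>A continuous function exceeding the countable supremum somewhere would exceed it on a
  nonempty open set, and this set contains a point of \<open>D\<close>.\<close>

lemma SUP_dense:
  fixes \<phi> :: "'a::metric_space \<Rightarrow> real"
  assumes W: "open W" and \<phi>: "continuous_on W \<phi>"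
    and D: "\<And>V. open V \<Longrightarrow> V \<noteq> {} \<Longrightarrow> \<exists>d\<in>D. d \<in> V"
  shows "(SUP \<theta>\<in>D \<inter> W. ennreal (\<phi> \<theta>)) = (SUP \<theta>\<in>W. ennreal (\<phi> \<theta>))"
proof (rule antisym)
  show "(SUP \<theta>\<in>D \<inter> W. ennreal (\<phi> \<theta>)) \<le> (SUP \<theta>\<in>W. ennreal (\<phi> \<theta>))"
    by (rule SUP_subset_mono) auto
  show "(SUP \<theta>\<in>W. ennreal (\<phi> \<theta>)) \<le> (SUP \<theta>\<in>D \<inter> W. ennreal (\<phi> \<theta>))" (is "_ \<le> ?S")
  proof (rule SUP_least, rule ccontr)
    fix \<theta> assume \<theta>: "\<theta> \<in> W" and "\<not> ennreal (\<phi> \<theta>) \<le> ?S"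
    then have lt: "?S < ennreal (\<phi> \<theta>)" by simp
    have "open {y::real. ?S < ennreal y}"
      by (rule open_Collect_less) (auto intro!: continuous_intros continuous_on_ennreal)
    then have "open (W \<inter> \<phi> -` {y. ?S < ennreal y})" by (rule continuous_open_preimage[OF \<phi> W])
    then obtain d where "d \<in> D" "d \<in> W \<inter> \<phi> -` {y. ?S < ennreal y}"
      using D[of "W \<inter> \<phi> -` {y. ?S < ennreal y}"] \<theta> lt by auto
    then have "ennreal (\<phi> d) \<le> ?S" "?S < ennreal (\<phi> d)" by (auto intro: SUP_upper)
    then show False by simp
  qed
qed

lemma countable_dense_exists_vec:
  "\<exists>D::(real ^ 'n::finite) set. countable D \<and> (\<forall>V. open V \<longrightarrow> V \<noteq> {} \<longrightarrow> (\<exists>d\<in>D. d \<in> V))"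
  using countable_dense_exists[where 'a = "real ^ 'n"] by blast

definition gradient_bound :: "(real ^ 'n) set \<Rightarrow> (real ^ 'n) set \<Rightarrow> (real ^ 'n::finite \<Rightarrow> real) \<Rightarrow> ennreal" where
  "gradient_bound D U f = (\<Sum>k\<in>UNIV. SUP \<theta>\<in>D \<inter> U. ennreal ((seq_pdiff k f \<theta>)\<^sup>2))"

text \<open>The squared defect of differentiability at \<open>\<theta>0\<close>, relative to the
  distance. The square matches the second-moment hypotheses; \<open>seq_gradient\<close> and a
  countable \<open>D\<close> make it measurable in any further argument of \<open>f\<close>.\<close>

definition taylor_remainder ::
  "(real ^ 'n) set \<Rightarrow> real ^ 'n \<Rightarrow> real \<Rightarrow> (real ^ 'n::finite \<Rightarrow> real) \<Rightarrow> ennreal" where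
  "taylor_remainder D \<theta>0 \<delta> f = (SUP \<theta>\<in>D \<inter> (ball \<theta>0 \<delta> - {\<theta>0}).
     ennreal (((f \<theta> - f \<theta>0 - seq_gradient f \<theta>0 \<bullet> (\<theta> - \<theta>0)) / norm (\<theta> - \<theta>0))\<^sup>2))"

lemma gradient_bound_measurable:
  assumes "countable D" "\<And>\<theta>. (\<lambda>w. f \<theta> w) \<in> borel_measurable M"
  shows "(\<lambda>w. gradient_bound D U (\<lambda>\<theta>. f \<theta> w)) \<in> borel_measurable M"
  unfolding gradient_bound_def
  by (intro borel_measurable_sum borel_measurable_SUP countable_Int1 assms(1)
      measurable_compose[OF _ measurable_ennreal] borel_measurable_power seq_pdiff_measurable assms(2))

lemma taylor_remainder_measurable:
  assumes "countable D" "\<And>\<theta>. (\<lambda>w. f \<theta> w) \<in> borel_measurable M"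
  shows "(\<lambda>w. taylor_remainder D \<theta>0 \<delta> (\<lambda>\<theta>. f \<theta> w)) \<in> borel_measurable M"
  unfolding taylor_remainder_def
  by (intro borel_measurable_SUP countable_Int1 assms(1)
      measurable_compose[OF _ measurable_ennreal] borel_measurable_power borel_measurable_divide borel_measurable_diff
      borel_measurable_inner borel_measurable_const seq_gradient_measurable assms(2))

text \<open>\<open>U\<close> is the set on which the derivatives are bounded, and the ball inside it
  is the convex set to which the mean value theorem is applied; \<open>D\<close> is the dense set
  over which suprema are taken.\<close>

locale C1_function =
  fixes f :: "real ^ 'n::finite \<Rightarrow> real" and U D :: "(real ^ 'n) set" and \<theta>0 :: "real ^ 'n" and r :: real
  assumes U: "open U" and ball: "ball \<theta>0 r \<subseteq> U" and r: "0 < r"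
    and diff: "\<And>\<theta>. \<theta> \<in> U \<Longrightarrow> f differentiable (at \<theta>)"
    and cont: "\<And>k. continuous_on U (pdiff k f)"
    and D: "\<And>V. open V \<Longrightarrow> V \<noteq> {} \<Longrightarrow> \<exists>d\<in>D. d \<in> V"
begin

lemma \<theta>0_in: "\<theta>0 \<in> U" using ball r by auto

lemma SUP_seq_pdiff:
  "(SUP \<theta>\<in>D \<inter> U. ennreal ((seq_pdiff k f \<theta>)\<^sup>2)) = (SUP \<theta>\<in>U. ennreal ((pdiff k f \<theta>)\<^sup>2))"
proof -
  have "(SUP \<theta>\<in>D \<inter> U. ennreal ((seq_pdiff k f \<theta>)\<^sup>2)) = (SUP \<theta>\<in>D \<inter> U. ennreal ((pdiff k f \<theta>)\<^sup>2))"
    by (intro SUP_cong) (auto simp: seq_pdiff_eq diff)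
  also have "\<dots> = (SUP \<theta>\<in>U. ennreal ((pdiff k f \<theta>)\<^sup>2))"
    by (intro SUP_dense U D continuous_on_power cont)
  finally show ?thesis .
qed

lemma norm_gradient_le:
  assumes "\<theta> \<in> U"
  shows "ennreal ((norm (gradient f \<theta>))\<^sup>2) \<le> gradient_bound D U f"
proof -
  have "(norm (gradient f \<theta>))\<^sup>2 = (\<Sum>k\<in>UNIV. (pdiff k f \<theta>)\<^sup>2)"
    by (simp add: norm_vec_def L2_set_def gradient_def sum_nonneg)
  then have "ennreal ((norm (gradient f \<theta>))\<^sup>2) = (\<Sum>k\<in>UNIV. ennreal ((pdiff k f \<theta>)\<^sup>2))"
    by (simp add: sum_ennreal)
  also have "\<dots> \<le> (\<Sum>k\<in>UNIV. SUP \<theta>\<in>U. ennreal ((pdiff k f \<theta>)\<^sup>2))"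
    using assms by (intro sum_mono SUP_upper)
  finally show ?thesis by (simp add: gradient_bound_def SUP_seq_pdiff)
qed

lemma lipschitz:
  assumes fin: "gradient_bound D U f < \<infinity>" and \<theta>: "\<theta> \<in> ball \<theta>0 r"
  shows "(f \<theta> - f \<theta>0)\<^sup>2 \<le> enn2real (gradient_bound D U f) * (norm (\<theta> - \<theta>0))\<^sup>2"
proof -
  let ?B = "enn2real (gradient_bound D U f)"
  have "norm (f \<theta> - f \<theta>0) \<le> sqrt ?B * norm (\<theta> - \<theta>0)"
  proof (rule differentiable_bound)
    show "convex (ball \<theta>0 r)" by simp
    show "\<theta> \<in> ball \<theta>0 r" by fact
    show "\<theta>0 \<in> ball \<theta>0 r" using r by simp
    fix x assume "x \<in> ball \<theta>0 r"
    then have x: "x \<in> U" using ball by auto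
    show "(f has_derivative (\<lambda>h. gradient f x \<bullet> h)) (at x within ball \<theta>0 r)"
      using differentiable_gradient(1)[OF diff[OF x]] by (rule has_derivative_at_withinI)
    have "(norm (gradient f x))\<^sup>2 \<le> ?B"
      using norm_gradient_le[OF x] fin
      by (metis enn2real_ennreal enn2real_mono zero_le_power2 infinity_ennreal_def)
    then have "norm (gradient f x) \<le> sqrt ?B" by (rule real_le_rsqrt)
    then show "onorm (\<lambda>h. gradient f x \<bullet> h) \<le> sqrt ?B"
      by (intro onorm_bound) (auto intro!: order_trans[OF Cauchy_Schwarz_ineq2] mult_right_mono)
  qed
  then have "\<bar>f \<theta> - f \<theta>0\<bar> \<le> \<bar>sqrt ?B * norm (\<theta> - \<theta>0)\<bar>" by simp
  then have "(f \<theta> - f \<theta>0)\<^sup>2 \<le> (sqrt ?B * norm (\<theta> - \<theta>0))\<^sup>2" by (simp only: abs_le_square_iff)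
  then show ?thesis by (simp add: power_mult_distrib)
qed

lemma taylor_remainder_eq:
  assumes \<delta>: "\<delta> \<le> r"
  shows "taylor_remainder D \<theta>0 \<delta> f = (SUP \<theta>\<in>ball \<theta>0 \<delta> - {\<theta>0}.
     ennreal (((f \<theta> - f \<theta>0 - gradient f \<theta>0 \<bullet> (\<theta> - \<theta>0)) / norm (\<theta> - \<theta>0))\<^sup>2))"
  unfolding taylor_remainder_def seq_gradient_eq[OF diff[OF \<theta>0_in]]
proof (rule SUP_dense)
  have "continuous_on U f"
    using diff by (intro continuous_at_imp_continuous_on ballI differentiable_imp_continuous_within)
  then have "continuous_on (ball \<theta>0 \<delta> - {\<theta>0}) f"
    by (rule continuous_on_subset) (use ball subset_ball[OF \<delta>, of \<theta>0] in blast)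
  then show "continuous_on (ball \<theta>0 \<delta> - {\<theta>0})
     (\<lambda>\<theta>. ((f \<theta> - f \<theta>0 - gradient f \<theta>0 \<bullet> (\<theta> - \<theta>0)) / norm (\<theta> - \<theta>0))\<^sup>2)"
    by (intro continuous_intros) auto
qed (use D in auto)

lemma taylor_remainder_bound:
  assumes \<delta>: "\<delta> \<le> r" and \<theta>: "\<theta> \<in> ball \<theta>0 \<delta>" and fin: "taylor_remainder D \<theta>0 \<delta> f < \<infinity>"
  shows "(f \<theta> - f \<theta>0 - gradient f \<theta>0 \<bullet> (\<theta> - \<theta>0))\<^sup>2 \<le> enn2real (taylor_remainder D \<theta>0 \<delta> f) * (norm (\<theta> - \<theta>0))\<^sup>2"
proof (cases "\<theta> = \<theta>0")
  case False
  have "ennreal (((f \<theta> - f \<theta>0 - gradient f \<theta>0 \<bullet> (\<theta> - \<theta>0)) / norm (\<theta> - \<theta>0))\<^sup>2) \<le> taylor_remainder D \<theta>0 \<delta> f"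
    unfolding taylor_remainder_eq[OF \<delta>] using \<theta> False by (intro SUP_upper) auto
  then have "((f \<theta> - f \<theta>0 - gradient f \<theta>0 \<bullet> (\<theta> - \<theta>0)) / norm (\<theta> - \<theta>0))\<^sup>2 \<le> enn2real (taylor_remainder D \<theta>0 \<delta> f)"
    using fin by (metis enn2real_ennreal enn2real_mono zero_le_power2 infinity_ennreal_def)
  then show ?thesis using False by (simp add: power_divide pos_divide_le_eq)
qed simp

text \<open>Provides the majorant for dominated convergence. Both
  \<open>f \<theta> - f \<theta>0\<close> and the linear term have square at most the gradient bound
  times the squared distance, and \<open>(a - b)^2 \<le> 2 * a^2 + 2 * b^2\<close> gives the factor
  four.\<close>

lemma taylor_remainder_le:
  assumes \<delta>: "\<delta> \<le> r"
  shows "taylor_remainder D \<theta>0 \<delta> f \<le> 4 * gradient_bound D U f"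
proof (cases "gradient_bound D U f < \<infinity>")
  case False
  then have "gradient_bound D U f = \<infinity>" by (simp add: less_top[symmetric])
  then show ?thesis by (simp add: ennreal_mult_top)
next
  case fin: True
  let ?B = "enn2real (gradient_bound D U f)"
  have B: "gradient_bound D U f = ennreal ?B" using fin by simp
  show ?thesis unfolding taylor_remainder_eq[OF \<delta>]
  proof (rule SUP_least)
    fix \<theta> assume "\<theta> \<in> ball \<theta>0 \<delta> - {\<theta>0}"
    then have \<theta>: "\<theta> \<in> ball \<theta>0 r" and ne: "\<theta> \<noteq> \<theta>0" using \<delta> by auto
    have g: "(norm (gradient f \<theta>0))\<^sup>2 \<le> ?B"
      using norm_gradient_le[OF \<theta>0_in] fin
      by (metis enn2real_ennreal enn2real_mono zero_le_power2 infinity_ennreal_def)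
    have "(gradient f \<theta>0 \<bullet> (\<theta> - \<theta>0))\<^sup>2 \<le> (norm (gradient f \<theta>0) * norm (\<theta> - \<theta>0))\<^sup>2"
      using Cauchy_Schwarz_ineq2 by (intro abs_le_square_iff[THEN iffD1]) auto
    also have "\<dots> \<le> ?B * (norm (\<theta> - \<theta>0))\<^sup>2" unfolding power_mult_distrib by (intro mult_right_mono g) auto
    finally have "(gradient f \<theta>0 \<bullet> (\<theta> - \<theta>0))\<^sup>2 \<le> ?B * (norm (\<theta> - \<theta>0))\<^sup>2" .
    moreover have "(a - b)\<^sup>2 \<le> 2 * a\<^sup>2 + 2 * b\<^sup>2" for a b :: real
      using zero_le_power2[of "a + b"] by (simp add: power2_eq_square algebra_simps)
    note this[of "f \<theta> - f \<theta>0" "gradient f \<theta>0 \<bullet> (\<theta> - \<theta>0)"]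
    ultimately have "(f \<theta> - f \<theta>0 - gradient f \<theta>0 \<bullet> (\<theta> - \<theta>0))\<^sup>2 \<le> 4 * (?B * (norm (\<theta> - \<theta>0))\<^sup>2)"
      using lipschitz[OF fin \<theta>] by linarith
    then have "((f \<theta> - f \<theta>0 - gradient f \<theta>0 \<bullet> (\<theta> - \<theta>0)) / norm (\<theta> - \<theta>0))\<^sup>2 \<le> 4 * ?B"
      using ne by (simp add: power_divide pos_divide_le_eq mult.assoc)
    then have "ennreal (((f \<theta> - f \<theta>0 - gradient f \<theta>0 \<bullet> (\<theta> - \<theta>0)) / norm (\<theta> - \<theta>0))\<^sup>2) \<le> ennreal (4 * ?B)"
      by (rule ennreal_leI)
    also have "\<dots> = 4 * gradient_bound D U f" by (subst B) (simp add: ennreal_mult)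
    finally show "ennreal (((f \<theta> - f \<theta>0 - gradient f \<theta>0 \<bullet> (\<theta> - \<theta>0)) / norm (\<theta> - \<theta>0))\<^sup>2) \<le> 4 * gradient_bound D U f" .
  qed
qed

text \<open>Differentiability at \<open>\<theta>0\<close>, rephrased for shrinking radii: within
  distance \<open>d\<close> the quotient is at most \<open>e\<close>.\<close>

lemma taylor_remainder_tendsto:
  assumes \<delta>: "\<delta> \<longlonglongrightarrow> 0"
  shows "(\<lambda>n. taylor_remainder D \<theta>0 (\<delta> n) f) \<longlonglongrightarrow> 0"
proof (rule order_tendstoI)
  fix a :: ennreal assume a: "0 < a"
  obtain e where e: "0 < e" "ennreal (e\<^sup>2) < a"
  proof -
    obtain c where c: "0 < c" "c < a" using dense[OF a] by auto
    then have c': "c < \<infinity>" by (auto simp: less_top[symmetric])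
    have "ennreal ((sqrt (enn2real c))\<^sup>2) = c" using c' by simp
    moreover have "0 < sqrt (enn2real c)" using c c' by (simp add: enn2real_positive_iff less_top)
    ultimately show ?thesis using c(2) by (intro that[of "sqrt (enn2real c)"]) auto
  qed
  have "(f has_derivative (\<lambda>h. gradient f \<theta>0 \<bullet> h)) (at \<theta>0)"
    by (rule differentiable_gradient(1)[OF diff[OF \<theta>0_in]])
  then obtain d where d: "0 < d" "\<And>\<theta>. norm (\<theta> - \<theta>0) < d \<Longrightarrow>
      norm (f \<theta> - f \<theta>0 - gradient f \<theta>0 \<bullet> (\<theta> - \<theta>0)) \<le> e * norm (\<theta> - \<theta>0)"
    using e(1) unfolding has_derivative_at_alt by blast
  have "eventually (\<lambda>n. \<delta> n < min d r) sequentially"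
    using \<delta> d(1) r by (intro order_tendstoD) auto
  then show "eventually (\<lambda>n. taylor_remainder D \<theta>0 (\<delta> n) f < a) sequentially"
  proof eventually_elim
    case (elim n)
    have "taylor_remainder D \<theta>0 (\<delta> n) f \<le> ennreal (e\<^sup>2)"
      unfolding taylor_remainder_eq[OF less_imp_le[OF elim[THEN less_le_trans, OF min.cobounded2]]]
    proof (intro SUP_least ennreal_leI)
      fix \<theta> assume \<theta>: "\<theta> \<in> ball \<theta>0 (\<delta> n) - {\<theta>0}"
      then have "norm (\<theta> - \<theta>0) < d" using elim by (auto simp: dist_norm norm_minus_commute)
      from d(2)[OF this] have "\<bar>(f \<theta> - f \<theta>0 - gradient f \<theta>0 \<bullet> (\<theta> - \<theta>0)) / norm (\<theta> - \<theta>0)\<bar> \<le> \<bar>e\<bar>"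
        using \<theta> e(1) by (simp add: pos_divide_le_eq)
      then show "((f \<theta> - f \<theta>0 - gradient f \<theta>0 \<bullet> (\<theta> - \<theta>0)) / norm (\<theta> - \<theta>0))\<^sup>2 \<le> e\<^sup>2"
        by (simp only: abs_le_square_iff)
    qed
    then show ?case using e(2) by (rule le_less_trans)
  qed
qed simp

end

lemma taylor_remainder_integral_tendsto:
  fixes f :: "real ^ 'n::finite \<Rightarrow> 'a \<Rightarrow> real"
  assumes D: "countable D" and meas: "\<And>\<theta>. (\<lambda>w. f \<theta> w) \<in> borel_measurable M"
    and C1: "AE w in M. C1_function (\<lambda>\<theta>. f \<theta> w) U D \<theta>0 r" and r: "0 < r"
    and fin: "(\<integral>\<^sup>+w. gradient_bound D U (\<lambda>\<theta>. f \<theta> w) \<partial>M) < \<infinity>"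
    and \<delta>: "\<delta> \<longlonglongrightarrow> 0" "\<And>n. \<delta> n \<le> r"
  shows "(\<lambda>n. \<integral>\<^sup>+w. taylor_remainder D \<theta>0 (\<delta> n) (\<lambda>\<theta>. f \<theta> w) \<partial>M) \<longlonglongrightarrow> 0"
proof -
  have "(\<lambda>n. \<integral>\<^sup>+w. taylor_remainder D \<theta>0 (\<delta> n) (\<lambda>\<theta>. f \<theta> w) \<partial>M) \<longlonglongrightarrow> (\<integral>\<^sup>+w. 0 \<partial>M)"
  proof (rule nn_integral_dominated_convergence[where w = "\<lambda>w. 4 * gradient_bound D U (\<lambda>\<theta>. f \<theta> w)"])
    show "(\<lambda>w. taylor_remainder D \<theta>0 (\<delta> n) (\<lambda>\<theta>. f \<theta> w)) \<in> borel_measurable M" for n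
      by (rule taylor_remainder_measurable[OF D meas])
    show "(\<lambda>w. 4 * gradient_bound D U (\<lambda>\<theta>. f \<theta> w)) \<in> borel_measurable M"
      using gradient_bound_measurable[OF D meas, of U] by simp
    show "(\<integral>\<^sup>+w. 4 * gradient_bound D U (\<lambda>\<theta>. f \<theta> w) \<partial>M) < \<infinity>"
      using fin gradient_bound_measurable[OF D meas, of U] by (simp add: nn_integral_cmult ennreal_mult_less_top)
    show "AE w in M. taylor_remainder D \<theta>0 (\<delta> n) (\<lambda>\<theta>. f \<theta> w) \<le> 4 * gradient_bound D U (\<lambda>\<theta>. f \<theta> w)" for n
      using C1 by eventually_elim (rule C1_function.taylor_remainder_le[OF _ \<delta>(2)])
    show "AE w in M. (\<lambda>n. taylor_remainder D \<theta>0 (\<delta> n) (\<lambda>\<theta>. f \<theta> w)) \<longlonglongrightarrow> 0"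
      using C1 by eventually_elim (rule C1_function.taylor_remainder_tendsto[OF _ \<delta>(1)])
  qed simp
  then show ?thesis by simp
qed

section \<open>Convergence and boundedness in probability\<close>

definition vanishing :: "'a measure \<Rightarrow> (nat \<Rightarrow> 'a \<Rightarrow> real) \<Rightarrow> bool" where
  "vanishing M X \<longleftrightarrow> (\<forall>T. X T \<in> borel_measurable M) \<and> small_oP M X"

definition bounded_in_prob :: "'a measure \<Rightarrow> (nat \<Rightarrow> 'a \<Rightarrow> real) \<Rightarrow> bool" where
  "bounded_in_prob M X \<longleftrightarrow> (\<forall>T. X T \<in> borel_measurable M) \<and>
     (\<forall>e>0. \<exists>K. eventually (\<lambda>T. measure M {w\<in>space M. K < \<bar>X T w\<bar>} < e) sequentially)"

lemma vanishingD:
  "vanishing M X \<Longrightarrow> X T \<in> borel_measurable M"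
  "vanishing M X \<Longrightarrow> 0 < e \<Longrightarrow> (\<lambda>T. measure M {w\<in>space M. e < \<bar>X T w\<bar>}) \<longlonglongrightarrow> 0"
  by (auto simp: vanishing_def small_oP_def)

context prob_space
begin

lemma vanishingI:
  assumes m: "\<And>T. X T \<in> borel_measurable M"
    and *: "\<And>e h. 0 < e \<Longrightarrow> 0 < h \<Longrightarrow> eventually (\<lambda>T. prob {w\<in>space M. e < \<bar>X T w\<bar>} < h) sequentially"
  shows "vanishing M X"
  unfolding vanishing_def small_oP_def real_norm_def
proof (intro conjI allI impI m)
  fix e :: real assume "0 < e"
  then show "(\<lambda>T. prob {w\<in>space M. e < \<bar>X T w\<bar>}) \<longlonglongrightarrow> 0"
    using * by (intro order_tendstoI) (auto intro!: always_eventually less_le_trans[OF _ measure_nonneg])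
qed

lemma vanishing_eventually:
  "vanishing M X \<Longrightarrow> 0 < e \<Longrightarrow> 0 < h \<Longrightarrow> eventually (\<lambda>T. prob {w\<in>space M. e < \<bar>X T w\<bar>} < h) sequentially"
  using order_tendstoD(2)[OF vanishingD(2)] by blast

lemma bounded_in_probE:
  assumes b: "bounded_in_prob M X" and e: "0 < e"
  obtains K where "0 < K" "eventually (\<lambda>T. prob {w\<in>space M. K < \<bar>X T w\<bar>} < e) sequentially"
proof -
  obtain K where K: "eventually (\<lambda>T. prob {w\<in>space M. K < \<bar>X T w\<bar>} < e) sequentially"
    using b e by (auto simp: bounded_in_prob_def)
  have [measurable]: "X T \<in> borel_measurable M" for T using b by (auto simp: bounded_in_prob_def)
  have "eventually (\<lambda>T. prob {w\<in>space M. max 1 K < \<bar>X T w\<bar>} < e) sequentially"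
    using K
  proof eventually_elim
    case (elim T)
    have "prob {w\<in>space M. max 1 K < \<bar>X T w\<bar>} \<le> prob {w\<in>space M. K < \<bar>X T w\<bar>}"
      by (intro finite_measure_mono) auto
    with elim show ?case by simp
  qed
  then show ?thesis by (rule that[rotated]) simp
qed

lemma vanishing_add:
  assumes X: "vanishing M X" and Y: "vanishing M Y"
  shows "vanishing M (\<lambda>T w. X T w + Y T w)"
proof (rule vanishingI)
  have [measurable]: "X T \<in> borel_measurable M" "Y T \<in> borel_measurable M" for T
    using vanishingD(1)[OF X] vanishingD(1)[OF Y] by auto
  then show "(\<lambda>w. X T w + Y T w) \<in> borel_measurable M" for T by measurable
  fix e h :: real assume eh: "0 < e" "0 < h"
  then have eh2: "0 < e / 2" "0 < h / 2" by auto
  from vanishing_eventually[OF X eh2] vanishing_eventually[OF Y eh2]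
  show "eventually (\<lambda>T. prob {w\<in>space M. e < \<bar>X T w + Y T w\<bar>} < h) sequentially"
  proof eventually_elim
    case (elim T)
    have "prob {w\<in>space M. e < \<bar>X T w + Y T w\<bar>}
      \<le> prob ({w\<in>space M. e/2 < \<bar>X T w\<bar>} \<union> {w\<in>space M. e/2 < \<bar>Y T w\<bar>})"
      by (intro finite_measure_mono) auto
    also have "\<dots> \<le> prob {w\<in>space M. e/2 < \<bar>X T w\<bar>} + prob {w\<in>space M. e/2 < \<bar>Y T w\<bar>}"
      by (intro measure_Un_le) measurable
    finally show ?case using elim by simp
  qed
qed

lemma vanishing_mult:
  assumes X: "vanishing M X" and Y: "bounded_in_prob M Y"
  shows "vanishing M (\<lambda>T w. X T w * Y T w)"
proof (rule vanishingI)
  have [measurable]: "X T \<in> borel_measurable M" "Y T \<in> borel_measurable M" for T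
    using vanishingD(1)[OF X] Y by (auto simp: bounded_in_prob_def)
  then show "(\<lambda>w. X T w * Y T w) \<in> borel_measurable M" for T by measurable
  fix e h :: real assume eh: "0 < e" "0 < h"
  then have h2: "0 < h / 2" by simp
  obtain K where K: "0 < K" and ev: "eventually (\<lambda>T. prob {w\<in>space M. K < \<bar>Y T w\<bar>} < h / 2) sequentially"
    using bounded_in_probE[OF Y h2] by blast
  have "0 < e / K" using eh K by simp
  from vanishing_eventually[OF X this h2] ev
  show "eventually (\<lambda>T. prob {w\<in>space M. e < \<bar>X T w * Y T w\<bar>} < h) sequentially"
  proof eventually_elim
    case (elim T)
    have "prob {w\<in>space M. e < \<bar>X T w * Y T w\<bar>}
      \<le> prob ({w\<in>space M. e / K < \<bar>X T w\<bar>} \<union> {w\<in>space M. K < \<bar>Y T w\<bar>})"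
    proof (intro finite_measure_mono subsetI)
      fix w assume a: "w \<in> {w\<in>space M. e < \<bar>X T w * Y T w\<bar>}"
      show "w \<in> {w\<in>space M. e / K < \<bar>X T w\<bar>} \<union> {w\<in>space M. K < \<bar>Y T w\<bar>}"
      proof (rule ccontr)
        assume "w \<notin> {w\<in>space M. e / K < \<bar>X T w\<bar>} \<union> {w\<in>space M. K < \<bar>Y T w\<bar>}"
        then have "\<bar>X T w\<bar> \<le> e / K" "\<bar>Y T w\<bar> \<le> K" using a by auto
        then have "\<bar>X T w * Y T w\<bar> \<le> e / K * K" unfolding abs_mult using eh K by (intro mult_mono) auto
        then show False using a K by simp
      qed
    qed auto
    also have "\<dots> \<le> prob {w\<in>space M. e / K < \<bar>X T w\<bar>} + prob {w\<in>space M. K < \<bar>Y T w\<bar>}"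
      by (intro measure_Un_le) measurable
    finally show ?case using elim by simp
  qed
qed

lemma vanishing_imp_bounded_in_prob:
  assumes X: "vanishing M X"
  shows "bounded_in_prob M X"
  unfolding bounded_in_prob_def using vanishingD(1)[OF X] vanishing_eventually[OF X, of 1] by auto

lemma bounded_in_prob_mult:
  assumes X: "bounded_in_prob M X" and Y: "bounded_in_prob M Y"
  shows "bounded_in_prob M (\<lambda>T w. X T w * Y T w)"
  unfolding bounded_in_prob_def
proof (intro conjI allI impI)
  have [measurable]: "X T \<in> borel_measurable M" "Y T \<in> borel_measurable M" for T
    using X Y by (auto simp: bounded_in_prob_def)
  then show "(\<lambda>w. X T w * Y T w) \<in> borel_measurable M" for T by measurable
  fix h :: real assume "0 < h"
  then have h2: "0 < h / 2" by simp
  obtain K where K: "0 < K" and ev: "eventually (\<lambda>T. prob {w\<in>space M. K < \<bar>X T w\<bar>} < h / 2) sequentially"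
    using bounded_in_probE[OF X h2] by blast
  obtain L where L: "0 < L" and ev': "eventually (\<lambda>T. prob {w\<in>space M. L < \<bar>Y T w\<bar>} < h / 2) sequentially"
    using bounded_in_probE[OF Y h2] by blast
  from ev ev' have "eventually (\<lambda>T. prob {w\<in>space M. K * L < \<bar>X T w * Y T w\<bar>} < h) sequentially"
  proof eventually_elim
    case (elim T)
    have "prob {w\<in>space M. K * L < \<bar>X T w * Y T w\<bar>}
      \<le> prob ({w\<in>space M. K < \<bar>X T w\<bar>} \<union> {w\<in>space M. L < \<bar>Y T w\<bar>})"
    proof (intro finite_measure_mono subsetI)
      fix w assume a: "w \<in> {w\<in>space M. K * L < \<bar>X T w * Y T w\<bar>}"
      show "w \<in> {w\<in>space M. K < \<bar>X T w\<bar>} \<union> {w\<in>space M. L < \<bar>Y T w\<bar>}"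
      proof (rule ccontr)
        assume "w \<notin> {w\<in>space M. K < \<bar>X T w\<bar>} \<union> {w\<in>space M. L < \<bar>Y T w\<bar>}"
        then have "\<bar>X T w\<bar> \<le> K" "\<bar>Y T w\<bar> \<le> L" using a by auto
        then have "\<bar>X T w * Y T w\<bar> \<le> K * L" unfolding abs_mult using K L by (intro mult_mono) auto
        then show False using a by simp
      qed
    qed auto
    also have "\<dots> \<le> prob {w\<in>space M. K < \<bar>X T w\<bar>} + prob {w\<in>space M. L < \<bar>Y T w\<bar>}"
      by (intro measure_Un_le) measurable
    finally show ?case using elim by simp
  qed
  then show "\<exists>K. eventually (\<lambda>T. prob {w\<in>space M. K < \<bar>X T w * Y T w\<bar>} < h) sequentially" by blast
qed

lemma bounded_in_prob_const: "bounded_in_prob M (\<lambda>T w. c)"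
  unfolding bounded_in_prob_def
proof (intro conjI allI impI)
  fix e :: real assume "0 < e"
  then show "\<exists>K. eventually (\<lambda>T. prob {w\<in>space M. K < \<bar>c\<bar>} < e) sequentially"
    by (intro exI[of _ "\<bar>c\<bar>"]) simp
qed simp

lemma vanishing_const: "c \<longlonglongrightarrow> 0 \<Longrightarrow> vanishing M (\<lambda>T w. c T)"
proof (rule vanishingI)
  fix e h :: real assume c: "c \<longlonglongrightarrow> 0" "0 < e" "0 < h"
  then have "eventually (\<lambda>T. \<bar>c T\<bar> < e) sequentially" by (auto dest!: tendstoD simp: dist_real_def)
  then show "eventually (\<lambda>T. prob {w\<in>space M. e < \<bar>c T\<bar>} < h) sequentially"
    by (rule eventually_mono) (use c in auto)
qed simp

lemma bounded_in_prob_add: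
  assumes X: "bounded_in_prob M X" and Y: "vanishing M Y"
  shows "bounded_in_prob M (\<lambda>T w. X T w + Y T w)"
  unfolding bounded_in_prob_def
proof (intro conjI allI impI)
  have [measurable]: "X T \<in> borel_measurable M" "Y T \<in> borel_measurable M" for T
    using X vanishingD(1)[OF Y] by (auto simp: bounded_in_prob_def)
  then show "(\<lambda>w. X T w + Y T w) \<in> borel_measurable M" for T by measurable
  fix h :: real assume "0 < h"
  then have h2: "0 < h / 2" by simp
  obtain K where ev: "eventually (\<lambda>T. prob {w\<in>space M. K < \<bar>X T w\<bar>} < h / 2) sequentially"
    using bounded_in_probE[OF X h2] by blast
  from ev vanishing_eventually[OF Y zero_less_one h2]
  have "eventually (\<lambda>T. prob {w\<in>space M. K + 1 < \<bar>X T w + Y T w\<bar>} < h) sequentially"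
  proof eventually_elim
    case (elim T)
    have "prob {w\<in>space M. K + 1 < \<bar>X T w + Y T w\<bar>}
      \<le> prob ({w\<in>space M. K < \<bar>X T w\<bar>} \<union> {w\<in>space M. 1 < \<bar>Y T w\<bar>})"
      by (intro finite_measure_mono) auto
    also have "\<dots> \<le> prob {w\<in>space M. K < \<bar>X T w\<bar>} + prob {w\<in>space M. 1 < \<bar>Y T w\<bar>}"
      by (intro measure_Un_le) measurable
    finally show ?case using elim by simp
  qed
  then show "\<exists>K. eventually (\<lambda>T. prob {w\<in>space M. K < \<bar>X T w + Y T w\<bar>} < h) sequentially" by blast
qed

lemma markov_nn:
  assumes [measurable]: "f \<in> borel_measurable M" and e: "0 < e"
    and le: "(\<integral>\<^sup>+w. ennreal \<bar>f w\<bar> \<partial>M) \<le> ennreal c" and c: "0 \<le> c"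
  shows "prob {w\<in>space M. e < \<bar>f w\<bar>} \<le> c / e"
proof -
  have i: "integrable M (\<lambda>w. \<bar>f w\<bar>)"
    using le by (intro integrableI_bounded) (auto intro: le_less_trans)
  have "ennreal (\<integral>w. \<bar>f w\<bar> \<partial>M) \<le> ennreal c" using le nn_integral_eq_integral[OF i] by simp
  then have ic: "(\<integral>w. \<bar>f w\<bar> \<partial>M) \<le> c" using c by (simp add: ennreal_le_iff)
  have "prob {w\<in>space M. e < \<bar>f w\<bar>} \<le> prob {w\<in>space M. e \<le> \<bar>f w\<bar>}"
    by (intro finite_measure_mono) auto
  also have "\<dots> \<le> (\<integral>w. \<bar>f w\<bar> \<partial>M) / e"
    using integral_Markov_inequality_measure[OF i, of "{}" e] e by auto
  also have "\<dots> \<le> c / e" using ic e by (intro divide_right_mono) auto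
  finally show ?thesis .
qed

lemma vanishing_expectation:
  assumes m: "\<And>T. X T \<in> borel_measurable M"
    and le: "eventually (\<lambda>T. (\<integral>\<^sup>+w. ennreal \<bar>X T w\<bar> \<partial>M) \<le> ennreal (c T)) sequentially"
    and c: "c \<longlonglongrightarrow> 0" "\<And>T. 0 \<le> c T"
  shows "vanishing M X"
proof (rule vanishingI[OF m])
  fix e h :: real assume eh: "0 < e" "0 < h"
  have "eventually (\<lambda>T. c T < h * e) sequentially" using c eh by (intro order_tendstoD) auto
  with le show "eventually (\<lambda>T. prob {w\<in>space M. e < \<bar>X T w\<bar>} < h) sequentially"
  proof eventually_elim
    case (elim T)
    have "prob {w\<in>space M. e < \<bar>X T w\<bar>} \<le> c T / e" by (rule markov_nn[OF m eh(1) elim(1) c(2)])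
    also have "\<dots> < h" using elim(2) eh by (simp add: pos_divide_less_eq)
    finally show ?case .
  qed
qed

lemma bounded_in_prob_expectation:
  assumes m: "\<And>T. X T \<in> borel_measurable M"
    and le: "\<And>T. (\<integral>\<^sup>+w. ennreal \<bar>X T w\<bar> \<partial>M) \<le> ennreal c" and c: "0 \<le> c"
  shows "bounded_in_prob M X"
  unfolding bounded_in_prob_def
proof (intro conjI allI impI m)
  fix e :: real assume e: "0 < e"
  let ?K = "(c + 1) / e"
  have K: "0 < ?K" using c e by simp
  have "c / ?K < e" using c e by (simp add: pos_divide_less_eq)
  then show "\<exists>K. eventually (\<lambda>T. prob {w\<in>space M. K < \<bar>X T w\<bar>} < e) sequentially"
    using markov_nn[OF m K le c] by (intro exI[of _ ?K] always_eventually) (auto intro: le_less_trans)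
qed

lemma vanishing_AE:
  assumes m: "\<And>T. X T \<in> borel_measurable M"
    and lim: "AE w in M. (\<lambda>T. X T w) \<longlonglongrightarrow> 0"
  shows "vanishing M X"
  unfolding vanishing_def small_oP_def real_norm_def
proof (intro conjI allI impI m)
  fix e :: real assume e: "0 < e"
  have [measurable]: "X T \<in> borel_measurable M" for T by (rule m)
  have "(\<lambda>T. \<integral>w. indicator {w\<in>space M. e < \<bar>X T w\<bar>} w \<partial>M) \<longlonglongrightarrow> (\<integral>w. (0::real) \<partial>M)"
  proof (rule integral_dominated_convergence[where w = "\<lambda>_. 1"])
    show "AE w in M. (\<lambda>T. indicator {w\<in>space M. e < \<bar>X T w\<bar>} w) \<longlonglongrightarrow> (0::real)"
      using lim
    proof eventually_elim
      case (elim w)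
      then have "eventually (\<lambda>T. \<bar>X T w\<bar> < e) sequentially"
        using e by (auto dest!: tendstoD simp: dist_real_def)
      then have "eventually (\<lambda>T. 0 = indicator {w\<in>space M. e < \<bar>X T w\<bar>} w) sequentially"
        by eventually_elim auto
      then show ?case by (rule Lim_transform_eventually[OF tendsto_const])
    qed
    show "AE w in M. norm (indicator {w\<in>space M. e < \<bar>X T w\<bar>} w :: real) \<le> 1" for T
      by (auto simp: indicator_def)
  qed auto
  then show "(\<lambda>T. prob {w\<in>space M. e < \<bar>X T w\<bar>}) \<longlonglongrightarrow> 0" by simp
qed

lemma vanishing_sqrt:
  assumes X: "vanishing M X"
  shows "vanishing M (\<lambda>T w. sqrt \<bar>X T w\<bar>)"
proof (rule vanishingI)
  show "(\<lambda>w. sqrt \<bar>X T w\<bar>) \<in> borel_measurable M" for T using vanishingD(1)[OF X] by measurable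
  fix e h :: real assume eh: "0 < e" "0 < h"
  have "e < \<bar>sqrt \<bar>y\<bar>\<bar> \<longleftrightarrow> e\<^sup>2 < \<bar>y\<bar>" for y :: real
    using eh real_less_lsqrt[of e "\<bar>y\<bar>"] real_less_rsqrt[of e "\<bar>y\<bar>"]
    by (metis abs_ge_zero abs_of_nonneg not_less real_le_rsqrt real_sqrt_ge_zero real_sqrt_le_iff real_sqrt_abs abs_of_pos)
  then show "eventually (\<lambda>T. prob {w\<in>space M. e < \<bar>sqrt \<bar>X T w\<bar>\<bar>} < h) sequentially"
    using vanishing_eventually[OF X, of "e\<^sup>2" h] eh by simp
qed

lemma bounded_in_prob_exceeds:
  assumes X: "bounded_in_prob M X" and c: "filterlim c at_top sequentially"
  shows "(\<lambda>T. prob {w\<in>space M. c T \<le> \<bar>X T w\<bar>}) \<longlonglongrightarrow> 0"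
proof (rule order_tendstoI)
  fix h :: real assume h: "0 < h"
  have [measurable]: "X T \<in> borel_measurable M" for T using X by (auto simp: bounded_in_prob_def)
  obtain K where "eventually (\<lambda>T. prob {w\<in>space M. K < \<bar>X T w\<bar>} < h) sequentially"
    using bounded_in_probE[OF X h] by blast
  moreover have "eventually (\<lambda>T. K < c T) sequentially" using c by (auto simp: filterlim_at_top_dense)
  ultimately show "eventually (\<lambda>T. prob {w\<in>space M. c T \<le> \<bar>X T w\<bar>} < h) sequentially"
  proof eventually_elim
    case (elim T)
    have "prob {w\<in>space M. c T \<le> \<bar>X T w\<bar>} \<le> prob {w\<in>space M. K < \<bar>X T w\<bar>}"
      using elim(2) by (intro finite_measure_mono) auto
    with elim(1) show ?case by simp
  qed
qed (intro always_eventually allI less_le_trans[OF _ measure_nonneg])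

text \<open>Characters are Lipschitz and of modulus one: where the difference is controlled it costs
  \<open>\<bar>t\<bar>\<close> times a small number, elsewhere at most twice a vanishing
  probability. Control is asked on \<open>E T\<close> only, because the expansions hold only when
  the estimators are close to the true parameters.\<close>

lemma char_tendsto_if_close:
  assumes S: "\<And>T. S T \<in> borel_measurable M" and I: "\<And>T. I T \<in> borel_measurable M"
    and close: "vanishing M R"
    and E: "\<And>T. E T \<in> sets M" "(\<lambda>T. prob (space M - E T)) \<longlonglongrightarrow> 0"
    and le: "eventually (\<lambda>T. AE w in M. w \<in> E T \<longrightarrow> \<bar>S T w - I T w\<bar> \<le> R T w) sequentially"
    and lim: "(\<lambda>T. \<integral>w. iexp (t * I T w) \<partial>M) \<longlonglongrightarrow> l"
  shows "(\<lambda>T. \<integral>w. iexp (t * S T w) \<partial>M) \<longlonglongrightarrow> l"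
proof -
  note [measurable] = S I E(1) vanishingD(1)[OF close]
  have "(\<lambda>T. (\<integral>w. iexp (t * S T w) \<partial>M) - (\<integral>w. iexp (t * I T w) \<partial>M)) \<longlonglongrightarrow> 0"
  proof (rule tendstoI)
    fix h :: real assume h: "0 < h"
    \<comment> \<open>The budget is \<open>h / 3\<close> for the Lipschitz part and twice
      \<open>h / 6\<close> for each of the two exceptional events; adding one to
      \<open>\<bar>t\<bar>\<close> covers \<open>t = 0\<close>.\<close>
    define e where "e = h / (3 * (\<bar>t\<bar> + 1))"
    have e: "0 < e" using h by (simp add: e_def)
    have te: "\<bar>t\<bar> * e \<le> h / 3"
    proof -
      have "\<bar>t\<bar> * e \<le> (\<bar>t\<bar> + 1) * e" using e by (intro mult_right_mono) auto
      also have "\<dots> = h / 3" by (simp add: e_def field_simps)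
      finally show ?thesis .
    qed
    have h6: "0 < h / 6" using h by simp
    have "eventually (\<lambda>T. prob (space M - E T) < h / 6) sequentially"
      using order_tendstoD(2)[OF E(2) h6] .
    with vanishing_eventually[OF close e h6] le
    show "eventually (\<lambda>T. dist ((\<integral>w. iexp (t * S T w) \<partial>M) - (\<integral>w. iexp (t * I T w) \<partial>M)) 0 < h) sequentially"
    proof eventually_elim
      case (elim T)
      let ?B = "{w\<in>space M. e < \<bar>R T w\<bar>}"
      have i: "integrable M (\<lambda>w. iexp (t * S T w))" "integrable M (\<lambda>w. iexp (t * I T w))"
        by (intro integrable_iexp_of_real; measurable)+
      have "cmod ((\<integral>w. iexp (t * S T w) \<partial>M) - (\<integral>w. iexp (t * I T w) \<partial>M))
        = cmod (\<integral>w. iexp (t * S T w) - iexp (t * I T w) \<partial>M)"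
        by (subst Bochner_Integration.integral_diff[OF i]) simp
      also have "\<dots> \<le> (\<integral>w. cmod (iexp (t * S T w) - iexp (t * I T w)) \<partial>M)" by (rule integral_norm_bound)
      also have "\<dots> \<le> (\<integral>w. \<bar>t\<bar> * e + 2 * (indicator ?B w + indicator (space M - E T) w) \<partial>M)"
      proof (rule integral_mono_AE)
        show "integrable M (\<lambda>w. cmod (iexp (t * S T w) - iexp (t * I T w)))" using i by auto
        show "integrable M (\<lambda>w. \<bar>t\<bar> * e + 2 * (indicator ?B w + indicator (space M - E T) w))"
          by (auto simp: emeasure_eq_measure)
        show "AE w in M. cmod (iexp (t * S T w) - iexp (t * I T w)) \<le> \<bar>t\<bar> * e + 2 * (indicator ?B w + indicator (space M - E T) w)"
          using elim(2) AE_space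
        proof eventually_elim
          case (elim w)
          have two: "cmod (iexp (t * S T w) - iexp (t * I T w)) \<le> 1 + 1"
            by (rule order_trans[OF norm_triangle_ineq4 add_mono]) auto
          have te0: "0 \<le> \<bar>t\<bar> * e" using e by simp
          show ?case
          proof (cases "w \<in> ?B \<or> w \<notin> E T")
            case True
            then have "1 \<le> (indicator ?B w + indicator (space M - E T) w :: real)" using elim by (auto simp: indicator_def)
            then have "0 + 2 * 1 \<le> \<bar>t\<bar> * e + 2 * (indicator ?B w + indicator (space M - E T) w)"
              using te0 by (intro add_mono mult_left_mono) auto
            with two show ?thesis by simp
          next
            case False
            then have "\<bar>S T w - I T w\<bar> \<le> e" using elim by auto
            then have "\<bar>t\<bar> * \<bar>S T w - I T w\<bar> \<le> \<bar>t\<bar> * e" by (intro mult_left_mono) auto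
            then have "cmod (iexp (t * S T w) - iexp (t * I T w)) \<le> \<bar>t\<bar> * e"
              using norm_iexp_diff_le[of "t * S T w" "t * I T w"]
              by (simp only: abs_mult flip: right_diff_distrib)
            then show ?thesis by (simp add: add_increasing2)
          qed
        qed
      qed
      also have "\<dots> = \<bar>t\<bar> * e + 2 * (prob ?B + prob (space M - E T))"
        by (simp add: prob_space emeasure_eq_measure)
      also have "\<dots> < h"
      proof -
        have "a + 2 * (p + q) < h" if "a \<le> h / 3" "p < h / 6" "q < h / 6" for a p q
          using that by (simp add: field_simps)
        from this[OF te elim(1,3)] show ?thesis .
      qed
      finally show ?case by (simp add: dist_norm)
    qed
  qed
  from tendsto_add[OF this lim] show ?thesis by simp
qed

end

text \<open>With \<open>q\<close> the integral of \<open>h\<close>, the weight \<open>sqrt q\<close>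
  in \<open>square_diff_bound\<close> balances the two errors: the bound vanishes with
  \<open>q\<close> as long as the integral of \<open>g^2\<close> stays bounded.\<close>

lemma integral_square_diff_le:
  fixes f g h :: "'u \<Rightarrow> real"
  assumes [measurable]: "f \<in> borel_measurable \<nu>" "g \<in> borel_measurable \<nu>"
    and g: "integrable \<nu> (\<lambda>u. (g u)\<^sup>2)" and h: "integrable \<nu> h"
    and le: "AE u in \<nu>. (f u - g u)\<^sup>2 \<le> h u"
  shows "\<bar>(\<integral>u. (f u)\<^sup>2 \<partial>\<nu>) - (\<integral>u. (g u)\<^sup>2 \<partial>\<nu>)\<bar>
    \<le> sqrt (\<integral>u. h u \<partial>\<nu>) * (\<integral>u. (g u)\<^sup>2 \<partial>\<nu>) + (\<integral>u. h u \<partial>\<nu>) + sqrt (\<integral>u. h u \<partial>\<nu>)"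
proof -
  let ?q = "\<integral>u. h u \<partial>\<nu>" and ?g = "\<integral>u. (g u)\<^sup>2 \<partial>\<nu>"
  have h0: "AE u in \<nu>. 0 \<le> h u" using le by eventually_elim (rule order_trans[OF zero_le_power2])
  then have q0: "0 \<le> ?q" by (rule integral_nonneg_AE)
  have bound: "\<bar>(\<integral>u. (f u)\<^sup>2 \<partial>\<nu>) - ?g\<bar> \<le> \<eta> * ?g + (1 + 1 / \<eta>) * ?q" if \<eta>: "0 < \<eta>" for \<eta>
  proof -
    have pt: "AE u in \<nu>. \<bar>(f u)\<^sup>2 - (g u)\<^sup>2\<bar> \<le> \<eta> * (g u)\<^sup>2 + (1 + 1 / \<eta>) * h u"
      using le
    proof eventually_elim
      case (elim u)
      show ?case
        using square_diff_bound[OF \<eta>, of "f u" "g u"] mult_left_mono[OF elim, of "1 + 1 / \<eta>"] \<eta>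
        by (simp add: add_nonneg_nonneg)
    qed
    have id: "integrable \<nu> (\<lambda>u. (f u)\<^sup>2 - (g u)\<^sup>2)"
    proof (rule Bochner_Integration.integrable_bound)
      show "integrable \<nu> (\<lambda>u. \<eta> * (g u)\<^sup>2 + (1 + 1 / \<eta>) * h u)" using g h by auto
      show "AE u in \<nu>. norm ((f u)\<^sup>2 - (g u)\<^sup>2) \<le> norm (\<eta> * (g u)\<^sup>2 + (1 + 1 / \<eta>) * h u)"
        using pt by eventually_elim (auto intro: order_trans[OF _ abs_ge_self])
    qed measurable
    have "integrable \<nu> (\<lambda>u. ((f u)\<^sup>2 - (g u)\<^sup>2) + (g u)\<^sup>2)" using id g by (rule Bochner_Integration.integrable_add)
    then have "integrable \<nu> (\<lambda>u. (f u)\<^sup>2)" by simp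
    then have "\<bar>(\<integral>u. (f u)\<^sup>2 \<partial>\<nu>) - ?g\<bar> = \<bar>\<integral>u. (f u)\<^sup>2 - (g u)\<^sup>2 \<partial>\<nu>\<bar>" using g by simp
    also have "\<dots> \<le> (\<integral>u. \<bar>(f u)\<^sup>2 - (g u)\<^sup>2\<bar> \<partial>\<nu>)" by (rule integral_abs_bound)
    also have "\<dots> \<le> (\<integral>u. \<eta> * (g u)\<^sup>2 + (1 + 1 / \<eta>) * h u \<partial>\<nu>)"
      using id g h pt by (intro integral_mono_AE) auto
    also have "\<dots> = \<eta> * ?g + (1 + 1 / \<eta>) * ?q" using g h by simp
    finally show ?thesis .
  qed
  show ?thesis
  proof (cases "?q = 0")
    case False
    then have s: "0 < sqrt ?q" using q0 by simp
    have "?q / sqrt ?q = sqrt ?q" using q0 by (simp add: real_div_sqrt)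
    then have "(1 + 1 / sqrt ?q) * ?q = ?q + sqrt ?q" by (simp add: distrib_right)
    with bound[OF s] show ?thesis by simp
  next
    case True
    \<comment> \<open>Here the weight \<open>sqrt q\<close> would be zero, so arbitrarily small
      positive weights are used instead.\<close>
    have "\<bar>(\<integral>u. (f u)\<^sup>2 \<partial>\<nu>) - ?g\<bar> \<le> 0"
    proof (rule field_le_epsilon)
      fix e :: real assume e: "0 < e"
      have g0: "0 \<le> ?g" by simp
      have "\<bar>(\<integral>u. (f u)\<^sup>2 \<partial>\<nu>) - ?g\<bar> \<le> e / (?g + 1) * ?g"
        using bound[of "e / (?g + 1)"] e g0 True by (simp add: add_nonneg_pos)
      also have "\<dots> \<le> e / (?g + 1) * (?g + 1)" using e g0 by (intro mult_left_mono) auto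
      also have "\<dots> = e" using g0 by (simp add: add_nonneg_eq_0_iff)
      finally show "\<bar>(\<integral>u. (f u)\<^sup>2 \<partial>\<nu>) - ?g\<bar> \<le> 0 + e" by simp
    qed
    then show ?thesis using True by simp
  qed
qed

section \<open>Square-integrable martingale differences of independent sequences\<close>

context prob_space
begin

text \<open>Square-integrable martingale differences for the filtration of
  \<open>\<epsilon>\<close>, with orthogonality to bounded functions of the past in place of
  conditional expectations; in this form finite linear combinations are immediate.\<close>

definition md_process :: "(int \<Rightarrow> 'a \<Rightarrow> 'b::topological_space) \<Rightarrow> (int \<Rightarrow> 'a \<Rightarrow> real) \<Rightarrow> bool" where
  "md_process \<epsilon> D \<longleftrightarrow> (\<forall>t. D t \<in> borel_measurable (gen_sigma M \<epsilon> {..t}) \<and> L2 M (D t) \<and>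
     (\<forall>g. g \<in> borel_measurable (gen_sigma M \<epsilon> {..t - 1}) \<longrightarrow> (\<exists>B. \<forall>w\<in>space M. \<bar>g w\<bar> \<le> B) \<longrightarrow>
       (\<integral>w. g w * D t w \<partial>M) = 0))"

lemma md_processD:
  assumes "md_process \<epsilon> D"
  shows "D t \<in> borel_measurable (gen_sigma M \<epsilon> {..t})" "L2 M (D t)"
    "g \<in> borel_measurable (gen_sigma M \<epsilon> {..t - 1}) \<Longrightarrow> (\<exists>B. \<forall>w\<in>space M. \<bar>g w\<bar> \<le> B) \<Longrightarrow> (\<integral>w. g w * D t w \<partial>M) = 0"
  using assms unfolding md_process_def by blast+

lemma bounded_mult_L2_integrable:
  assumes "g \<in> borel_measurable M" "\<exists>B. \<forall>w\<in>space M. \<bar>g w\<bar> \<le> B" "L2 M f"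
  shows "integrable M (\<lambda>w. g w * f w)"
proof (rule L2_mult)
  obtain B where B: "\<And>w. w \<in> space M \<Longrightarrow> \<bar>g w\<bar> \<le> B" using assms(2) by auto
  have "integrable M (\<lambda>w. (g w)\<^sup>2)"
  proof (rule integrable_const_bound[where B = "B\<^sup>2"])
    show "AE w in M. norm ((g w)\<^sup>2) \<le> B\<^sup>2"
    proof (rule AE_I2)
      fix w assume "w \<in> space M"
      from power_mono[OF B[OF this], of 2] show "norm ((g w)\<^sup>2) \<le> B\<^sup>2" by simp
    qed
  qed (use assms(1) in measurable)
  then show "L2 M g" using assms(1) by (simp add: L2_def)
qed (rule assms(3))

lemma md_process_sum:
  assumes \<epsilon>: "\<And>t. \<epsilon> t \<in> borel_measurable M" and D: "\<And>i. i \<in> A \<Longrightarrow> md_process \<epsilon> (D i)"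
  shows "md_process \<epsilon> (\<lambda>t w. \<Sum>i\<in>A. c i * D i t w)"
  unfolding md_process_def
proof (intro allI conjI impI)
  fix t
  show "(\<lambda>w. \<Sum>i\<in>A. c i * D i t w) \<in> borel_measurable (gen_sigma M \<epsilon> {..t})"
    using md_processD(1)[OF D] by (intro borel_measurable_sum borel_measurable_times) auto
  show "L2 M (\<lambda>w. \<Sum>i\<in>A. c i * D i t w)"
    using md_processD(2)[OF D] by (intro L2_sum L2_scale) auto
  fix g :: "'a \<Rightarrow> real" assume g: "g \<in> borel_measurable (gen_sigma M \<epsilon> {..t - 1})" "\<exists>B. \<forall>w\<in>space M. \<bar>g w\<bar> \<le> B"
  have gm: "g \<in> borel_measurable M"
    using measurable_from_subalg[OF subalgebra_gen_sigma g(1)] \<epsilon> by blast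
  have "(\<integral>w. g w * (\<Sum>i\<in>A. c i * D i t w) \<partial>M) = (\<integral>w. (\<Sum>i\<in>A. c i * (g w * D i t w)) \<partial>M)"
    by (simp add: sum_distrib_left mult_ac)
  also have "\<dots> = (\<Sum>i\<in>A. c i * (\<integral>w. g w * D i t w \<partial>M))"
    using bounded_mult_L2_integrable[OF gm g(2) md_processD(2)[OF D]]
    by (subst Bochner_Integration.integral_sum) auto
  also have "\<dots> = 0" using md_processD(3)[OF D g] by simp
  finally show "(\<integral>w. g w * (\<Sum>i\<in>A. c i * D i t w) \<partial>M) = 0" .
qed

text \<open>Truncating \<open>g\<close> at \<open>- n\<close> and \<open>n\<close> extends the
  orthogonality from bounded to square-integrable functions of the past, in particular to earlier
  members of the sequence.\<close>

lemma md_process_orthogonal_past: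
  assumes \<epsilon>: "\<And>t. \<epsilon> t \<in> borel_measurable M" and D: "md_process \<epsilon> D"
    and g: "g \<in> borel_measurable (gen_sigma M \<epsilon> {..t - 1})" "L2 M g"
  shows "(\<integral>w. g w * D t w \<partial>M) = 0"
proof (rule LIMSEQ_unique)
  let ?g = "\<lambda>n w. max (- real n) (min (real n) (g w))"
  note [measurable] = L2_measurable[OF g(2)] L2_measurable[OF md_processD(2)[OF D]]
  show "(\<lambda>n. \<integral>w. ?g n w * D t w \<partial>M) \<longlonglongrightarrow> (\<integral>w. g w * D t w \<partial>M)"
  proof (rule integral_dominated_convergence[where w = "\<lambda>w. \<bar>g w * D t w\<bar>"])
    show "integrable M (\<lambda>w. \<bar>g w * D t w\<bar>)" using L2_mult[OF g(2) md_processD(2)[OF D]] by (rule integrable_abs)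
    show "AE w in M. (\<lambda>n. ?g n w * D t w) \<longlonglongrightarrow> g w * D t w"
    proof (rule AE_I2)
      fix w
      obtain N :: nat where N: "\<bar>g w\<bar> \<le> real N" using real_arch_simple by blast
      have "eventually (\<lambda>n. g w * D t w = ?g n w * D t w) sequentially"
        using N by (intro eventually_sequentiallyI[of N]) (auto simp: max_def min_def)
      then show "(\<lambda>n. ?g n w * D t w) \<longlonglongrightarrow> g w * D t w" by (rule Lim_transform_eventually[OF tendsto_const])
    qed
    show "AE w in M. norm (?g n w * D t w) \<le> \<bar>g w * D t w\<bar>" for n
      by (intro AE_I2) (auto simp: abs_mult intro!: mult_right_mono)
  qed measurable
  have "(\<integral>w. ?g n w * D t w \<partial>M) = 0" for n
    using g(1) by (intro md_processD(3)[OF D] exI[of _ "real n"]) auto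
  then show "(\<lambda>n. \<integral>w. ?g n w * D t w \<partial>M) \<longlonglongrightarrow> 0" by simp
qed

lemma md_process_orthogonal:
  assumes \<epsilon>: "\<And>t. \<epsilon> t \<in> borel_measurable M" and D: "md_process \<epsilon> D" and st: "s \<noteq> t"
  shows "(\<integral>w. D s w * D t w \<partial>M) = 0"
proof -
  have *: "(\<integral>w. D s w * D t w \<partial>M) = 0" if "s < t" for s t
    by (rule md_process_orthogonal_past[OF \<epsilon> D])
       (use that borel_measurable_gen_sigma_mono[OF _ md_processD(1)[OF D], of s "{..t - 1}"] md_processD(2)[OF D] in auto)
  show ?thesis using *[of s t] *[of t s] st by (cases "s < t") (auto simp: mult.commute)
qed

text \<open>Orthogonality makes the variance the same for every \<open>T > 0\<close>; the
  convergence of integrated squares rests on this exact equality.\<close>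

lemma md_process_normalized_sum:
  assumes \<epsilon>: "\<And>t. \<epsilon> t \<in> borel_measurable M" and D: "md_process \<epsilon> D"
    and v: "\<And>t. (\<integral>w. (D t w)\<^sup>2 \<partial>M) = v" and T: "0 < T"
  shows "(\<integral>w. ((\<Sum>t=1..T. D (int t) w) / sqrt (real T))\<^sup>2 \<partial>M) = v"
    and "L2 M (\<lambda>w. (\<Sum>t=1..T. D (int t) w) / sqrt (real T))"
proof -
  have "(\<integral>w. (\<Sum>t\<in>{1..T}. (1 / sqrt (real T)) * D (int t) w)\<^sup>2 \<partial>M) = (\<Sum>t\<in>{1..T}. (1 / sqrt (real T))\<^sup>2 * (\<integral>w. (D (int t) w)\<^sup>2 \<partial>M))"
    by (rule integral_sum_orthogonal) (auto intro: md_processD(2)[OF D] md_process_orthogonal[OF \<epsilon> D])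
  also have "\<dots> = v" using T by (simp add: v power_divide)
  finally show "(\<integral>w. ((\<Sum>t=1..T. D (int t) w) / sqrt (real T))\<^sup>2 \<partial>M) = v"
    by (simp add: sum_divide_distrib)
  have "L2 M (\<lambda>w. (1 / sqrt (real T)) * (\<Sum>t=1..T. D (int t) w))"
    by (intro L2_scale L2_sum md_processD(2)[OF D])
  then show "L2 M (\<lambda>w. (\<Sum>t=1..T. D (int t) w) / sqrt (real T))" by simp
qed

text \<open>A bounded function of the past may be multiplied into the conditional expectation, which
  is zero.\<close>

lemma md_process_martingale_differences:
  assumes \<epsilon>: "\<And>t. \<epsilon> t \<in> borel_measurable M"
    and m: "martingale_differences M (\<lambda>t. gen_sigma M \<epsilon> {..t}) m"
    and m2: "\<And>t k. integrable M (\<lambda>w. (m t w $ k)\<^sup>2)"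
  shows "md_process \<epsilon> (\<lambda>t w. m t w $ k)"
  unfolding md_process_def
proof (intro allI conjI impI)
  fix t
  have mm: "m t \<in> borel_measurable (gen_sigma M \<epsilon> {..t})" using m by (simp add: martingale_differences_def)
  then show mk: "(\<lambda>w. m t w $ k) \<in> borel_measurable (gen_sigma M \<epsilon> {..t})"
    using measurable_compose[OF mm borel_measurable_nth] by simp
  have mkM: "(\<lambda>w. m t w $ k) \<in> borel_measurable M"
    using measurable_from_subalg[OF subalgebra_gen_sigma mk] \<epsilon> by blast
  then show L: "L2 M (\<lambda>w. m t w $ k)" using m2 by (simp add: L2_def)
  fix g :: "'a \<Rightarrow> real" assume g: "g \<in> borel_measurable (gen_sigma M \<epsilon> {..t - 1})" "\<exists>B. \<forall>w\<in>space M. \<bar>g w\<bar> \<le> B"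
  have sub: "subalgebra M (gen_sigma M \<epsilon> {..t - 1})" using \<epsilon> by (intro subalgebra_gen_sigma)
  have gm: "g \<in> borel_measurable M" using measurable_from_subalg[OF sub g(1)] .
  interpret S: finite_measure_subalgebra M "gen_sigma M \<epsilon> {..t - 1}" by unfold_locales (rule sub)
  have "(\<integral>w. g w * m t w $ k \<partial>M) = (\<integral>w. g w * real_cond_exp M (gen_sigma M \<epsilon> {..t - 1}) (\<lambda>w. m t w $ k) w \<partial>M)"
    using bounded_mult_L2_integrable[OF gm g(2) L] g(1) mkM by (intro S.real_cond_exp_intg(2)[symmetric])
  also have "\<dots> = (\<integral>w. 0 \<partial>M)"
  proof (rule integral_cong_AE)
    have "AE w in M. real_cond_exp M (gen_sigma M \<epsilon> {..t - 1}) (\<lambda>w. m t w $ k) w = 0"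
      using m by (simp add: martingale_differences_def)
    then show "AE w in M. g w * real_cond_exp M (gen_sigma M \<epsilon> {..t - 1}) (\<lambda>w. m t w $ k) w = 0"
      by eventually_elim simp
  qed (use gm in auto)
  finally show "(\<integral>w. g w * m t w $ k \<partial>M) = 0" by simp
qed

lemma indep_past_integral:
  fixes \<epsilon> :: "int \<Rightarrow> 'a \<Rightarrow> 'b::topological_space" and f :: "'b \<Rightarrow> real"
  assumes indep: "indep_vars (\<lambda>_. borel) \<epsilon> UNIV" and f: "f \<in> borel_measurable borel"
    and fi: "integrable M (\<lambda>w. f (\<epsilon> t w))"
    and g: "g \<in> borel_measurable (gen_sigma M \<epsilon> {..t - 1})" "integrable M g"
  shows "(\<integral>w. g w * f (\<epsilon> t w) \<partial>M) = (\<integral>w. g w \<partial>M) * (\<integral>w. f (\<epsilon> t w) \<partial>M)"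
proof -
  let ?E = "\<lambda>s. {\<epsilon> s -` A \<inter> space M | A. A \<in> sets borel}"
  have rv: "random_variable borel (\<epsilon> s)" for s using indep by (auto simp: indep_vars_def2)
  have ind: "indep_sets ?E UNIV" using indep by (auto simp: indep_vars_def2)
  define I where "I b = (if b then {..t - 1} else {t})" for b
  have "indep_sets (\<lambda>b. sigma_sets (space M) (\<Union>s\<in>I b. ?E s)) UNIV"
  proof (rule indep_sets_collect_sigma)
    show "indep_sets ?E (\<Union>b\<in>UNIV. I b)" by (rule indep_sets_mono_index[OF _ ind]) auto
    show "disjoint_family_on I UNIV" by (auto simp: disjoint_family_on_def I_def)
    fix s
    show "Int_stable (?E s)"
    proof (rule Int_stableI)
      fix a b assume "a \<in> ?E s" "b \<in> ?E s"
      then obtain A B where "a = \<epsilon> s -` A \<inter> space M" "b = \<epsilon> s -` B \<inter> space M" "A \<in> sets borel" "B \<in> sets borel" by auto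
      then show "a \<inter> b \<in> ?E s" by (intro CollectI exI[of _ "A \<inter> B"]) auto
    qed
  qed
  then have sets: "indep_sets (\<lambda>b. sigma_sets (space M) (\<Union>s\<in>I b. ?E s)) (UNIV::bool set)" .
  have eq: "sigma_sets (space M) (\<Union>s\<in>S. ?E s) = sets (gen_sigma M \<epsilon> S)" for S
    unfolding sets_gen_sigma by (rule arg_cong[where f = "sigma_sets (space M)"]) auto
  have "indep_var borel g borel (\<lambda>w. f (\<epsilon> t w))"
    unfolding indep_var_def indep_vars_def2
  proof (intro conjI ballI)
    fix b :: bool
    have "subalgebra M (gen_sigma M \<epsilon> {..t - 1})" using rv by (intro subalgebra_gen_sigma)
    then show "random_variable (case b of True \<Rightarrow> borel | False \<Rightarrow> borel) (case b of True \<Rightarrow> g | False \<Rightarrow> \<lambda>w. f (\<epsilon> t w))"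
      using measurable_from_subalg[OF _ g(1)] measurable_compose[OF rv f] by (cases b) auto
  next
    show "indep_sets (\<lambda>b. {(case b of True \<Rightarrow> g | False \<Rightarrow> \<lambda>w. f (\<epsilon> t w)) -` A \<inter> space M | A. A \<in> sets (case b of True \<Rightarrow> borel | False \<Rightarrow> borel)}) UNIV"
    proof (rule indep_sets_mono_sets[OF sets])
      fix b :: bool
      have ft: "(\<lambda>w. f (\<epsilon> t w)) \<in> borel_measurable (gen_sigma M \<epsilon> {t})"
        by (rule measurable_compose[OF measurable_gen_sigma f]) simp
      show "{(case b of True \<Rightarrow> g | False \<Rightarrow> \<lambda>w. f (\<epsilon> t w)) -` A \<inter> space M | A. A \<in> sets (case b of True \<Rightarrow> borel | False \<Rightarrow> borel)}
        \<subseteq> sigma_sets (space M) (\<Union>s\<in>I b. ?E s)"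
        unfolding eq using measurable_sets[OF g(1)] measurable_sets[OF ft] by (cases b) (auto simp: I_def)
    qed
  qed
  then show ?thesis using g(2) fi by (rule indep_var_lebesgue_integral)
qed

lemma md_process_independent:
  fixes \<epsilon> :: "int \<Rightarrow> 'a \<Rightarrow> 'b::topological_space" and f :: "'b \<Rightarrow> real"
  assumes indep: "indep_vars (\<lambda>_. borel) \<epsilon> UNIV" and f: "f \<in> borel_measurable borel"
    and L: "\<And>t. L2 M (\<lambda>w. f (\<epsilon> t w))" and c: "\<And>t. (\<integral>w. f (\<epsilon> t w) \<partial>M) = c"
  shows "md_process \<epsilon> (\<lambda>t w. f (\<epsilon> t w) - c)"
  unfolding md_process_def
proof (intro allI conjI impI)
  fix t
  have rv: "random_variable borel (\<epsilon> s)" for s using indep by (auto simp: indep_vars_def2)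
  show "(\<lambda>w. f (\<epsilon> t w) - c) \<in> borel_measurable (gen_sigma M \<epsilon> {..t})"
    by (intro borel_measurable_diff borel_measurable_const measurable_compose[OF measurable_gen_sigma f]) simp
  have "L2 M (\<lambda>_. c)" by (simp add: L2_def)
  then show "L2 M (\<lambda>w. f (\<epsilon> t w) - c)" using L by (intro L2_diff)
  fix g :: "'a \<Rightarrow> real" assume g: "g \<in> borel_measurable (gen_sigma M \<epsilon> {..t - 1})" "\<exists>B. \<forall>w\<in>space M. \<bar>g w\<bar> \<le> B"
  have gm: "g \<in> borel_measurable M" using measurable_from_subalg[OF subalgebra_gen_sigma g(1)] rv by blast
  obtain B where "\<And>w. w \<in> space M \<Longrightarrow> \<bar>g w\<bar> \<le> B" using g(2) by auto
  then have gi: "integrable M g" using gm by (intro integrable_const_bound[where B = B]) auto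
  have fi: "integrable M (\<lambda>w. f (\<epsilon> t w))"
    using square_integrable_imp_integrable[OF L2_measurable[OF L] L2_square[OF L]] .
  have "(\<integral>w. g w * (f (\<epsilon> t w) - c) \<partial>M) = (\<integral>w. g w * f (\<epsilon> t w) - g w * c \<partial>M)"
    by (simp add: right_diff_distrib)
  also have "\<dots> = (\<integral>w. g w * f (\<epsilon> t w) \<partial>M) - (\<integral>w. g w \<partial>M) * c"
    using bounded_mult_L2_integrable[OF gm g(2) L] gi by simp
  also have "\<dots> = 0" unfolding indep_past_integral[OF indep f fi g(1) gi] c by simp
  finally show "(\<integral>w. g w * (f (\<epsilon> t w) - c) \<partial>M) = 0" .
qed

text \<open>The differences are adapted to independent innovations, so
  \<open>adapted_stationary_lln\<close> applies to their squares and supplies the hypothesis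
  \<open>D_lln\<close> of the martingale theorem.\<close>

theorem md_process_clt:
  fixes \<epsilon> :: "int \<Rightarrow> 'a \<Rightarrow> 'b::topological_space"
  assumes indep: "indep_vars (\<lambda>_. borel) \<epsilon> UNIV" and D: "md_process \<epsilon> D"
    and stat: "strictly_stationary M D"
  shows "(\<lambda>T. \<integral>w. iexp ((\<Sum>t=1..T. D (int t) w) / sqrt (real T)) \<partial>M) \<longlonglongrightarrow> of_real (exp (- ((\<integral>w. (D 0 w)\<^sup>2 \<partial>M) / 2)))"
proof -
  have rv: "random_variable borel (\<epsilon> s)" for s using indep by (auto simp: indep_vars_def2)
  have sub: "subalgebra M (gen_sigma M \<epsilon> S)" for S using rv by (intro subalgebra_gen_sigma)
  interpret A: martingale_difference_array M "\<lambda>n. D (int n)" "\<lambda>n. gen_sigma M \<epsilon> {..int n}" "\<integral>w. (D 0 w)\<^sup>2 \<partial>M"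
  proof
    fix n
    show "subalgebra M (gen_sigma M \<epsilon> {..int n})" by (rule sub)
    show "sets (gen_sigma M \<epsilon> {..int n}) \<subseteq> sets (gen_sigma M \<epsilon> {..int (Suc n)})" by (intro gen_sigma_mono) auto
    show "D (int (Suc n)) \<in> borel_measurable (gen_sigma M \<epsilon> {..int (Suc n)})" by (rule md_processD(1)[OF D])
    show "integrable M (\<lambda>w. (D (int (Suc n)) w)\<^sup>2)" by (rule L2_square[OF md_processD(2)[OF D]])
    show "distr M borel (D (int (Suc n))) = distr M borel (D (int 1))"
      using strictly_stationary_distr[OF stat] by metis
    fix g :: "'a \<Rightarrow> real" assume "g \<in> borel_measurable (gen_sigma M \<epsilon> {..int n})" "\<exists>B. \<forall>w\<in>space M. \<bar>g w\<bar> \<le> B"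
    then show "(\<integral>w. g w * D (int (Suc n)) w \<partial>M) = 0" by (intro md_processD(3)[OF D]) auto
  next
    fix e :: real assume e: "0 < e"
    show "(\<lambda>T. prob {w\<in>space M. e < \<bar>(\<Sum>t=1..T. (D (int t) w)\<^sup>2) / real T - (\<integral>w. (D 0 w)\<^sup>2 \<partial>M)\<bar>}) \<longlonglongrightarrow> 0"
    proof (rule adapted_stationary_lln[OF indep _ _ _ e])
      show "(\<lambda>w. (D t w)\<^sup>2) \<in> borel_measurable (gen_sigma M \<epsilon> {..t})" for t
        using md_processD(1)[OF D] by simp
      show "strictly_stationary M (\<lambda>t w. (D t w)\<^sup>2)" using stat by (rule strictly_stationary_compose) simp
      show "integrable M (\<lambda>w. (D 0 w)\<^sup>2)" by (rule L2_square[OF md_processD(2)[OF D]])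
    qed
  qed simp
  from A.martingale_clt show ?thesis by simp
qed

end

section \<open>Gaussian processes and their characteristic functions\<close>

lemma integral_sum_square:
  assumes L: "\<And>i. i \<in> A \<Longrightarrow> L2 M (f i)"
  shows "(\<integral>w. (\<Sum>i\<in>A. c i * f i w)\<^sup>2 \<partial>M) = (\<Sum>i\<in>A. \<Sum>j\<in>A. (c i * c j) * (\<integral>w. f i w * f j w \<partial>M))"
proof -
  have "(\<integral>w. (\<Sum>i\<in>A. c i * f i w)\<^sup>2 \<partial>M) = (\<integral>w. (\<Sum>i\<in>A. \<Sum>j\<in>A. (c i * c j) * (f i w * f j w)) \<partial>M)"
    by (simp add: power2_eq_square sum_product mult_ac)
  also have "\<dots> = (\<Sum>i\<in>A. \<Sum>j\<in>A. (c i * c j) * (\<integral>w. f i w * f j w \<partial>M))"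
    using L2_mult[OF L L] by (simp add: Bochner_Integration.integral_sum)
  finally show ?thesis .
qed

text \<open>Finite combinations are centred normal, and their second moments are quadratic forms in
  the covariance, hence equal to those of the combinations of \<open>Y\<close>. A centred normal law
  is determined by its second moment, whatever the space \<open>N\<close>.\<close>

lemma centred_gaussian_char:
  assumes cg: "centred_gaussian_with_cov N I Z C"
    and C: "\<And>u s. u \<in> I \<Longrightarrow> s \<in> I \<Longrightarrow> C u s = (\<integral>w. Y u w * Y s w \<partial>M)"
    and Y: "\<And>u. u \<in> I \<Longrightarrow> L2 M (Y u)"
  shows "u \<in> I \<Longrightarrow> integrable N (\<lambda>v. (Z u v)\<^sup>2)"
    and "finite J \<Longrightarrow> J \<subseteq> I \<Longrightarrow>
      (\<integral>v. iexp (\<Sum>u\<in>J. c u * Z u v) \<partial>N) = of_real (exp (- ((\<integral>w. (\<Sum>u\<in>J. c u * Y u w)\<^sup>2 \<partial>M) / 2)))"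
proof -
  have gp: "gaussian_process N I Z" using cg by (simp add: centred_gaussian_with_cov_def)
  interpret N: prob_space N using gp by (simp add: gaussian_process_def)
  have nrv: "normal_rv N (\<lambda>v. \<Sum>u\<in>J. c u * Z u v)" if "finite J" "J \<subseteq> I" for J c
    using gp that by (simp add: gaussian_process_def)
  have n1: "normal_rv N (Z u)" and m1: "(\<integral>v. Z u v \<partial>N) = 0" if "u \<in> I" for u
    using nrv[of "{u}" "\<lambda>_. 1"] cg that by (simp_all add: centred_gaussian_with_cov_def)
  note Z2 = N.normal_rv_zero_mean_char(1,2)[OF n1 m1]
  then show "u \<in> I \<Longrightarrow> integrable N (\<lambda>v. (Z u v)\<^sup>2)" by blast
  have LZ: "L2 N (Z u)" if "u \<in> I" for u
    using Z2(1)[OF that that] n1[OF that] by (simp add: L2_def normal_rv_def)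
  assume J: "finite J" "J \<subseteq> I"
  have mean: "(\<integral>v. (\<Sum>u\<in>J. c u * Z u v) \<partial>N) = 0"
    using Z2(2) m1 J by (subst Bochner_Integration.integral_sum) (auto intro!: sum.neutral)
  have "(\<integral>v. (\<Sum>u\<in>J. c u * Z u v)\<^sup>2 \<partial>N) = (\<Sum>i\<in>J. \<Sum>j\<in>J. (c i * c j) * (\<integral>v. Z i v * Z j v \<partial>N))"
    using J LZ by (intro integral_sum_square) auto
  also have "\<dots> = (\<Sum>i\<in>J. \<Sum>j\<in>J. (c i * c j) * (\<integral>w. Y i w * Y j w \<partial>M))"
  proof (rule sum.cong[OF refl], rule sum.cong[OF refl])
    fix i j assume "i \<in> J" "j \<in> J"
    then have "i \<in> I" "j \<in> I" using J by auto
    then have "(\<integral>v. Z i v * Z j v \<partial>N) = (\<integral>w. Y i w * Y j w \<partial>M)"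
      using cg C by (simp add: centred_gaussian_with_cov_def)
    then show "(c i * c j) * (\<integral>v. Z i v * Z j v \<partial>N) = (c i * c j) * (\<integral>w. Y i w * Y j w \<partial>M)" by simp
  qed
  also have "\<dots> = (\<integral>w. (\<Sum>u\<in>J. c u * Y u w)\<^sup>2 \<partial>M)"
    using J Y by (intro integral_sum_square[symmetric]) auto
  finally show "(\<integral>v. iexp (\<Sum>u\<in>J. c u * Z u v) \<partial>N) = of_real (exp (- ((\<integral>w. (\<Sum>u\<in>J. c u * Y u w)\<^sup>2 \<partial>M) / 2)))"
    using N.normal_rv_zero_mean_char(3)[OF nrv[OF J] mean, of 1] by simp
qed

text \<open>The characteristic functions identify the law of every finite combination; the
  covariance of two values follows by polarisation from the second moment of their sum.\<close>

lemma centred_gaussian_if_char: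
  assumes N: "prob_space N" and Zm: "(\<lambda>(v, u). Z u v) \<in> borel_measurable (N \<Otimes>\<^sub>M restrict_space borel I)"
    and C: "\<And>u s. u \<in> I \<Longrightarrow> s \<in> I \<Longrightarrow> C u s = (\<integral>w. Y u w * Y s w \<partial>M)"
    and Y: "\<And>u. u \<in> I \<Longrightarrow> L2 M (Y u)"
    and ch: "\<And>J c. finite J \<Longrightarrow> J \<subseteq> I \<Longrightarrow>
      (\<integral>v. iexp (\<Sum>u\<in>J. c u * Z u v) \<partial>N) = of_real (exp (- ((\<integral>w. (\<Sum>u\<in>J. c u * Y u w)\<^sup>2 \<partial>M) / 2)))"
  shows "centred_gaussian_with_cov N I Z C"
proof -
  interpret N: prob_space N by (rule N)
  have Zu [measurable]: "Z u \<in> borel_measurable N" if "u \<in> I" for u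
    using measurable_compose[OF measurable_Pair2' Zm, of u] that by (simp add: space_restrict_space)
  have normal: "normal_rv N (\<lambda>v. \<Sum>u\<in>J. c u * Z u v) \<and> (\<integral>v. (\<Sum>u\<in>J. c u * Z u v) \<partial>N) = 0 \<and>
      (\<integral>v. (\<Sum>u\<in>J. c u * Z u v)\<^sup>2 \<partial>N) = (\<integral>w. (\<Sum>u\<in>J. c u * Y u w)\<^sup>2 \<partial>M) \<and>
      integrable N (\<lambda>v. (\<Sum>u\<in>J. c u * Z u v)\<^sup>2)"
    if J: "finite J" "J \<subseteq> I" for J c
  proof -
    have m: "(\<lambda>v. \<Sum>u\<in>J. c u * Z u v) \<in> borel_measurable N"
      using J by (intro borel_measurable_sum borel_measurable_times Zu) auto
    have s: "0 \<le> (\<integral>w. (\<Sum>u\<in>J. c u * Y u w)\<^sup>2 \<partial>M)" by simp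
    have "(\<integral>v. iexp (t * (\<Sum>u\<in>J. c u * Z u v)) \<partial>N) = of_real (exp (- (t\<^sup>2 * (\<integral>w. (\<Sum>u\<in>J. c u * Y u w)\<^sup>2 \<partial>M) / 2)))" for t
    proof -
      have "(\<integral>v. iexp (t * (\<Sum>u\<in>J. c u * Z u v)) \<partial>N) = (\<integral>v. iexp (\<Sum>u\<in>J. (t * c u) * Z u v) \<partial>N)"
        by (simp add: sum_distrib_left mult.assoc)
      also have "\<dots> = of_real (exp (- ((\<integral>w. (\<Sum>u\<in>J. (t * c u) * Y u w)\<^sup>2 \<partial>M) / 2)))" by (rule ch[OF J])
      also have "(\<integral>w. (\<Sum>u\<in>J. (t * c u) * Y u w)\<^sup>2 \<partial>M) = t\<^sup>2 * (\<integral>w. (\<Sum>u\<in>J. c u * Y u w)\<^sup>2 \<partial>M)"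
        by (simp add: mult.assoc power_mult_distrib flip: sum_distrib_left)
      finally show ?thesis .
    qed
    from N.normal_rv_if_char[OF m s this] show ?thesis by blast
  qed
  have sq: "(\<integral>v. Z u v * Z u v \<partial>N) = (\<integral>w. Y u w * Y u w \<partial>M)" and i: "integrable N (\<lambda>v. (Z u v)\<^sup>2)" and mean: "(\<integral>v. Z u v \<partial>N) = 0" if "u \<in> I" for u
    using normal[of "{u}" "\<lambda>_. 1"] that by (simp_all add: power2_eq_square)
  have LZ: "L2 N (Z u)" if "u \<in> I" for u using i[OF that] Zu[OF that] by (simp add: L2_def)
  have "(\<integral>v. Z u v * Z s v \<partial>N) = C u s" if us: "u \<in> I" "s \<in> I" for u s
  proof (cases "u = s")
    case False
    have "(\<integral>v. (\<Sum>r\<in>{u, s}. 1 * Z r v)\<^sup>2 \<partial>N) = (\<integral>w. (\<Sum>r\<in>{u, s}. 1 * Y r w)\<^sup>2 \<partial>M)"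
      using normal[of "{u, s}" "\<lambda>_. 1"] us by simp
    moreover have "(\<integral>v. (\<Sum>r\<in>{u, s}. 1 * Z r v)\<^sup>2 \<partial>N) = (\<integral>v. Z u v * Z u v \<partial>N) + (\<integral>v. Z s v * Z s v \<partial>N) + 2 * (\<integral>v. Z u v * Z s v \<partial>N)"
      using us LZ False by (subst integral_sum_square) (auto simp: mult.commute)
    moreover have "(\<integral>w. (\<Sum>r\<in>{u, s}. 1 * Y r w)\<^sup>2 \<partial>M) = (\<integral>w. Y u w * Y u w \<partial>M) + (\<integral>w. Y s w * Y s w \<partial>M) + 2 * (\<integral>w. Y u w * Y s w \<partial>M)"
      using us Y False by (subst integral_sum_square) (auto simp: mult.commute)
    ultimately show ?thesis using sq us C by simp
  qed (use sq us C in auto)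
  then show ?thesis
    unfolding centred_gaussian_with_cov_def gaussian_process_def using N Zm normal mean by blast
qed

context prob_space
begin

text \<open>Every finite combination of the \<open>Y t u\<close> is again a stationary sequence of
  martingale differences, so the one-dimensional limit theorem yields all finite-dimensional ones,
  as in the device of Cramer and Wold.\<close>

theorem md_field_integrated_square_clt:
  fixes \<epsilon> :: "int \<Rightarrow> 'a \<Rightarrow> 'b::topological_space" and Y :: "int \<Rightarrow> 'u \<Rightarrow> 'a \<Rightarrow> real"
  assumes indep: "indep_vars (\<lambda>_. borel) \<epsilon> UNIV"
    and \<nu>: "finite_measure \<nu>"
    and Ym: "\<And>t. (\<lambda>(w, u). Y t u w) \<in> borel_measurable (M \<Otimes>\<^sub>M \<nu>)"
    and md: "\<And>u. u \<in> space \<nu> \<Longrightarrow> md_process \<epsilon> (\<lambda>t. Y t u)"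
    and stat: "\<And>J c. finite J \<Longrightarrow> J \<subseteq> space \<nu> \<Longrightarrow> strictly_stationary M (\<lambda>t w. \<Sum>u\<in>J. c u * Y t u w)"
    and Ci: "integrable \<nu> (\<lambda>u. \<integral>w. (Y 0 u w)\<^sup>2 \<partial>M)"
    and N: "prob_space N" and Zm: "(\<lambda>(v, u). Z u v) \<in> borel_measurable (N \<Otimes>\<^sub>M \<nu>)"
    and Z2: "\<And>u. u \<in> space \<nu> \<Longrightarrow> integrable N (\<lambda>v. (Z u v)\<^sup>2)"
      "\<And>u. u \<in> space \<nu> \<Longrightarrow> (\<integral>v. (Z u v)\<^sup>2 \<partial>N) = (\<integral>w. (Y 0 u w)\<^sup>2 \<partial>M)"
    and ch: "\<And>J c. finite J \<Longrightarrow> J \<subseteq> space \<nu> \<Longrightarrow>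
      (\<integral>v. iexp (\<Sum>u\<in>J. c u * Z u v) \<partial>N) = of_real (exp (- ((\<integral>w. (\<Sum>u\<in>J. c u * Y 0 u w)\<^sup>2 \<partial>M) / 2)))"
  shows "(\<lambda>T. \<integral>w. iexp (r * (\<integral>u. ((\<Sum>t=1..T. Y (int t) u w) / sqrt (real T))\<^sup>2 \<partial>\<nu>)) \<partial>M)
    \<longlonglongrightarrow> (\<integral>v. iexp (r * (\<integral>u. (Z u v)\<^sup>2 \<partial>\<nu>)) \<partial>N)"
proof (rule integrated_square_char_tendsto)
  have rv: "random_variable borel (\<epsilon> t)" for t using indep by (auto simp: indep_vars_def2)
  interpret \<nu>: finite_measure \<nu> by (rule \<nu>)
  have [measurable]: "(\<lambda>(w, u). Y t u w) \<in> borel_measurable (M \<Otimes>\<^sub>M \<nu>)" for t by (rule Ym)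
  show "random_field M \<nu> (\<lambda>u w. (\<Sum>t=1..T. Y (int t) u w) / sqrt (real T))" for T
    by unfold_locales measurable
  interpret N: prob_space N by (rule N)
  show "random_field N \<nu> Z" by unfold_locales (rule Zm)
  have var: "(\<integral>w. (Y t u w)\<^sup>2 \<partial>M) = (\<integral>w. (Y 0 u w)\<^sup>2 \<partial>M)" if u: "u \<in> space \<nu>" for t u
  proof -
    have st: "strictly_stationary M (\<lambda>t. Y t u)" using stat[of "{u}" "\<lambda>_. 1"] u by simp
    have "(\<integral>w. (Y t u w)\<^sup>2 \<partial>M) = (\<integral>y. y\<^sup>2 \<partial>distr M borel (Y t u))" for t
      using strictly_stationary_measurable[OF st] by (intro integral_distr[symmetric]) auto
    then show ?thesis using strictly_stationary_distr[OF st, of t] by simp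
  qed
  show "integrable M (\<lambda>w. ((\<Sum>t=1..T. Y (int t) u w) / sqrt (real T))\<^sup>2)"
    "(\<integral>w. ((\<Sum>t=1..T. Y (int t) u w) / sqrt (real T))\<^sup>2 \<partial>M) = (\<integral>w. (Y 0 u w)\<^sup>2 \<partial>M)"
    if "0 < T" "u \<in> space \<nu>" for T u
    using md_process_normalized_sum[OF rv md[OF that(2)] var[OF that(2)] that(1)] by (auto intro: L2_square)
  fix J c assume J: "finite J" "J \<subseteq> space \<nu>"
  have "md_process \<epsilon> (\<lambda>t w. \<Sum>u\<in>J. c u * Y t u w)"
    using J by (intro md_process_sum rv md) auto
  from md_process_clt[OF indep this stat[OF J]]
  show "(\<lambda>T. \<integral>w. iexp (\<Sum>u\<in>J. c u * ((\<Sum>t=1..T. Y (int t) u w) / sqrt (real T))) \<partial>M)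
    \<longlonglongrightarrow> (\<integral>v. iexp (\<Sum>u\<in>J. c u * Z u v) \<partial>N)"
    unfolding ch[OF J]
    by (simp add: sum_divide_distrib sum_distrib_left sum.swap[of _ J] del: of_real_sum)
qed (use Z2 Ci in auto)

end

text \<open>Meant for functions not known to be measurable: the integral is a supremum over simple
  functions below the integrand, and these can be rescaled. The moment conditions contain suprema
  over the uncountable set \<open>U\<close>, which are of this kind.\<close>

lemma nn_integral_cmult_le:
  assumes c: "0 < c"
  shows "(\<integral>\<^sup>+w. ennreal c * f w \<partial>M) \<le> ennreal c * (\<integral>\<^sup>+w. f w \<partial>M)"
  unfolding nn_integral_def[of M "\<lambda>w. ennreal c * f w"]
proof (rule SUP_least)
  fix g assume g: "g \<in> {g. simple_function M g \<and> g \<le> (\<lambda>w. ennreal c * f w)}"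
  then have sg: "simple_function M g" and le: "\<And>w. g w \<le> ennreal c * f w" by (auto simp: le_fun_def)
  have inv: "ennreal (1 / c) * (ennreal c * y) = y" "ennreal c * (ennreal (1 / c) * y) = y" for y
    using c by (simp_all add: mult.assoc[symmetric] ennreal_mult[symmetric])
  have "integral\<^sup>S M g = (\<integral>\<^sup>+w. g w \<partial>M)" using sg by (rule nn_integral_eq_simple_integral[symmetric])
  also have "\<dots> = (\<integral>\<^sup>+w. ennreal c * (ennreal (1 / c) * g w) \<partial>M)" by (simp add: inv)
  also have "\<dots> = ennreal c * (\<integral>\<^sup>+w. ennreal (1 / c) * g w \<partial>M)"
    using borel_measurable_simple_function[OF sg] by (intro nn_integral_cmult) auto
  also have "\<dots> \<le> ennreal c * (\<integral>\<^sup>+w. f w \<partial>M)"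
  proof (intro mult_left_mono nn_integral_mono)
    fix w
    have "ennreal (1 / c) * g w \<le> ennreal (1 / c) * (ennreal c * f w)" by (intro mult_left_mono le) simp
    then show "ennreal (1 / c) * g w \<le> f w" by (simp only: inv)
  qed simp
  finally show "integral\<^sup>S M g \<le> ennreal c * (\<integral>\<^sup>+w. f w \<partial>M)" .
qed

section \<open>The observation process\<close>

lemma pdiff_eq_derivative:
  assumes "(f has_derivative f') (at \<theta>)"
  shows "pdiff k f \<theta> = f' (axis k 1)"
proof -
  have "f differentiable (at \<theta>)" using assms by (auto simp: differentiable_def)
  from has_derivative_unique[OF assms differentiable_gradient(1)[OF this]]
  show ?thesis by (simp add: gradient_def inner_axis)
qed

text \<open>The extension by zero outside \<open>\<Omega>\<close> does not affect derivatives on the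
  open set \<open>U\<close>. The derivative of \<open>c / m\<close> is
  \<open>- c * m' / m^2\<close>, so the lower bound on \<open>m\<close> brings in
  \<open>1 / \<omega>0 ^ 4\<close> for its square.\<close>

lemma quotient_C1:
  fixes m :: "real ^ 'n::finite \<Rightarrow> real" and c :: real
  assumes C2: "C2_on (interior \<Omega>) m" and low: "\<And>\<theta>. \<theta> \<in> \<Omega> \<Longrightarrow> \<omega>0 \<le> m \<theta>" and \<omega>0: "0 < \<omega>0"
    and U: "open U" "U \<subseteq> interior \<Omega>"
  defines "f \<equiv> \<lambda>\<theta>. if \<theta> \<in> \<Omega> then c / m \<theta> else 0"
  shows "\<theta> \<in> U \<Longrightarrow> f differentiable (at \<theta>)"
    and "\<theta> \<in> U \<Longrightarrow> pdiff k f \<theta> = - (c * pdiff k m \<theta> / (m \<theta>)\<^sup>2)"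
    and "continuous_on U (pdiff k f)"
    and "\<theta> \<in> U \<Longrightarrow> (pdiff k f \<theta>)\<^sup>2 \<le> c\<^sup>2 / \<omega>0 ^ 4 * \<bar>pdiff k m \<theta> * pdiff k m \<theta>\<bar>"
proof -
  have pos: "0 < m \<theta>" "\<theta> \<in> \<Omega>" if "\<theta> \<in> U" for \<theta>
    using that U low[of \<theta>] \<omega>0 interior_subset by force+
  have der: "(f has_derivative (\<lambda>h. - (c * (gradient m \<theta> \<bullet> h) / (m \<theta>)\<^sup>2))) (at \<theta>)" if \<theta>: "\<theta> \<in> U" for \<theta>
  proof -
    have "m differentiable (at \<theta>)" using C2 \<theta> U by (auto simp: C2_on_def)
    from differentiable_gradient(1)[OF this]
    have "((\<lambda>x. c / m x) has_derivative (\<lambda>h. (0 * m \<theta> - c * (gradient m \<theta> \<bullet> h)) / (m \<theta> * m \<theta>))) (at \<theta>)"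
      using pos[OF \<theta>] by (intro has_derivative_divide') auto
    then have "((\<lambda>x. c / m x) has_derivative (\<lambda>h. - (c * (gradient m \<theta> \<bullet> h) / (m \<theta>)\<^sup>2))) (at \<theta>)"
      by (simp add: power2_eq_square)
    then show ?thesis
      by (rule has_derivative_transform_within_open[OF _ U(1) \<theta>]) (use pos in \<open>simp add: f_def\<close>)
  qed
  then show "\<theta> \<in> U \<Longrightarrow> f differentiable (at \<theta>)" by (auto simp: differentiable_def)
  show pd: "pdiff k f \<theta> = - (c * pdiff k m \<theta> / (m \<theta>)\<^sup>2)" if "\<theta> \<in> U" for \<theta>
    using pdiff_eq_derivative[OF der[OF that], of k] by (simp add: gradient_def inner_axis)
  have "continuous_on U m" "continuous_on U (pdiff k m)"
    using C2 U by (auto simp: C2_on_def intro!: continuous_at_imp_continuous_on differentiable_imp_continuous_within)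
  then have "continuous_on U (\<lambda>\<theta>. - (c * pdiff k m \<theta> / (m \<theta>)\<^sup>2))"
    using pos(1) by (intro continuous_intros) (metis less_numeral_extra(3) power_eq_0_iff)+
  then show "continuous_on U (pdiff k f)" by (rule continuous_on_eq) (simp add: pd)
  show "(pdiff k f \<theta>)\<^sup>2 \<le> c\<^sup>2 / \<omega>0 ^ 4 * \<bar>pdiff k m \<theta> * pdiff k m \<theta>\<bar>" if \<theta>: "\<theta> \<in> U"
  proof -
    have "\<omega>0 ^ 4 \<le> (m \<theta>) ^ 4" using low pos[OF \<theta>] \<omega>0 by (intro power_mono) auto
    moreover have "(pdiff k f \<theta>)\<^sup>2 = c\<^sup>2 * (pdiff k m \<theta>)\<^sup>2 / (m \<theta>) ^ 4"
      by (simp add: pd[OF \<theta>] power_divide power_mult_distrib flip: power_mult)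
    ultimately have "(pdiff k f \<theta>)\<^sup>2 \<le> c\<^sup>2 * (pdiff k m \<theta>)\<^sup>2 / \<omega>0 ^ 4"
      using \<omega>0 by (simp add: frac_le)
    then show ?thesis by (simp add: power2_eq_square)
  qed
qed

text \<open>Position \<open>0\<close> of a two-sided path is the present and
  \<open>- 1 - int n\<close> its past, so that a single path carries both the observation and the
  argument of \<open>\<mu>\<close>.\<close>

definition path_past :: "(int \<Rightarrow> 'b) \<Rightarrow> nat \<Rightarrow> 'b" where
  "path_past p = (\<lambda>n. p (- 1 - int n))"

definition dense_set :: "(real ^ 'n::finite) set" where
  "dense_set = (SOME D. countable D \<and> (\<forall>V. open V \<longrightarrow> V \<noteq> {} \<longrightarrow> (\<exists>d\<in>D. d \<in> V)))"

lemma dense_set: "countable (dense_set :: (real ^ 'n::finite) set)"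
  "open V \<Longrightarrow> V \<noteq> {} \<Longrightarrow> \<exists>d\<in>(dense_set :: (real ^ 'n) set). d \<in> V"
  using someI_ex[OF countable_dense_exists_vec[where 'n = 'n]] unfolding dense_set_def[symmetric] by auto

locale vmem = prob_space M for M :: "'w measure" +
  fixes x \<epsilon> :: "int \<Rightarrow> 'w \<Rightarrow> real ^ 'd::finite"
    and \<mu> :: "real ^ 'k::finite \<Rightarrow> (nat \<Rightarrow> real ^ 'd) \<Rightarrow> real ^ 'd"
    and \<theta>0 :: "real ^ 'k" and \<Omega>0 U :: "(real ^ 'k) set" and \<omega>0 :: real
  assumes x_nonneg: "\<And>t. AE w in M. \<forall>j. 0 \<le> x t w $ j"
    and \<mu>_measurable: "\<And>\<theta>. \<theta> \<in> \<Omega>0 \<Longrightarrow> \<mu> \<theta> \<in> borel_measurable (PiM UNIV (\<lambda>_. borel))"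
    and model: "\<And>t. AE w in M. x t w = hadamard_prod (\<mu> \<theta>0 (past x (t - 1) w)) (\<epsilon> t w)"
    and stationary: "strictly_stationary M x"
    and ergodic: "ergodic_process M x"
    and \<omega>0: "0 < \<omega>0"
    and \<mu>_lower: "AE w in M. \<forall>t. \<forall>\<theta>\<in>\<Omega>0. \<forall>j. \<omega>0 \<le> \<mu> \<theta> (past x t w) $ j"
    and \<mu>_C2: "AE w in M. \<forall>t j. C2_on (interior \<Omega>0) (\<lambda>\<theta>. \<mu> \<theta> (past x t w) $ j)"
    and U: "open U" "\<theta>0 \<in> U" "U \<subseteq> interior \<Omega>0"
    and gradient_moment: "\<And>t j k l. (\<integral>\<^sup>+w. ennreal ((norm (x t w))\<^sup>2) * (SUP \<theta>\<in>U. ennreal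
           \<bar>pdiff k (\<lambda>\<eta>. \<mu> \<eta> (past x (t - 1) w) $ j) \<theta>
             * pdiff l (\<lambda>\<eta>. \<mu> \<eta> (past x (t - 1) w) $ j) \<theta>\<bar>) \<partial>M) < \<infinity>"
begin

abbreviation path_space :: "(int \<Rightarrow> real ^ 'd) measure" where
  "path_space \<equiv> PiM UNIV (\<lambda>_. borel)"

definition path :: "int \<Rightarrow> 'w \<Rightarrow> int \<Rightarrow> real ^ 'd" where
  "path t w = (\<lambda>s. x (s + t) w)"

text \<open>The value zero outside \<open>\<Omega>0\<close> keeps this measurable in the path for
  every parameter, as required by the countable suprema and by the difference quotients, whose
  shifted arguments may leave \<open>\<Omega>0\<close>.\<close>

definition ratio :: "'d \<Rightarrow> real ^ 'k \<Rightarrow> (int \<Rightarrow> real ^ 'd) \<Rightarrow> real" where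
  "ratio j \<theta> p = (if \<theta> \<in> \<Omega>0 then p 0 $ j / \<mu> \<theta> (path_past p) $ j else 0)"

definition ratio_vec :: "real ^ 'k \<Rightarrow> (int \<Rightarrow> real ^ 'd) \<Rightarrow> real ^ 'd" where
  "ratio_vec \<theta> p = (\<chi> j. ratio j \<theta> p)"

definition ratio_grad :: "'d \<Rightarrow> (int \<Rightarrow> real ^ 'd) \<Rightarrow> real ^ 'k" where
  "ratio_grad j p = seq_gradient (\<lambda>\<theta>. ratio j \<theta> p) \<theta>0"

definition radius :: real where
  "radius = (SOME r. 0 < r \<and> ball \<theta>0 r \<subseteq> U)"

definition grad_bound :: "(int \<Rightarrow> real ^ 'd) \<Rightarrow> ennreal" where
  "grad_bound p = (\<Sum>j\<in>UNIV. gradient_bound dense_set U (\<lambda>\<theta>. ratio j \<theta> p))"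

definition remainder :: "real \<Rightarrow> (int \<Rightarrow> real ^ 'd) \<Rightarrow> ennreal" where
  "remainder \<delta> p = (\<Sum>j\<in>UNIV. taylor_remainder dense_set \<theta>0 \<delta> (\<lambda>\<theta>. ratio j \<theta> p))"

text \<open>The gradient of \<open>\<theta> \<mapsto> exp (- u \<bullet> (x\<^sub>t \<oslash> \<mu>\<^sub>t(\<theta>)))\<close> at \<open>\<theta>0\<close>.\<close>

definition score :: "real ^ 'd \<Rightarrow> (int \<Rightarrow> real ^ 'd) \<Rightarrow> real ^ 'k" where
  "score u p = (- exp (- (u \<bullet> ratio_vec \<theta>0 p))) *\<^sub>R (\<Sum>j\<in>UNIV. (u $ j) *\<^sub>R ratio_grad j p)"

lemma radius: "0 < radius" "ball \<theta>0 radius \<subseteq> U"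
proof -
  have "\<exists>r. 0 < r \<and> ball \<theta>0 r \<subseteq> U" using U openE by metis
  from someI_ex[OF this] show "0 < radius" "ball \<theta>0 radius \<subseteq> U" unfolding radius_def[symmetric] by auto
qed

lemma U_subset: "U \<subseteq> \<Omega>0" using U(3) interior_subset by blast

lemma x_measurable [measurable]: "x t \<in> borel_measurable M"
  using stationary by (rule strictly_stationary_measurable)

lemma path_measurable' [measurable]: "path t \<in> measurable M path_space"
  unfolding path_def by (rule path_measurable) simp

lemma path_past_path: "path_past (path t w) = past x (t - 1) w"
  unfolding path_past_def path_def past_def
proof
  fix n
  have "- 1 - int n + t = t - 1 - int n" by simp
  then show "x (- 1 - int n + t) w = x (t - 1 - int n) w" by (simp only:)
qed

lemma ratio_path: "\<theta> \<in> \<Omega>0 \<Longrightarrow> ratio j \<theta> (path t w) = x t w $ j / \<mu> \<theta> (past x (t - 1) w) $ j"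
  by (simp add: ratio_def path_past_path) (simp add: path_def)

lemma path_past_measurable: "path_past \<in> measurable path_space (PiM UNIV (\<lambda>_::nat. borel))"
  unfolding path_past_def by (rule shift_measurable)

lemma vec_nth_measurable: "(\<lambda>y::real ^ 'n::finite. y $ j) \<in> borel_measurable borel"
  by (intro borel_measurable_continuous_onI continuous_intros)

lemma ratio_measurable: "(\<lambda>p. ratio j \<theta> p) \<in> borel_measurable path_space"
proof (cases "\<theta> \<in> \<Omega>0")
  case True
  have "(\<lambda>p. p 0 $ j) \<in> borel_measurable path_space"
    by (rule measurable_compose[OF _ vec_nth_measurable]) simp
  moreover have "(\<lambda>p. \<mu> \<theta> (path_past p) $ j) \<in> borel_measurable path_space"
    by (rule measurable_compose[OF measurable_compose[OF path_past_measurable \<mu>_measurable[OF True]] vec_nth_measurable])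
  ultimately show ?thesis using True by (simp add: ratio_def)
qed (simp add: ratio_def)

lemma ratio_vec_measurable [measurable]: "ratio_vec \<theta> \<in> borel_measurable path_space"
  unfolding ratio_vec_def by (intro vec_lambda_measurable ratio_measurable)

lemma ratio_grad_measurable [measurable]: "ratio_grad j \<in> borel_measurable path_space"
  unfolding ratio_grad_def by (intro seq_gradient_measurable ratio_measurable)

lemma grad_bound_measurable [measurable]: "grad_bound \<in> borel_measurable path_space"
  unfolding grad_bound_def by (intro borel_measurable_sum gradient_bound_measurable dense_set ratio_measurable)

lemma remainder_measurable [measurable]: "remainder \<delta> \<in> borel_measurable path_space"
  unfolding remainder_def by (intro borel_measurable_sum taylor_remainder_measurable dense_set ratio_measurable)

section \<open>The law of the observed path and its ergodicity\<close>

definition law :: "(int \<Rightarrow> real ^ 'd) measure" where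
  "law = distr M path_space (path 0)"

lemma distr_path: "distr M path_space (path t) = law"
  using stationary unfolding law_def path_def strictly_stationary_def by simp

lemma nn_integral_path: "F \<in> borel_measurable path_space \<Longrightarrow> (\<integral>\<^sup>+w. F (path t w) \<partial>M) = (\<integral>\<^sup>+p. F p \<partial>law)"
  by (subst distr_path[symmetric, of t], subst nn_integral_distr) auto

lemma integral_path:
  fixes F :: "(int \<Rightarrow> real ^ 'd) \<Rightarrow> real"
  shows "F \<in> borel_measurable path_space \<Longrightarrow> (\<integral>w. F (path t w) \<partial>M) = (\<integral>p. F p \<partial>law)"
  by (subst distr_path[symmetric, of t], subst integral_distr) auto

lemma integrable_path:
  fixes F :: "(int \<Rightarrow> real ^ 'd) \<Rightarrow> real"
  shows "F \<in> borel_measurable path_space \<Longrightarrow> integrable M (\<lambda>w. F (path t w)) \<longleftrightarrow> integrable law F"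
  by (subst distr_path[symmetric, of t], subst integrable_distr_eq) auto

sublocale law: ergodic_transformation law "\<lambda>p s. p (s + 1)"
proof -
  have sets: "sets law = sets path_space" by (simp add: law_def)
  interpret L: prob_space law unfolding law_def by (rule prob_space_distr) simp
  have tm: "(\<lambda>p (s::int). p (s + 1)) \<in> measurable path_space path_space" by (rule shift_measurable)
  show "ergodic_transformation law (\<lambda>p s. p (s + 1))"
  proof
    show "(\<lambda>p s. p (s + 1)) \<in> measurable law law" using tm by (simp add: measurable_cong_sets[OF sets sets])
    have "distr law law (\<lambda>p s. p (s + 1)) = distr law path_space (\<lambda>p s. p (s + 1))"
      by (rule distr_cong) (auto simp: sets)
    also have "\<dots> = distr M path_space ((\<lambda>p s. p (s + 1)) \<circ> path 0)"
      unfolding law_def by (subst distr_distr[OF tm]) auto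
    also have "(\<lambda>p s. p (s + 1)) \<circ> path 0 = path 1" by (auto simp: path_def)
    finally show "distr law law (\<lambda>p s. p (s + 1)) = law" using distr_path by simp
  next
    fix A assume A: "A \<in> sets law" "(\<lambda>p s. p (s + 1)) -` A \<inter> space law = A"
    have "space law = UNIV" by (simp add: law_def space_PiM)
    then have inv: "{p. (\<lambda>t. p (t + 1)) \<in> A} = A" using A(2) by auto
    have "measure law A = prob {w\<in>space M. (\<lambda>t. x t w) \<in> A}"
      unfolding law_def using A(1) sets by (subst measure_distr) (auto simp: path_def vimage_def intro!: arg_cong[where f = prob])
    then show "L.prob A \<in> {0, 1}" using ergodic A(1) sets inv unfolding ergodic_process_def by simp
  qed
qed

lemma lln:
  assumes F: "integrable law F"
  shows "AE w in M. (\<lambda>T. (\<Sum>t=1..T. F (path (int t) w)) / real T) \<longlonglongrightarrow> (\<integral>p. F p \<partial>law)"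
proof -
  have Fm: "F \<in> borel_measurable path_space" using F by (auto simp: law_def)
  have iter: "((\<lambda>p s. p (s + 1)) ^^ k) p = (\<lambda>s. p (s + int k))" for k and p :: "int \<Rightarrow> real ^ 'd"
    by (induction k arbitrary: p) (auto simp: funpow_swap1 algebra_simps)
  \<comment> \<open>Birkhoff sums start at shift zero while the average starts at
    \<open>t = 1\<close>; composing with one shift changes neither integrability nor the
    mean.\<close>
  let ?F = "\<lambda>p. F (\<lambda>s. p (s + 1))"
  have F': "integrable law ?F" "(\<integral>p. ?F p \<partial>law) = (\<integral>p. F p \<partial>law)"
    using law.integrable_comp_tau[OF F] law.integral_comp_tau[of F] F by auto
  have "AE p in law. (\<lambda>n. (\<Sum>k<n. ?F (\<lambda>s. p (s + int k))) / real n) \<longlonglongrightarrow> (\<integral>p. F p \<partial>law)"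
    using law.birkhoff[OF F'(1)] unfolding F'(2) iter .
  then have "AE w in M. (\<lambda>n. (\<Sum>k<n. ?F (\<lambda>s. path 0 w (s + int k))) / real n) \<longlonglongrightarrow> (\<integral>p. F p \<partial>law)"
    unfolding law_def by (rule AE_distrD[rotated]) simp
  moreover have "(\<Sum>k<n. ?F (\<lambda>s. path 0 w (s + int k))) = (\<Sum>t=1..n. F (path (int t) w))" for n w
  proof -
    have "(\<Sum>t=1..n. F (path (int t) w)) = (\<Sum>k<n. F (path (int (Suc k)) w))"
      by (rule sum.reindex_bij_witness[of _ Suc "\<lambda>t. t - 1"]) auto
    also have "\<dots> = (\<Sum>k<n. ?F (\<lambda>s. path 0 w (s + int k)))"
    proof (rule sum.cong[OF refl])
      fix k
      have "s + int (Suc k) = s + 1 + int k + 0" for s by simp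
      then have "path (int (Suc k)) w = (\<lambda>s. path 0 w (s + 1 + int k))" unfolding path_def by (simp only:)
      then show "F (path (int (Suc k)) w) = ?F (\<lambda>s. path 0 w (s + int k))" by simp
    qed
    finally show ?thesis by simp
  qed
  ultimately show ?thesis by simp
qed

text \<open>One null set serves all times, components and parameters. The bound on squared
  derivatives is by the quantity whose integral the moment hypothesis makes finite; the explicit
  derivative at \<open>\<theta>0\<close> serves to recognise \<open>Gamma_mat\<close>.\<close>

lemma ratio_C1:
  "AE w in M. \<forall>t j. C1_function (\<lambda>\<theta>. ratio j \<theta> (path t w)) U dense_set \<theta>0 radius \<and>
     (\<forall>k. \<forall>\<theta>\<in>U. ennreal ((pdiff k (\<lambda>\<theta>. ratio j \<theta> (path t w)) \<theta>)\<^sup>2)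
        \<le> ennreal (1 / \<omega>0 ^ 4) * (ennreal ((norm (x t w))\<^sup>2) * (SUP \<theta>\<in>U. ennreal
           \<bar>pdiff k (\<lambda>\<eta>. \<mu> \<eta> (past x (t - 1) w) $ j) \<theta> * pdiff k (\<lambda>\<eta>. \<mu> \<eta> (past x (t - 1) w) $ j) \<theta>\<bar>)))
     \<and> pdiff k (\<lambda>\<theta>. ratio j \<theta> (path t w)) \<theta>0
        = - (x t w $ j * pdiff k (\<lambda>\<theta>. \<mu> \<theta> (past x (t - 1) w) $ j) \<theta>0 / (\<mu> \<theta>0 (past x (t - 1) w) $ j)\<^sup>2)"
  using \<mu>_lower \<mu>_C2
proof (eventually_elim, intro allI)
  fix w t j
  assume low: "\<forall>t. \<forall>\<theta>\<in>\<Omega>0. \<forall>j. \<omega>0 \<le> \<mu> \<theta> (past x t w) $ j" and C2: "\<forall>t j. C2_on (interior \<Omega>0) (\<lambda>\<theta>. \<mu> \<theta> (past x t w) $ j)"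
  let ?m = "\<lambda>\<theta>. \<mu> \<theta> (past x (t - 1) w) $ j" and ?f = "\<lambda>\<theta>. ratio j \<theta> (path t w)"
  have f: "?f = (\<lambda>\<theta>. if \<theta> \<in> \<Omega>0 then x t w $ j / ?m \<theta> else 0)"
    by (auto simp: fun_eq_iff ratio_path) (simp add: ratio_def)
  have C2m: "C2_on (interior \<Omega>0) ?m" and lowm: "\<And>\<theta>. \<theta> \<in> \<Omega>0 \<Longrightarrow> \<omega>0 \<le> ?m \<theta>" using low C2 by auto
  have Q1: "?f differentiable (at \<theta>)" and Q2: "pdiff k ?f \<theta> = - (x t w $ j * pdiff k ?m \<theta> / (?m \<theta>)\<^sup>2)"
    and Q4: "(pdiff k ?f \<theta>)\<^sup>2 \<le> (x t w $ j)\<^sup>2 / \<omega>0 ^ 4 * \<bar>pdiff k ?m \<theta> * pdiff k ?m \<theta>\<bar>" if \<theta>: "\<theta> \<in> U" for \<theta> k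
    unfolding f by (rule quotient_C1[of \<Omega>0]; use C2m lowm \<omega>0 U \<theta> in blast)+
  have Q3: "continuous_on U (pdiff k ?f)" for k
    unfolding f by (rule quotient_C1[of \<Omega>0]; use C2m lowm \<omega>0 U in blast)
  have C1: "C1_function ?f U dense_set \<theta>0 radius"
    using U(1) radius(2,1) Q1 Q3 dense_set(2) by (rule C1_function.intro)
  have bound: "ennreal ((pdiff k ?f \<theta>)\<^sup>2) \<le> ennreal (1 / \<omega>0 ^ 4) * (ennreal ((norm (x t w))\<^sup>2) * (SUP \<theta>\<in>U. ennreal \<bar>pdiff k ?m \<theta> * pdiff k ?m \<theta>\<bar>))"
    if \<theta>: "\<theta> \<in> U" for k \<theta>
  proof -
    have "(x t w $ j)\<^sup>2 \<le> (norm (x t w))\<^sup>2"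
      using component_le_norm_cart[of "x t w" j] by (simp add: abs_le_square_iff[symmetric])
    then have "(x t w $ j)\<^sup>2 / \<omega>0 ^ 4 * \<bar>pdiff k ?m \<theta> * pdiff k ?m \<theta>\<bar> \<le> (norm (x t w))\<^sup>2 / \<omega>0 ^ 4 * \<bar>pdiff k ?m \<theta> * pdiff k ?m \<theta>\<bar>"
      using \<omega>0 by (intro mult_right_mono divide_right_mono) auto
    with Q4[OF \<theta>, of k] have "ennreal ((pdiff k ?f \<theta>)\<^sup>2) \<le> ennreal (1 / \<omega>0 ^ 4 * ((norm (x t w))\<^sup>2 * \<bar>pdiff k ?m \<theta> * pdiff k ?m \<theta>\<bar>))"
      by (intro ennreal_leI) simp
    also have "\<dots> = ennreal (1 / \<omega>0 ^ 4) * (ennreal ((norm (x t w))\<^sup>2) * ennreal \<bar>pdiff k ?m \<theta> * pdiff k ?m \<theta>\<bar>)"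
    proof -
      have em: "ennreal (c * (a * b)) = ennreal c * (ennreal a * ennreal b)" if "0 \<le> c" "0 \<le> a" "0 \<le> b" for a b c
        using that by (simp add: ennreal_mult)
      show ?thesis by (rule em) (use \<omega>0 in auto)
    qed
    also have "\<dots> \<le> ennreal (1 / \<omega>0 ^ 4) * (ennreal ((norm (x t w))\<^sup>2) * (SUP \<theta>\<in>U. ennreal \<bar>pdiff k ?m \<theta> * pdiff k ?m \<theta>\<bar>))"
      using \<theta> by (intro mult_left_mono SUP_upper) auto
    finally show ?thesis .
  qed
  show "C1_function ?f U dense_set \<theta>0 radius \<and>
     (\<forall>k. \<forall>\<theta>\<in>U. ennreal ((pdiff k ?f \<theta>)\<^sup>2) \<le> ennreal (1 / \<omega>0 ^ 4) * (ennreal ((norm (x t w))\<^sup>2) * (SUP \<theta>\<in>U. ennreal \<bar>pdiff k ?m \<theta> * pdiff k ?m \<theta>\<bar>)))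
     \<and> pdiff k ?f \<theta>0 = - (x t w $ j * pdiff k ?m \<theta>0 / (?m \<theta>0)\<^sup>2)"
    using C1 bound Q2[OF U(2)] by blast
qed

lemma grad_bound_finite: "(\<integral>\<^sup>+p. grad_bound p \<partial>law) < \<infinity>"
proof -
  have comp: "(\<integral>\<^sup>+w. (SUP \<theta>\<in>dense_set \<inter> U. ennreal ((seq_pdiff k (\<lambda>\<theta>. ratio j \<theta> (path 0 w)) \<theta>)\<^sup>2)) \<partial>M) < \<infinity>" for j k
  proof -
    let ?S = "\<lambda>w. (SUP \<theta>\<in>U. ennreal \<bar>pdiff k (\<lambda>\<eta>. \<mu> \<eta> (past x (0 - 1) w) $ j) \<theta> * pdiff k (\<lambda>\<eta>. \<mu> \<eta> (past x (0 - 1) w) $ j) \<theta>\<bar>)"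
    have "(\<integral>\<^sup>+w. (SUP \<theta>\<in>dense_set \<inter> U. ennreal ((seq_pdiff k (\<lambda>\<theta>. ratio j \<theta> (path 0 w)) \<theta>)\<^sup>2)) \<partial>M)
      \<le> (\<integral>\<^sup>+w. ennreal (1 / \<omega>0 ^ 4) * (ennreal ((norm (x 0 w))\<^sup>2) * ?S w) \<partial>M)"
    proof (rule nn_integral_mono_AE)
      show "AE w in M. (SUP \<theta>\<in>dense_set \<inter> U. ennreal ((seq_pdiff k (\<lambda>\<theta>. ratio j \<theta> (path 0 w)) \<theta>)\<^sup>2))
        \<le> ennreal (1 / \<omega>0 ^ 4) * (ennreal ((norm (x 0 w))\<^sup>2) * ?S w)"
        using ratio_C1[of k]
      proof eventually_elim
        case (elim w)
        then have "C1_function (\<lambda>\<theta>. ratio j \<theta> (path 0 w)) U dense_set \<theta>0 radius" by blast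
        then show ?case
          unfolding C1_function.SUP_seq_pdiff[OF \<open>C1_function _ _ _ _ _\<close>]
          by (intro SUP_least) (use elim in blast)
      qed
    qed
    \<comment> \<open>The integrand contains a supremum over all of \<open>U\<close>, whose
      measurability is unknown, so the constant is extracted by an inequality.\<close>
    also have "\<dots> \<le> ennreal (1 / \<omega>0 ^ 4) * (\<integral>\<^sup>+w. ennreal ((norm (x 0 w))\<^sup>2) * ?S w \<partial>M)"
      using \<omega>0 by (intro nn_integral_cmult_le) simp
    also have "\<dots> < \<infinity>" using gradient_moment[where t = 0 and j = j and k = k and l = k] by (simp add: ennreal_mult_less_top)
    finally show ?thesis .
  qed
  have m: "(\<lambda>w. SUP \<theta>\<in>dense_set \<inter> U. ennreal ((seq_pdiff k (\<lambda>\<theta>. ratio j \<theta> (path 0 w)) \<theta>)\<^sup>2)) \<in> borel_measurable M" for j k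
    by (intro borel_measurable_SUP countable_Int1 dense_set measurable_compose[OF _ measurable_ennreal]
        borel_measurable_power seq_pdiff_measurable measurable_compose[OF path_measurable' ratio_measurable])
  have "(\<integral>\<^sup>+p. grad_bound p \<partial>law) = (\<integral>\<^sup>+w. grad_bound (path 0 w) \<partial>M)" by (simp add: nn_integral_path)
  also have "\<dots> = (\<Sum>j\<in>UNIV. \<Sum>k\<in>UNIV. (\<integral>\<^sup>+w. (SUP \<theta>\<in>dense_set \<inter> U. ennreal ((seq_pdiff k (\<lambda>\<theta>. ratio j \<theta> (path 0 w)) \<theta>)\<^sup>2)) \<partial>M))"
    unfolding grad_bound_def gradient_bound_def using m by (simp add: nn_integral_sum)
  also have "\<dots> < \<infinity>" using comp by (simp add: less_top)
  finally show ?thesis .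
qed

lemma remainder_tendsto:
  assumes \<delta>: "\<delta> \<longlonglongrightarrow> 0" "\<And>n. \<delta> n \<le> radius"
  shows "(\<lambda>n. \<integral>\<^sup>+p. remainder (\<delta> n) p \<partial>law) \<longlonglongrightarrow> 0"
proof -
  have meas: "(\<lambda>w. ratio j \<theta> (path 0 w)) \<in> borel_measurable M" for j \<theta>
    by (rule measurable_compose[OF path_measurable' ratio_measurable])
  have "(\<integral>\<^sup>+p. remainder (\<delta> n) p \<partial>law) = (\<Sum>j\<in>UNIV. \<integral>\<^sup>+w. taylor_remainder dense_set \<theta>0 (\<delta> n) (\<lambda>\<theta>. ratio j \<theta> (path 0 w)) \<partial>M)" for n
  proof -
    have "(\<integral>\<^sup>+p. remainder (\<delta> n) p \<partial>law) = (\<integral>\<^sup>+w. remainder (\<delta> n) (path 0 w) \<partial>M)" by (simp add: nn_integral_path)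
    moreover have "(\<lambda>w. taylor_remainder dense_set \<theta>0 (\<delta> n) (\<lambda>\<theta>. ratio j \<theta> (path 0 w))) \<in> borel_measurable M" for j
      by (rule taylor_remainder_measurable[OF dense_set(1) meas])
    ultimately show ?thesis unfolding remainder_def by (simp add: nn_integral_sum)
  qed
  moreover have "(\<lambda>n. \<Sum>j\<in>UNIV. \<integral>\<^sup>+w. taylor_remainder dense_set \<theta>0 (\<delta> n) (\<lambda>\<theta>. ratio j \<theta> (path 0 w)) \<partial>M) \<longlonglongrightarrow> (\<Sum>j\<in>(UNIV::'d set). 0)"
  proof (intro tendsto_sum taylor_remainder_integral_tendsto[OF dense_set(1) meas _ radius(1) _ \<delta>])
    fix j
    show "AE w in M. C1_function (\<lambda>\<theta>. ratio j \<theta> (path 0 w)) U dense_set \<theta>0 radius"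
      using ratio_C1[of undefined] by eventually_elim blast
    have "(\<integral>\<^sup>+w. gradient_bound dense_set U (\<lambda>\<theta>. ratio j \<theta> (path 0 w)) \<partial>M) \<le> (\<integral>\<^sup>+w. grad_bound (path 0 w) \<partial>M)"
      unfolding grad_bound_def by (intro nn_integral_mono member_le_sum) auto
    also have "\<dots> < \<infinity>" using grad_bound_finite by (simp add: nn_integral_path)
    finally show "(\<integral>\<^sup>+w. gradient_bound dense_set U (\<lambda>\<theta>. ratio j \<theta> (path 0 w)) \<partial>M) < \<infinity>" .
  qed
  ultimately show ?thesis by simp
qed

end

text \<open>By convexity the tangent at \<open>s0\<close> lies below the function, and the tangent
  at \<open>s\<close> bounds the remainder by \<open>(exp (- s0) - exp (- s)) * (s - s0)\<close>.
  Nonnegative arguments make the first factor at most \<open>\<bar>s - s0\<bar>\<close> in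
  modulus.\<close>

lemma exp_neg_taylor_bound:
  fixes s s0 :: real
  assumes "0 \<le> s" "0 \<le> s0"
  shows "\<bar>exp (- s) - exp (- s0) + exp (- s0) * (s - s0)\<bar> \<le> (s - s0)\<^sup>2"
proof -
  have lower: "0 \<le> exp (- s) - exp (- s0) + exp (- s0) * (s - s0)"
  proof -
    have "exp (- s) - exp (- s0) + exp (- s0) * (s - s0) = exp (- s0) * (exp (- (s - s0)) - (1 + - (s - s0)))"
      by (simp add: algebra_simps flip: exp_add)
    also have "0 \<le> \<dots>" using exp_ge_add_one_self[of "- (s - s0)"] by (intro mult_nonneg_nonneg) auto
    finally show ?thesis .
  qed
  have "exp (- s) * (s - s0) \<le> exp (- s0) - exp (- s)"
  proof -
    have "exp (- s0) - exp (- s) - exp (- s) * (s - s0) = exp (- s) * (exp (s - s0) - (1 + (s - s0)))"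
      by (simp add: algebra_simps flip: exp_add)
    also have "0 \<le> \<dots>" using exp_ge_add_one_self[of "s - s0"] by (intro mult_nonneg_nonneg) auto
    finally show ?thesis by simp
  qed
  then have "exp (- s) - exp (- s0) + exp (- s0) * (s - s0) \<le> (exp (- s0) - exp (- s)) * (s - s0)"
    by (simp add: algebra_simps)
  also have "\<dots> \<le> \<bar>exp (- s0) - exp (- s)\<bar> * \<bar>s - s0\<bar>" by (simp flip: abs_mult)
  also have "\<dots> \<le> \<bar>s0 - s\<bar> * \<bar>s - s0\<bar>"
    using assms by (intro mult_right_mono abs_exp_neg_diff_le) auto
  also have "\<dots> = (s - s0)\<^sup>2" by (simp add: power2_eq_square abs_minus_commute flip: abs_mult)
  finally show ?thesis using lower by simp
qed

section \<open>Pathwise expansion in the parameter\<close>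

lemma norm_vec_squared: "(norm (v :: real ^ 'n::finite))\<^sup>2 = (\<Sum>k\<in>UNIV. (v $ k)\<^sup>2)"
  by (simp add: norm_vec_def L2_set_def sum_nonneg)

lemma enn2real_sum': "(\<And>i. i \<in> A \<Longrightarrow> f i < top) \<Longrightarrow> enn2real (sum f A) = (\<Sum>i\<in>A. enn2real (f i))"
proof (induction A rule: infinite_finite_induct)
  case (insert i A)
  then show ?case by (simp add: enn2real_plus)
qed auto

lemma pos_orthant_open: "open (pos_orthant :: (real ^ 'd::finite) set)"
proof -
  have eq: "pos_orthant = (\<Inter>i. {u::real ^ 'd. 0 < u $ i})" by (auto simp: pos_orthant_def)
  show ?thesis unfolding eq by (intro open_INT ballI open_Collect_less continuous_intros) auto
qed

lemma inner_nonneg_orthant: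
  assumes "u \<in> pos_orthant" "\<And>j. 0 \<le> (a :: real ^ 'd::finite) $ j"
  shows "0 \<le> u \<bullet> a"
proof -
  have "0 \<le> u $ j" for j using assms(1) less_imp_le by (auto simp: pos_orthant_def)
  then show ?thesis unfolding inner_vec_def using assms(2) by (auto intro!: sum_nonneg mult_nonneg_nonneg)
qed

context vmem
begin

text \<open>Conditions on a single path under which the expansions hold simultaneously for all
  \<open>u\<close> in the orthant and all parameters near \<open>\<theta>0\<close>; almost every
  path satisfies them at all times.\<close>

definition regular :: "(int \<Rightarrow> real ^ 'd) \<Rightarrow> bool" where
  "regular p \<longleftrightarrow> (\<forall>j. \<forall>\<theta>\<in>\<Omega>0. 0 \<le> ratio j \<theta> p) \<and> grad_bound p < \<infinity> \<and>
     (\<forall>j. C1_function (\<lambda>\<theta>. ratio j \<theta> p) U dense_set \<theta>0 radius)"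

lemma \<theta>0_in: "\<theta>0 \<in> \<Omega>0" using U U_subset by auto

lemma AE_path_nn_finite:
  assumes "F \<in> borel_measurable path_space" "(\<integral>\<^sup>+p. F p \<partial>law) < \<infinity>"
  shows "AE w in M. F (path t w) < (\<infinity>::ennreal)"
proof -
  have m: "(\<lambda>w. F (path t w)) \<in> borel_measurable M" by (rule measurable_compose[OF path_measurable' assms(1)])
  have "(\<integral>\<^sup>+w. F (path t w) \<partial>M) \<noteq> \<infinity>" using assms by (simp add: nn_integral_path)
  from nn_integral_PInf_AE[OF m this] show ?thesis by eventually_elim (simp add: less_top)
qed

lemma ratio_vec_eq: "AE w in M. \<forall>t. ratio_vec \<theta>0 (path t w) = \<epsilon> t w"
proof -
  have "AE w in M. \<forall>t. x t w = hadamard_prod (\<mu> \<theta>0 (past x (t - 1) w)) (\<epsilon> t w)"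
    using model by (subst AE_all_countable) auto
  with \<mu>_lower show ?thesis
  proof (eventually_elim, intro allI)
    fix w t
    assume low: "\<forall>t. \<forall>\<theta>\<in>\<Omega>0. \<forall>j. \<omega>0 \<le> \<mu> \<theta> (past x t w) $ j"
      and eq: "\<forall>t. x t w = hadamard_prod (\<mu> \<theta>0 (past x (t - 1) w)) (\<epsilon> t w)"
    have "ratio j \<theta>0 (path t w) = \<epsilon> t w $ j" for j
    proof -
      have "\<omega>0 \<le> \<mu> \<theta>0 (past x (t - 1) w) $ j" using low \<theta>0_in by blast
      then have "\<mu> \<theta>0 (past x (t - 1) w) $ j \<noteq> 0" using \<omega>0 by auto
      moreover have "x t w $ j = \<mu> \<theta>0 (past x (t - 1) w) $ j * \<epsilon> t w $ j"
        using eq[rule_format, of t] by (simp add: hadamard_prod_def)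
      ultimately show ?thesis unfolding ratio_path[OF \<theta>0_in] by simp
    qed
    then show "ratio_vec \<theta>0 (path t w) = \<epsilon> t w" by (simp add: ratio_vec_def vec_eq_iff)
  qed
qed

lemma AE_regular: "AE w in M. \<forall>t. regular (path t w)"
proof -
  have 1: "AE w in M. \<forall>t. \<forall>j. 0 \<le> x t w $ j" using x_nonneg by (subst AE_all_countable) auto
  have 2: "AE w in M. \<forall>t::int. grad_bound (path t w) < \<infinity>"
    using AE_path_nn_finite[OF grad_bound_measurable grad_bound_finite] by (subst AE_all_countable) auto
  have 3: "AE w in M. \<forall>t j. C1_function (\<lambda>\<theta>. ratio j \<theta> (path t w)) U dense_set \<theta>0 radius"
    using ratio_C1[of undefined] by eventually_elim blast
  show ?thesis using 1 2 \<mu>_lower 3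
  proof (eventually_elim, intro allI)
    fix w t
    assume a: "\<forall>t j. 0 \<le> x t w $ j" "\<forall>t::int. grad_bound (path t w) < \<infinity>"
      "\<forall>t. \<forall>\<theta>\<in>\<Omega>0. \<forall>j. \<omega>0 \<le> \<mu> \<theta> (past x t w) $ j"
      "\<forall>t j. C1_function (\<lambda>\<theta>. ratio j \<theta> (path t w)) U dense_set \<theta>0 radius"
    have "0 \<le> ratio j \<theta> (path t w)" if "\<theta> \<in> \<Omega>0" for j \<theta>
    proof -
      have "\<omega>0 \<le> \<mu> \<theta> (past x (t - 1) w) $ j" using a(3) that by blast
      then show ?thesis using a(1) \<omega>0 unfolding ratio_path[OF that] by (intro divide_nonneg_nonneg) auto
    qed
    then show "regular (path t w)" unfolding regular_def using a(2,4) by blast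
  qed
qed

definition grad_bound_real :: "(int \<Rightarrow> real ^ 'd) \<Rightarrow> real" where
  "grad_bound_real p = enn2real (grad_bound p)"

definition remainder_real :: "real \<Rightarrow> (int \<Rightarrow> real ^ 'd) \<Rightarrow> real" where
  "remainder_real \<delta> p = enn2real (remainder \<delta> p)"

lemma gradient_bound_finite: "regular p \<Longrightarrow> gradient_bound dense_set U (\<lambda>\<theta>. ratio j \<theta> p) < \<infinity>"
proof -
  assume "regular p"
  then have "grad_bound p < \<infinity>" by (simp add: regular_def)
  moreover have "gradient_bound dense_set U (\<lambda>\<theta>. ratio j \<theta> p) \<le> grad_bound p"
    unfolding grad_bound_def by (rule member_le_sum) auto
  ultimately show ?thesis by (rule le_less_trans[rotated])
qed

lemma taylor_remainder_finite:
  "regular p \<Longrightarrow> \<delta> \<le> radius \<Longrightarrow> taylor_remainder dense_set \<theta>0 \<delta> (\<lambda>\<theta>. ratio j \<theta> p) < \<infinity>"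
proof -
  assume p: "regular p" and \<delta>: "\<delta> \<le> radius"
  interpret C1_function "\<lambda>\<theta>. ratio j \<theta> p" U dense_set \<theta>0 radius using p by (simp add: regular_def)
  have "4 * gradient_bound dense_set U (\<lambda>\<theta>. ratio j \<theta> p) < \<infinity>"
    using gradient_bound_finite[OF p, of j] by (simp add: ennreal_mult_less_top)
  with taylor_remainder_le[OF \<delta>] show ?thesis by (rule le_less_trans)
qed

lemma regular_ratio_vec:
  assumes p: "regular p" and \<delta>: "\<delta> \<le> radius" and \<theta>: "\<theta> \<in> ball \<theta>0 \<delta>"
  shows "(norm (ratio_vec \<theta> p - ratio_vec \<theta>0 p))\<^sup>2 \<le> grad_bound_real p * (norm (\<theta> - \<theta>0))\<^sup>2"
    and "(norm (ratio_vec \<theta> p - ratio_vec \<theta>0 p - (\<chi> j. ratio_grad j p \<bullet> (\<theta> - \<theta>0))))\<^sup>2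
      \<le> remainder_real \<delta> p * (norm (\<theta> - \<theta>0))\<^sup>2"
    and "\<theta> \<in> \<Omega>0"
proof -
  have C1: "C1_function (\<lambda>\<theta>. ratio j \<theta> p) U dense_set \<theta>0 radius" for j using p by (simp add: regular_def)
  have \<theta>r: "\<theta> \<in> ball \<theta>0 radius" using \<theta> \<delta> by auto
  then show "\<theta> \<in> \<Omega>0" using radius U_subset by auto
  have "(norm (ratio_vec \<theta> p - ratio_vec \<theta>0 p))\<^sup>2 = (\<Sum>j\<in>UNIV. (ratio j \<theta> p - ratio j \<theta>0 p)\<^sup>2)"
    by (simp add: norm_vec_squared ratio_vec_def)
  also have "\<dots> \<le> (\<Sum>j\<in>UNIV. enn2real (gradient_bound dense_set U (\<lambda>\<theta>. ratio j \<theta> p)) * (norm (\<theta> - \<theta>0))\<^sup>2)"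
    by (intro sum_mono C1_function.lipschitz[OF C1 gradient_bound_finite[OF p] \<theta>r])
  also have "\<dots> = grad_bound_real p * (norm (\<theta> - \<theta>0))\<^sup>2"
    unfolding grad_bound_real_def grad_bound_def using gradient_bound_finite[OF p]
    by (subst enn2real_sum') (simp_all add: sum_distrib_right)
  finally show "(norm (ratio_vec \<theta> p - ratio_vec \<theta>0 p))\<^sup>2 \<le> grad_bound_real p * (norm (\<theta> - \<theta>0))\<^sup>2" .
  have g: "ratio_grad j p = gradient (\<lambda>\<theta>. ratio j \<theta> p) \<theta>0" for j
    unfolding ratio_grad_def
    by (rule seq_gradient_eq[OF C1_function.diff[OF C1 U(2)]])
  have "(norm (ratio_vec \<theta> p - ratio_vec \<theta>0 p - (\<chi> j. ratio_grad j p \<bullet> (\<theta> - \<theta>0))))\<^sup>2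
    = (\<Sum>j\<in>UNIV. (ratio j \<theta> p - ratio j \<theta>0 p - gradient (\<lambda>\<theta>. ratio j \<theta> p) \<theta>0 \<bullet> (\<theta> - \<theta>0))\<^sup>2)"
    by (simp add: norm_vec_squared ratio_vec_def g)
  also have "\<dots> \<le> (\<Sum>j\<in>UNIV. enn2real (taylor_remainder dense_set \<theta>0 \<delta> (\<lambda>\<theta>. ratio j \<theta> p)) * (norm (\<theta> - \<theta>0))\<^sup>2)"
    by (intro sum_mono C1_function.taylor_remainder_bound[OF C1 \<delta> \<theta> taylor_remainder_finite[OF p \<delta>]])
  also have "\<dots> = remainder_real \<delta> p * (norm (\<theta> - \<theta>0))\<^sup>2"
    unfolding remainder_real_def remainder_def using taylor_remainder_finite[OF p \<delta>]
    by (subst enn2real_sum') (simp_all add: sum_distrib_right)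
  finally show "(norm (ratio_vec \<theta> p - ratio_vec \<theta>0 p - (\<chi> j. ratio_grad j p \<bullet> (\<theta> - \<theta>0))))\<^sup>2
      \<le> remainder_real \<delta> p * (norm (\<theta> - \<theta>0))\<^sup>2" .
qed

lemma score_inner: "score u p \<bullet> h = - exp (- (u \<bullet> ratio_vec \<theta>0 p)) * (u \<bullet> (\<chi> j. ratio_grad j p \<bullet> h))"
  unfolding score_def by (simp add: inner_sum_left inner_vec_def[of u])

text \<open>Two errors of different nature: the curvature of the exponential, quadratic in
  \<open>u\<close> and in the distance, and the nonlinearity of the ratio in the parameter, linear
  in \<open>u\<close> and of smaller order than the distance. Nonnegative exponents keep the
  exponential factors at most one.\<close>

lemma exp_expansion:
  assumes p: "regular p" and \<delta>: "\<delta> \<le> radius" and \<theta>: "\<theta> \<in> ball \<theta>0 \<delta>" and u: "u \<in> pos_orthant"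
  shows "\<bar>exp (- (u \<bullet> ratio_vec \<theta> p)) - exp (- (u \<bullet> ratio_vec \<theta>0 p)) - score u p \<bullet> (\<theta> - \<theta>0)\<bar>
    \<le> (norm u)\<^sup>2 * grad_bound_real p * (norm (\<theta> - \<theta>0))\<^sup>2 + norm u * sqrt (remainder_real \<delta> p) * norm (\<theta> - \<theta>0)"
proof -
  note R = regular_ratio_vec[OF p \<delta> \<theta>]
  let ?s = "u \<bullet> ratio_vec \<theta> p" and ?z = "u \<bullet> ratio_vec \<theta>0 p" and ?l = "\<chi> j. ratio_grad j p \<bullet> (\<theta> - \<theta>0)"
  have nn: "0 \<le> ?s" "0 \<le> ?z"
    using p R(3) \<theta>0_in u by (auto intro!: inner_nonneg_orthant simp: regular_def ratio_vec_def)
  have eq: "exp (- ?s) - exp (- ?z) - score u p \<bullet> (\<theta> - \<theta>0)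
    = (exp (- ?s) - exp (- ?z) + exp (- ?z) * (?s - ?z)) - exp (- ?z) * (u \<bullet> (ratio_vec \<theta> p - ratio_vec \<theta>0 p - ?l))"
  proof -
    have "a - b - (- c * d) = (a - b + c * (e - f)) - c * (e - f - d)" for a b c d e f :: real
      by (simp add: algebra_simps)
    from this[of _ _ _ "u \<bullet> ?l"] show ?thesis unfolding score_inner inner_diff_right[of u] .
  qed
  have "\<bar>exp (- ?s) - exp (- ?z) - score u p \<bullet> (\<theta> - \<theta>0)\<bar>
    \<le> \<bar>exp (- ?s) - exp (- ?z) + exp (- ?z) * (?s - ?z)\<bar> + \<bar>exp (- ?z) * (u \<bullet> (ratio_vec \<theta> p - ratio_vec \<theta>0 p - ?l))\<bar>"
    unfolding eq by (rule abs_triangle_ineq4)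
  also have "\<dots> \<le> (norm u)\<^sup>2 * (grad_bound_real p * (norm (\<theta> - \<theta>0))\<^sup>2) + norm u * (sqrt (remainder_real \<delta> p) * norm (\<theta> - \<theta>0))"
  proof (rule add_mono)
    have "\<bar>exp (- ?s) - exp (- ?z) + exp (- ?z) * (?s - ?z)\<bar> \<le> (?s - ?z)\<^sup>2"
      using nn by (rule exp_neg_taylor_bound)
    also have "\<dots> = \<bar>u \<bullet> (ratio_vec \<theta> p - ratio_vec \<theta>0 p)\<bar>\<^sup>2" by (simp add: inner_diff_right)
    also have "\<dots> \<le> (norm u * norm (ratio_vec \<theta> p - ratio_vec \<theta>0 p))\<^sup>2"
      by (intro power_mono Cauchy_Schwarz_ineq2) simp
    also have "\<dots> \<le> (norm u)\<^sup>2 * (grad_bound_real p * (norm (\<theta> - \<theta>0))\<^sup>2)"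
      unfolding power_mult_distrib by (intro mult_left_mono R) simp
    finally show "\<bar>exp (- ?s) - exp (- ?z) + exp (- ?z) * (?s - ?z)\<bar> \<le> (norm u)\<^sup>2 * (grad_bound_real p * (norm (\<theta> - \<theta>0))\<^sup>2)" .
    have "\<bar>exp (- ?z) * (u \<bullet> (ratio_vec \<theta> p - ratio_vec \<theta>0 p - ?l))\<bar> \<le> 1 * (norm u * norm (ratio_vec \<theta> p - ratio_vec \<theta>0 p - ?l))"
      unfolding abs_mult using nn(2) by (intro mult_mono Cauchy_Schwarz_ineq2) auto
    also have "norm (ratio_vec \<theta> p - ratio_vec \<theta>0 p - ?l) \<le> sqrt (remainder_real \<delta> p) * norm (\<theta> - \<theta>0)"
    proof -
      have "norm (ratio_vec \<theta> p - ratio_vec \<theta>0 p - ?l) \<le> sqrt (remainder_real \<delta> p * (norm (\<theta> - \<theta>0))\<^sup>2)"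
        using R(2) by (rule real_le_rsqrt)
      then show ?thesis by (simp add: real_sqrt_mult)
    qed
    finally show "\<bar>exp (- ?z) * (u \<bullet> (ratio_vec \<theta> p - ratio_vec \<theta>0 p - ?l))\<bar> \<le> norm u * (sqrt (remainder_real \<delta> p) * norm (\<theta> - \<theta>0))"
      by (simp add: mult_left_mono)
  qed
  finally show ?thesis by (simp add: mult.assoc)
qed

section \<open>Scores and their averages\<close>

definition grad_norm :: "(int \<Rightarrow> real ^ 'd) \<Rightarrow> real" where
  "grad_norm p = (\<Sum>j\<in>UNIV. norm (ratio_grad j p))"

lemma grad_norm_nonneg: "0 \<le> grad_norm p"
  unfolding grad_norm_def by (intro sum_nonneg) simp

lemma grad_norm_measurable [measurable]: "grad_norm \<in> borel_measurable path_space"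
  unfolding grad_norm_def by measurable

lemma score_measurable [measurable]: "score u \<in> borel_measurable path_space"
  unfolding score_def by measurable

text \<open>On regular paths the exponential is at most one, so that \<open>grad_norm\<close> is an
  integrable envelope for all \<open>u\<close> at once, up to the factor
  \<open>norm u\<close>.\<close>

lemma score_bound:
  assumes "regular p" "u \<in> pos_orthant"
  shows "norm (score u p) \<le> norm u * grad_norm p"
proof -
  have "0 \<le> u \<bullet> ratio_vec \<theta>0 p"
    using assms \<theta>0_in by (auto intro!: inner_nonneg_orthant simp: regular_def ratio_vec_def)
  then have "norm (score u p) \<le> 1 * norm (\<Sum>j\<in>UNIV. (u $ j) *\<^sub>R ratio_grad j p)"
    unfolding score_def norm_scaleR by (intro mult_right_mono) auto
  also have "\<dots> \<le> (\<Sum>j\<in>UNIV. \<bar>u $ j\<bar> * norm (ratio_grad j p))"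
    by (simp add: sum_norm_le)
  also have "\<dots> \<le> (\<Sum>j\<in>UNIV. norm u * norm (ratio_grad j p))"
    by (intro sum_mono mult_right_mono component_le_norm_cart) auto
  finally show ?thesis by (simp add: grad_norm_def sum_distrib_left)
qed

lemma grad_bound_real_integrable: "integrable M (\<lambda>w. grad_bound_real (path t w))"
proof (rule integrableI_bounded)
  show "(\<lambda>w. grad_bound_real (path t w)) \<in> borel_measurable M" unfolding grad_bound_real_def by measurable
  have "(\<integral>\<^sup>+w. ennreal (norm (grad_bound_real (path t w))) \<partial>M) \<le> (\<integral>\<^sup>+w. grad_bound (path t w) \<partial>M)"
    by (intro nn_integral_mono) (simp add: grad_bound_real_def ennreal_enn2real_if)
  also have "\<dots> < \<infinity>" using grad_bound_finite by (simp add: nn_integral_path)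
  finally show "(\<integral>\<^sup>+w. ennreal (norm (grad_bound_real (path t w))) \<partial>M) < \<infinity>" .
qed

text \<open>From \<open>a \<le> 1 + a^2\<close> in each component; integrability of
  \<open>grad_norm\<close> is thereby reduced to that of the bound for squared gradients.\<close>

lemma grad_norm_le:
  assumes p: "regular p"
  shows "grad_norm p \<le> real CARD('d) + grad_bound_real p"
proof -
  have "norm (ratio_grad j p) \<le> 1 + enn2real (gradient_bound dense_set U (\<lambda>\<theta>. ratio j \<theta> p))" for j
  proof -
    have C1: "C1_function (\<lambda>\<theta>. ratio j \<theta> p) U dense_set \<theta>0 radius" using p by (simp add: regular_def)
    have g: "ratio_grad j p = gradient (\<lambda>\<theta>. ratio j \<theta> p) \<theta>0"
      unfolding ratio_grad_def by (rule seq_gradient_eq[OF C1_function.diff[OF C1 U(2)]])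
    have "(norm (ratio_grad j p))\<^sup>2 \<le> enn2real (gradient_bound dense_set U (\<lambda>\<theta>. ratio j \<theta> p))"
      using C1_function.norm_gradient_le[OF C1 U(2)] gradient_bound_finite[OF p, of j] unfolding g
      by (metis enn2real_ennreal enn2real_mono zero_le_power2 infinity_ennreal_def)
    moreover have "norm (ratio_grad j p) \<le> 1 + (norm (ratio_grad j p))\<^sup>2"
      using zero_le_power2[of "norm (ratio_grad j p) - 1/2"] by (simp add: power2_eq_square algebra_simps)
    ultimately show ?thesis by simp
  qed
  then have "grad_norm p \<le> (\<Sum>j\<in>UNIV. 1 + enn2real (gradient_bound dense_set U (\<lambda>\<theta>. ratio j \<theta> p)))"
    unfolding grad_norm_def by (intro sum_mono)
  also have "\<dots> = real CARD('d) + grad_bound_real p"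
    unfolding grad_bound_real_def grad_bound_def using gradient_bound_finite[OF p]
    by (subst enn2real_sum') (simp_all add: sum.distrib)
  finally show ?thesis .
qed

lemma grad_norm_integrable: "integrable law grad_norm"
proof -
  have "integrable M (\<lambda>w. grad_norm (path 0 w))"
  proof (rule Bochner_Integration.integrable_bound)
    show "integrable M (\<lambda>w. real CARD('d) + grad_bound_real (path 0 w))"
      using grad_bound_real_integrable by auto
    show "(\<lambda>w. grad_norm (path 0 w)) \<in> borel_measurable M" by measurable
    show "AE w in M. norm (grad_norm (path 0 w)) \<le> norm (real CARD('d) + grad_bound_real (path 0 w))"
      using AE_regular
    proof eventually_elim
      case (elim w)
      from grad_norm_le[OF elim[rule_format, of 0]] grad_norm_nonneg[of "path 0 w"]
      show ?case by simp
    qed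
  qed
  then show ?thesis by (simp add: integrable_path)
qed

lemma score_integrable:
  assumes u: "u \<in> pos_orthant"
  shows "integrable law (\<lambda>p. score u p $ k)"
proof -
  have m: "(\<lambda>p. score u p $ k) \<in> borel_measurable path_space"
    by (rule measurable_compose[OF score_measurable vec_nth_measurable])
  have "integrable M (\<lambda>w. score u (path 0 w) $ k)"
  proof (rule Bochner_Integration.integrable_bound)
    show "integrable M (\<lambda>w. norm u * grad_norm (path 0 w))"
      using grad_norm_integrable by (auto simp: integrable_path)
    show "(\<lambda>w. score u (path 0 w) $ k) \<in> borel_measurable M" by (rule measurable_compose[OF path_measurable' m])
    show "AE w in M. norm (score u (path 0 w) $ k) \<le> norm (norm u * grad_norm (path 0 w))"
      using AE_regular
    proof eventually_elim
      case (elim w)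
      have "\<bar>score u (path 0 w) $ k\<bar> \<le> norm (score u (path 0 w))" by (rule component_le_norm_cart)
      also have "\<dots> \<le> norm u * grad_norm (path 0 w)" using elim u by (intro score_bound) auto
      finally show ?case by simp
    qed
  qed
  then show ?thesis by (rule integrable_path[OF m, THEN iffD1])
qed

definition mean_score :: "real ^ 'd \<Rightarrow> real ^ 'k" where
  "mean_score u = (\<chi> k. \<integral>p. score u p $ k \<partial>law)"

definition score_average :: "nat \<Rightarrow> real ^ 'd \<Rightarrow> 'w \<Rightarrow> real ^ 'k" where
  "score_average T u w = (1 / real T) *\<^sub>R (\<Sum>t=1..T. score u (path (int t) w))"

lemma score_jointly_measurable:
  "(\<lambda>(w, u). score u (path t w)) \<in> borel_measurable (M \<Otimes>\<^sub>M borel)"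
proof -
  have [measurable]: "(\<lambda>w. ratio_vec \<theta>0 (path t w)) \<in> borel_measurable M" "(\<lambda>w. ratio_grad j (path t w)) \<in> borel_measurable M" for j
    by measurable
  have [measurable]: "(\<lambda>u::real ^ 'd. u $ j) \<in> borel_measurable borel" for j by (rule vec_nth_measurable)
  show ?thesis unfolding score_def by measurable
qed

lemma mean_score_measurable: "mean_score \<in> borel_measurable borel"
proof -
  have [measurable]: "(\<lambda>v::real ^ 'k. v $ k) \<in> borel_measurable borel" for k by (rule vec_nth_measurable)
  have eq: "(\<integral>p. score u p $ k \<partial>law) = (\<integral>w. score u (path 0 w) $ k \<partial>M)" for u k
    by (rule integral_path[symmetric], rule measurable_compose[OF score_measurable vec_nth_measurable])
  note [measurable] = score_jointly_measurable
  show ?thesis unfolding mean_score_def eq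
  proof (intro vec_lambda_measurable)
    fix k
    show "(\<lambda>u. \<integral>w. score u (path 0 w) $ k \<partial>M) \<in> borel_measurable borel" by measurable
  qed
qed

lemma mean_score_bound:
  assumes u: "u \<in> pos_orthant"
  shows "norm (mean_score u) \<le> real CARD('k) * norm u * (\<integral>p. grad_norm p \<partial>law)"
proof -
  have m: "(\<lambda>p. score u p $ k) \<in> borel_measurable path_space" for k
    by (rule measurable_compose[OF score_measurable vec_nth_measurable])
  have "\<bar>mean_score u $ k\<bar> \<le> norm u * (\<integral>p. grad_norm p \<partial>law)" for k
  proof -
    have "mean_score u $ k = (\<integral>w. score u (path 0 w) $ k \<partial>M)" by (simp add: mean_score_def integral_path[OF m])
    also have "\<bar>\<dots>\<bar> \<le> (\<integral>w. \<bar>score u (path 0 w) $ k\<bar> \<partial>M)" by (rule integral_abs_bound)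
    also have "\<dots> \<le> (\<integral>w. norm u * grad_norm (path 0 w) \<partial>M)"
    proof (rule integral_mono_AE)
      show "integrable M (\<lambda>w. \<bar>score u (path 0 w) $ k\<bar>)" by (intro integrable_abs integrable_path[OF m, THEN iffD2] score_integrable u)
      show "integrable M (\<lambda>w. norm u * grad_norm (path 0 w))" using grad_norm_integrable by (auto simp: integrable_path)
      show "AE w in M. \<bar>score u (path 0 w) $ k\<bar> \<le> norm u * grad_norm (path 0 w)"
        using AE_regular by eventually_elim (rule order_trans[OF component_le_norm_cart score_bound[OF _ u]], blast)
    qed
    also have "\<dots> = norm u * (\<integral>p. grad_norm p \<partial>law)" by (simp add: integral_path)
    finally show ?thesis .
  qed
  then have "(\<Sum>k\<in>UNIV. \<bar>mean_score u $ k\<bar>) \<le> (\<Sum>k\<in>(UNIV::'k set). norm u * (\<integral>p. grad_norm p \<partial>law))" by (intro sum_mono)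
  with norm_le_l1_cart[of "mean_score u"] show ?thesis by simp
qed

end

text \<open>With countable quantifiers only, the set of points of convergence is seen to be
  measurable; this allows two almost-everywhere quantifiers to be exchanged.\<close>

lemma LIMSEQ_iff_countable:
  fixes L :: "'a::real_normed_vector"
  shows "X \<longlonglongrightarrow> L \<longleftrightarrow> (\<forall>m::nat. \<exists>N::nat. \<forall>n. N \<le> n \<longrightarrow> norm (X n - L) < 1 / real (Suc m))"
proof
  assume "X \<longlonglongrightarrow> L"
  then show "\<forall>m::nat. \<exists>N::nat. \<forall>n. N \<le> n \<longrightarrow> norm (X n - L) < 1 / real (Suc m)"
    using LIMSEQ_D[of X L] by (auto simp del: of_nat_Suc)
next
  assume *: "\<forall>m::nat. \<exists>N::nat. \<forall>n. N \<le> n \<longrightarrow> norm (X n - L) < 1 / real (Suc m)"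
  show "X \<longlonglongrightarrow> L"
  proof (rule LIMSEQ_I)
    fix r :: real assume "0 < r"
    then obtain m where "inverse (real (Suc m)) < r" using reals_Archimedean by blast
    with *[rule_format, of m] show "\<exists>no. \<forall>n\<ge>no. norm (X n - L) < r"
      by (auto simp: inverse_eq_divide intro: less_trans)
  qed
qed

text \<open>If an entry vanishes there is no inverse, and \<open>matrix_inv\<close> chooses from the
  empty predicate, always the same matrix. The explicit form in both cases makes the entries
  measurable functions of \<open>a\<close>.\<close>

lemma matrix_inv_diag_mat:
  "matrix_inv (diag_mat (a :: real ^ 'd::finite)) =
     (if \<forall>i. a $ i \<noteq> 0 then diag_mat (\<chi> i. 1 / a $ i) else (SOME B. False))"
proof -
  have left: "(diag_mat a ** B) $ i $ j = a $ i * B $ i $ j" for B :: "real ^ 'd ^ 'd" and i j and a :: "real ^ 'd"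
    by (simp add: diag_mat_def matrix_matrix_mult_def if_distrib[of "\<lambda>x. x * _"] cong: if_cong)
  show ?thesis
  proof (cases "\<forall>i. a $ i \<noteq> 0")
    case True
    have "diag_mat a ** B = mat 1 \<and> B ** diag_mat a = mat 1 \<longleftrightarrow> B = diag_mat (\<chi> i. 1 / a $ i)" for B
    proof
      assume "diag_mat a ** B = mat 1 \<and> B ** diag_mat a = mat 1"
      then have "a $ i * B $ i $ j = (if i = j then 1 else 0)" for i j
        using left[of a B i j] by (simp add: mat_def)
      then show "B = diag_mat (\<chi> i. 1 / a $ i)"
        using True by (auto simp: vec_eq_iff diag_mat_def field_simps) (metis mult_eq_0_iff)
    next
      assume B: "B = diag_mat (\<chi> i. 1 / a $ i)"
      show "diag_mat a ** B = mat 1 \<and> B ** diag_mat a = mat 1"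
        unfolding B using True by (simp add: vec_eq_iff left) (simp add: diag_mat_def mat_def)
    qed
    then show ?thesis using True by (simp add: matrix_inv_def)
  next
    case False
    then obtain i where i: "a $ i = 0" by auto
    have "\<not> (diag_mat a ** B = mat 1 \<and> B ** diag_mat a = mat 1)" for B
    proof
      assume "diag_mat a ** B = mat 1 \<and> B ** diag_mat a = mat 1"
      then show False using left[of a B i i] i by (simp add: mat_def)
    qed
    then have "(\<lambda>B. diag_mat a ** B = mat 1 \<and> B ** diag_mat a = mat 1) = (\<lambda>_. False)" by blast
    then show ?thesis using False unfolding matrix_inv_def by (simp only: if_False)
  qed
qed

lemma matrix_diag_mult: "(B ** diag_mat a) $ i $ j = B $ i $ j * (a :: real ^ 'd::finite) $ j"
  by (simp add: diag_mat_def matrix_matrix_mult_def if_distrib[of "\<lambda>x. _ * x"] cong: if_cong)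

lemma integrable_matrix:
  fixes F :: "'a \<Rightarrow> real ^ 'k::finite ^ 'd::finite"
  assumes "\<And>i k. integrable M (\<lambda>w. F w $ i $ k)"
  shows "integrable M F" "(\<integral>w. F w \<partial>M) $ i $ k = (\<integral>w. F w $ i $ k \<partial>M)"
proof -
  have "F w = (\<Sum>i\<in>UNIV. \<Sum>k\<in>UNIV. (F w $ i $ k) *\<^sub>R axis i (axis k 1))" for w
  proof -
    have "(\<Sum>i\<in>UNIV. \<Sum>k\<in>UNIV. (F w $ i $ k) *\<^sub>R axis i (axis k 1)) $ a $ b = F w $ a $ b" for a b
    proof -
      have sif: "(\<Sum>k\<in>UNIV. if P then f k else 0) = (if P then sum f UNIV else 0)" for P and f :: "'k \<Rightarrow> real"
        by simp
      show ?thesis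
        by (simp add: axis_def if_distrib[of "\<lambda>x. x $ _"] if_distrib[of "\<lambda>x. _ * x"] sif cong: if_cong)
    qed
    then show ?thesis by (simp add: vec_eq_iff)
  qed
  then have "F = (\<lambda>w. \<Sum>i\<in>UNIV. \<Sum>k\<in>UNIV. (F w $ i $ k) *\<^sub>R axis i (axis k 1))" by (rule ext)
  moreover have "integrable M (\<lambda>w. \<Sum>i\<in>UNIV. \<Sum>k\<in>UNIV. (F w $ i $ k) *\<^sub>R axis i (axis k 1) :: real ^ 'k ^ 'd)"
    using assms by (intro Bochner_Integration.integrable_sum integrable_scaleR_left) auto
  ultimately show i: "integrable M F" by simp
  have "bounded_linear (\<lambda>A::real ^ 'k ^ 'd. A $ i $ k)"
    by (rule bounded_linear_compose[OF bounded_linear_vec_nth bounded_linear_vec_nth])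
  from integral_bounded_linear[OF this i]
  show "(\<integral>w. F w \<partial>M) $ i $ k = (\<integral>w. F w $ i $ k \<partial>M)" by simp
qed

context vmem
begin

text \<open>Birkhoff's theorem gives convergence for each \<open>u\<close>, with a null set
  depending on \<open>u\<close>; Fubini's theorem turns this into convergence for almost all
  \<open>u\<close> outside one null set. The averages of \<open>grad_norm\<close> converge, hence
  are bounded along almost every path, and supply the majorant
  \<open>c^2 * (norm u)^2\<close>.\<close>

lemma score_average_tendsto:
  assumes \<nu>: "finite_measure \<nu>" and sp: "space \<nu> = pos_orthant" and idm: "(\<lambda>u. u) \<in> borel_measurable \<nu>"
    and sq: "integrable \<nu> (\<lambda>u. (norm u)\<^sup>2)"
  shows "vanishing M (\<lambda>T w. \<integral>u. (norm (score_average T u w - mean_score u))\<^sup>2 \<partial>\<nu>)"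
proof -
  interpret \<nu>: finite_measure \<nu> by (rule \<nu>)
  interpret P: pair_sigma_finite M \<nu> ..
  have [measurable]: "(\<lambda>(w, u). score u (path t w)) \<in> borel_measurable (M \<Otimes>\<^sub>M \<nu>)" for t
  proof -
    have "(\<lambda>x. (fst x, snd x)) \<in> measurable (M \<Otimes>\<^sub>M \<nu>) (M \<Otimes>\<^sub>M borel)"
      by (intro measurable_Pair measurable_fst measurable_compose[OF measurable_snd idm])
    from measurable_compose[OF this score_jointly_measurable] show ?thesis by (simp add: split_beta')
  qed
  have [measurable]: "mean_score \<in> borel_measurable \<nu>"
    using measurable_compose[OF idm mean_score_measurable] by simp
  have sam [measurable]: "(\<lambda>(w, u). score_average T u w) \<in> borel_measurable (M \<Otimes>\<^sub>M \<nu>)" for T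
    unfolding score_average_def by measurable
  have pointwise: "AE w in M. (\<lambda>T. score_average T u w) \<longlonglongrightarrow> mean_score u" if u: "u \<in> pos_orthant" for u
  proof -
    have "AE w in M. \<forall>k. (\<lambda>T. (\<Sum>t=1..T. score u (path (int t) w) $ k) / real T) \<longlonglongrightarrow> (\<integral>p. score u p $ k \<partial>law)"
      using lln[OF score_integrable[OF u]] by (subst AE_all_countable) auto
    then show ?thesis
    proof eventually_elim
      case (elim w)
      show ?case
      proof (rule vec_tendstoI)
        fix k
        have "score_average T u w $ k = (\<Sum>t=1..T. score u (path (int t) w) $ k) / real T" for T
          by (simp add: score_average_def)
        then show "(\<lambda>T. score_average T u w $ k) \<longlonglongrightarrow> mean_score u $ k"
          using elim by (simp add: mean_score_def)
      qed
    qed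
  qed
  have "AE u in \<nu>. AE w in M. (\<lambda>T. score_average T u w) \<longlonglongrightarrow> mean_score u"
    by (rule AE_I2) (use pointwise sp in auto)
  moreover have "{x \<in> space (M \<Otimes>\<^sub>M \<nu>). (\<lambda>T. score_average T (snd x) (fst x)) \<longlonglongrightarrow> mean_score (snd x)} \<in> sets (M \<Otimes>\<^sub>M \<nu>)"
    unfolding LIMSEQ_iff_countable by measurable
  ultimately have conv: "AE w in M. AE u in \<nu>. (\<lambda>T. score_average T u w) \<longlonglongrightarrow> mean_score u"
    by (subst P.AE_commute) auto
  have gn: "AE w in M. (\<lambda>T. (\<Sum>t=1..T. grad_norm (path (int t) w)) / real T) \<longlonglongrightarrow> (\<integral>p. grad_norm p \<partial>law)"
    by (rule lln[OF grad_norm_integrable])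
  show ?thesis
  proof (rule vanishing_AE)
    show "(\<lambda>w. \<integral>u. (norm (score_average T u w - mean_score u))\<^sup>2 \<partial>\<nu>) \<in> borel_measurable M" for T
      by measurable
    show "AE w in M. (\<lambda>T. \<integral>u. (norm (score_average T u w - mean_score u))\<^sup>2 \<partial>\<nu>) \<longlonglongrightarrow> 0"
      using conv gn AE_regular AE_space
    proof eventually_elim
      case (elim w)
      obtain K where K: "\<And>T. norm ((\<Sum>t=1..T. grad_norm (path (int t) w)) / real T) \<le> K"
        using convergent_imp_Bseq[OF convergentI[OF elim(2)]] by (auto simp: Bseq_def)
      define c where "c = K + real CARD('k) * (\<integral>p. grad_norm p \<partial>law)"
      have bound: "norm (score_average T u w - mean_score u) \<le> c * norm u" if u: "u \<in> pos_orthant" for T u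
      proof -
        have "norm (score_average T u w) \<le> (1 / real T) * (\<Sum>t=1..T. norm u * grad_norm (path (int t) w))"
          unfolding score_average_def norm_scaleR
          using score_bound[OF elim(3)[rule_format] u] by (auto intro!: divide_right_mono sum_norm_le)
        also have "\<dots> = norm u * ((\<Sum>t=1..T. grad_norm (path (int t) w)) / real T)"
          by (simp add: sum_distrib_left sum_divide_distrib)
        also have "\<dots> \<le> norm u * K" by (rule mult_left_mono[OF abs_le_D1[OF K[of T, unfolded real_norm_def]] norm_ge_zero])
        finally have "norm (score_average T u w) \<le> norm u * K" .
        moreover have "norm (mean_score u) \<le> real CARD('k) * norm u * (\<integral>p. grad_norm p \<partial>law)"
          by (rule mean_score_bound[OF u])
        ultimately show ?thesis
          using norm_triangle_ineq4[of "score_average T u w" "mean_score u"] by (simp add: c_def algebra_simps)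
      qed
      have sm [measurable]: "(\<lambda>u. score_average T u w) \<in> borel_measurable \<nu>" for T
        using measurable_compose[OF measurable_Pair1' sam, of w] elim(4) by simp
      have "(\<lambda>T. \<integral>u. (norm (score_average T u w - mean_score u))\<^sup>2 \<partial>\<nu>) \<longlonglongrightarrow> (\<integral>u. 0 \<partial>\<nu>)"
      proof (rule integral_dominated_convergence[where w = "\<lambda>u. c\<^sup>2 * (norm u)\<^sup>2"])
        show "AE u in \<nu>. (\<lambda>T. (norm (score_average T u w - mean_score u))\<^sup>2) \<longlonglongrightarrow> 0"
          using elim(1)
        proof eventually_elim
          case (elim u)
          from tendsto_power[OF tendsto_norm[OF LIM_zero[OF elim]], of 2] show ?case by simp
        qed
        show "AE u in \<nu>. norm ((norm (score_average T u w - mean_score u))\<^sup>2) \<le> c\<^sup>2 * (norm u)\<^sup>2" for T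
        proof (rule AE_I2)
          fix u assume "u \<in> space \<nu>"
          then have "norm (score_average T u w - mean_score u) \<le> c * norm u" using bound sp by auto
          from power_mono[OF this norm_ge_zero, of 2]
          show "norm ((norm (score_average T u w - mean_score u))\<^sup>2) \<le> c\<^sup>2 * (norm u)\<^sup>2" by (simp add: power_mult_distrib)
        qed
        show "integrable \<nu> (\<lambda>u. c\<^sup>2 * (norm u)\<^sup>2)" using sq by auto
      qed measurable
      then show ?case by simp
    qed
  qed
qed

text \<open>The derivative of the ratio at \<open>\<theta>0\<close> is minus
  \<open>\<epsilon>\<close> times the derivative of \<open>\<mu>\<close> over \<open>\<mu>\<close>,
  and the score carries another minus sign; hence the plus sign before \<open>Gamma_mat\<close> in
  \<open>Y_term\<close>. Integrand and path functional agree almost surely only, so the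
  measurability of the integrand is established separately.\<close>

lemma Gamma_mat_mult:
  assumes \<epsilon>: "\<And>t. \<epsilon> t \<in> borel_measurable M"
    and pd: "\<And>t j k. (\<lambda>w. pdiff k (\<lambda>\<theta>. \<mu> \<theta> (past x (t - 1) w) $ j) \<theta>0) \<in> borel_measurable M"
    and u: "u \<in> pos_orthant"
  shows "u \<bullet> (Gamma_mat M \<mu> x \<epsilon> \<theta>0 t u *v m) = mean_score u \<bullet> m"
proof -
  let ?\<mu> = "\<lambda>w. \<mu> \<theta>0 (past x (t - 1) w)"
  define F where "F w = exp (- (u \<bullet> \<epsilon> t w)) *\<^sub>R (matrix_inv (diag_mat (?\<mu> w)) ** diag_mat (\<epsilon> t w)
          ** jacobian_mat (\<lambda>\<theta>. \<mu> \<theta> (past x (t - 1) w)) \<theta>0)" for w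
  note [measurable] = \<epsilon> pd
  have [measurable]: "(\<lambda>y::real ^ 'd. y $ j) \<in> borel_measurable borel" for j by (rule vec_nth_measurable)
  have past_m: "(\<lambda>w. past x (t - 1) w) \<in> measurable M (PiM UNIV (\<lambda>_. borel))"
    unfolding past_def by (rule path_measurable) simp
  have [measurable]: "(\<lambda>w. ?\<mu> w) \<in> borel_measurable M"
    by (rule measurable_compose[OF past_m \<mu>_measurable[OF \<theta>0_in]])
  have F_entry: "F w $ i $ k = exp (- (u \<bullet> \<epsilon> t w)) * (\<Sum>l\<in>UNIV. (if \<forall>i. ?\<mu> w $ i \<noteq> 0 then (if i = l then 1 / ?\<mu> w $ i else 0)
       else (SOME B :: real ^ 'd ^ 'd. False) $ i $ l) * \<epsilon> t w $ l * pdiff k (\<lambda>\<theta>. \<mu> \<theta> (past x (t - 1) w) $ l) \<theta>0)" for w i k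
  proof -
    have "F w $ i $ k = exp (- (u \<bullet> \<epsilon> t w)) * (\<Sum>l\<in>UNIV. (matrix_inv (diag_mat (?\<mu> w)) ** diag_mat (\<epsilon> t w)) $ i $ l
        * jacobian_mat (\<lambda>\<theta>. \<mu> \<theta> (past x (t - 1) w)) \<theta>0 $ l $ k)"
      unfolding F_def by (simp add: matrix_matrix_mult_def[of "matrix_inv _ ** _"])
    then show ?thesis unfolding matrix_diag_mult matrix_inv_diag_mat
      by (simp add: jacobian_mat_def diag_mat_def if_distrib[of "\<lambda>A. A $ i $ _"] cong: if_cong)
  qed
  have Fm: "(\<lambda>w. F w $ i $ k) \<in> borel_measurable M" for i k
    unfolding F_entry by measurable
  define G where "G i k p = - exp (- (u \<bullet> ratio_vec \<theta>0 p)) * ratio_grad i p $ k" for i k and p :: "int \<Rightarrow> real ^ 'd"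
  have [measurable]: "(\<lambda>y::real ^ 'k. y $ j) \<in> borel_measurable borel" for j by (rule vec_nth_measurable)
  have Gm: "G i k \<in> borel_measurable path_space" for i k unfolding G_def by measurable
  have AE_F: "AE w in M. F w $ i $ k = G i k (path t w)" for i k
    using \<mu>_lower ratio_C1[of k] ratio_vec_eq model[of t]
  proof eventually_elim
    case (elim w)
    have pos: "0 < ?\<mu> w $ j" for j using elim(1) \<theta>0_in \<omega>0 by (meson less_le_trans)
    then have ne: "?\<mu> w $ j \<noteq> 0" for j by (metis less_irrefl)
    have C1: "C1_function (\<lambda>\<theta>. ratio i \<theta> (path t w)) U dense_set \<theta>0 radius" using elim(2) by blast
    have pdr: "pdiff k (\<lambda>\<theta>. ratio i \<theta> (path t w)) \<theta>0
        = - (x t w $ i * pdiff k (\<lambda>\<theta>. \<mu> \<theta> (past x (t - 1) w) $ i) \<theta>0 / (?\<mu> w $ i)\<^sup>2)" using elim(2) by blast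
    have "F w $ i $ k = exp (- (u \<bullet> \<epsilon> t w)) * (1 / ?\<mu> w $ i * \<epsilon> t w $ i * pdiff k (\<lambda>\<theta>. \<mu> \<theta> (past x (t - 1) w) $ i) \<theta>0)"
      unfolding F_entry using ne by (simp add: if_distrib[of "\<lambda>y. y * _"] cong: if_cong)
    moreover have "ratio_grad i (path t w) $ k = - (\<epsilon> t w $ i * pdiff k (\<lambda>\<theta>. \<mu> \<theta> (past x (t - 1) w) $ i) \<theta>0 / ?\<mu> w $ i)"
    proof -
      have "ratio_grad i (path t w) $ k = pdiff k (\<lambda>\<theta>. ratio i \<theta> (path t w)) \<theta>0"
        unfolding ratio_grad_def seq_gradient_eq[OF C1_function.diff[OF C1 U(2)]] by (simp add: gradient_def)
      also have "x t w $ i = ?\<mu> w $ i * \<epsilon> t w $ i" by (subst elim(4)) (simp add: hadamard_prod_def)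
      then have "pdiff k (\<lambda>\<theta>. ratio i \<theta> (path t w)) \<theta>0 = - (\<epsilon> t w $ i * pdiff k (\<lambda>\<theta>. \<mu> \<theta> (past x (t - 1) w) $ i) \<theta>0 / ?\<mu> w $ i)"
        unfolding pdr using ne[of i] by (simp add: power2_eq_square)
      finally show ?thesis .
    qed
    ultimately show ?case unfolding G_def using elim(3) by simp
  qed
  have Gi: "integrable M (\<lambda>w. G i k (path t w))" for i k t
  proof (rule Bochner_Integration.integrable_bound)
    show "integrable M (\<lambda>w. grad_norm (path t w))" using grad_norm_integrable by (simp add: integrable_path)
    show "(\<lambda>w. G i k (path t w)) \<in> borel_measurable M" by (rule measurable_compose[OF path_measurable' Gm])
    show "AE w in M. norm (G i k (path t w)) \<le> norm (grad_norm (path t w))"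
      using AE_regular
    proof eventually_elim
      case (elim w)
      have "0 \<le> u \<bullet> ratio_vec \<theta>0 (path t w)"
        using elim u \<theta>0_in by (auto intro!: inner_nonneg_orthant simp: regular_def ratio_vec_def)
      then have "\<bar>G i k (path t w)\<bar> \<le> 1 * norm (ratio_grad i (path t w))"
        unfolding G_def abs_mult by (intro mult_mono component_le_norm_cart) auto
      also have "\<dots> \<le> grad_norm (path t w)" unfolding grad_norm_def mult_1 by (rule member_le_sum) auto
      finally show ?case by simp
    qed
  qed
  have Fi: "integrable M (\<lambda>w. F w $ i $ k)" for i k
  proof (rule integrable_cong_AE_imp[OF Gi[of i k t] Fm])
    show "AE w in M. G i k (path t w) = F w $ i $ k" using AE_F[of i k] by eventually_elim simp
  qed
  have \<Gamma>: "Gamma_mat M \<mu> x \<epsilon> \<theta>0 t u $ i $ k = (\<integral>p. G i k p \<partial>law)" for i k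
  proof -
    have "Gamma_mat M \<mu> x \<epsilon> \<theta>0 t u $ i $ k = (\<integral>w. F w $ i $ k \<partial>M)"
      unfolding Gamma_mat_def F_def[symmetric] by (rule integrable_matrix(2)[OF Fi])
    also have "\<dots> = (\<integral>w. G i k (path t w) \<partial>M)"
      by (rule integral_cong_AE[OF Fm measurable_compose[OF path_measurable' Gm] AE_F])
    finally show ?thesis by (simp add: integral_path[OF Gm])
  qed
  have G_int: "integrable law (G i k)" for i k using Gi[of i k 0] integrable_path[OF Gm] by blast
  have ms: "mean_score u $ k = (\<Sum>i\<in>UNIV. u $ i * (\<integral>p. G i k p \<partial>law))" for k
  proof -
    have "score u p $ k = (\<Sum>i\<in>UNIV. u $ i * G i k p)" for p
      by (simp add: score_def G_def sum_distrib_left mult_ac flip: sum_negf)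
    then show ?thesis using G_int by (simp add: mean_score_def Bochner_Integration.integral_sum)
  qed
  have "u \<bullet> (Gamma_mat M \<mu> x \<epsilon> \<theta>0 t u *v m) = (\<Sum>i\<in>UNIV. \<Sum>k\<in>UNIV. u $ i * ((\<integral>p. G i k p \<partial>law) * m $ k))"
    by (simp add: inner_vec_def matrix_vector_mult_def \<Gamma> sum_distrib_left)
  also have "\<dots> = mean_score u \<bullet> m"
    unfolding inner_vec_def ms by (subst sum.swap) (simp add: sum_distrib_right mult.assoc)
  finally show ?thesis .
qed

end

section \<open>The parametric family and the weight\<close>

locale weighted_family =
  fixes G :: "real ^ 'r::finite \<Rightarrow> (real ^ 'd::finite) measure" and \<Phi> \<Phi>0 :: "(real ^ 'r) set"
    and \<phi>0 :: "real ^ 'r" and W :: "real ^ 'd \<Rightarrow> real"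
  assumes G_prob: "\<And>\<phi>. \<phi> \<in> \<Phi> \<Longrightarrow> prob_space (G \<phi>)"
    and G_sets: "\<And>\<phi>. \<phi> \<in> \<Phi> \<Longrightarrow> sets (G \<phi>) = sets borel"
    and \<Phi>0: "open \<Phi>0" "\<Phi>0 \<subseteq> \<Phi>" "\<phi>0 \<in> \<Phi>0"
    and C2: "\<And>u. u \<in> pos_orthant \<Longrightarrow> C2_on \<Phi>0 (\<lambda>\<phi>. laplace (G \<phi>) u)"
    and gradient_square_integrable: "\<And>j. (\<integral>\<^sup>+u\<in>pos_orthant.
           ((SUP \<phi>\<in>\<Phi>0. ennreal (\<bar>pdiff j (\<lambda>\<psi>. laplace (G \<psi>) u) \<phi>\<bar>\<^sup>2)) * ennreal (W u))
           \<partial>lborel) < \<infinity>"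
    and W_nonneg: "\<And>u. u \<in> pos_orthant \<Longrightarrow> 0 \<le> W u"
    and W_integrable: "set_integrable lborel pos_orthant W"
    and W_moment: "set_integrable lborel pos_orthant (\<lambda>u. norm u ^ 4 * W u)"
begin

definition \<nu> :: "(real ^ 'd) measure" where
  "\<nu> = density (restrict_space lborel pos_orthant) (\<lambda>u. ennreal (W u))"

lemma space_\<nu> [simp]: "space \<nu> = pos_orthant"
  by (simp add: \<nu>_def space_restrict_space)

lemma sets_\<nu> [measurable_cong]: "sets \<nu> = sets (restrict_space borel pos_orthant)"
  by (simp add: \<nu>_def sets_restrict_space)

lemma measurable_\<nu>: "f \<in> borel_measurable borel \<Longrightarrow> f \<in> borel_measurable \<nu>"
  by (simp add: measurable_cong_sets[OF sets_\<nu> refl] measurable_restrict_space1)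

lemma pos_orthant_sets [simp]: "(pos_orthant :: (real ^ 'd) set) \<in> sets borel"
  by (rule borel_open[OF pos_orthant_open])

lemma W_measurable: "W \<in> borel_measurable (restrict_space lborel pos_orthant)"
  using borel_measurable_integrable[OF W_integrable[unfolded set_integrable_def]]
  by (subst borel_measurable_restrict_space_iff) simp_all

lemma integral_\<nu>:
  fixes f :: "real ^ 'd \<Rightarrow> real"
  assumes f: "f \<in> borel_measurable \<nu>"
  shows "(LINT u:pos_orthant|lborel. f u * W u) = (\<integral>u. f u \<partial>\<nu>)"
    and "set_integrable lborel pos_orthant (\<lambda>u. f u * W u) \<longleftrightarrow> integrable \<nu> f"
proof -
  have fm: "f \<in> borel_measurable (restrict_space lborel pos_orthant)" using f by (simp add: \<nu>_def)
  have pos: "AE u in restrict_space lborel pos_orthant. 0 \<le> W u"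
    by (rule AE_I2) (simp add: W_nonneg space_restrict_space)
  show "(LINT u:pos_orthant|lborel. f u * W u) = (\<integral>u. f u \<partial>\<nu>)"
    unfolding \<nu>_def set_lebesgue_integral_def
    by (subst integral_density[OF fm W_measurable pos], subst integral_restrict_space) (simp_all add: mult.commute)
  show "set_integrable lborel pos_orthant (\<lambda>u. f u * W u) \<longleftrightarrow> integrable \<nu> f"
    unfolding \<nu>_def set_integrable_def
    by (subst integrable_density[OF fm W_measurable pos], subst integrable_restrict_space) (simp_all add: mult.commute)
qed

lemma nn_integral_\<nu>:
  assumes f: "f \<in> borel_measurable \<nu>"
  shows "(\<integral>\<^sup>+u\<in>pos_orthant. (f u * ennreal (W u)) \<partial>lborel) = (\<integral>\<^sup>+u. f u \<partial>\<nu>)"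
proof -
  have fm: "f \<in> borel_measurable (restrict_space lborel pos_orthant)" using f by (simp add: \<nu>_def)
  show ?thesis unfolding \<nu>_def
    by (subst nn_integral_density[OF measurable_compose[OF W_measurable measurable_ennreal] fm],
        subst nn_integral_restrict_space) (simp_all add: mult.commute)
qed

sublocale \<nu>: finite_measure \<nu>
proof
  have "integrable \<nu> (\<lambda>u. 1::real)"
    using integral_\<nu>(2)[of "\<lambda>u. 1"] W_integrable by simp
  then show "emeasure \<nu> (space \<nu>) \<noteq> \<infinity>"
    by (simp add: integrable_iff_bounded less_top)
qed

lemma norm_power4_integrable: "integrable \<nu> (\<lambda>u. norm u ^ 4)"
  using integral_\<nu>(2)[of "\<lambda>u. norm u ^ 4"] W_moment by (simp add: measurable_\<nu>)

lemma norm_square_integrable: "integrable \<nu> (\<lambda>u. (norm u)\<^sup>2)"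
proof (rule Bochner_Integration.integrable_bound)
  show "integrable \<nu> (\<lambda>u. 1 + norm u ^ 4)" using norm_power4_integrable by simp
  show "(\<lambda>u. (norm u)\<^sup>2) \<in> borel_measurable \<nu>" by (rule measurable_\<nu>) simp
  have "a\<^sup>2 \<le> 1 + a ^ 4" for a :: real
    using zero_le_power2[of "a\<^sup>2 - 1/2"] by (simp add: power2_eq_square power4_eq_xxxx algebra_simps)
  then show "AE u in \<nu>. norm ((norm u)\<^sup>2) \<le> norm (1 + norm u ^ 4)" by simp
qed

text \<open>Zero outside \<open>\<Phi>0\<close>, so that all values, and hence all difference
  quotients, are measurable in \<open>u\<close>; near \<open>\<phi>0\<close> it is the Laplace
  transform.\<close>

definition L :: "real ^ 'r \<Rightarrow> real ^ 'd \<Rightarrow> real" where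
  "L \<phi> u = (if \<phi> \<in> \<Phi>0 then laplace (G \<phi>) u else 0)"

definition L_grad :: "real ^ 'd \<Rightarrow> real ^ 'r" where
  "L_grad u = seq_gradient (\<lambda>\<phi>. L \<phi> u) \<phi>0"

definition L_radius :: real where
  "L_radius = (SOME r. 0 < r \<and> ball \<phi>0 r \<subseteq> \<Phi>0)"

definition L_remainder :: "real \<Rightarrow> real ^ 'd \<Rightarrow> real" where
  "L_remainder \<delta> u = enn2real (taylor_remainder dense_set \<phi>0 \<delta> (\<lambda>\<phi>. L \<phi> u))"

lemma L_radius: "0 < L_radius" "ball \<phi>0 L_radius \<subseteq> \<Phi>0"
proof -
  have "\<exists>r. 0 < r \<and> ball \<phi>0 r \<subseteq> \<Phi>0" using \<Phi>0 openE by metis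
  from someI_ex[OF this] show "0 < L_radius" "ball \<phi>0 L_radius \<subseteq> \<Phi>0" unfolding L_radius_def[symmetric] by auto
qed

lemma laplace_measurable: "\<phi> \<in> \<Phi> \<Longrightarrow> laplace (G \<phi>) \<in> borel_measurable borel"
proof -
  assume \<phi>: "\<phi> \<in> \<Phi>"
  interpret G: prob_space "G \<phi>" by (rule G_prob[OF \<phi>])
  have [measurable_cong]: "sets (G \<phi>) = sets borel" by (rule G_sets[OF \<phi>])
  have [measurable]: "(pos_orthant :: (real ^ 'd) set) \<in> sets borel" by simp
  show ?thesis unfolding laplace_def set_lebesgue_integral_def by measurable
qed

lemma L_measurable_borel: "L \<phi> \<in> borel_measurable borel"
  unfolding L_def using laplace_measurable \<Phi>0 by (cases "\<phi> \<in> \<Phi>0") auto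

lemma L_measurable: "L \<phi> \<in> borel_measurable \<nu>"
  by (rule measurable_\<nu>[OF L_measurable_borel])

lemma L_grad_measurable: "L_grad \<in> borel_measurable borel"
  unfolding L_grad_def by (intro seq_gradient_measurable L_measurable_borel)

lemma L_derivative:
  assumes u: "u \<in> pos_orthant" and \<phi>: "\<phi> \<in> \<Phi>0"
  shows "((\<lambda>\<phi>. L \<phi> u) has_derivative (\<lambda>h. gradient (\<lambda>\<phi>. laplace (G \<phi>) u) \<phi> \<bullet> h)) (at \<phi>)"
    and "pdiff k (\<lambda>\<phi>. L \<phi> u) \<phi> = pdiff k (\<lambda>\<phi>. laplace (G \<phi>) u) \<phi>"
proof -
  have "(\<lambda>\<phi>. laplace (G \<phi>) u) differentiable (at \<phi>)" using C2[OF u] \<phi> by (auto simp: C2_on_def)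
  from differentiable_gradient(1)[OF this]
  show *: "((\<lambda>\<phi>. L \<phi> u) has_derivative (\<lambda>h. gradient (\<lambda>\<phi>. laplace (G \<phi>) u) \<phi> \<bullet> h)) (at \<phi>)"
    by (rule has_derivative_transform_within_open[OF _ \<Phi>0(1) \<phi>]) (simp add: L_def)
  show "pdiff k (\<lambda>\<phi>. L \<phi> u) \<phi> = pdiff k (\<lambda>\<phi>. laplace (G \<phi>) u) \<phi>"
    using pdiff_eq_derivative[OF *, of k] by (simp add: gradient_def inner_axis)
qed

lemma L_C1:
  assumes u: "u \<in> pos_orthant"
  shows "C1_function (\<lambda>\<phi>. L \<phi> u) \<Phi>0 dense_set \<phi>0 L_radius"
proof (rule C1_function.intro[OF \<Phi>0(1) L_radius(2,1) _ _ dense_set(2)])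
  show "(\<lambda>\<phi>. L \<phi> u) differentiable (at \<phi>)" if "\<phi> \<in> \<Phi>0" for \<phi>
    using L_derivative(1)[OF u that] by (auto simp: differentiable_def)
  have "continuous_on \<Phi>0 (pdiff k (\<lambda>\<phi>. laplace (G \<phi>) u))" for k
    using C2[OF u] by (auto simp: C2_on_def intro!: continuous_at_imp_continuous_on differentiable_imp_continuous_within)
  then show "continuous_on \<Phi>0 (pdiff k (\<lambda>\<phi>. L \<phi> u))" for k
    by (rule continuous_on_eq) (simp add: L_derivative(2)[OF u])
qed

lemma L_grad_eq: "u \<in> pos_orthant \<Longrightarrow> L_grad u = gradient (\<lambda>\<phi>. laplace (G \<phi>) u) \<phi>0"
  unfolding L_grad_def
  by (subst seq_gradient_eq[OF C1_function.diff[OF L_C1 \<Phi>0(3)]]) (auto simp: gradient_def L_derivative(2) \<Phi>0)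

lemma gradient_bound_measurable_\<nu>: "(\<lambda>u. gradient_bound dense_set \<Phi>0 (\<lambda>\<phi>. L \<phi> u)) \<in> borel_measurable \<nu>"
  by (intro gradient_bound_measurable dense_set L_measurable)

lemma gradient_bound_\<nu>: "(\<integral>\<^sup>+u. gradient_bound dense_set \<Phi>0 (\<lambda>\<phi>. L \<phi> u) \<partial>\<nu>) < \<infinity>"
proof -
  let ?S = "\<lambda>k u. SUP \<phi>\<in>dense_set \<inter> \<Phi>0. ennreal ((seq_pdiff k (\<lambda>\<phi>. L \<phi> u) \<phi>)\<^sup>2)"
  have m: "?S k \<in> borel_measurable \<nu>" for k
    by (intro borel_measurable_SUP countable_Int1 dense_set measurable_compose[OF _ measurable_ennreal]
        borel_measurable_power seq_pdiff_measurable L_measurable)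
  have "(\<integral>\<^sup>+u. ?S k u \<partial>\<nu>) < \<infinity>" for k
  proof -
    have "(\<integral>\<^sup>+u. ?S k u \<partial>\<nu>) = (\<integral>\<^sup>+u\<in>pos_orthant. (?S k u * ennreal (W u)) \<partial>lborel)"
      by (rule nn_integral_\<nu>[OF m, symmetric])
    also have "\<dots> = (\<integral>\<^sup>+u\<in>pos_orthant. ((SUP \<phi>\<in>\<Phi>0. ennreal (\<bar>pdiff k (\<lambda>\<psi>. laplace (G \<psi>) u) \<phi>\<bar>\<^sup>2)) * ennreal (W u)) \<partial>lborel)"
    proof (rule nn_integral_cong)
      fix u
      have "?S k u = (SUP \<phi>\<in>\<Phi>0. ennreal (\<bar>pdiff k (\<lambda>\<psi>. laplace (G \<psi>) u) \<phi>\<bar>\<^sup>2))" if u: "u \<in> pos_orthant"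
        unfolding C1_function.SUP_seq_pdiff[OF L_C1[OF u]] by (intro SUP_cong) (simp_all add: L_derivative(2)[OF u])
      then show "?S k u * ennreal (W u) * indicator pos_orthant u
        = (SUP \<phi>\<in>\<Phi>0. ennreal (\<bar>pdiff k (\<lambda>\<psi>. laplace (G \<psi>) u) \<phi>\<bar>\<^sup>2)) * ennreal (W u) * indicator pos_orthant u"
        by (cases "u \<in> pos_orthant") simp_all
    qed
    also have "\<dots> < \<infinity>" by (rule gradient_square_integrable)
    finally show ?thesis .
  qed
  then show ?thesis unfolding gradient_bound_def by (subst nn_integral_sum[OF m]) (simp add: less_top)
qed

lemma AE_gradient_bound: "AE u in \<nu>. gradient_bound dense_set \<Phi>0 (\<lambda>\<phi>. L \<phi> u) < \<infinity>"
  using nn_integral_PInf_AE[OF gradient_bound_measurable_\<nu>] gradient_bound_\<nu> by (auto simp: less_top)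

lemma L_grad_square_integrable: "integrable \<nu> (\<lambda>u. (norm (L_grad u))\<^sup>2)"
proof (rule integrableI_bounded)
  show "(\<lambda>u. (norm (L_grad u))\<^sup>2) \<in> borel_measurable \<nu>"
    using measurable_\<nu>[OF L_grad_measurable] by simp
  have "(\<integral>\<^sup>+u. ennreal (norm ((norm (L_grad u))\<^sup>2)) \<partial>\<nu>) \<le> (\<integral>\<^sup>+u. gradient_bound dense_set \<Phi>0 (\<lambda>\<phi>. L \<phi> u) \<partial>\<nu>)"
  proof (rule nn_integral_mono)
    fix u assume "u \<in> space \<nu>"
    then have C1: "C1_function (\<lambda>\<phi>. L \<phi> u) \<Phi>0 dense_set \<phi>0 L_radius" by (simp add: L_C1)
    show "ennreal (norm ((norm (L_grad u))\<^sup>2)) \<le> gradient_bound dense_set \<Phi>0 (\<lambda>\<phi>. L \<phi> u)"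
      using C1_function.norm_gradient_le[OF C1 \<Phi>0(3)]
      unfolding L_grad_def seq_gradient_eq[OF C1_function.diff[OF C1 \<Phi>0(3)]] by simp
  qed
  also have "\<dots> < \<infinity>" by (rule gradient_bound_\<nu>)
  finally show "(\<integral>\<^sup>+u. ennreal (norm ((norm (L_grad u))\<^sup>2)) \<partial>\<nu>) < \<infinity>" .
qed

text \<open>The null set of exceptional \<open>u\<close> is the same for all \<open>\<phi>\<close>
  in the ball, so the random \<open>\<phi>hat T\<close> may be inserted.\<close>

lemma L_expansion:
  assumes \<delta>: "\<delta> \<le> L_radius"
  shows "AE u in \<nu>. \<forall>\<phi>\<in>ball \<phi>0 \<delta>. \<bar>L \<phi> u - L \<phi>0 u - L_grad u \<bullet> (\<phi> - \<phi>0)\<bar> \<le> sqrt (L_remainder \<delta> u) * norm (\<phi> - \<phi>0)"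
  using AE_gradient_bound AE_space[of \<nu>]
proof (eventually_elim, intro ballI)
  fix u \<phi>
  assume fin: "gradient_bound dense_set \<Phi>0 (\<lambda>\<phi>. L \<phi> u) < \<infinity>" and u: "u \<in> space \<nu>" and \<phi>: "\<phi> \<in> ball \<phi>0 \<delta>"
  have C1: "C1_function (\<lambda>\<phi>. L \<phi> u) \<Phi>0 dense_set \<phi>0 L_radius" using u by (simp add: L_C1)
  have "4 * gradient_bound dense_set \<Phi>0 (\<lambda>\<phi>. L \<phi> u) < \<infinity>" using fin by (simp add: ennreal_mult_less_top)
  then have "taylor_remainder dense_set \<phi>0 \<delta> (\<lambda>\<phi>. L \<phi> u) < \<infinity>"
    by (rule le_less_trans[OF C1_function.taylor_remainder_le[OF C1 \<delta>]])
  from C1_function.taylor_remainder_bound[OF C1 \<delta> \<phi> this]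
  have "(L \<phi> u - L \<phi>0 u - L_grad u \<bullet> (\<phi> - \<phi>0))\<^sup>2 \<le> L_remainder \<delta> u * (norm (\<phi> - \<phi>0))\<^sup>2"
    unfolding L_grad_def L_remainder_def seq_gradient_eq[OF C1_function.diff[OF C1 \<Phi>0(3)]] .
  from real_sqrt_le_mono[OF this]
  show "\<bar>L \<phi> u - L \<phi>0 u - L_grad u \<bullet> (\<phi> - \<phi>0)\<bar> \<le> sqrt (L_remainder \<delta> u) * norm (\<phi> - \<phi>0)"
    by (simp add: real_sqrt_mult)
qed

lemma L_remainder_nonneg: "0 \<le> L_remainder \<delta> u"
  by (simp add: L_remainder_def)

lemma L_remainder_integral:
  assumes \<delta>: "\<delta> \<longlonglongrightarrow> 0" "\<And>n. \<delta> n \<le> L_radius"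
  shows "integrable \<nu> (L_remainder (\<delta> n))" and "(\<lambda>n. \<integral>u. L_remainder (\<delta> n) u \<partial>\<nu>) \<longlonglongrightarrow> 0"
proof -
  have m: "(\<lambda>u. taylor_remainder dense_set \<phi>0 \<delta> (\<lambda>\<phi>. L \<phi> u)) \<in> borel_measurable \<nu>" for \<delta>
    by (intro taylor_remainder_measurable dense_set L_measurable)
  have le: "ennreal (L_remainder \<delta> u) \<le> taylor_remainder dense_set \<phi>0 \<delta> (\<lambda>\<phi>. L \<phi> u)" for \<delta> u
    by (simp add: L_remainder_def ennreal_enn2real_if)
  show i: "integrable \<nu> (L_remainder (\<delta> n))" for n
  proof (rule integrableI_bounded)
    show "L_remainder (\<delta> n) \<in> borel_measurable \<nu>" unfolding L_remainder_def using m by measurable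
    have "(\<integral>\<^sup>+u. ennreal (norm (L_remainder (\<delta> n) u)) \<partial>\<nu>) \<le> (\<integral>\<^sup>+u. 4 * gradient_bound dense_set \<Phi>0 (\<lambda>\<phi>. L \<phi> u) \<partial>\<nu>)"
    proof (rule nn_integral_mono)
      fix u assume u: "u \<in> space \<nu>"
      have "ennreal (norm (L_remainder (\<delta> n) u)) \<le> taylor_remainder dense_set \<phi>0 (\<delta> n) (\<lambda>\<phi>. L \<phi> u)"
        using le by (simp add: L_remainder_nonneg)
      also have "\<dots> \<le> 4 * gradient_bound dense_set \<Phi>0 (\<lambda>\<phi>. L \<phi> u)"
        using u by (intro C1_function.taylor_remainder_le[OF L_C1 \<delta>(2)]) simp
      finally show "ennreal (norm (L_remainder (\<delta> n) u)) \<le> 4 * gradient_bound dense_set \<Phi>0 (\<lambda>\<phi>. L \<phi> u)" .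
    qed
    also have "\<dots> < \<infinity>" using gradient_bound_\<nu> gradient_bound_measurable_\<nu>
      by (subst nn_integral_cmult) (auto simp: ennreal_mult_less_top)
    finally show "(\<integral>\<^sup>+u. ennreal (norm (L_remainder (\<delta> n) u)) \<partial>\<nu>) < \<infinity>" .
  qed
  have "(\<lambda>n. \<integral>\<^sup>+u. taylor_remainder dense_set \<phi>0 (\<delta> n) (\<lambda>\<phi>. L \<phi> u) \<partial>\<nu>) \<longlonglongrightarrow> 0"
    by (rule taylor_remainder_integral_tendsto[OF dense_set(1) L_measurable _ L_radius(1) gradient_bound_\<nu> \<delta>])
      (auto intro!: AE_I2 L_C1)
  then have "(\<lambda>n. ennreal (\<integral>u. L_remainder (\<delta> n) u \<partial>\<nu>)) \<longlonglongrightarrow> 0"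
  proof (rule tendsto_sandwich[OF _ _ tendsto_const, rotated 2])
    show "eventually (\<lambda>n. ennreal (\<integral>u. L_remainder (\<delta> n) u \<partial>\<nu>) \<le> (\<integral>\<^sup>+u. taylor_remainder dense_set \<phi>0 (\<delta> n) (\<lambda>\<phi>. L \<phi> u) \<partial>\<nu>)) sequentially"
      using le by (intro always_eventually allI, subst nn_integral_eq_integral[symmetric, OF i])
        (auto intro!: nn_integral_mono simp: L_remainder_nonneg)
  qed auto
  from tendsto_enn2real[of _ 0, unfolded ennreal_0, OF this] show "(\<lambda>n. \<integral>u. L_remainder (\<delta> n) u \<partial>\<nu>) \<longlonglongrightarrow> 0"
    by (simp add: integral_nonneg_AE L_remainder_nonneg)
qed

end

section \<open>The limit process\<close>

context prob_space
begin

lemma md_process_add: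
  assumes \<epsilon>: "\<And>t. \<epsilon> t \<in> borel_measurable M" and D: "md_process \<epsilon> D" and D': "md_process \<epsilon> D'"
  shows "md_process \<epsilon> (\<lambda>t w. D t w + D' t w)"
  using md_process_sum[OF \<epsilon>, where A = "UNIV :: bool set" and D = "\<lambda>b. if b then D else D'" and c = "\<lambda>_. 1"] D D'
  by (simp add: UNIV_bool add.commute)

lemma md_process_inner:
  assumes \<epsilon>: "\<And>t. \<epsilon> t \<in> borel_measurable M"
    and m: "martingale_differences M (\<lambda>t. gen_sigma M \<epsilon> {..t}) m"
    and m2: "\<And>t k. integrable M (\<lambda>w. (m t w $ k)\<^sup>2)"
  shows "md_process \<epsilon> (\<lambda>t w. a \<bullet> m t w)"
  unfolding inner_vec_def inner_real_def
  by (rule md_process_sum[OF \<epsilon> md_process_martingale_differences[OF \<epsilon> m m2]])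

text \<open>The second moments of the normalised sums do not grow with \<open>T\<close>, and
  \<open>a \<le> 1 + a^2\<close> converts this into a bound on the expected norm.\<close>

lemma normalized_sum_bounded:
  fixes m :: "int \<Rightarrow> 'a \<Rightarrow> real ^ 'n::finite"
  assumes \<epsilon>: "\<And>t. \<epsilon> t \<in> borel_measurable M"
    and m: "martingale_differences M (\<lambda>t. gen_sigma M \<epsilon> {..t}) m"
    and m2: "\<And>t k. integrable M (\<lambda>w. (m t w $ k)\<^sup>2)"
    and stat: "strictly_stationary M m"
  shows "bounded_in_prob M (\<lambda>T w. norm ((1 / sqrt (real T)) *\<^sub>R (\<Sum>t = 1..T. m (int t) w)))"
proof -
  note [measurable] = strictly_stationary_measurable[OF stat]
  have vm: "(\<lambda>y::real ^ 'n. y $ k) \<in> borel_measurable borel" for k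
    by (intro borel_measurable_continuous_onI continuous_intros)
  define v where "v k = (\<integral>w. (m 0 w $ k)\<^sup>2 \<partial>M)" for k
  have v: "(\<integral>w. (m t w $ k)\<^sup>2 \<partial>M) = v k" for t k
  proof -
    have "(\<integral>w. (m t w $ k)\<^sup>2 \<partial>M) = (\<integral>y. (y $ k)\<^sup>2 \<partial>distr M borel (m t))" for t
      by (subst integral_distr) (use vm in auto)
    then show ?thesis unfolding v_def using strictly_stationary_distr[OF stat, of t] by simp
  qed
  define S where "S T w = (1 / sqrt (real T)) *\<^sub>R (\<Sum>t = 1..T. m (int t) w)" for T w
  have Sk: "S T w $ k = (\<Sum>t = 1..T. m (int t) w $ k) / sqrt (real T)" for T w k
    unfolding S_def by simp
  have Sm [measurable]: "S T \<in> borel_measurable M" for T unfolding S_def by measurable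
  show ?thesis unfolding S_def[symmetric]
  proof (rule bounded_in_prob_expectation)
    show "(\<lambda>w. norm (S T w)) \<in> borel_measurable M" for T by measurable
    show "0 \<le> 1 + (\<Sum>k\<in>UNIV. v k)" by (intro add_nonneg_nonneg sum_nonneg) (auto simp: v_def)
    fix T
    have sq: "integrable M (\<lambda>w. (S T w $ k)\<^sup>2)" "(\<integral>w. (S T w $ k)\<^sup>2 \<partial>M) \<le> v k" for k
    proof -
      have "integrable M (\<lambda>w. (S T w $ k)\<^sup>2) \<and> (\<integral>w. (S T w $ k)\<^sup>2 \<partial>M) \<le> v k"
      proof (cases "T = 0")
        case True
        then show ?thesis by (simp add: S_def v_def)
      next
        case False
        from md_process_normalized_sum[OF \<epsilon> md_process_martingale_differences[OF \<epsilon> m m2] v, of T k] False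
        show ?thesis unfolding Sk by (auto dest: L2_square)
      qed
      then show "integrable M (\<lambda>w. (S T w $ k)\<^sup>2)" "(\<integral>w. (S T w $ k)\<^sup>2 \<partial>M) \<le> v k" by auto
    qed
    have le: "norm (S T w) \<le> 1 + (\<Sum>k\<in>UNIV. (S T w $ k)\<^sup>2)" for w
      using zero_le_power2[of "norm (S T w) - 1/2"] unfolding norm_vec_squared[symmetric]
      by (simp add: power2_eq_square algebra_simps)
    have "(\<integral>\<^sup>+w. ennreal \<bar>norm (S T w)\<bar> \<partial>M) \<le> (\<integral>\<^sup>+w. ennreal (1 + (\<Sum>k\<in>UNIV. (S T w $ k)\<^sup>2)) \<partial>M)"
      using le by (intro nn_integral_mono ennreal_leI) simp
    also have "\<dots> = ennreal (\<integral>w. 1 + (\<Sum>k\<in>UNIV. (S T w $ k)\<^sup>2) \<partial>M)"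
      using sq by (intro nn_integral_eq_integral) (auto intro!: add_nonneg_nonneg sum_nonneg)
    also have "\<dots> \<le> ennreal (1 + (\<Sum>k\<in>UNIV. v k))"
      using sq by (intro ennreal_leI) (simp add: prob_space sum_mono)
    finally show "(\<integral>\<^sup>+w. ennreal \<bar>norm (S T w)\<bar> \<partial>M) \<le> ennreal (1 + (\<Sum>k\<in>UNIV. v k))" .
  qed
qed

end

locale vmem_test = vmem M x \<epsilon> \<mu> \<theta>0 \<Omega>0 U \<omega>0 + weighted_family G \<Phi> \<Phi>0 \<phi>0 W
  for M :: "'w measure" and x \<epsilon> :: "int \<Rightarrow> 'w \<Rightarrow> real ^ 'd::finite"
    and \<mu> :: "real ^ 'k::finite \<Rightarrow> (nat \<Rightarrow> real ^ 'd) \<Rightarrow> real ^ 'd"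
    and \<theta>0 :: "real ^ 'k" and \<Omega>0 U :: "(real ^ 'k) set" and \<omega>0 :: real
    and G :: "real ^ 'r::finite \<Rightarrow> (real ^ 'd) measure" and \<Phi> \<Phi>0 :: "(real ^ 'r) set"
    and \<phi>0 :: "real ^ 'r" and W :: "real ^ 'd \<Rightarrow> real" +
  fixes m1 :: "int \<Rightarrow> 'w \<Rightarrow> real ^ 'k" and m2 :: "int \<Rightarrow> 'w \<Rightarrow> real ^ 'r"
  assumes \<epsilon>_measurable [measurable]: "\<And>t. \<epsilon> t \<in> borel_measurable M"
    and \<epsilon>_integrable: "\<And>t. integrable M (\<epsilon> t)"
    and \<epsilon>_indep: "indep_vars (\<lambda>_. borel) \<epsilon> UNIV"
    and G_support: "\<And>\<phi>. \<phi> \<in> \<Phi> \<Longrightarrow> AE y in G \<phi>. y \<in> pos_orthant"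
    and \<epsilon>_distr: "\<And>t. distr M borel (\<epsilon> t) = G \<phi>0"
    and joint_stationary: "strictly_stationary M (\<lambda>t w. (\<epsilon> t w, m1 t w, m2 t w))"
    and m1: "martingale_differences M (\<lambda>t. gen_sigma M \<epsilon> {..t}) m1"
    and m2: "martingale_differences M (\<lambda>t. gen_sigma M \<epsilon> {..t}) m2"
    and m1_square: "\<And>t k. integrable M (\<lambda>w. (m1 t w $ k)\<^sup>2)"
    and m2_square: "\<And>t k. integrable M (\<lambda>w. (m2 t w $ k)\<^sup>2)"
    and pdiff_measurable: "\<And>t j k. (\<lambda>w. pdiff k (\<lambda>\<theta>. \<mu> \<theta> (past x (t - 1) w) $ j) \<theta>0) \<in> borel_measurable M"
begin

abbreviation cov :: "int \<Rightarrow> real ^ 'd \<Rightarrow> real ^ 'd \<Rightarrow> real" where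
  "cov \<equiv> limit_cov M \<mu> x \<epsilon> \<theta>0 G \<phi>0 m1 m2"

text \<open>A version of \<open>Y_term\<close> jointly measurable in \<open>u\<close> and the sample
  point: \<open>mean_score\<close> stands for the row obtained from \<open>Gamma_mat\<close>, and
  \<open>L_grad\<close> for the gradient. The two versions agree on the orthant, and here the
  coefficients do not mention the time \<open>t\<close>.\<close>

definition Y :: "int \<Rightarrow> real ^ 'd \<Rightarrow> 'w \<Rightarrow> real" where
  "Y t u w = exp (- (u \<bullet> \<epsilon> t w)) - L \<phi>0 u + mean_score u \<bullet> m1 t w - L_grad u \<bullet> m2 t w"

lemma Y_term_eq: "u \<in> pos_orthant \<Longrightarrow> Y_term M \<mu> x \<epsilon> \<theta>0 G \<phi>0 m1 m2 t u w = Y t u w"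
  unfolding Y_term_def Y_def Gamma_mat_mult[OF \<epsilon>_measurable pdiff_measurable]
  by (simp add: L_def \<Phi>0 L_grad_eq)

lemma m_stationary: "strictly_stationary M m1" "strictly_stationary M m2"
  using strictly_stationary_compose[OF joint_stationary, of "\<lambda>(a, b, c). b"]
    strictly_stationary_compose[OF joint_stationary, of "\<lambda>(a, b, c). c"] by (simp_all add: borel_prod[symmetric])

lemma m_measurable [measurable]: "m1 t \<in> borel_measurable M" "m2 t \<in> borel_measurable M"
  using m_stationary by (auto intro: strictly_stationary_measurable)

lemma AE_\<epsilon>: "AE w in M. \<epsilon> t w \<in> pos_orthant"
proof -
  have "AE y in distr M borel (\<epsilon> t). y \<in> pos_orthant"
    unfolding \<epsilon>_distr using G_support[of \<phi>0] \<Phi>0 by auto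
  then show ?thesis by (rule AE_distrD[rotated]) simp
qed

lemma exp_neg_inner_le_one: "u \<in> pos_orthant \<Longrightarrow> y \<in> pos_orthant \<Longrightarrow> exp (- (u \<bullet> y)) \<le> (1::real)"
  using inner_nonneg_orthant[of u y] by (auto simp: pos_orthant_def less_imp_le)

lemma exp_\<epsilon>_integrable:
  assumes u: "u \<in> pos_orthant"
  shows "L2 M (\<lambda>w. exp (- (u \<bullet> \<epsilon> t w)))" "integrable M (\<lambda>w. exp (- (u \<bullet> \<epsilon> t w)))"
    "(\<integral>w. exp (- (u \<bullet> \<epsilon> t w)) \<partial>M) = L \<phi>0 u"
proof -
  have "AE w in M. norm (exp (- (u \<bullet> \<epsilon> t w))) \<le> 1"
    using AE_\<epsilon>[of t] by eventually_elim (use exp_neg_inner_le_one[OF u] in auto)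
  then show "integrable M (\<lambda>w. exp (- (u \<bullet> \<epsilon> t w)))" by (rule integrable_const_bound) measurable
  have "AE w in M. norm ((exp (- (u \<bullet> \<epsilon> t w)))\<^sup>2) \<le> 1"
    using AE_\<epsilon>[of t] by eventually_elim (use exp_neg_inner_le_one[OF u] in \<open>auto intro!: power_le_one\<close>)
  then have "integrable M (\<lambda>w. (exp (- (u \<bullet> \<epsilon> t w)))\<^sup>2)" by (rule integrable_const_bound) measurable
  then show "L2 M (\<lambda>w. exp (- (u \<bullet> \<epsilon> t w)))" by (simp add: L2_def)
  have m: "(\<lambda>y. exp (- (u \<bullet> y))) \<in> borel_measurable borel" by measurable
  have "(\<integral>w. exp (- (u \<bullet> \<epsilon> t w)) \<partial>M) = (\<integral>y. exp (- (u \<bullet> y)) \<partial>G \<phi>0)"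
    unfolding \<epsilon>_distr[of t, symmetric] by (subst integral_distr) auto
  also have "\<dots> = laplace (G \<phi>0) u"
    unfolding laplace_def set_lebesgue_integral_def
  proof (rule integral_cong_AE)
    have s: "sets (G \<phi>0) = sets borel" using G_sets \<Phi>0 by auto
    show "(\<lambda>y. exp (- (u \<bullet> y))) \<in> borel_measurable (G \<phi>0)" by (simp add: measurable_cong_sets[OF s refl])
    show "(\<lambda>y. indicat_real pos_orthant y *\<^sub>R exp (- (u \<bullet> y))) \<in> borel_measurable (G \<phi>0)"
      unfolding measurable_cong_sets[OF s refl]
      by (intro borel_measurable_scaleR borel_measurable_indicator pos_orthant_sets m)
    show "AE y in G \<phi>0. exp (- (u \<bullet> y)) = indicat_real pos_orthant y *\<^sub>R exp (- (u \<bullet> y))"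
    proof -
      have "AE y in G \<phi>0. y \<in> pos_orthant" using G_support[of \<phi>0] \<Phi>0 by blast
      then show ?thesis by eventually_elim simp
    qed
  qed
  finally show "(\<integral>w. exp (- (u \<bullet> \<epsilon> t w)) \<partial>M) = L \<phi>0 u" by (simp add: L_def \<Phi>0)
qed

lemma Y_md: "u \<in> pos_orthant \<Longrightarrow> md_process \<epsilon> (\<lambda>t. Y t u)"
proof -
  assume u: "u \<in> pos_orthant"
  have "md_process \<epsilon> (\<lambda>t w. (exp (- (u \<bullet> \<epsilon> t w)) - L \<phi>0 u) + (mean_score u \<bullet> m1 t w + (- L_grad u) \<bullet> m2 t w))"
    by (intro md_process_add \<epsilon>_measurable md_process_inner m1 m2 m1_square m2_square
        md_process_independent[OF \<epsilon>_indep, of "\<lambda>y. exp (- (u \<bullet> y))"] exp_\<epsilon>_integrable[OF u]) measurable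
  then show ?thesis unfolding Y_def[abs_def] by (simp add: algebra_simps)
qed

lemma Y_L2: "u \<in> pos_orthant \<Longrightarrow> L2 M (Y t u)"
  using md_processD(2)[OF Y_md] by auto

lemma Y_stationary:
  assumes g: "g \<in> borel_measurable borel"
  shows "strictly_stationary M (\<lambda>t w. g (\<epsilon> t w, m1 t w, m2 t w))"
  by (rule strictly_stationary_compose[OF joint_stationary g])

lemma Y_fun_measurable:
  "(\<lambda>(y, a, b). exp (- (u \<bullet> y)) - L \<phi>0 u + mean_score u \<bullet> a - L_grad u \<bullet> b) \<in> borel_measurable borel"
  by (simp add: borel_prod[symmetric])

lemma Y_eq: "Y t u w = (\<lambda>(y, a, b). exp (- (u \<bullet> y)) - L \<phi>0 u + mean_score u \<bullet> a - L_grad u \<bullet> b) (\<epsilon> t w, m1 t w, m2 t w)"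
  by (simp add: Y_def)

lemma Y_combination_stationary: "strictly_stationary M (\<lambda>t w. \<Sum>u\<in>J. c u * Y t u w)"
  unfolding Y_eq
  by (rule Y_stationary[of "\<lambda>z. \<Sum>u\<in>J. c u * (\<lambda>(y, a, b). exp (- (u \<bullet> y)) - L \<phi>0 u + mean_score u \<bullet> a - L_grad u \<bullet> b) z"])
    (intro borel_measurable_sum borel_measurable_times borel_measurable_const Y_fun_measurable)

lemma stationary_integral:
  fixes D :: "int \<Rightarrow> 'w \<Rightarrow> real"
  assumes "strictly_stationary M D"
  shows "(\<integral>w. D t w \<partial>M) = (\<integral>w. D 0 w \<partial>M)"
proof -
  have "(\<integral>w. D t w \<partial>M) = (\<integral>y. y \<partial>distr M borel (D t))" for t
    using strictly_stationary_measurable[OF assms, of t] by (simp add: integral_distr)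
  then show ?thesis using strictly_stationary_distr[OF assms, of t] by simp
qed

text \<open>Joint stationarity makes the covariance independent of the time \<open>t0\<close> at
  which it is evaluated.\<close>

lemma limit_cov_eq:
  assumes "u \<in> pos_orthant" "s \<in> pos_orthant"
  shows "cov t0 u s = (\<integral>w. Y 0 u w * Y 0 s w \<partial>M)"
proof -
  have "strictly_stationary M (\<lambda>t w. Y t u w * Y t s w)"
    unfolding Y_eq
    by (rule Y_stationary[of "\<lambda>z. (\<lambda>(y, a, b). exp (- (u \<bullet> y)) - L \<phi>0 u + mean_score u \<bullet> a - L_grad u \<bullet> b) z
        * (\<lambda>(y, a, b). exp (- (s \<bullet> y)) - L \<phi>0 s + mean_score s \<bullet> a - L_grad s \<bullet> b) z"])
      (intro borel_measurable_times Y_fun_measurable)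
  from stationary_integral[OF this, of t0] show ?thesis
    unfolding limit_cov_def using assms by (simp add: Y_term_eq)
qed

lemma id_\<nu> [measurable]: "(\<lambda>u. u) \<in> borel_measurable \<nu>"
  by (rule measurable_\<nu>) simp

lemma [measurable]: "mean_score \<in> borel_measurable borel" "L_grad \<in> borel_measurable borel" "L \<phi> \<in> borel_measurable borel"
  by (fact mean_score_measurable L_grad_measurable L_measurable_borel)+

lemma Y_jointly_measurable_borel: "(\<lambda>(w, u). Y t u w) \<in> borel_measurable (M \<Otimes>\<^sub>M borel)"
  unfolding Y_def by measurable

lemma Y_jointly_measurable [measurable]: "(\<lambda>(w, u). Y t u w) \<in> borel_measurable (M \<Otimes>\<^sub>M \<nu>)"
proof -
  have "(\<lambda>z. (fst z, snd z)) \<in> measurable (M \<Otimes>\<^sub>M \<nu>) (M \<Otimes>\<^sub>M borel)" by measurable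
  from measurable_compose[OF this Y_jointly_measurable_borel[of t]] show ?thesis by (simp add: case_prod_beta)
qed

definition second_moment :: "('w \<Rightarrow> 'z::real_normed_vector) \<Rightarrow> real" where
  "second_moment X = (\<integral>w. (norm (X w))\<^sup>2 \<partial>M)"

lemma norm_square_m: "integrable M (\<lambda>w. (norm (m1 t w))\<^sup>2)" "integrable M (\<lambda>w. (norm (m2 t w))\<^sup>2)"
  unfolding norm_vec_squared using m1_square m2_square by auto

lemma mean_score_square_integrable: "integrable \<nu> (\<lambda>u. (norm (mean_score u))\<^sup>2)"
proof (rule Bochner_Integration.integrable_bound)
  let ?c = "real CARD('k) * (\<integral>p. grad_norm p \<partial>law)"
  show "integrable \<nu> (\<lambda>u. ?c\<^sup>2 * (norm u)\<^sup>2)" using norm_square_integrable by simp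
  show "(\<lambda>u. (norm (mean_score u))\<^sup>2) \<in> borel_measurable \<nu>"
    using measurable_\<nu>[OF mean_score_measurable] by simp
  show "AE u in \<nu>. norm ((norm (mean_score u))\<^sup>2) \<le> norm (?c\<^sup>2 * (norm u)\<^sup>2)"
  proof (rule AE_I2)
    fix u assume "u \<in> space \<nu>"
    then have "norm (mean_score u) \<le> ?c * norm u" using mean_score_bound[of u] by (simp add: mult_ac)
    from power_mono[OF this norm_ge_zero, of 2]
    show "norm ((norm (mean_score u))\<^sup>2) \<le> norm (?c\<^sup>2 * (norm u)\<^sup>2)" by (simp add: power_mult_distrib)
  qed
qed

lemma inner_square_le: "(a \<bullet> b)\<^sup>2 \<le> (norm a)\<^sup>2 * (norm b)\<^sup>2" for a b :: "'z::real_inner"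
  using power_mono[OF Cauchy_Schwarz_ineq2[of a b], of 2] by (simp add: power_mult_distrib)

lemma square_sum_le: "(a + b - c)\<^sup>2 \<le> 3 * (a\<^sup>2 + b\<^sup>2 + c\<^sup>2)" for a b c :: real
  using sum_squares_ge_zero[of "a - b" "a + c"] zero_le_power2[of "b + c"]
  by (simp add: power2_eq_square algebra_simps)

lemma Y_variance_bound:
  assumes u: "u \<in> pos_orthant"
  shows "(\<integral>w. (Y 0 u w)\<^sup>2 \<partial>M) \<le> 3 * (1 + (norm (mean_score u))\<^sup>2 * second_moment (m1 0) + (norm (L_grad u))\<^sup>2 * second_moment (m2 0))"
proof -
  have L01: "0 \<le> L \<phi>0 u" "L \<phi>0 u \<le> 1"
  proof -
    have "AE w in M. exp (- (u \<bullet> \<epsilon> 0 w)) \<le> 1" using AE_\<epsilon>[of 0] by eventually_elim (use exp_neg_inner_le_one[OF u] in auto)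
    from integral_mono_AE[OF exp_\<epsilon>_integrable(2)[OF u] _ this] show "L \<phi>0 u \<le> 1"
      by (simp add: exp_\<epsilon>_integrable(3)[OF u] prob_space)
    show "0 \<le> L \<phi>0 u" unfolding exp_\<epsilon>_integrable(3)[OF u, of 0, symmetric] by (intro integral_nonneg_AE AE_I2) simp
  qed
  have "(\<integral>w. (Y 0 u w)\<^sup>2 \<partial>M) \<le> (\<integral>w. 3 * (1 + (norm (mean_score u))\<^sup>2 * (norm (m1 0 w))\<^sup>2 + (norm (L_grad u))\<^sup>2 * (norm (m2 0 w))\<^sup>2) \<partial>M)"
  proof (rule integral_mono_AE)
    show "integrable M (\<lambda>w. (Y 0 u w)\<^sup>2)" by (rule L2_square[OF Y_L2[OF u]])
    show "integrable M (\<lambda>w. 3 * (1 + (norm (mean_score u))\<^sup>2 * (norm (m1 0 w))\<^sup>2 + (norm (L_grad u))\<^sup>2 * (norm (m2 0 w))\<^sup>2))"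
      using norm_square_m by auto
    show "AE w in M. (Y 0 u w)\<^sup>2 \<le> 3 * (1 + (norm (mean_score u))\<^sup>2 * (norm (m1 0 w))\<^sup>2 + (norm (L_grad u))\<^sup>2 * (norm (m2 0 w))\<^sup>2)"
      using AE_\<epsilon>[of 0]
    proof eventually_elim
      case (elim w)
      have "\<bar>exp (- (u \<bullet> \<epsilon> 0 w)) - L \<phi>0 u\<bar> \<le> 1" unfolding abs_le_iff
        using exp_neg_inner_le_one[OF u elim] exp_ge_zero[of "- (u \<bullet> \<epsilon> 0 w)"] L01 by linarith
      from power_mono[OF this, of 2] have 1: "(exp (- (u \<bullet> \<epsilon> 0 w)) - L \<phi>0 u)\<^sup>2 \<le> 1" by simp
      show ?case unfolding Y_def
        by (rule order_trans[OF square_sum_le]) (intro mult_left_mono add_mono 1 inner_square_le, simp)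
    qed
  qed
  also have "\<dots> = 3 * (1 + (norm (mean_score u))\<^sup>2 * second_moment (m1 0) + (norm (L_grad u))\<^sup>2 * second_moment (m2 0))"
    unfolding second_moment_def using norm_square_m by (simp add: prob_space)
  finally show ?thesis .
qed

lemma Y_variance_integrable: "integrable \<nu> (\<lambda>u. \<integral>w. (Y 0 u w)\<^sup>2 \<partial>M)"
proof (rule Bochner_Integration.integrable_bound)
  show "integrable \<nu> (\<lambda>u. 3 * (1 + (norm (mean_score u))\<^sup>2 * second_moment (m1 0) + (norm (L_grad u))\<^sup>2 * second_moment (m2 0)))"
    using mean_score_square_integrable L_grad_square_integrable by auto
  show "(\<lambda>u. \<integral>w. (Y 0 u w)\<^sup>2 \<partial>M) \<in> borel_measurable \<nu>" by measurable
  show "AE u in \<nu>. norm (\<integral>w. (Y 0 u w)\<^sup>2 \<partial>M)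
    \<le> norm (3 * (1 + (norm (mean_score u))\<^sup>2 * second_moment (m1 0) + (norm (L_grad u))\<^sup>2 * second_moment (m2 0)))"
    by (rule AE_I2) (auto intro!: order_trans[OF Y_variance_bound] order_trans[OF _ abs_ge_self])
qed

text \<open>The difference of the two exponentials is at most one in modulus, so its square is at
  most its modulus; the Lipschitz bound then involves only the first moment of
  \<open>\<epsilon>\<close>, which is finite by assumption.\<close>

lemma Y_distance_bound:
  assumes u: "u \<in> pos_orthant" and s: "s \<in> pos_orthant"
  shows "(\<integral>w. (Y 0 s w - Y 0 u w)\<^sup>2 \<partial>M) \<le> 4 * (norm (s - u) * (\<integral>w. norm (\<epsilon> 0 w) \<partial>M) + (L \<phi>0 s - L \<phi>0 u)\<^sup>2
    + (norm (mean_score s - mean_score u))\<^sup>2 * second_moment (m1 0) + (norm (L_grad s - L_grad u))\<^sup>2 * second_moment (m2 0))"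
proof -
  let ?B = "\<lambda>w. 4 * (norm (s - u) * norm (\<epsilon> 0 w) + (L \<phi>0 s - L \<phi>0 u)\<^sup>2
    + (norm (mean_score s - mean_score u))\<^sup>2 * (norm (m1 0 w))\<^sup>2 + (norm (L_grad s - L_grad u))\<^sup>2 * (norm (m2 0 w))\<^sup>2)"
  have "(\<integral>w. (Y 0 s w - Y 0 u w)\<^sup>2 \<partial>M) \<le> (\<integral>w. ?B w \<partial>M)"
  proof (rule integral_mono_AE)
    show "integrable M (\<lambda>w. (Y 0 s w - Y 0 u w)\<^sup>2)" by (intro L2_square L2_diff Y_L2 u s)
    show "integrable M ?B" using norm_square_m \<epsilon>_integrable by auto
    show "AE w in M. (Y 0 s w - Y 0 u w)\<^sup>2 \<le> ?B w"
      using AE_\<epsilon>[of 0]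
    proof eventually_elim
      case (elim w)
      have d: "Y 0 s w - Y 0 u w = (exp (- (s \<bullet> \<epsilon> 0 w)) - exp (- (u \<bullet> \<epsilon> 0 w))) - (L \<phi>0 s - L \<phi>0 u)
        + (mean_score s - mean_score u) \<bullet> m1 0 w - (L_grad s - L_grad u) \<bullet> m2 0 w"
        by (simp add: Y_def inner_diff_left)
      have four: "(a - b + c - d)\<^sup>2 \<le> 4 * (a\<^sup>2 + b\<^sup>2 + c\<^sup>2 + d\<^sup>2)" for a b c d :: real
        using sum_squares_ge_zero[of "a + b" "a - c"] sum_squares_ge_zero[of "a + d" "b + c"] sum_squares_ge_zero[of "b - d" "c + d"]
        by (simp add: power2_eq_square algebra_simps)
      let ?e = "exp (- (s \<bullet> \<epsilon> 0 w)) - exp (- (u \<bullet> \<epsilon> 0 w))"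
      have "\<bar>?e\<bar> \<le> 1" unfolding abs_le_iff
        using exp_neg_inner_le_one[OF u elim] exp_ge_zero[of "- (u \<bullet> \<epsilon> 0 w)"]
          exp_neg_inner_le_one[OF s elim] exp_ge_zero[of "- (s \<bullet> \<epsilon> 0 w)"] by linarith
      then have "\<bar>?e\<bar> * \<bar>?e\<bar> \<le> \<bar>?e\<bar> * 1" by (intro mult_left_mono) auto
      then have "?e\<^sup>2 \<le> \<bar>?e\<bar> * 1" by (simp add: power2_eq_square flip: abs_mult)
      also have "\<bar>?e\<bar> \<le> \<bar>s \<bullet> \<epsilon> 0 w - u \<bullet> \<epsilon> 0 w\<bar>"
        using elim u s by (intro abs_exp_neg_diff_le inner_nonneg_orthant) (auto simp: pos_orthant_def less_imp_le)
      also have "\<dots> \<le> norm (s - u) * norm (\<epsilon> 0 w)" unfolding inner_diff_left[symmetric] by (rule Cauchy_Schwarz_ineq2)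
      finally have 1: "?e\<^sup>2 \<le> norm (s - u) * norm (\<epsilon> 0 w)" by simp
      show ?case unfolding d
        by (rule order_trans[OF four]) (intro mult_left_mono add_mono order_refl 1 inner_square_le, simp)
    qed
  qed
  also have "\<dots> = 4 * (norm (s - u) * (\<integral>w. norm (\<epsilon> 0 w) \<partial>M) + (L \<phi>0 s - L \<phi>0 u)\<^sup>2
    + (norm (mean_score s - mean_score u))\<^sup>2 * second_moment (m1 0) + (norm (L_grad s - L_grad u))\<^sup>2 * second_moment (m2 0))"
    unfolding second_moment_def using norm_square_m \<epsilon>_integrable by (simp add: prob_space)
  finally show ?thesis .
qed

text \<open>Separability replaces continuity in \<open>u\<close>: the orthant is mapped by
  \<open>h\<close> into a Euclidean space, where every subset has a countable dense subset, and the
  four components of \<open>h\<close> control the distance of the \<open>Y 0 u\<close>.\<close>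

lemma Y_separable:
  "\<exists>q. (\<forall>n::nat. q n \<in> pos_orthant) \<and>
    (\<forall>u\<in>pos_orthant. \<forall>e>0. \<exists>n. (\<integral>w. (Y 0 (q n) w - Y 0 u w)\<^sup>2 \<partial>M) < e)"
proof -
  define h where "h u = (u, L \<phi>0 u, mean_score u, L_grad u)" for u
  obtain T where T: "countable T" "T \<subseteq> h ` pos_orthant" "h ` pos_orthant \<subseteq> closure T"
    using separable[of "h ` pos_orthant"] by blast
  have ne: "(pos_orthant :: (real ^ 'd) set) \<noteq> {}"
    by (auto simp: pos_orthant_def intro!: exI[of _ "\<chi> i. 1"])
  then have "T \<noteq> {}" using T(3) by auto
  then have r: "range (from_nat_into T) = T" using range_from_nat_into[OF _ T(1)] by blast
  define r where "r = from_nat_into T"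
  have r: "range r = T" using r by (simp add: r_def)
  then have "\<exists>u\<in>pos_orthant. r n = h u" for n :: nat using T(2) by blast
  then obtain q where q: "\<And>n. q n \<in> pos_orthant" "\<And>n. r n = h (q n)" by metis
  define c where "c = (\<integral>w. norm (\<epsilon> 0 w) \<partial>M) + 1 + second_moment (m1 0) + second_moment (m2 0)"
  have nn: "0 \<le> second_moment (m1 0)" "0 \<le> second_moment (m2 0)" "0 \<le> (\<integral>w. norm (\<epsilon> 0 w) \<partial>M)"
    by (auto simp: second_moment_def)
  then have c: "0 < c" unfolding c_def by linarith
  show ?thesis
  proof (intro exI[of _ q] conjI allI ballI impI)
    show "q n \<in> pos_orthant" for n by (rule q(1))
    fix u :: "real ^ 'd" and e :: real assume u: "u \<in> pos_orthant" and e: "0 < e"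
    \<comment> \<open>The minimum with one gives \<open>\<eta>^2 \<le> \<eta>\<close>, so all four
      terms are at most \<open>\<eta>\<close> times their constants; the other bound makes the total
      at most \<open>e / 2\<close>.\<close>
    define \<eta> where "\<eta> = min 1 (e / (8 * c))"
    have \<eta>: "0 < \<eta>" using e c by (simp add: \<eta>_def)
    have "h u \<in> closure T" using T(3) u by auto
    then obtain n where "dist (r n) (h u) < \<eta>" using \<eta> r by (metis closure_approachable rangeE)
    then have d: "dist (h (q n)) (h u) < \<eta>" by (simp add: q)
    have "norm (q n - u) \<le> \<eta>" "\<bar>L \<phi>0 (q n) - L \<phi>0 u\<bar> \<le> \<eta>" "norm (mean_score (q n) - mean_score u) \<le> \<eta>" "norm (L_grad (q n) - L_grad u) \<le> \<eta>"
    proof -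
      have f: "dist (fst a) (fst b) \<le> dist a b" for a b :: "'x::metric_space \<times> 'y::metric_space" by (rule dist_fst_le)
      have s: "dist (snd a) (snd b) \<le> dist a b" for a b :: "'x::metric_space \<times> 'y::metric_space" by (rule dist_snd_le)
      let ?a = "h (q n)" and ?b = "h u"
      show "norm (q n - u) \<le> \<eta>" using f[of ?a ?b] d by (simp add: h_def dist_norm)
      show "\<bar>L \<phi>0 (q n) - L \<phi>0 u\<bar> \<le> \<eta>" using f[of "snd ?a" "snd ?b"] s[of ?a ?b] d by (simp add: h_def dist_norm)
      show "norm (mean_score (q n) - mean_score u) \<le> \<eta>"
        using f[of "snd (snd ?a)" "snd (snd ?b)"] s[of "snd ?a" "snd ?b"] s[of ?a ?b] d by (simp add: h_def dist_norm)
      show "norm (L_grad (q n) - L_grad u) \<le> \<eta>"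
        using s[of "snd (snd ?a)" "snd (snd ?b)"] s[of "snd ?a" "snd ?b"] s[of ?a ?b] d by (simp add: h_def dist_norm)
    qed
    note b = this
    have sq: "y\<^sup>2 \<le> \<eta>" if "\<bar>y\<bar> \<le> \<eta>" for y :: real
    proof -
      have "y\<^sup>2 \<le> \<eta>\<^sup>2" using power_mono[OF that, of 2] by simp
      also have "\<dots> \<le> \<eta> * 1" unfolding power2_eq_square using \<eta> by (intro mult_left_mono) (auto simp: \<eta>_def)
      finally show ?thesis by simp
    qed
    have "(\<integral>w. (Y 0 (q n) w - Y 0 u w)\<^sup>2 \<partial>M) \<le> 4 * (\<eta> * (\<integral>w. norm (\<epsilon> 0 w) \<partial>M) + \<eta> + \<eta> * second_moment (m1 0) + \<eta> * second_moment (m2 0))"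
      by (rule order_trans[OF Y_distance_bound[OF u q(1)]])
        (intro mult_left_mono add_mono mult_right_mono sq, use b nn in auto)
    also have "\<dots> = 4 * c * \<eta>" by (simp add: c_def algebra_simps)
    also have "\<dots> \<le> 4 * c * (e / (8 * c))" using c by (intro mult_left_mono) (auto simp: \<eta>_def)
    also have "\<dots> < e" using c e by simp
    finally show "\<exists>n. (\<integral>w. (Y 0 (q n) w - Y 0 u w)\<^sup>2 \<partial>M) < e" by blast
  qed
qed

lemma limit_process_exists:
  "\<exists>Z. centred_gaussian_with_cov white_noise pos_orthant Z (cov t0)"
proof -
  let ?R = "restrict_space borel pos_orthant :: (real ^ 'd) measure"
  have spR: "space ?R = pos_orthant" by (simp add: space_restrict_space)
  obtain q where q: "\<And>n::nat. q n \<in> pos_orthant"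
    "\<And>u e. u \<in> pos_orthant \<Longrightarrow> 0 < e \<Longrightarrow> \<exists>n. (\<integral>w. (Y 0 (q n) w - Y 0 u w)\<^sup>2 \<partial>M) < e"
    using Y_separable by blast
  have dm: "(\<lambda>u. \<integral>w. (Y 0 (q n) w - Y 0 u w)\<^sup>2 \<partial>M) \<in> borel_measurable ?R" for n
  proof -
    note [measurable] = Y_jointly_measurable_borel
    have [measurable]: "Y 0 (q n) \<in> borel_measurable M" by (rule L2_measurable[OF Y_L2[OF q(1)]])
    have "(\<lambda>u. \<integral>w. (Y 0 (q n) w - Y 0 u w)\<^sup>2 \<partial>M) \<in> borel_measurable borel" by measurable
    then show ?thesis by (rule measurable_restrict_space1)
  qed
  obtain Z where Z: "(\<lambda>(\<xi>, u). Z u \<xi>) \<in> borel_measurable (white_noise \<Otimes>\<^sub>M ?R)"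
    "\<And>J c. finite J \<Longrightarrow> J \<subseteq> pos_orthant \<Longrightarrow>
       (\<integral>\<xi>. iexp (\<Sum>u\<in>J. c u * Z u \<xi>) \<partial>white_noise) = of_real (exp (- ((\<integral>w. (\<Sum>u\<in>J. c u * Y 0 u w)\<^sup>2 \<partial>M) / 2)))"
    using gaussian_field_exists[of M ?R "Y 0" q] prob_space_axioms Y_L2 q dm unfolding spR by blast
  have "centred_gaussian_with_cov white_noise pos_orthant Z (cov t0)"
    by (rule centred_gaussian_if_char[OF white_noise.prob_space_axioms Z(1) limit_cov_eq Y_L2 Z(2)])
  then show ?thesis by (rule exI[of _ Z])
qed

definition Y_sum :: "nat \<Rightarrow> real ^ 'd \<Rightarrow> 'w \<Rightarrow> real" where
  "Y_sum T u w = (\<Sum>t=1..T. Y (int t) u w) / sqrt (real T)"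

lemma Y_sum_jointly_measurable [measurable]: "(\<lambda>(w, u). Y_sum T u w) \<in> borel_measurable (M \<Otimes>\<^sub>M \<nu>)"
  unfolding Y_sum_def by measurable

lemma Y_sum_square_clt:
  assumes cg: "centred_gaussian_with_cov N pos_orthant Z (cov t0)"
  shows "(\<lambda>T. \<integral>w. iexp (r * (\<integral>u. (Y_sum T u w)\<^sup>2 \<partial>\<nu>)) \<partial>M) \<longlonglongrightarrow> (\<integral>v. iexp (r * (\<integral>u. (Z u v)\<^sup>2 \<partial>\<nu>)) \<partial>N)"
    and "(\<lambda>(v, u). Z u v) \<in> borel_measurable (N \<Otimes>\<^sub>M \<nu>)"
proof -
  have N: "prob_space N" using cg by (auto simp: centred_gaussian_with_cov_def gaussian_process_def)
  have "(\<lambda>(v, u). Z u v) \<in> borel_measurable (N \<Otimes>\<^sub>M restrict_space borel pos_orthant)"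
    using cg by (simp add: centred_gaussian_with_cov_def)
  then show Zm: "(\<lambda>(v, u). Z u v) \<in> borel_measurable (N \<Otimes>\<^sub>M \<nu>)"
    by (simp add: measurable_cong_sets[OF sets_pair_measure_cong[OF refl sets_\<nu>] refl])
  show "(\<lambda>T. \<integral>w. iexp (r * (\<integral>u. (Y_sum T u w)\<^sup>2 \<partial>\<nu>)) \<partial>M) \<longlonglongrightarrow> (\<integral>v. iexp (r * (\<integral>u. (Z u v)\<^sup>2 \<partial>\<nu>)) \<partial>N)"
    unfolding Y_sum_def
  proof (rule md_field_integrated_square_clt[where Y = Y and \<nu> = \<nu> and N = N and Z = Z, OF \<epsilon>_indep \<nu>.finite_measure_axioms Y_jointly_measurable _ _ Y_variance_integrable N Zm])
    show "u \<in> space \<nu> \<Longrightarrow> md_process \<epsilon> (\<lambda>t. Y t u)" for u by (simp add: Y_md)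
    show "strictly_stationary M (\<lambda>t w. \<Sum>u\<in>J. c u * Y t u w)" for J c by (rule Y_combination_stationary)
    show "integrable N (\<lambda>v. (Z u v)\<^sup>2)" if "u \<in> space \<nu>" for u
      using centred_gaussian_char(1)[OF cg limit_cov_eq Y_L2] that by simp
    show "(\<integral>v. (Z u v)\<^sup>2 \<partial>N) = (\<integral>w. (Y 0 u w)\<^sup>2 \<partial>M)" if "u \<in> space \<nu>" for u
      using cg limit_cov_eq[of u u] that by (auto simp: centred_gaussian_with_cov_def power2_eq_square)
    show "(\<integral>v. iexp (\<Sum>u\<in>J. c u * Z u v) \<partial>N) = of_real (exp (- ((\<integral>w. (\<Sum>u\<in>J. c u * Y 0 u w)\<^sup>2 \<partial>M) / 2)))"
      if "finite J" "J \<subseteq> space \<nu>" for J c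
      using centred_gaussian_char(2)[OF cg limit_cov_eq Y_L2] that by simp
  qed
qed

text \<open>By Tonelli's theorem the expected integral is the integral of the variances, which do
  not depend on \<open>T\<close>.\<close>

lemma Y_sum_square:
  assumes T: "0 < T"
  shows "AE w in M. integrable \<nu> (\<lambda>u. (Y_sum T u w)\<^sup>2)"
    and "(\<integral>\<^sup>+w. ennreal (\<integral>u. (Y_sum T u w)\<^sup>2 \<partial>\<nu>) \<partial>M) \<le> ennreal (\<integral>u. \<integral>w. (Y 0 u w)\<^sup>2 \<partial>M \<partial>\<nu>)"
proof -
  interpret P: pair_sigma_finite M \<nu> ..
  have var: "(\<integral>\<^sup>+w. ennreal ((Y_sum T u w)\<^sup>2) \<partial>M) = ennreal (\<integral>w. (Y 0 u w)\<^sup>2 \<partial>M)" if "u \<in> pos_orthant" for u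
  proof -
    have "strictly_stationary M (\<lambda>t w. Y t u w)" using Y_combination_stationary[of "\<lambda>_. 1" "{u}"] by simp
    then have "strictly_stationary M (\<lambda>t w. (Y t u w)\<^sup>2)" by (rule strictly_stationary_compose) simp
    from stationary_integral[OF this] have v: "(\<integral>w. (Y t u w)\<^sup>2 \<partial>M) = (\<integral>w. (Y 0 u w)\<^sup>2 \<partial>M)" for t .
    note S = md_process_normalized_sum[OF \<epsilon>_measurable Y_md[OF that] v T]
    show ?thesis unfolding Y_sum_def
      using nn_integral_eq_integral[OF L2_square[OF S(2)]] S(1) by simp
  qed
  have tot: "(\<integral>\<^sup>+w. \<integral>\<^sup>+u. ennreal ((Y_sum T u w)\<^sup>2) \<partial>\<nu> \<partial>M) = ennreal (\<integral>u. \<integral>w. (Y 0 u w)\<^sup>2 \<partial>M \<partial>\<nu>)"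
  proof -
    have "(\<integral>\<^sup>+w. \<integral>\<^sup>+u. ennreal ((Y_sum T u w)\<^sup>2) \<partial>\<nu> \<partial>M) = (\<integral>\<^sup>+u. \<integral>\<^sup>+w. ennreal ((Y_sum T u w)\<^sup>2) \<partial>M \<partial>\<nu>)"
      by (rule P.Fubini'[symmetric]) measurable
    also have "\<dots> = (\<integral>\<^sup>+u. ennreal (\<integral>w. (Y 0 u w)\<^sup>2 \<partial>M) \<partial>\<nu>)" by (rule nn_integral_cong) (simp add: var)
    finally show ?thesis using nn_integral_eq_integral[OF Y_variance_integrable] by simp
  qed
  have "AE w in M. (\<integral>\<^sup>+u. ennreal ((Y_sum T u w)\<^sup>2) \<partial>\<nu>) \<noteq> \<infinity>"
    by (rule nn_integral_PInf_AE) (measurable, simp add: tot)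
  then show "AE w in M. integrable \<nu> (\<lambda>u. (Y_sum T u w)\<^sup>2)"
    using AE_space[of M]
  proof eventually_elim
    case (elim w)
    have [measurable]: "(\<lambda>u. Y_sum T u w) \<in> borel_measurable \<nu>"
      using measurable_compose[OF measurable_Pair1' Y_sum_jointly_measurable, of w] elim(2) by simp
    show ?case using elim(1) by (intro integrableI_bounded) (auto simp: less_top)
  qed
  have "(\<integral>\<^sup>+w. ennreal (\<integral>u. (Y_sum T u w)\<^sup>2 \<partial>\<nu>) \<partial>M) \<le> (\<integral>\<^sup>+w. \<integral>\<^sup>+u. ennreal ((Y_sum T u w)\<^sup>2) \<partial>\<nu> \<partial>M)"
  proof (rule nn_integral_mono)
    fix w
    show "ennreal (\<integral>u. (Y_sum T u w)\<^sup>2 \<partial>\<nu>) \<le> (\<integral>\<^sup>+u. ennreal ((Y_sum T u w)\<^sup>2) \<partial>\<nu>)"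
      by (cases "integrable \<nu> (\<lambda>u. (Y_sum T u w)\<^sup>2)") (simp_all add: nn_integral_eq_integral not_integrable_integral_eq)
  qed
  then show "(\<integral>\<^sup>+w. ennreal (\<integral>u. (Y_sum T u w)\<^sup>2 \<partial>\<nu>) \<partial>M) \<le> ennreal (\<integral>u. \<integral>w. (Y 0 u w)\<^sup>2 \<partial>M \<partial>\<nu>)" unfolding tot .
qed

lemma Y_sum_square_bounded: "bounded_in_prob M (\<lambda>T w. \<integral>u. (Y_sum T u w)\<^sup>2 \<partial>\<nu>)"
proof (rule bounded_in_prob_expectation)
  show "(\<lambda>w. \<integral>u. (Y_sum T u w)\<^sup>2 \<partial>\<nu>) \<in> borel_measurable M" for T by measurable
  show "0 \<le> (\<integral>u. \<integral>w. (Y 0 u w)\<^sup>2 \<partial>M \<partial>\<nu>)" by simp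
  show "(\<integral>\<^sup>+w. ennreal \<bar>\<integral>u. (Y_sum T u w)\<^sup>2 \<partial>\<nu>\<bar> \<partial>M) \<le> ennreal (\<integral>u. \<integral>w. (Y 0 u w)\<^sup>2 \<partial>M \<partial>\<nu>)" for T
  proof (cases "T = 0")
    case False
    then show ?thesis using Y_sum_square(2)[of T] by simp
  qed (simp add: Y_sum_def)
qed

end

section \<open>The test statistic\<close>

lemma hadamard_div_diff_le:
  fixes a b y :: "real ^ 'd::finite"
  assumes \<omega>0: "0 < \<omega>0" and a: "\<And>j. \<omega>0 \<le> a $ j" and b: "\<And>j. \<omega>0 \<le> b $ j"
  shows "norm (hadamard_div y a - hadamard_div y b) \<le> norm (a - b) / \<omega>0\<^sup>2 * norm y"
proof -
  have "norm (hadamard_div y a - hadamard_div y b) \<le> norm ((norm (a - b) / \<omega>0\<^sup>2) *\<^sub>R y)"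
  proof (rule norm_le_componentwise_cart)
    fix j
    have pos: "0 < a $ j" "0 < b $ j" using \<omega>0 a[of j] b[of j] by auto
    have "(hadamard_div y a - hadamard_div y b) $ j = y $ j * ((b - a) $ j / (a $ j * b $ j))"
      using pos by (simp add: hadamard_div_def field_simps)
    then have "norm ((hadamard_div y a - hadamard_div y b) $ j) = \<bar>y $ j\<bar> * (\<bar>(b - a) $ j\<bar> / (a $ j * b $ j))"
      using pos by (simp add: abs_mult)
    also have "\<dots> \<le> \<bar>y $ j\<bar> * (norm (a - b) / \<omega>0\<^sup>2)"
    proof (intro mult_left_mono frac_le)
      show "\<bar>(b - a) $ j\<bar> \<le> norm (a - b)" using component_le_norm_cart[of "b - a" j] by (simp add: norm_minus_commute)
      show "\<omega>0\<^sup>2 \<le> a $ j * b $ j" unfolding power2_eq_square using a b \<omega>0 pos by (intro mult_mono) auto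
    qed (use \<omega>0 in auto)
    finally show "norm ((hadamard_div y a - hadamard_div y b) $ j) \<le> norm (((norm (a - b) / \<omega>0\<^sup>2) *\<^sub>R y) $ j)"
      by (simp add: abs_mult mult.commute)
  qed
  then show ?thesis by simp
qed

text \<open>Concavity of the square root, in the form of the Cauchy-Schwarz inequality.\<close>

lemma sum_sqrt_le:
  assumes "\<And>t. t \<in> A \<Longrightarrow> 0 \<le> a t" "finite A" "A \<noteq> {}"
  shows "(\<Sum>t\<in>A. sqrt (a t)) / real (card A) \<le> sqrt ((\<Sum>t\<in>A. a t) / real (card A))"
proof (rule real_le_rsqrt)
  have c: "0 < real (card A)" using assms by (simp add: card_gt_0_iff)
  have "(\<Sum>t\<in>A. sqrt (a t))\<^sup>2 \<le> (\<Sum>t\<in>A. (sqrt (a t))\<^sup>2) * real (card A)"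
    by (rule sum_squared_le_sum_of_squares)
  also have "(\<Sum>t\<in>A. (sqrt (a t))\<^sup>2) = (\<Sum>t\<in>A. a t)" using assms by simp
  finally show "((\<Sum>t\<in>A. sqrt (a t)) / real (card A))\<^sup>2 \<le> (\<Sum>t\<in>A. a t) / real (card A)"
    using c by (simp add: power_divide power2_eq_square field_simps)
qed

lemma square_sum7_le:
  fixes a b c d e f g :: real
  shows "(a + b + c + d + e + f + g)\<^sup>2 \<le> 7 * (a\<^sup>2 + b\<^sup>2 + c\<^sup>2 + d\<^sup>2 + e\<^sup>2 + f\<^sup>2 + g\<^sup>2)"
proof -
  let ?s = "\<lambda>i::nat. [a, b, c, d, e, f, g] ! i"
  have "(\<Sum>i<7. ?s i)\<^sup>2 \<le> (\<Sum>i<7. (?s i)\<^sup>2) * real (card {..<7::nat})" by (rule sum_squared_le_sum_of_squares)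
  then show ?thesis by (simp add: eval_nat_numeral)
qed

lemma over_sqrt_tendsto: "(\<lambda>T. c / sqrt (real T)) \<longlonglongrightarrow> 0"
  by (rule tendsto_divide_0[OF tendsto_const filterlim_at_top_imp_at_infinity[OF filterlim_compose[OF sqrt_at_top filterlim_real_sequentially]]])

locale vmem_estimation = vmem_test M x \<epsilon> \<mu> \<theta>0 \<Omega>0 U \<omega>0 G \<Phi> \<Phi>0 \<phi>0 W m1 m2
  for M :: "'w measure" and x \<epsilon> :: "int \<Rightarrow> 'w \<Rightarrow> real ^ 'd::finite"
    and \<mu> :: "real ^ 'k::finite \<Rightarrow> (nat \<Rightarrow> real ^ 'd) \<Rightarrow> real ^ 'd"
    and \<theta>0 :: "real ^ 'k" and \<Omega>0 U :: "(real ^ 'k) set" and \<omega>0 :: real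
    and G :: "real ^ 'r::finite \<Rightarrow> (real ^ 'd) measure" and \<Phi> \<Phi>0 :: "(real ^ 'r) set"
    and \<phi>0 :: "real ^ 'r" and W :: "real ^ 'd \<Rightarrow> real"
    and m1 :: "int \<Rightarrow> 'w \<Rightarrow> real ^ 'k" and m2 :: "int \<Rightarrow> 'w \<Rightarrow> real ^ 'r" +
  fixes \<mu>f :: "real ^ 'k \<Rightarrow> (real ^ 'd) list \<Rightarrow> real ^ 'd" and K0 \<rho> :: real
    and \<theta>hat :: "nat \<Rightarrow> 'w \<Rightarrow> real ^ 'k" and \<phi>hat :: "nat \<Rightarrow> 'w \<Rightarrow> real ^ 'r"
  assumes \<mu>f_lower: "AE w in M. \<forall>t. \<forall>\<theta>\<in>\<Omega>0. \<forall>j. \<omega>0 \<le> \<mu>f \<theta> (observed x t w) $ j"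
    and K0: "0 < K0" and \<rho>: "0 < \<rho>" "\<rho> < 1"
    and initial_values: "AE w in M. \<forall>t\<ge>1. \<forall>\<theta>\<in>\<Omega>0.
           norm (\<mu>f \<theta> (observed x t w) - \<mu> \<theta> (past x (int t) w)) < K0 * \<rho> ^ t"
    and x_integrable: "\<And>t. integrable M (\<lambda>w. norm (x t w))"
    and \<theta>hat_measurable [measurable]: "\<And>T. \<theta>hat T \<in> borel_measurable M"
    and \<phi>hat_measurable [measurable]: "\<And>T. \<phi>hat T \<in> borel_measurable M"
    and test_stat_measurable: "\<And>T. test_stat \<mu>f x \<theta>hat G \<phi>hat W T \<in> borel_measurable M"
    and \<theta>hat_expansion: "small_oP M (\<lambda>T w. sqrt (real T) *\<^sub>R (\<theta>hat T w - \<theta>0)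
           - (1 / sqrt (real T)) *\<^sub>R (\<Sum>t = 1..T. m1 (int t) w))"
    and \<phi>hat_expansion: "small_oP M (\<lambda>T w. sqrt (real T) *\<^sub>R (\<phi>hat T w - \<phi>0)
           - (1 / sqrt (real T)) *\<^sub>R (\<Sum>t = 1..T. m2 (int t) w))"
begin

abbreviation stat :: "nat \<Rightarrow> 'w \<Rightarrow> real" where
  "stat \<equiv> test_stat \<mu>f x \<theta>hat G \<phi>hat W"

definition \<theta>_error :: "nat \<Rightarrow> 'w \<Rightarrow> real ^ 'k" where "\<theta>_error T w = sqrt (real T) *\<^sub>R (\<theta>hat T w - \<theta>0)"
definition \<phi>_error :: "nat \<Rightarrow> 'w \<Rightarrow> real ^ 'r" where "\<phi>_error T w = sqrt (real T) *\<^sub>R (\<phi>hat T w - \<phi>0)"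
definition m1_sum :: "nat \<Rightarrow> 'w \<Rightarrow> real ^ 'k" where "m1_sum T w = (1 / sqrt (real T)) *\<^sub>R (\<Sum>t = 1..T. m1 (int t) w)"
definition m2_sum :: "nat \<Rightarrow> 'w \<Rightarrow> real ^ 'r" where "m2_sum T w = (1 / sqrt (real T)) *\<^sub>R (\<Sum>t = 1..T. m2 (int t) w)"
definition \<theta>_gap :: "nat \<Rightarrow> 'w \<Rightarrow> real" where "\<theta>_gap T w = norm (\<theta>_error T w - m1_sum T w)"
definition \<phi>_gap :: "nat \<Rightarrow> 'w \<Rightarrow> real" where "\<phi>_gap T w = norm (\<phi>_error T w - m2_sum T w)"
text \<open>A tight majorant of the scaled estimation error: the normalised martingale sum plus the
  gap left by the asymptotic expansion.\<close>

definition \<theta>_size :: "nat \<Rightarrow> 'w \<Rightarrow> real" where "\<theta>_size T w = norm (m1_sum T w) + \<theta>_gap T w"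
definition \<phi>_size :: "nat \<Rightarrow> 'w \<Rightarrow> real" where "\<phi>_size T w = norm (m2_sum T w) + \<phi>_gap T w"

text \<open>Of order \<open>T\<close> to the power \<open>- 1/4\<close>: it tends to zero, yet
  \<open>sqrt T * \<delta> T\<close> tends to infinity and so exceeds the tight scaled errors with
  probability tending to one. The two fixed radii keep the balls inside \<open>U\<close> and
  \<open>\<Phi>0\<close>.\<close>

definition \<delta> :: "nat \<Rightarrow> real" where
  "\<delta> T = min (min radius L_radius) (1 / sqrt (sqrt (real T)))"

definition good :: "nat \<Rightarrow> 'w set" where
  "good T = {w\<in>space M. \<theta>_size T w < sqrt (real T) * \<delta> T \<and> \<phi>_size T w < sqrt (real T) * \<delta> T}"

lemma errors_measurable [measurable]:
  "\<theta>_error T \<in> borel_measurable M" "\<phi>_error T \<in> borel_measurable M" "m1_sum T \<in> borel_measurable M" "m2_sum T \<in> borel_measurable M"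
  "\<theta>_gap T \<in> borel_measurable M" "\<phi>_gap T \<in> borel_measurable M" "\<theta>_size T \<in> borel_measurable M" "\<phi>_size T \<in> borel_measurable M"
  unfolding \<theta>_size_def \<phi>_size_def \<theta>_gap_def \<phi>_gap_def \<theta>_error_def \<phi>_error_def m1_sum_def m2_sum_def by measurable

lemma gaps_vanish: "vanishing M \<theta>_gap" "vanishing M \<phi>_gap"
  using \<theta>hat_expansion \<phi>hat_expansion
  unfolding vanishing_def small_oP_def \<theta>_gap_def \<phi>_gap_def \<theta>_error_def[symmetric] \<phi>_error_def[symmetric] m1_sum_def[symmetric] m2_sum_def[symmetric]
  by (auto intro!: borel_measurable_norm borel_measurable_diff)

lemma sizes_bounded: "bounded_in_prob M \<theta>_size" "bounded_in_prob M \<phi>_size"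
  using bounded_in_prob_add[OF normalized_sum_bounded[OF \<epsilon>_measurable m1 m1_square m_stationary(1)] gaps_vanish(1)]
    bounded_in_prob_add[OF normalized_sum_bounded[OF \<epsilon>_measurable m2 m2_square m_stationary(2)] gaps_vanish(2)]
  unfolding m1_sum_def[symmetric] m2_sum_def[symmetric] \<theta>_size_def[symmetric] \<phi>_size_def[symmetric] by blast+

lemma gaps_nonneg: "0 \<le> \<theta>_gap T w" "0 \<le> \<phi>_gap T w" "0 \<le> \<theta>_size T w" "0 \<le> \<phi>_size T w"
  by (simp_all add: \<theta>_gap_def \<phi>_gap_def \<theta>_size_def \<phi>_size_def)

lemma error_le_size: "norm (\<theta>_error T w) \<le> \<theta>_size T w" "norm (\<phi>_error T w) \<le> \<phi>_size T w"
  unfolding \<theta>_size_def \<phi>_size_def \<theta>_gap_def \<phi>_gap_def using norm_triangle_sub by blast+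

lemma \<delta>: "\<delta> \<longlonglongrightarrow> 0" "\<delta> T \<le> radius" "\<delta> T \<le> L_radius" "filterlim (\<lambda>T. sqrt (real T) * \<delta> T) at_top sequentially"
proof -
  let ?r = "min radius L_radius"
  have r: "0 < ?r" using radius(1) L_radius(1) by simp
  show "\<delta> T \<le> radius" "\<delta> T \<le> L_radius" by (auto simp: \<delta>_def)
  have s: "filterlim (\<lambda>T. sqrt (real T)) at_top sequentially"
    by (rule filterlim_compose[OF sqrt_at_top filterlim_real_sequentially])
  then have ss: "filterlim (\<lambda>T. sqrt (sqrt (real T))) at_top sequentially"
    by (rule filterlim_compose[OF sqrt_at_top])
  have lim: "(\<lambda>T. 1 / sqrt (sqrt (real T))) \<longlonglongrightarrow> 0"
    by (rule tendsto_divide_0[OF tendsto_const filterlim_at_top_imp_at_infinity[OF ss]])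
  show "\<delta> \<longlonglongrightarrow> 0"
  proof (rule tendsto_sandwich[OF _ _ tendsto_const lim])
    show "eventually (\<lambda>T. 0 \<le> \<delta> T) sequentially" using r by (intro always_eventually allI) (auto simp: \<delta>_def)
    show "eventually (\<lambda>T. \<delta> T \<le> 1 / sqrt (sqrt (real T))) sequentially" by (intro always_eventually allI) (auto simp: \<delta>_def)
  qed
  show "filterlim (\<lambda>T. sqrt (real T) * \<delta> T) at_top sequentially"
    unfolding filterlim_at_top
  proof
    fix Z :: real
    have "eventually (\<lambda>T. Z / ?r \<le> sqrt (real T)) sequentially" "eventually (\<lambda>T. Z \<le> sqrt (sqrt (real T))) sequentially"
      using s ss unfolding filterlim_at_top by auto
    then show "eventually (\<lambda>T. Z \<le> sqrt (real T) * \<delta> T) sequentially"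
      using eventually_gt_at_top[of 0]
    proof eventually_elim
      case (elim T)
      have "Z \<le> sqrt (real T) * ?r" using elim(1) r by (simp add: pos_divide_le_eq)
      moreover have "sqrt (real T) * (1 / sqrt (sqrt (real T))) = sqrt (sqrt (real T))"
        by (simp add: real_div_sqrt)
      ultimately show ?case
        using elim(2) by (simp only: \<delta>_def min_mult_distrib_left[of "sqrt (real T)"] min.bounded_iff real_sqrt_ge_zero of_nat_0_le_iff if_True)
    qed
  qed
qed

lemma good_sets [measurable]: "good T \<in> sets M"
  unfolding good_def by measurable

lemma good_prob: "(\<lambda>T. prob (space M - good T)) \<longlonglongrightarrow> 0"
proof (rule tendsto_sandwich[OF _ _ tendsto_const])
  let ?A = "\<lambda>T. {w\<in>space M. sqrt (real T) * \<delta> T \<le> \<bar>\<theta>_size T w\<bar>}" and ?B = "\<lambda>T. {w\<in>space M. sqrt (real T) * \<delta> T \<le> \<bar>\<phi>_size T w\<bar>}"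
  show "eventually (\<lambda>T. prob (space M - good T) \<le> prob (?A T) + prob (?B T)) sequentially"
  proof (intro always_eventually allI)
    fix T
    have "prob (space M - good T) \<le> prob (?A T \<union> ?B T)"
      by (intro finite_measure_mono) (auto simp: good_def gaps_nonneg)
    also have "\<dots> \<le> prob (?A T) + prob (?B T)" by (intro measure_Un_le) auto
    finally show "prob (space M - good T) \<le> prob (?A T) + prob (?B T)" .
  qed
  show "(\<lambda>T. prob (?A T) + prob (?B T)) \<longlonglongrightarrow> 0"
    using tendsto_add[OF bounded_in_prob_exceeds[OF sizes_bounded(1) \<delta>(4)] bounded_in_prob_exceeds[OF sizes_bounded(2) \<delta>(4)]] by simp
qed simp

lemma good_balls:
  assumes T: "0 < T" and w: "w \<in> good T"
  shows "\<theta>hat T w \<in> ball \<theta>0 (\<delta> T)" "\<phi>hat T w \<in> ball \<phi>0 (\<delta> T)" "\<phi>hat T w \<in> \<Phi>0"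
proof -
  have s: "0 < sqrt (real T)" using T by simp
  have "sqrt (real T) * norm (\<theta>hat T w - \<theta>0) < sqrt (real T) * \<delta> T"
    using error_le_size(1)[of T w] w by (simp add: \<theta>_error_def good_def)
  then show "\<theta>hat T w \<in> ball \<theta>0 (\<delta> T)" using s by (simp add: dist_norm norm_minus_commute)
  have "sqrt (real T) * norm (\<phi>hat T w - \<phi>0) < sqrt (real T) * \<delta> T"
    using error_le_size(2)[of T w] w by (simp add: \<phi>_error_def good_def)
  then show b: "\<phi>hat T w \<in> ball \<phi>0 (\<delta> T)" using s by (simp add: dist_norm norm_minus_commute)
  then show "\<phi>hat T w \<in> \<Phi>0" using L_radius(2) \<delta>(3)[of T] by auto
qed

text \<open>The conditional mean at time \<open>t\<close> depends on the observations up to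
  \<open>t - 1\<close>, whence the exponent; the factor \<open>1 / \<omega>0^2\<close> comes from
  the difference of two reciprocals.\<close>

definition initial_error :: "nat \<Rightarrow> 'w \<Rightarrow> real" where
  "initial_error T w = (K0 / \<omega>0\<^sup>2) * (\<Sum>t=1..T. \<rho> ^ (t - 1) * norm (x (int t) w)) / sqrt (real T)"

definition quadratic_error :: "nat \<Rightarrow> 'w \<Rightarrow> real" where
  "quadratic_error T w = (\<Sum>t=1..T. grad_bound_real (path (int t) w)) / real T * (\<theta>_size T w)\<^sup>2 / sqrt (real T)"

definition linear_error :: "nat \<Rightarrow> 'w \<Rightarrow> real" where
  "linear_error T w = sqrt \<bar>(\<Sum>t=1..T. remainder_real (\<delta> T) (path (int t) w)) / real T\<bar> * \<theta>_size T w"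

section \<open>Error terms that vanish in probability\<close>

lemma path_fun_measurable [measurable]:
  "(\<lambda>w. grad_bound_real (path t w)) \<in> borel_measurable M" "(\<lambda>w. remainder_real d (path t w)) \<in> borel_measurable M"
  unfolding grad_bound_real_def remainder_real_def by measurable

text \<open>The expectation is at most a geometric series times the stationary first moment of
  \<open>norm (x t w)\<close>, divided by \<open>sqrt T\<close>.\<close>

lemma initial_error_vanishes: "vanishing M initial_error"
proof (rule vanishing_expectation)
  let ?c = "K0 / \<omega>0\<^sup>2 * ((\<integral>w. norm (x 0 w) \<partial>M) / (1 - \<rho>))"
  have c: "0 \<le> K0 / \<omega>0\<^sup>2" using K0 by simp
  show "initial_error T \<in> borel_measurable M" for T unfolding initial_error_def by measurable
  show "0 \<le> ?c / sqrt (real T)" for T using K0 \<rho> by simp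
  show "(\<lambda>T. ?c / sqrt (real T)) \<longlonglongrightarrow> 0"
    by (rule over_sqrt_tendsto)
  show "eventually (\<lambda>T. (\<integral>\<^sup>+w. ennreal \<bar>initial_error T w\<bar> \<partial>M) \<le> ennreal (?c / sqrt (real T))) sequentially"
  proof (intro always_eventually allI)
    fix T
    have x0: "(\<integral>w. norm (x t w) \<partial>M) = (\<integral>w. norm (x 0 w) \<partial>M)" for t
      by (rule stationary_integral, rule strictly_stationary_compose[OF stationary]) simp
    have i: "integrable M (initial_error T)" unfolding initial_error_def using x_integrable by auto
    have nn: "0 \<le> initial_error T w" for w
      unfolding initial_error_def using c \<rho> by (intro divide_nonneg_nonneg mult_nonneg_nonneg[OF c] sum_nonneg) auto
    have "(\<integral>w. initial_error T w \<partial>M) = (K0 / \<omega>0\<^sup>2) * ((\<Sum>t=1..T. \<rho> ^ (t - 1)) * (\<integral>w. norm (x 0 w) \<partial>M)) / sqrt (real T)"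
    proof -
      have j: "integrable M (\<lambda>w. \<rho> ^ (t - 1) * norm (x (int t) w))" for t using x_integrable[of "int t"] by simp
      have "(\<integral>w. (\<Sum>t=1..T. \<rho> ^ (t - 1) * norm (x (int t) w)) \<partial>M) = (\<Sum>t=1..T. \<integral>w. \<rho> ^ (t - 1) * norm (x (int t) w) \<partial>M)"
        by (rule Bochner_Integration.integral_sum[OF j])
      also have "\<dots> = (\<Sum>t=1..T. \<rho> ^ (t - 1) * (\<integral>w. norm (x 0 w) \<partial>M))"
        by (intro sum.cong refl, subst integral_mult_right_zero, subst x0, rule refl)
      also have "\<dots> = (\<Sum>t=1..T. \<rho> ^ (t - 1)) * (\<integral>w. norm (x 0 w) \<partial>M)" by (rule sum_distrib_right[symmetric])
      finally show ?thesis unfolding initial_error_def integral_divide_zero integral_mult_right_zero by (rule arg_cong)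
    qed
    also have "\<dots> \<le> ?c / sqrt (real T)"
    proof (intro divide_right_mono mult_left_mono c)
      have "(\<Sum>t=1..T. \<rho> ^ (t - 1)) = (\<Sum>t<T. \<rho> ^ t)"
        by (rule sum.reindex_bij_witness[of _ Suc "\<lambda>t. t - 1"]) auto
      also have "\<dots> \<le> 1 / (1 - \<rho>)"
        using \<rho> by (simp add: sum_gp_strict divide_right_mono)
      finally have "(\<Sum>t=1..T. \<rho> ^ (t - 1)) * (\<integral>w. norm (x 0 w) \<partial>M) \<le> 1 / (1 - \<rho>) * (\<integral>w. norm (x 0 w) \<partial>M)"
        by (rule mult_right_mono) simp
      then show "(\<Sum>t=1..T. \<rho> ^ (t - 1)) * (\<integral>w. norm (x 0 w) \<partial>M) \<le> (\<integral>w. norm (x 0 w) \<partial>M) / (1 - \<rho>)" by simp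
    qed simp
    finally have "(\<integral>w. initial_error T w \<partial>M) \<le> ?c / sqrt (real T)" .
    then show "(\<integral>\<^sup>+w. ennreal \<bar>initial_error T w\<bar> \<partial>M) \<le> ennreal (?c / sqrt (real T))"
      unfolding abs_of_nonneg[OF nn] nn_integral_eq_integral[OF i AE_I2[OF nn]] by (rule ennreal_leI)
  qed
qed

lemma average_expectation:
  assumes F: "integrable law F" "F \<in> borel_measurable path_space" and nn: "\<And>p. 0 \<le> F p"
  shows "(\<integral>\<^sup>+w. ennreal \<bar>(\<Sum>t=1..T. F (path (int t) w)) / real T\<bar> \<partial>M) \<le> ennreal (\<integral>p. F p \<partial>law)"
proof -
  note i = integrable_path[OF F(2), THEN iffD2, OF F(1)]
  have "(\<integral>\<^sup>+w. ennreal \<bar>(\<Sum>t=1..T. F (path (int t) w)) / real T\<bar> \<partial>M) = ennreal (\<integral>w. (\<Sum>t=1..T. F (path (int t) w)) / real T \<partial>M)"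
  proof -
    have p: "0 \<le> (\<Sum>t=1..T. F (path (int t) w)) / real T" for w using nn by (intro divide_nonneg_nonneg sum_nonneg) auto
    have "integrable M (\<lambda>w. (\<Sum>t=1..T. F (path (int t) w)) / real T)" using i by auto
    from nn_integral_eq_integral[OF this AE_I2[OF p]] show ?thesis unfolding abs_of_nonneg[OF p] .
  qed
  also have "(\<integral>w. (\<Sum>t=1..T. F (path (int t) w)) / real T \<partial>M) = real T * (\<integral>p. F p \<partial>law) / real T"
    using i by (simp add: integral_path[OF F(2)])
  also have "ennreal (real T * (\<integral>p. F p \<partial>law) / real T) \<le> ennreal (\<integral>p. F p \<partial>law)"
    using nn by (intro ennreal_leI) (cases "T = 0"; simp)
  finally show ?thesis .
qed

text \<open>A tight average of gradient bounds times a tight squared error, with one factor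
  \<open>1 / sqrt T\<close> left over.\<close>

lemma quadratic_error_vanishes: "vanishing M quadratic_error"
proof -
  have gm: "grad_bound_real \<in> borel_measurable path_space" unfolding grad_bound_real_def by measurable
  have gi: "integrable law grad_bound_real" by (rule integrable_path[OF gm, THEN iffD1, OF grad_bound_real_integrable])
  have "bounded_in_prob M (\<lambda>T w. (\<Sum>t=1..T. grad_bound_real (path (int t) w)) / real T)"
  proof (rule bounded_in_prob_expectation)
    show "(\<lambda>w. (\<Sum>t=1..T. grad_bound_real (path (int t) w)) / real T) \<in> borel_measurable M" for T by measurable
    show "(\<integral>\<^sup>+w. ennreal \<bar>(\<Sum>t=1..T. grad_bound_real (path (int t) w)) / real T\<bar> \<partial>M) \<le> ennreal (\<integral>p. grad_bound_real p \<partial>law)" for T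
      by (rule average_expectation[OF gi gm]) (simp add: grad_bound_real_def)
    show "0 \<le> (\<integral>p. grad_bound_real p \<partial>law)" by (simp add: grad_bound_real_def)
  qed
  from bounded_in_prob_mult[OF this bounded_in_prob_mult[OF sizes_bounded(1) sizes_bounded(1)]]
  have b: "bounded_in_prob M (\<lambda>T w. (\<Sum>t=1..T. grad_bound_real (path (int t) w)) / real T * (\<theta>_size T w * \<theta>_size T w))" .
  from vanishing_mult[OF vanishing_const[OF over_sqrt_tendsto[of 1]] b]
  show ?thesis unfolding quadratic_error_def[abs_def] by (simp add: power2_eq_square mult.commute)
qed

lemma remainder_real_integral: "integrable law (remainder_real (\<delta> T))" "(\<lambda>T. \<integral>p. remainder_real (\<delta> T) p \<partial>law) \<longlonglongrightarrow> 0"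
proof -
  have lm: "sets law = sets path_space" by (simp add: law_def)
  have m: "remainder d \<in> borel_measurable law" for d
    using remainder_measurable by (simp add: measurable_cong_sets[OF lm refl])
  have fin: "(\<integral>\<^sup>+p. remainder (\<delta> T) p \<partial>law) < \<infinity>" for T
  proof -
    have "AE w in M. remainder (\<delta> T) (path 0 w) \<le> 4 * grad_bound (path 0 w)"
      using AE_regular
    proof eventually_elim
      case (elim w)
      then show ?case unfolding remainder_def grad_bound_def sum_distrib_left
        by (intro sum_mono C1_function.taylor_remainder_le[OF _ \<delta>(2)]) (auto simp: regular_def)
    qed
    then have "(\<integral>\<^sup>+w. remainder (\<delta> T) (path 0 w) \<partial>M) \<le> (\<integral>\<^sup>+w. 4 * grad_bound (path 0 w) \<partial>M)" by (rule nn_integral_mono_AE)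
    also have "\<dots> = 4 * (\<integral>\<^sup>+p. grad_bound p \<partial>law)"
      by (subst nn_integral_cmult) (measurable, simp add: nn_integral_path)
    also have "\<dots> < \<infinity>" using grad_bound_finite by (simp add: ennreal_mult_less_top)
    finally show ?thesis by (simp add: nn_integral_path)
  qed
  have le: "ennreal (remainder_real d p) \<le> remainder d p" for d p by (simp add: remainder_real_def ennreal_enn2real_if)
  show i: "integrable law (remainder_real (\<delta> T))" for T
  proof (rule integrableI_bounded)
    show "remainder_real (\<delta> T) \<in> borel_measurable law" unfolding remainder_real_def using m by measurable
    have "(\<integral>\<^sup>+p. ennreal (norm (remainder_real (\<delta> T) p)) \<partial>law) \<le> (\<integral>\<^sup>+p. remainder (\<delta> T) p \<partial>law)"
      using le by (intro nn_integral_mono) (simp add: remainder_real_def)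
    then show "(\<integral>\<^sup>+p. ennreal (norm (remainder_real (\<delta> T) p)) \<partial>law) < \<infinity>" using fin by (rule le_less_trans)
  qed
  have "(\<lambda>T. ennreal (\<integral>p. remainder_real (\<delta> T) p \<partial>law)) \<longlonglongrightarrow> 0"
  proof (rule tendsto_sandwich[OF _ _ tendsto_const remainder_tendsto[OF \<delta>(1,2)]])
    show "eventually (\<lambda>T. ennreal (\<integral>p. remainder_real (\<delta> T) p \<partial>law) \<le> (\<integral>\<^sup>+p. remainder (\<delta> T) p \<partial>law)) sequentially"
      using le by (intro always_eventually allI, subst nn_integral_eq_integral[symmetric, OF i])
        (auto intro!: nn_integral_mono simp: remainder_real_def)
  qed simp
  from tendsto_enn2real[of _ 0, unfolded ennreal_0, OF this]
  show "(\<lambda>T. \<integral>p. remainder_real (\<delta> T) p \<partial>law) \<longlonglongrightarrow> 0" by (simp add: remainder_real_def)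
qed

text \<open>By stationarity the expected average is at most the integral of the remainder on the
  ball of radius \<open>\<delta> T\<close>, which tends to zero; the square root and the tight
  factor preserve this.\<close>

lemma linear_error_vanishes: "vanishing M linear_error"
  unfolding linear_error_def[abs_def]
proof (rule vanishing_mult[OF vanishing_sqrt sizes_bounded(1)])
  show "vanishing M (\<lambda>T w. (\<Sum>t=1..T. remainder_real (\<delta> T) (path (int t) w)) / real T)"
  proof (rule vanishing_expectation)
    show "(\<lambda>w. (\<Sum>t=1..T. remainder_real (\<delta> T) (path (int t) w)) / real T) \<in> borel_measurable M" for T by measurable
    have m: "remainder_real d \<in> borel_measurable path_space" for d unfolding remainder_real_def by measurable
    show "eventually (\<lambda>T. (\<integral>\<^sup>+w. ennreal \<bar>(\<Sum>t=1..T. remainder_real (\<delta> T) (path (int t) w)) / real T\<bar> \<partial>M)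
        \<le> ennreal (\<integral>p. remainder_real (\<delta> T) p \<partial>law)) sequentially"
      by (intro always_eventually allI average_expectation remainder_real_integral m) (simp add: remainder_real_def)
    show "(\<lambda>T. \<integral>p. remainder_real (\<delta> T) p \<partial>law) \<longlonglongrightarrow> 0" by (rule remainder_real_integral(2))
    show "0 \<le> (\<integral>p. remainder_real (\<delta> T) p \<partial>law)" for T by (simp add: remainder_real_def)
  qed
qed

lemma score_average_bound:
  assumes "\<And>t. regular (path t w)" "u \<in> pos_orthant"
  shows "norm (score_average T u w) \<le> (\<Sum>t=1..T. grad_norm (path (int t) w)) / real T * norm u"
proof -
  have "norm (\<Sum>t=1..T. score u (path (int t) w)) \<le> (\<Sum>t=1..T. norm u * grad_norm (path (int t) w))"
    by (intro sum_norm_le score_bound assms)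
  then have "norm (\<Sum>t=1..T. score u (path (int t) w)) / real T \<le> (\<Sum>t=1..T. norm u * grad_norm (path (int t) w)) / real T"
    by (rule divide_right_mono) simp
  then show ?thesis
    unfolding score_average_def norm_scaleR sum_distrib_left[symmetric] by (simp add: mult.commute)
qed

lemma score_average_measurable [measurable]: "(\<lambda>u. score_average T u w) \<in> borel_measurable borel"
proof -
  have [measurable]: "(\<lambda>u::real ^ 'd. u $ j) \<in> borel_measurable borel" for j by (rule vec_nth_measurable)
  show ?thesis unfolding score_average_def score_def by measurable
qed

definition score_error :: "nat \<Rightarrow> 'w \<Rightarrow> real" where
  "score_error T w = (\<integral>u. (norm (score_average T u w - mean_score u))\<^sup>2 \<partial>\<nu>)"

lemma score_error_vanishes: "vanishing M score_error"
  using score_average_tendsto[OF \<nu>.finite_measure_axioms space_\<nu> id_\<nu> norm_square_integrable]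
  unfolding score_error_def[abs_def] .

lemma score_error_integrable:
  assumes "\<And>t. regular (path t w)"
  shows "integrable \<nu> (\<lambda>u. (norm (score_average T u w - mean_score u))\<^sup>2)"
proof (rule Bochner_Integration.integrable_bound)
  let ?a = "(\<Sum>t=1..T. grad_norm (path (int t) w)) / real T"
  show "integrable \<nu> (\<lambda>u. 2 * (?a\<^sup>2 * (norm u)\<^sup>2 + (norm (mean_score u))\<^sup>2))"
    using norm_square_integrable mean_score_square_integrable by auto
  have "(\<lambda>u. (norm (score_average T u w - mean_score u))\<^sup>2) \<in> borel_measurable borel" by measurable
  then show "(\<lambda>u. (norm (score_average T u w - mean_score u))\<^sup>2) \<in> borel_measurable \<nu>" by (rule measurable_\<nu>)
  show "AE u in \<nu>. norm ((norm (score_average T u w - mean_score u))\<^sup>2) \<le> norm (2 * (?a\<^sup>2 * (norm u)\<^sup>2 + (norm (mean_score u))\<^sup>2))"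
  proof (rule AE_I2)
    fix u assume "u \<in> space \<nu>"
    then have u: "u \<in> pos_orthant" by simp
    have "(norm (score_average T u w - mean_score u))\<^sup>2 \<le> (norm (score_average T u w) + norm (mean_score u))\<^sup>2"
      by (intro power_mono norm_triangle_ineq4) simp
    also have "\<dots> \<le> (?a * norm u + norm (mean_score u))\<^sup>2"
      by (intro power_mono add_right_mono score_average_bound[OF assms u]) simp
    also have "\<dots> \<le> 2 * ((?a * norm u)\<^sup>2 + (norm (mean_score u))\<^sup>2)"
      using zero_le_power2[of "?a * norm u - norm (mean_score u)"] unfolding power2_sum power2_diff by simp
    finally show "norm ((norm (score_average T u w - mean_score u))\<^sup>2) \<le> norm (2 * (?a\<^sup>2 * (norm u)\<^sup>2 + (norm (mean_score u))\<^sup>2))"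
      unfolding power_mult_distrib by simp
  qed
qed

section \<open>Decomposition of the scaled difference of transforms\<close>

definition scaled_difference :: "nat \<Rightarrow> real ^ 'd \<Rightarrow> 'w \<Rightarrow> real" where
  "scaled_difference T u w = sqrt (real T) * (emp_laplace \<mu>f x \<theta>hat T w u - laplace (G (\<phi>hat T w)) u)"

text \<open>A deterministic statement about one sample point of the good event and one
  \<open>u\<close>. The summands stand for the first observation, the initial values together with
  the nonlinearity of the ratio, the curvature of the exponential, the fluctuation of the score
  average, the gap of \<open>\<theta>hat\<close>, and the remainder and gap on the side of the
  Laplace transform.\<close>

lemma scaled_difference_expansion:
  assumes w: "w \<in> good T" and T: "0 < T" and u: "u \<in> pos_orthant"
    and low: "\<And>t \<theta> j. \<theta> \<in> \<Omega>0 \<Longrightarrow> \<omega>0 \<le> \<mu> \<theta> (past x t w) $ j"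
    and lowf: "\<And>t \<theta> j. \<theta> \<in> \<Omega>0 \<Longrightarrow> \<omega>0 \<le> \<mu>f \<theta> (observed x t w) $ j"
    and init: "\<And>t \<theta>. 1 \<le> t \<Longrightarrow> \<theta> \<in> \<Omega>0 \<Longrightarrow> norm (\<mu>f \<theta> (observed x t w) - \<mu> \<theta> (past x (int t) w)) < K0 * \<rho> ^ t"
    and reg: "\<And>t. regular (path t w)" and rv: "\<And>t. ratio_vec \<theta>0 (path t w) = \<epsilon> t w"
    and xn: "\<And>t j. 0 \<le> x t w $ j"
    and Lx: "\<And>\<phi>. \<phi> \<in> ball \<phi>0 (\<delta> T) \<Longrightarrow> \<bar>L \<phi> u - L \<phi>0 u - L_grad u \<bullet> (\<phi> - \<phi>0)\<bar> \<le> sqrt (L_remainder (\<delta> T) u) * norm (\<phi> - \<phi>0)"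
  shows "\<bar>scaled_difference T u w - Y_sum T u w\<bar> \<le> 1 / sqrt (real T) + norm u * (initial_error T w + linear_error T w)
    + (norm u)\<^sup>2 * quadratic_error T w + norm (score_average T u w - mean_score u) * \<theta>_size T w
    + norm (mean_score u) * \<theta>_gap T w + sqrt (L_remainder (\<delta> T) u) * \<phi>_size T w + norm (L_grad u) * \<phi>_gap T w"
proof -
  define s where "s = sqrt (real T)"
  define \<theta> where "\<theta> = \<theta>hat T w"
  define \<phi> where "\<phi> = \<phi>hat T w"
  let ?p = "\<lambda>t. path (int t) w" and ?res = "\<lambda>t. residual \<mu>f x \<theta>hat T t w"
  have s: "0 < s" "s * s = real T" using T by (auto simp: s_def)
  note balls = good_balls[OF T w, folded \<theta>_def \<phi>_def]
  have \<theta>\<Omega>: "\<theta> \<in> \<Omega>0" using regular_ratio_vec(3)[OF reg \<delta>(2) balls(1)] .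
  have L\<phi>: "laplace (G \<phi>) u = L \<phi> u" using balls(3) by (simp add: L_def)
  define A where "A t = exp (- (u \<bullet> ?res t)) - exp (- (u \<bullet> ratio_vec \<theta> (?p t)))" for t
  define B where "B t = exp (- (u \<bullet> ratio_vec \<theta> (?p t))) - exp (- (u \<bullet> ratio_vec \<theta>0 (?p t))) - score u (?p t) \<bullet> (\<theta> - \<theta>0)" for t
  have g: "\<theta>_error T w = s *\<^sub>R (\<theta> - \<theta>0)" and f: "\<phi>_error T w = s *\<^sub>R (\<phi> - \<phi>0)"
    by (simp_all add: \<theta>_error_def \<phi>_error_def s_def \<theta>_def \<phi>_def)
  have sT: "c / s = s * (c / real T)" for c using s by (simp add: s(2)[symmetric])
  have sum_AB: "(\<Sum>t=1..T. A t) / s + (\<Sum>t=1..T. B t) / s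
    = s * emp_laplace \<mu>f x \<theta>hat T w u - (\<Sum>t=1..T. exp (- (u \<bullet> \<epsilon> (int t) w))) / s - score_average T u w \<bullet> \<theta>_error T w"
  proof -
    have "(\<Sum>t=1..T. A t) / s + (\<Sum>t=1..T. B t) / s
      = (\<Sum>t=1..T. exp (- (u \<bullet> ?res t))) / s - (\<Sum>t=1..T. exp (- (u \<bullet> \<epsilon> (int t) w))) / s - (\<Sum>t=1..T. score u (?p t) \<bullet> (\<theta> - \<theta>0)) / s"
      unfolding A_def B_def rv by (simp only: sum_subtractf diff_divide_distrib)
    moreover have "(\<Sum>t=1..T. exp (- (u \<bullet> ?res t))) / s = s * emp_laplace \<mu>f x \<theta>hat T w u"
      unfolding sT[of "\<Sum>t=1..T. exp (- (u \<bullet> ?res t))"] emp_laplace_def by simp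
    moreover have "(\<Sum>t=1..T. score u (?p t) \<bullet> (\<theta> - \<theta>0)) / s = score_average T u w \<bullet> \<theta>_error T w"
    proof -
      have "(\<Sum>t=1..T. score u (?p t) \<bullet> (\<theta> - \<theta>0)) / s = s * ((\<Sum>t=1..T. score u (?p t)) \<bullet> (\<theta> - \<theta>0) / real T)"
        unfolding inner_sum_left by (rule sT)
      then show ?thesis unfolding g score_average_def by simp
    qed
    ultimately show ?thesis by simp
  qed
  have Ys: "Y_sum T u w = (\<Sum>t=1..T. exp (- (u \<bullet> \<epsilon> (int t) w))) / s - s * L \<phi>0 u + mean_score u \<bullet> m1_sum T w - L_grad u \<bullet> m2_sum T w"
  proof -
    have "Y_sum T u w = (\<Sum>t=1..T. exp (- (u \<bullet> \<epsilon> (int t) w))) / s - real T * L \<phi>0 u / s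
      + (\<Sum>t=1..T. mean_score u \<bullet> m1 (int t) w) / s - (\<Sum>t=1..T. L_grad u \<bullet> m2 (int t) w) / s"
      unfolding Y_sum_def Y_def s_def[symmetric] sum_subtractf sum.distrib by (simp add: diff_divide_distrib add_divide_distrib)
    moreover have "real T * L \<phi>0 u / s = s * L \<phi>0 u" using s by (simp add: s(2)[symmetric])
    ultimately show ?thesis
      unfolding m1_sum_def m2_sum_def s_def[symmetric] inner_sum_right[symmetric] by simp
  qed
  \<comment> \<open>Six differences: computed residuals against infinite-past ratios, expansion in
    \<open>\<theta>\<close>, average against mean score, scaled error against martingale sum, and
    for the Laplace transform the expansion in \<open>\<phi>\<close> and the same replacement of the
    error.\<close>
  have decomposition: "scaled_difference T u w - Y_sum T u w = (\<Sum>t=1..T. A t) / s + (\<Sum>t=1..T. B t) / s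
      + (score_average T u w - mean_score u) \<bullet> \<theta>_error T w + mean_score u \<bullet> (\<theta>_error T w - m1_sum T w)
      - s * (L \<phi> u - L \<phi>0 u - L_grad u \<bullet> (\<phi> - \<phi>0)) - L_grad u \<bullet> (\<phi>_error T w - m2_sum T w)"
    unfolding sum_AB Ys scaled_difference_def \<phi>_def[symmetric] L\<phi> s_def[symmetric]
    by (simp add: f inner_diff_left inner_diff_right algebra_simps)
  have boundA: "\<bar>(\<Sum>t=1..T. A t) / s\<bar> \<le> 1 / s + norm u * initial_error T w"
  proof -
    have At: "\<bar>A t\<bar> \<le> (if t = 1 then 1 else 0) + norm u * (K0 / \<omega>0\<^sup>2 * (\<rho> ^ (t - 1) * norm (x (int t) w)))" if t: "t \<in> {1..T}" for t
    proof -
      have res: "?res t = hadamard_div (x (int t) w) (\<mu>f \<theta> (observed x (t - 1) w))"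
        by (simp add: residual_def mu_hat_def \<theta>_def)
      have rat: "ratio_vec \<theta> (?p t) = hadamard_div (x (int t) w) (\<mu> \<theta> (past x (int t - 1) w))"
        by (simp add: ratio_vec_def hadamard_div_def ratio_path[OF \<theta>\<Omega>])
      have pos: "0 \<le> ?res t $ j" "0 \<le> ratio_vec \<theta> (?p t) $ j" for j
        unfolding res rat hadamard_div_def using xn[of "int t"] lowf[OF \<theta>\<Omega>, of "t - 1" j] low[OF \<theta>\<Omega>, of "int t - 1" j] \<omega>0
        by (simp_all add: divide_nonneg_nonneg)
      have nn: "0 \<le> u \<bullet> ?res t" "0 \<le> u \<bullet> ratio_vec \<theta> (?p t)" by (intro inner_nonneg_orthant u pos)+
      have rest: "0 \<le> norm u * (K0 / \<omega>0\<^sup>2 * (\<rho> ^ (t - 1) * norm (x (int t) w)))" using K0 \<rho> by simp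
      show ?thesis
      \<comment> \<open>At \<open>t = 1\<close> the list of past observations is empty, and the
        comparison of initial values starts only with one observation. The difference of two numbers
        between zero and one is at most one; after division by \<open>s\<close> this is the summand
        \<open>1 / s\<close>.\<close>
      proof (cases "t = 1")
        case True
        have "\<bar>A t\<bar> \<le> 1" unfolding A_def abs_le_iff using nn exp_ge_zero[of "- (u \<bullet> ?res t)"] exp_ge_zero[of "- (u \<bullet> ratio_vec \<theta> (?p t))"]
            exp_le_one_iff[of "- (u \<bullet> ?res t)"] exp_le_one_iff[of "- (u \<bullet> ratio_vec \<theta> (?p t))"] by linarith
        then show ?thesis using rest True by simp
      next
        case False
        then have t1: "1 \<le> t - 1" using t by auto
        have it: "int (t - 1) = int t - 1" using t by auto
        have "\<bar>A t\<bar> \<le> \<bar>u \<bullet> ?res t - u \<bullet> ratio_vec \<theta> (?p t)\<bar>" unfolding A_def by (rule abs_exp_neg_diff_le[OF nn])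
        also have "\<dots> \<le> norm u * norm (?res t - ratio_vec \<theta> (?p t))"
          unfolding inner_diff_right[symmetric] by (rule Cauchy_Schwarz_ineq2)
        also have "\<dots> \<le> norm u * (norm (\<mu>f \<theta> (observed x (t - 1) w) - \<mu> \<theta> (past x (int t - 1) w)) / \<omega>0\<^sup>2 * norm (x (int t) w))"
          unfolding res rat by (intro mult_left_mono hadamard_div_diff_le[OF \<omega>0] low lowf \<theta>\<Omega>) simp
        also have "\<dots> \<le> norm u * (K0 * \<rho> ^ (t - 1) / \<omega>0\<^sup>2 * norm (x (int t) w))"
          using init[OF t1 \<theta>\<Omega>] unfolding it by (intro mult_left_mono mult_right_mono divide_right_mono) auto
        finally show ?thesis using False by (simp add: mult_ac)
      qed
    qed
    have "\<bar>\<Sum>t=1..T. A t\<bar> \<le> (\<Sum>t=1..T. (if t = 1 then 1 else 0) + norm u * (K0 / \<omega>0\<^sup>2 * (\<rho> ^ (t - 1) * norm (x (int t) w))))"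
      by (rule order_trans[OF sum_abs sum_mono[OF At]])
    also have "\<dots> = 1 + norm u * (K0 / \<omega>0\<^sup>2 * (\<Sum>t=1..T. \<rho> ^ (t - 1) * norm (x (int t) w)))"
      using T unfolding sum.distrib sum_distrib_left by (subst sum.delta) auto
    finally have "\<bar>\<Sum>t=1..T. A t\<bar> / s \<le> (1 + norm u * (K0 / \<omega>0\<^sup>2 * (\<Sum>t=1..T. \<rho> ^ (t - 1) * norm (x (int t) w)))) / s"
      using s by (intro divide_right_mono) auto
    then show ?thesis unfolding initial_error_def s_def[symmetric] using s by (simp add: add_divide_distrib)
  qed
  have hnorm: "norm (\<theta> - \<theta>0) \<le> \<theta>_size T w / s"
    using error_le_size(1)[of T w] s unfolding g by (simp add: pos_le_divide_eq mult.commute)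
  have boundB: "\<bar>(\<Sum>t=1..T. B t) / s\<bar> \<le> (norm u)\<^sup>2 * quadratic_error T w + norm u * linear_error T w"
  proof -
    have Bt: "\<bar>B t\<bar> \<le> (norm u)\<^sup>2 * (\<theta>_size T w / s)\<^sup>2 * grad_bound_real (?p t) + norm u * (\<theta>_size T w / s) * sqrt (remainder_real (\<delta> T) (?p t))" for t
    proof -
      have "\<bar>B t\<bar> \<le> (norm u)\<^sup>2 * grad_bound_real (?p t) * (norm (\<theta> - \<theta>0))\<^sup>2 + norm u * sqrt (remainder_real (\<delta> T) (?p t)) * norm (\<theta> - \<theta>0)"
        unfolding B_def by (rule exp_expansion[OF reg \<delta>(2) balls(1) u])
      also have "\<dots> \<le> (norm u)\<^sup>2 * grad_bound_real (?p t) * (\<theta>_size T w / s)\<^sup>2 + norm u * sqrt (remainder_real (\<delta> T) (?p t)) * (\<theta>_size T w / s)"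
        by (intro add_mono mult_left_mono power_mono hnorm) (simp_all add: grad_bound_real_def remainder_real_def)
      finally show ?thesis by (simp add: mult_ac)
    qed
    have "\<bar>\<Sum>t=1..T. B t\<bar> \<le> (norm u)\<^sup>2 * (\<theta>_size T w / s)\<^sup>2 * (\<Sum>t=1..T. grad_bound_real (?p t))
      + norm u * (\<theta>_size T w / s) * (\<Sum>t=1..T. sqrt (remainder_real (\<delta> T) (?p t)))"
      unfolding sum_distrib_left sum.distrib[symmetric] by (rule order_trans[OF sum_abs sum_mono[OF Bt]])
    then have "\<bar>\<Sum>t=1..T. B t\<bar> / s \<le> ((norm u)\<^sup>2 * (\<theta>_size T w / s)\<^sup>2 * (\<Sum>t=1..T. grad_bound_real (?p t))
      + norm u * (\<theta>_size T w / s) * (\<Sum>t=1..T. sqrt (remainder_real (\<delta> T) (?p t)))) / s"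
      using s by (intro divide_right_mono) auto
    also have "\<dots> = (norm u)\<^sup>2 * quadratic_error T w + norm u * ((\<Sum>t=1..T. sqrt (remainder_real (\<delta> T) (?p t))) / real T * \<theta>_size T w)"
      unfolding quadratic_error_def s_def[symmetric] s(2)[symmetric] using s(1)
      by (simp add: add_divide_distrib power_divide power2_eq_square mult_ac)
    also have "\<dots> \<le> (norm u)\<^sup>2 * quadratic_error T w + norm u * linear_error T w"
    proof (intro add_left_mono mult_left_mono)
      have rn: "0 \<le> remainder_real (\<delta> T) p" for p by (simp add: remainder_real_def)
      have "(\<Sum>t=1..T. sqrt (remainder_real (\<delta> T) (?p t))) / real (card {1..T})
        \<le> sqrt ((\<Sum>t=1..T. remainder_real (\<delta> T) (?p t)) / real (card {1..T}))"
        by (rule sum_sqrt_le) (use T rn in auto)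
      also have "\<dots> \<le> sqrt \<bar>(\<Sum>t=1..T. remainder_real (\<delta> T) (?p t)) / real T\<bar>" by (simp del: abs_divide)
      finally show "(\<Sum>t=1..T. sqrt (remainder_real (\<delta> T) (?p t))) / real T * \<theta>_size T w \<le> linear_error T w"
        unfolding linear_error_def by (intro mult_right_mono gaps_nonneg) simp
    qed simp
    finally show ?thesis using s by simp
  qed
  have boundC: "\<bar>(score_average T u w - mean_score u) \<bullet> \<theta>_error T w\<bar> \<le> norm (score_average T u w - mean_score u) * \<theta>_size T w"
    by (rule order_trans[OF Cauchy_Schwarz_ineq2 mult_left_mono[OF error_le_size(1) norm_ge_zero]])
  have boundD: "\<bar>mean_score u \<bullet> (\<theta>_error T w - m1_sum T w)\<bar> \<le> norm (mean_score u) * \<theta>_gap T w"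
    unfolding \<theta>_gap_def by (rule Cauchy_Schwarz_ineq2)
  have boundE: "\<bar>s * (L \<phi> u - L \<phi>0 u - L_grad u \<bullet> (\<phi> - \<phi>0))\<bar> \<le> sqrt (L_remainder (\<delta> T) u) * \<phi>_size T w"
  proof -
    have "\<bar>s * (L \<phi> u - L \<phi>0 u - L_grad u \<bullet> (\<phi> - \<phi>0))\<bar> \<le> s * (sqrt (L_remainder (\<delta> T) u) * norm (\<phi> - \<phi>0))"
      unfolding abs_mult abs_of_pos[OF s(1)] using s by (intro mult_left_mono Lx balls) auto
    also have "\<dots> = sqrt (L_remainder (\<delta> T) u) * norm (\<phi>_error T w)" unfolding f using s by simp
    also have "\<dots> \<le> sqrt (L_remainder (\<delta> T) u) * \<phi>_size T w"
      by (intro mult_left_mono error_le_size) (simp add: L_remainder_nonneg)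
    finally show ?thesis .
  qed
  have boundF: "\<bar>L_grad u \<bullet> (\<phi>_error T w - m2_sum T w)\<bar> \<le> norm (L_grad u) * \<phi>_gap T w"
    unfolding \<phi>_gap_def by (rule Cauchy_Schwarz_ineq2)
  have tri: "\<bar>a + b + c + d - e - f\<bar> \<le> \<bar>a\<bar> + \<bar>b\<bar> + \<bar>c\<bar> + \<bar>d\<bar> + \<bar>e\<bar> + \<bar>f\<bar>" for a b c d e f :: real by linarith
  have "\<bar>scaled_difference T u w - Y_sum T u w\<bar> \<le> (1 / s + norm u * initial_error T w)
    + ((norm u)\<^sup>2 * quadratic_error T w + norm u * linear_error T w) + norm (score_average T u w - mean_score u) * \<theta>_size T w
    + norm (mean_score u) * \<theta>_gap T w + sqrt (L_remainder (\<delta> T) u) * \<phi>_size T w + norm (L_grad u) * \<phi>_gap T w"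
    unfolding decomposition
    by (rule order_trans[OF tri]) (intro add_mono boundA boundB boundC boundD boundE boundF)
  then show ?thesis unfolding s_def by (simp add: distrib_left)
qed

text \<open>The \<open>\<nu>\<close>-integral of the square of the bound in
  \<open>scaled_difference_expansion\<close>; the factor seven comes from squaring a sum of seven
  terms.\<close>

definition total_error :: "nat \<Rightarrow> 'w \<Rightarrow> real" where
  "total_error T w = 7 * ((1 / sqrt (real T))\<^sup>2 * measure \<nu> pos_orthant
     + (\<integral>u. (norm u)\<^sup>2 \<partial>\<nu>) * (initial_error T w + linear_error T w)\<^sup>2
     + (\<integral>u. norm u ^ 4 \<partial>\<nu>) * (quadratic_error T w)\<^sup>2
     + score_error T w * (\<theta>_size T w)\<^sup>2
     + (\<integral>u. (norm (mean_score u))\<^sup>2 \<partial>\<nu>) * (\<theta>_gap T w)\<^sup>2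
     + (\<integral>u. L_remainder (\<delta> T) u \<partial>\<nu>) * (\<phi>_size T w)\<^sup>2
     + (\<integral>u. (norm (L_grad u))\<^sup>2 \<partial>\<nu>) * (\<phi>_gap T w)\<^sup>2)"

lemma total_error_vanishes: "vanishing M total_error"
proof -
  have sq: "vanishing M (\<lambda>T w. c * (X T w)\<^sup>2)" if "vanishing M X" for c X
    using vanishing_mult[OF vanishing_mult[OF that vanishing_imp_bounded_in_prob[OF that]] bounded_in_prob_const[of c]]
    by (simp add: power2_eq_square mult_ac)
  have bd: "vanishing M (\<lambda>T w. X T w * (B T w)\<^sup>2)" if "vanishing M X" "bounded_in_prob M B" for X B
    using vanishing_mult[OF that(1) bounded_in_prob_mult[OF that(2,2)]] by (simp add: power2_eq_square)
  have "(\<lambda>T. (1 / sqrt (real T))\<^sup>2 * measure \<nu> pos_orthant) \<longlonglongrightarrow> 0\<^sup>2 * measure \<nu> pos_orthant"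
    by (intro tendsto_intros over_sqrt_tendsto)
  then have c0: "vanishing M (\<lambda>T w. (1 / sqrt (real T))\<^sup>2 * measure \<nu> pos_orthant)"
    by (intro vanishing_const) simp
  have "vanishing M (\<lambda>T w. ((1 / sqrt (real T))\<^sup>2 * measure \<nu> pos_orthant
     + (\<integral>u. (norm u)\<^sup>2 \<partial>\<nu>) * (initial_error T w + linear_error T w)\<^sup>2
     + (\<integral>u. norm u ^ 4 \<partial>\<nu>) * (quadratic_error T w)\<^sup>2
     + score_error T w * (\<theta>_size T w)\<^sup>2
     + (\<integral>u. (norm (mean_score u))\<^sup>2 \<partial>\<nu>) * (\<theta>_gap T w)\<^sup>2
     + (\<integral>u. L_remainder (\<delta> T) u \<partial>\<nu>) * (\<phi>_size T w)\<^sup>2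
     + (\<integral>u. (norm (L_grad u))\<^sup>2 \<partial>\<nu>) * (\<phi>_gap T w)\<^sup>2) * 7)"
    by (intro vanishing_mult[OF _ bounded_in_prob_const] vanishing_add c0 sq bd initial_error_vanishes
        linear_error_vanishes quadratic_error_vanishes score_error_vanishes gaps_vanish sizes_bounded
        vanishing_const[OF L_remainder_integral(2)[OF \<delta>(1,3)]])
  then show ?thesis unfolding total_error_def[abs_def] by (simp only: mult.commute[of 7])
qed

lemma test_stat_eq:
  assumes "\<phi>hat T w \<in> \<Phi>0"
  shows "stat T w = (\<integral>u. (scaled_difference T u w)\<^sup>2 \<partial>\<nu>)"
    and "(\<lambda>u. scaled_difference T u w) \<in> borel_measurable \<nu>"
proof -
  have [measurable]: "laplace (G (\<phi>hat T w)) \<in> borel_measurable borel" using assms \<Phi>0 by (intro laplace_measurable) auto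
  have [measurable]: "emp_laplace \<mu>f x \<theta>hat T w \<in> borel_measurable borel" unfolding emp_laplace_def by measurable
  have m: "(\<lambda>u. (emp_laplace \<mu>f x \<theta>hat T w u - laplace (G (\<phi>hat T w)) u)\<^sup>2) \<in> borel_measurable \<nu>"
    by (rule measurable_\<nu>) measurable
  show "stat T w = (\<integral>u. (scaled_difference T u w)\<^sup>2 \<partial>\<nu>)"
    unfolding test_stat_def integral_\<nu>(1)[OF m] scaled_difference_def by (simp add: power_mult_distrib)
  show "(\<lambda>u. scaled_difference T u w) \<in> borel_measurable \<nu>"
    unfolding scaled_difference_def by (rule measurable_\<nu>) measurable
qed

text \<open>The pointwise bound is squared, majorised by \<open>h\<close> with integral
  \<open>total_error\<close>, and inserted into \<open>integral_square_diff_le\<close>. As the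
  integral of the squared \<open>Y_sum\<close> is tight, the right side vanishes in
  probability.\<close>

lemma test_stat_close:
  assumes T: "0 < T"
  shows "AE w in M. w \<in> good T \<longrightarrow> \<bar>stat T w - (\<integral>u. (Y_sum T u w)\<^sup>2 \<partial>\<nu>)\<bar>
    \<le> sqrt \<bar>total_error T w\<bar> * (\<integral>u. (Y_sum T u w)\<^sup>2 \<partial>\<nu>) + total_error T w + sqrt \<bar>total_error T w\<bar>"
proof -
  have xn: "AE w in M. \<forall>t. \<forall>j. 0 \<le> x t w $ j" using x_nonneg by (subst AE_all_countable) auto
  show ?thesis
    using \<mu>_lower \<mu>f_lower initial_values AE_regular ratio_vec_eq xn Y_sum_square(1)[OF T]
  proof (eventually_elim, intro impI)
    fix w
    assume low: "\<forall>t. \<forall>\<theta>\<in>\<Omega>0. \<forall>j. \<omega>0 \<le> \<mu> \<theta> (past x t w) $ j" and lowf: "\<forall>t. \<forall>\<theta>\<in>\<Omega>0. \<forall>j. \<omega>0 \<le> \<mu>f \<theta> (observed x t w) $ j"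
      and init: "\<forall>t\<ge>1. \<forall>\<theta>\<in>\<Omega>0. norm (\<mu>f \<theta> (observed x t w) - \<mu> \<theta> (past x (int t) w)) < K0 * \<rho> ^ t"
      and reg: "\<forall>t. regular (path t w)" and rv: "\<forall>t. ratio_vec \<theta>0 (path t w) = \<epsilon> t w" and xn: "\<forall>t j. 0 \<le> x t w $ j"
      and Yi: "integrable \<nu> (\<lambda>u. (Y_sum T u w)\<^sup>2)" and w: "w \<in> good T"
    define h where "h u = 7 * ((1 / sqrt (real T))\<^sup>2 + (norm u)\<^sup>2 * (initial_error T w + linear_error T w)\<^sup>2
      + norm u ^ 4 * (quadratic_error T w)\<^sup>2 + (norm (score_average T u w - mean_score u))\<^sup>2 * (\<theta>_size T w)\<^sup>2
      + (norm (mean_score u))\<^sup>2 * (\<theta>_gap T w)\<^sup>2 + L_remainder (\<delta> T) u * (\<phi>_size T w)\<^sup>2 + (norm (L_grad u))\<^sup>2 * (\<phi>_gap T w)\<^sup>2)" for u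
    note ints = norm_square_integrable norm_power4_integrable score_error_integrable[OF reg[rule_format], of T] mean_score_square_integrable
      L_remainder_integral(1)[OF \<delta>(1,3), of T] L_grad_square_integrable
    have hi: "integrable \<nu> h" unfolding h_def
      by (intro integrable_mult_right Bochner_Integration.integrable_add integrable_mult_left \<nu>.integrable_const ints)
    have hv: "(\<integral>u. h u \<partial>\<nu>) = total_error T w"
    proof -
      have I: "has_bochner_integral \<nu> h (total_error T w)"
        unfolding h_def total_error_def score_error_def
        by (intro has_bochner_integral_mult_right has_bochner_integral_add has_bochner_integral_mult_left has_bochner_integral_integrable ints)
           (simp add: has_bochner_integral_iff mult.commute)
      then show ?thesis by (simp add: has_bochner_integral_iff)
    qed
    have hb: "AE u in \<nu>. (scaled_difference T u w - Y_sum T u w)\<^sup>2 \<le> h u"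
      using L_expansion[OF \<delta>(3)[of T]] AE_space[of \<nu>]
    proof eventually_elim
      case (elim u)
      then have u: "u \<in> pos_orthant" by simp
      have "\<bar>scaled_difference T u w - Y_sum T u w\<bar> \<le> 1 / sqrt (real T) + norm u * (initial_error T w + linear_error T w)
        + (norm u)\<^sup>2 * quadratic_error T w + norm (score_average T u w - mean_score u) * \<theta>_size T w
        + norm (mean_score u) * \<theta>_gap T w + sqrt (L_remainder (\<delta> T) u) * \<phi>_size T w + norm (L_grad u) * \<phi>_gap T w" (is "_ \<le> ?S")
        by (rule scaled_difference_expansion[OF w T u]) (use low lowf init reg rv xn elim(1) in blast)+
      from power_mono[OF this abs_ge_zero, of 2]
      have "(scaled_difference T u w - Y_sum T u w)\<^sup>2 \<le> ?S\<^sup>2" by simp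
      also have "\<dots> \<le> h u" unfolding h_def
        by (rule order_trans[OF square_sum7_le]) (simp add: power_mult_distrib L_remainder_nonneg flip: power_mult)
      finally show ?case .
    qed
    have te: "0 \<le> total_error T w" unfolding hv[symmetric]
    proof (rule integral_nonneg_AE)
      show "AE u in \<nu>. 0 \<le> h u" using hb by eventually_elim (rule order_trans[OF zero_le_power2])
    qed
    have ms: "w \<in> space M" using w by (simp add: good_def)
    have Ym: "(\<lambda>u. Y_sum T u w) \<in> borel_measurable \<nu>"
      using measurable_compose[OF measurable_Pair1'[OF ms] Y_sum_jointly_measurable] by simp
    note t = test_stat_eq[OF good_balls(3)[OF T w]]
    show "\<bar>stat T w - (\<integral>u. (Y_sum T u w)\<^sup>2 \<partial>\<nu>)\<bar>
      \<le> sqrt \<bar>total_error T w\<bar> * (\<integral>u. (Y_sum T u w)\<^sup>2 \<partial>\<nu>) + total_error T w + sqrt \<bar>total_error T w\<bar>"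
      using integral_square_diff_le[OF t(2) Ym Yi hi hb] unfolding t(1) hv abs_of_nonneg[OF te] .
  qed
qed

text \<open>Levy's continuity theorem, the limit of the characteristic functions being transferred
  from the integrated square of \<open>Y_sum\<close> to the statistic. \<open>N\<close> and
  \<open>Z\<close> are arbitrary, so the result covers the constructed process as well as any other
  with the same covariance.\<close>

theorem test_stat_weak_convergence:
  assumes cg: "centred_gaussian_with_cov N pos_orthant Z (cov t0)"
  shows "weak_conv_m (\<lambda>T. distr M borel (stat T))
                (distr N borel (\<lambda>v. LINT u:pos_orthant|lborel. (Z u v)\<^sup>2 * W u))"
proof -
  interpret N: prob_space N using cg by (auto simp: centred_gaussian_with_cov_def gaussian_process_def)
  note [measurable] = Y_sum_square_clt(2)[OF cg] test_stat_measurable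
  have "distr N borel (\<lambda>v. LINT u:pos_orthant|lborel. (Z u v)\<^sup>2 * W u) = distr N borel (\<lambda>v. \<integral>u. (Z u v)\<^sup>2 \<partial>\<nu>)"
  proof (rule distr_cong[OF refl refl])
    fix v assume v: "v \<in> space N"
    have [measurable]: "(\<lambda>u. Z u v) \<in> borel_measurable \<nu>"
      using measurable_compose[OF measurable_Pair1'[OF v] Y_sum_square_clt(2)[OF cg]] by simp
    show "(LINT u:pos_orthant|lborel. (Z u v)\<^sup>2 * W u) = (\<integral>u. (Z u v)\<^sup>2 \<partial>\<nu>)" by (rule integral_\<nu>(1)) measurable
  qed
  moreover have "weak_conv_m (\<lambda>T. distr M borel (stat T)) (distr N borel (\<lambda>v. \<integral>u. (Z u v)\<^sup>2 \<partial>\<nu>))"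
  proof (rule levy_continuity)
    show "real_distribution (distr M borel (stat T))" for T
      by (rule real_distribution_distr) measurable
    show "real_distribution (distr N borel (\<lambda>v. \<integral>u. (Z u v)\<^sup>2 \<partial>\<nu>))" by (rule N.real_distribution_distr) measurable
    fix r :: real
    let ?I = "\<lambda>T w. \<integral>u. (Y_sum T u w)\<^sup>2 \<partial>\<nu>"
    have "(\<lambda>T. \<integral>w. iexp (r * stat T w) \<partial>M) \<longlonglongrightarrow> (\<integral>v. iexp (r * (\<integral>u. (Z u v)\<^sup>2 \<partial>\<nu>)) \<partial>N)"
    proof (rule char_tendsto_if_close[OF test_stat_measurable _ _ good_sets good_prob _ Y_sum_square_clt(1)[OF cg]])
      show "?I T \<in> borel_measurable M" for T by measurable
      show "vanishing M (\<lambda>T w. sqrt \<bar>total_error T w\<bar> * ?I T w + total_error T w + sqrt \<bar>total_error T w\<bar>)"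
        by (intro vanishing_add vanishing_mult[OF vanishing_sqrt Y_sum_square_bounded] vanishing_sqrt total_error_vanishes)
      show "eventually (\<lambda>T. AE w in M. w \<in> good T \<longrightarrow> \<bar>stat T w - ?I T w\<bar>
        \<le> sqrt \<bar>total_error T w\<bar> * ?I T w + total_error T w + sqrt \<bar>total_error T w\<bar>) sequentially"
        using eventually_gt_at_top[of 0] by eventually_elim (rule test_stat_close)
    qed
    then show "(\<lambda>T. char (distr M borel (stat T)) r) \<longlonglongrightarrow> char (distr N borel (\<lambda>v. \<integral>u. (Z u v)\<^sup>2 \<partial>\<nu>)) r"
      by (subst char_distr_eq[OF test_stat_measurable], subst N.char_distr_eq) measurable
  qed
  ultimately show ?thesis by simp
qed

end

theorem theorem1:
  fixes M :: "'w measure"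
    and x \<epsilon> :: "int \<Rightarrow> 'w \<Rightarrow> real ^ 'd::finite"
    and \<mu> :: "real ^ 'k::finite \<Rightarrow> (nat \<Rightarrow> real ^ 'd) \<Rightarrow> real ^ 'd"
    and \<mu>f :: "real ^ 'k \<Rightarrow> (real ^ 'd) list \<Rightarrow> real ^ 'd"
    and \<theta>0 :: "real ^ 'k" and \<Omega>0 U :: "(real ^ 'k) set"
    and \<omega>0 K0 \<rho> :: real
    and G :: "real ^ 'r::finite \<Rightarrow> (real ^ 'd) measure"
    and \<Phi> \<Phi>0 :: "(real ^ 'r) set" and \<phi>0 :: "real ^ 'r"
    and \<theta>hat :: "nat \<Rightarrow> 'w \<Rightarrow> real ^ 'k" and \<phi>hat :: "nat \<Rightarrow> 'w \<Rightarrow> real ^ 'r"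
    and m1 :: "int \<Rightarrow> 'w \<Rightarrow> real ^ 'k" and m2 :: "int \<Rightarrow> 'w \<Rightarrow> real ^ 'r"
    and W :: "real ^ 'd \<Rightarrow> real" and t0 :: int
  assumes "prob_space M"
    \<comment> \<open>the model and A1\<close>
    and "\<And>t. x t \<in> borel_measurable M"
    and "\<And>t. \<epsilon> t \<in> borel_measurable M"
    and "\<And>t. AE \<omega> in M. \<forall>j. 0 \<le> x t \<omega> $ j"
    and "\<And>t. AE \<omega> in M. \<forall>j. 0 \<le> \<epsilon> t \<omega> $ j"
    and "prob_space.indep_vars M (\<lambda>_. borel) \<epsilon> UNIV"
    and "\<And>t. integrable M (\<epsilon> t)"
    and "\<And>t. (\<integral>\<omega>. \<epsilon> t \<omega> \<partial>M) = (\<chi> j. 1)"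
    and "\<And>\<theta>. \<theta> \<in> \<Omega>0 \<Longrightarrow> \<mu> \<theta> \<in> borel_measurable (PiM UNIV (\<lambda>_. borel))"
    and "\<And>t. AE \<omega> in M. x t \<omega> = hadamard_prod (\<mu> \<theta>0 (past x (t - 1) \<omega>)) (\<epsilon> t \<omega>)"
    and "\<And>t j. AE \<omega> in M.
           real_cond_exp M (gen_sigma M x {..t - 1}) (\<lambda>\<omega>. x t \<omega> $ j) \<omega>
           = \<mu> \<theta>0 (past x (t - 1) \<omega>) $ j"
    and "strictly_stationary M x"
    and "ergodic_process M x"
    and "compact \<Omega>0" and "\<theta>0 \<in> \<Omega>0"
    and "0 < \<omega>0"
    and "AE \<omega> in M. \<forall>t. \<forall>\<theta>\<in>\<Omega>0. \<forall>j. \<omega>0 \<le> \<mu> \<theta> (past x t \<omega>) $ j"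
    and "AE \<omega> in M. \<forall>t. \<forall>\<theta>\<in>\<Omega>0. \<forall>j. \<omega>0 \<le> \<mu>f \<theta> (observed x t \<omega>) $ j"
    and "0 < K0" and "0 < \<rho>" and "\<rho> < 1"
    and "AE \<omega> in M. \<forall>t\<ge>1. \<forall>\<theta>\<in>\<Omega>0.
           norm (\<mu>f \<theta> (observed x t \<omega>) - \<mu> \<theta> (past x (int t) \<omega>)) < K0 * \<rho> ^ t"
    \<comment> \<open>the parametric family and A2\<close>
    and "\<And>\<phi>. \<phi> \<in> \<Phi> \<Longrightarrow> prob_space (G \<phi>)"
    and "\<And>\<phi>. \<phi> \<in> \<Phi> \<Longrightarrow> sets (G \<phi>) = sets borel"
    and "\<And>\<phi>. \<phi> \<in> \<Phi> \<Longrightarrow> AE y in G \<phi>. y \<in> pos_orthant"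
    and "open \<Phi>0" and "\<Phi>0 \<subseteq> \<Phi>" and "\<phi>0 \<in> \<Phi>0"
    and "\<And>t. distr M borel (\<epsilon> t) = G \<phi>0"
    and "\<And>u. u \<in> pos_orthant \<Longrightarrow> C2_on \<Phi>0 (\<lambda>\<phi>. laplace (G \<phi>) u)"
    and "\<And>j. (\<integral>\<^sup>+u\<in>pos_orthant.
           ((SUP \<phi>\<in>\<Phi>0. ennreal (\<bar>pdiff j (\<lambda>\<psi>. laplace (G \<psi>) u) \<phi>\<bar>\<^sup>2)) * ennreal (W u))
           \<partial>lborel) < \<infinity>"
    and "\<And>j k. (\<integral>\<^sup>+u\<in>pos_orthant.
           ((SUP \<phi>\<in>\<Phi>0. ennreal (\<bar>pdiff j (pdiff k (\<lambda>\<psi>. laplace (G \<psi>) u)) \<phi>\<bar>\<^sup>2))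
             * ennreal (W u)) \<partial>lborel) < \<infinity>"
    and "\<And>j i \<phi> u. \<phi> \<in> \<Phi>0 \<Longrightarrow> u \<in> pos_orthant \<Longrightarrow>
           has_pdiff j (\<lambda>\<psi>. pdiff i (laplace (G \<psi>)) u) \<phi>"
    and "\<And>j i. continuous_on (\<Phi>0 \<times> pos_orthant)
           (\<lambda>(\<phi>, u). pdiff j (\<lambda>\<psi>. pdiff i (laplace (G \<psi>)) u) \<phi>)"
    \<comment> \<open>the estimators and A3\<close>
    and "\<And>T. \<theta>hat T \<in> borel_measurable (gen_sigma M x {1..int T})"
    and "\<And>T. \<phi>hat T \<in> borel_measurable (gen_sigma M x {1..int T})"
    and "\<And>T \<omega>. \<omega> \<in> space M \<Longrightarrow> \<phi>hat T \<omega> \<in> \<Phi>"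
    and "\<And>T t. t \<in> {1..T} \<Longrightarrow> mu_hat \<mu>f x \<theta>hat T t \<in> borel_measurable M"
    and "\<And>T. test_stat \<mu>f x \<theta>hat G \<phi>hat W T \<in> borel_measurable M"
    and "small_oP M (\<lambda>T \<omega>. sqrt (real T) *\<^sub>R (\<theta>hat T \<omega> - \<theta>0)
           - (1 / sqrt (real T)) *\<^sub>R (\<Sum>t = 1..T. m1 (int t) \<omega>))"
    and "small_oP M (\<lambda>T \<omega>. sqrt (real T) *\<^sub>R (\<phi>hat T \<omega> - \<phi>0)
           - (1 / sqrt (real T)) *\<^sub>R (\<Sum>t = 1..T. m2 (int t) \<omega>))"
    and "strictly_stationary M (\<lambda>t \<omega>. (\<epsilon> t \<omega>, m1 t \<omega>, m2 t \<omega>))"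
    and "martingale_differences M (\<lambda>t. gen_sigma M \<epsilon> {..t}) m1"
    and "martingale_differences M (\<lambda>t. gen_sigma M \<epsilon> {..t}) m2"
    and "\<And>t k. integrable M (\<lambda>\<omega>. (m1 t \<omega> $ k)\<^sup>2)"
    and "\<And>t k. integrable M (\<lambda>\<omega>. (m2 t \<omega> $ k)\<^sup>2)"
    \<comment> \<open>A4\<close>
    and "AE \<omega> in M. \<forall>t j. C2_on (interior \<Omega>0) (\<lambda>\<theta>. \<mu> \<theta> (past x t \<omega>) $ j)"
    and "\<And>t j k. (\<lambda>\<omega>. pdiff k (\<lambda>\<theta>. \<mu> \<theta> (past x (t - 1) \<omega>) $ j) \<theta>0) \<in> borel_measurable M"
    and "\<And>t. integrable M (\<lambda>\<omega>. norm (x t \<omega>))"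
    and "\<And>t j k. (\<integral>\<^sup>+\<omega>. ennreal (\<bar>pdiff k (\<lambda>\<theta>. \<mu> \<theta> (past x (t - 1) \<omega>) $ j) \<theta>0\<bar>
           * (\<epsilon> t \<omega> $ j / \<mu> \<theta>0 (past x (t - 1) \<omega>) $ j)) \<partial>M) < \<infinity>"
    and "open U" and "\<theta>0 \<in> U" and "U \<subseteq> interior \<Omega>0"
    and "\<And>t j k l. (\<integral>\<^sup>+\<omega>. ennreal ((norm (x t \<omega>))\<^sup>2) * (SUP \<theta>\<in>U. ennreal
           \<bar>pdiff k (\<lambda>\<eta>. \<mu> \<eta> (past x (t - 1) \<omega>) $ j) \<theta>
             * pdiff l (\<lambda>\<eta>. \<mu> \<eta> (past x (t - 1) \<omega>) $ j) \<theta>\<bar>) \<partial>M) < \<infinity>"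
    and "\<And>t j k l. (\<integral>\<^sup>+\<omega>. ennreal \<bar>x t \<omega> $ j\<bar> * (SUP \<theta>\<in>U. ennreal
           \<bar>pdiff k (pdiff l (\<lambda>\<eta>. \<mu> \<eta> (past x (t - 1) \<omega>) $ j)) \<theta>\<bar>) \<partial>M) < \<infinity>"
    \<comment> \<open>A5\<close>
    and "\<And>u. u \<in> pos_orthant \<Longrightarrow> 0 \<le> W u"
    and "set_integrable lborel pos_orthant W"
    and "set_integrable lborel pos_orthant (\<lambda>u. norm u ^ 4 * W u)"
  shows "(\<exists>(N :: (nat \<Rightarrow> real) measure) Z.
            centred_gaussian_with_cov N pos_orthant Z (limit_cov M \<mu> x \<epsilon> \<theta>0 G \<phi>0 m1 m2 t0)
            \<and> weak_conv_m (\<lambda>T. distr M borel (test_stat \<mu>f x \<theta>hat G \<phi>hat W T))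
                (distr N borel (\<lambda>v. LINT u:pos_orthant|lborel. (Z u v)\<^sup>2 * W u)))
       \<and> (\<forall>(N :: 'v measure) Z.
            centred_gaussian_with_cov N pos_orthant Z (limit_cov M \<mu> x \<epsilon> \<theta>0 G \<phi>0 m1 m2 t0)
            \<longrightarrow> weak_conv_m (\<lambda>T. distr M borel (test_stat \<mu>f x \<theta>hat G \<phi>hat W T))
                (distr N borel (\<lambda>v. LINT u:pos_orthant|lborel. (Z u v)\<^sup>2 * W u)))"
proof -
  interpret prob_space M by (rule assms(1))
  \<comment> \<open>The estimators are given as measurable functions of the observations, while the
    locale asks for measurability on the whole space.\<close>
  have observations: "f \<in> borel_measurable M" if "f \<in> borel_measurable (gen_sigma M x {1..int T})"
    for f :: "'w \<Rightarrow> real ^ 'n::finite" and T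
    using subalgebra_gen_sigma[OF assms(2)] that by (rule measurable_from_subalg)
  have model: "vmem M x \<epsilon> \<mu> \<theta>0 \<Omega>0 U \<omega>0"
    by unfold_locales (fact assms)+
  have family: "weighted_family G \<Phi> \<Phi>0 \<phi>0 W"
    by (rule weighted_family.intro) (fact assms)+
  interpret vmem_estimation M x \<epsilon> \<mu> \<theta>0 \<Omega>0 U \<omega>0 G \<Phi> \<Phi>0 \<phi>0 W m1 m2 \<mu>f K0 \<rho> \<theta>hat \<phi>hat
    by (intro vmem_estimation.intro vmem_test.intro vmem_test_axioms.intro vmem_estimation_axioms.intro)
      (fact model family assms | rule observations, fact assms)+
  obtain Z where Z: "centred_gaussian_with_cov white_noise pos_orthant Z (limit_cov M \<mu> x \<epsilon> \<theta>0 G \<phi>0 m1 m2 t0)"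
    using limit_process_exists[of t0] by (rule exE)
  show ?thesis
    by (intro conjI exI[of _ white_noise] exI[of _ Z] allI impI Z test_stat_weak_convergence[OF Z])
      (rule test_stat_weak_convergence)
qed

end
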